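(* Let $X$ be a locally Lipschitz vector field on an open set $\Omega\subset\mathbb{R}^n$ and let $f,g\in L^1_{\rm loc}(\Omega)$ be given. Then the following conditions are equivalent: (i) $g=Xf$, that is, $g$ is the distributional derivative of $f$ with respect to $X$; (ii) $g=L_Xf$, that is, $g$ is the Lie derivative of $f$ with respect to $X$; (iii) $\lim_{t\to0^+}\Delta^X_tf=g$ in the $L^1_{\rm loc}(\Omega)$ topology, that is, $$\lim_{t\to0^+}\int_{\Omega'}\left|\frac{f(\gamma^X_t(x))-f(x)}{t}-g(x)\right|dx=0$$ for each relatively compact open set $\Omega'\subset\Omega$ (i.e. with compact closure contained in $\Omega$).
   Context: A vector field on $\Omega$ is a map $X=(a_1,\dots,a_n):\Omega\to\mathbb{R}^n$. If $X$ is locally Lipschitz, for $x\in\Omega$ let $t\mapsto\gamma^X_t(x)\in\Omega$, $t\in\Gamma^X_x$ (an open interval containing $0$), be the unique maximal solution of $\dot\gamma(t)=X(\gamma(t))$, $\gamma(0)=x$. Put $\Gamma^X=\bigcup_{x\in\Omega}\Gamma^X_x\times\{x\}$, an open subset of $\mathbb{R}\times\Omega$ containing $\{0\}\times\Omega$, and $\Gamma^X_+=\{(t,x)\in\Gamma^X: t>0\}$. "Almost all $(t,x)\in\Gamma^X_+$" refers to Lebesgue measure in $\mathbb{R}^{n+1}$. For every relatively compact open $\Omega'\subset\Omega$ there is $t_0>0$ with $[-t_0,t_0]\times\Omega'\subset\Gamma^X$, so the integrals in (iii) make sense for small $t$. The difference quotient is $\Delta^X_tf(x)=\frac{f(\gamma^X_t(x))-f(x)}{t}$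 for $(t,x)\in\Gamma^X$, $t\ne0$. Distributional derivative: $g\in L^1_{\rm loc}(\Omega)$ is the distributional derivative of $f\in L^1_{\rm loc}(\Omega)$ with respect to $X$, written $g=Xf$, if for each $u\in C_0^\infty(\Omega)$ $$\int_\Omega g\,u\,dx=-\int_\Omega f\,Xu\,dx-\int_\Omega f\,u\,\operatorname{div}X\,dx,$$ where $Xu=\sum_i a_i\,\partial u/\partial x_i$ and $\operatorname{div}X=\sum_i\partial a_i/\partial x_i$ (defined a.e. and locally bounded by Rademacher's theorem). Lie derivative: $g\in L^1_{\rm loc}(\Omega)$ is the Lie derivative of $f\in L^1_{\rm loc}(\Omega)$ with respect to $X$, written $g=L_Xf$, if $f(\gamma^X_t(x))-f(x)=\int_0^tg(\gamma^X_s(x))\,ds$ for almost all $(t,x)\in\Gamma^X_+$. *)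

theory Defs
  imports "HOL-Analysis.Analysis"
begin

text \<open>
  Vector fields and functions on an open set \<open>\<Omega>\<close> are total functions on \<open>real ^ 'n\<close> of which only
  the values on \<open>\<Omega>\<close> matter. Integrals are taken with respect to \<open>lebesgue\<close> (not \<open>lborel\<close>), since
  functions in \<open>L\<^sup>1\<^bsub>loc\<^esub>\<close> are only Lebesgue measurable.
\<close>

definition locally_lipschitz_field :: "(real ^ 'n) set \<Rightarrow> (real ^ 'n \<Rightarrow> real ^ 'n) \<Rightarrow> bool" where
  "locally_lipschitz_field \<Omega> X \<longleftrightarrow> local_lipschitz (UNIV :: real set) \<Omega> (\<lambda>_. X)"

definition L1loc :: "(real ^ 'n) set \<Rightarrow> (real ^ 'n \<Rightarrow> real) \<Rightarrow> bool" where
  "L1loc \<Omega> f \<longleftrightarrow> (\<forall>K. compact K \<and> K \<subseteq> \<Omega> \<longrightarrow> set_integrable lebesgue K f)"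

subsection \<open>The flow of a vector field\<close>

definition solution :: "(real ^ 'n) set \<Rightarrow> (real ^ 'n \<Rightarrow> real ^ 'n) \<Rightarrow> real ^ 'n \<Rightarrow>
    real set \<Rightarrow> (real \<Rightarrow> real ^ 'n) \<Rightarrow> bool" where
  "solution \<Omega> X x I \<gamma> \<longleftrightarrow>
     open I \<and> is_interval I \<and> 0 \<in> I \<and> \<gamma> 0 = x \<and>
     (\<forall>t\<in>I. \<gamma> t \<in> \<Omega> \<and> (\<gamma> has_vector_derivative X (\<gamma> t)) (at t))"

definition maximal_solution :: "(real ^ 'n) set \<Rightarrow> (real ^ 'n \<Rightarrow> real ^ 'n) \<Rightarrow> real ^ 'n \<Rightarrow>
    real set \<Rightarrow> (real \<Rightarrow> real ^ 'n) \<Rightarrow> bool" where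
  "maximal_solution \<Omega> X x I \<gamma> \<longleftrightarrow>
     solution \<Omega> X x I \<gamma> \<and>
     (\<forall>J \<eta>. solution \<Omega> X x J \<eta> \<and> I \<subseteq> J \<and> (\<forall>t\<in>I. \<eta> t = \<gamma> t) \<longrightarrow> J = I)"

text \<open>
  For locally Lipschitz \<open>X\<close>, open \<open>\<Omega>\<close> and \<open>x \<in> \<Omega>\<close>, the maximal interval is unique and
  the maximal solution is unique on it; \<open>flow \<Omega> X t x\<close> has a meaning only for
  \<open>t \<in> flow_interval \<Omega> X x\<close>.
\<close>

definition flow_interval :: "(real ^ 'n) set \<Rightarrow> (real ^ 'n \<Rightarrow> real ^ 'n) \<Rightarrow> real ^ 'n \<Rightarrow> real set" where
  "flow_interval \<Omega> X x = (THE I. \<exists>\<gamma>. maximal_solution \<Omega> X x I \<gamma>)"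

definition flow :: "(real ^ 'n) set \<Rightarrow> (real ^ 'n \<Rightarrow> real ^ 'n) \<Rightarrow> real \<Rightarrow> real ^ 'n \<Rightarrow> real ^ 'n" where
  "flow \<Omega> X t x = (SOME \<gamma>. maximal_solution \<Omega> X x (flow_interval \<Omega> X x) \<gamma>) t"

definition flow_domain :: "(real ^ 'n) set \<Rightarrow> (real ^ 'n \<Rightarrow> real ^ 'n) \<Rightarrow> (real \<times> (real ^ 'n)) set" where
  "flow_domain \<Omega> X = (\<Union>x\<in>\<Omega>. flow_interval \<Omega> X x \<times> {x})"

definition flow_domain_pos :: "(real ^ 'n) set \<Rightarrow> (real ^ 'n \<Rightarrow> real ^ 'n) \<Rightarrow> (real \<times> (real ^ 'n)) set" where
  "flow_domain_pos \<Omega> X = {(t, x). (t, x) \<in> flow_domain \<Omega> X \<and> t > 0}"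

definition diff_quotient :: "(real ^ 'n) set \<Rightarrow> (real ^ 'n \<Rightarrow> real ^ 'n) \<Rightarrow>
    real \<Rightarrow> (real ^ 'n \<Rightarrow> real) \<Rightarrow> real ^ 'n \<Rightarrow> real" where
  "diff_quotient \<Omega> X t f x = (f (flow \<Omega> X t x) - f x) / t"

subsection \<open>Test functions and distributional derivative\<close>

definition partial :: "'n \<Rightarrow> (real ^ 'n \<Rightarrow> real) \<Rightarrow> real ^ 'n \<Rightarrow> real" where
  "partial i u x = deriv (\<lambda>s. u (x + s *\<^sub>R axis i 1)) 0"

primrec C_k :: "nat \<Rightarrow> (real ^ 'n \<Rightarrow> real) \<Rightarrow> bool" where
  "C_k 0 u \<longleftrightarrow> continuous_on UNIV u"
| "C_k (Suc k) u \<longleftrightarrow> continuous_on UNIV u \<and>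
     (\<forall>i. (\<forall>x. (\<lambda>s. u (x + s *\<^sub>R axis i 1)) differentiable (at 0)) \<and> C_k k (partial i u))"

text \<open>Elements of \<open>C\<^sub>0\<^sup>\<infinity>(\<Omega>)\<close> are identified with their extensions by zero to the whole space.\<close>

definition test_function :: "(real ^ 'n) set \<Rightarrow> (real ^ 'n \<Rightarrow> real) \<Rightarrow> bool" where
  "test_function \<Omega> u \<longleftrightarrow>
     (\<forall>k. C_k k u) \<and> compact (closure {x. u x \<noteq> 0}) \<and> closure {x. u x \<noteq> 0} \<subseteq> \<Omega>"

definition apply_field :: "(real ^ 'n \<Rightarrow> real ^ 'n) \<Rightarrow> (real ^ 'n \<Rightarrow> real) \<Rightarrow> real ^ 'n \<Rightarrow> real" where
  "apply_field X u x = (\<Sum>i\<in>UNIV. X x $ i * partial i u x)"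

text \<open>
  The partial derivatives of a locally Lipschitz field exist almost everywhere in \<open>\<Omega>\<close>;
  on the exceptional null set \<open>divergence\<close> has an irrelevant value.
\<close>

definition divergence :: "(real ^ 'n \<Rightarrow> real ^ 'n) \<Rightarrow> real ^ 'n \<Rightarrow> real" where
  "divergence X x = (\<Sum>i\<in>UNIV. partial i (\<lambda>y. X y $ i) x)"

definition is_distr_derivative :: "(real ^ 'n) set \<Rightarrow> (real ^ 'n \<Rightarrow> real ^ 'n) \<Rightarrow>
    (real ^ 'n \<Rightarrow> real) \<Rightarrow> (real ^ 'n \<Rightarrow> real) \<Rightarrow> bool" where
  "is_distr_derivative \<Omega> X f g \<longleftrightarrow>
     (\<forall>u. test_function \<Omega> u \<longrightarrow>
        (LINT x:\<Omega>|lebesgue. g x * u x) =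
          - (LINT x:\<Omega>|lebesgue. f x * apply_field X u x)
          - (LINT x:\<Omega>|lebesgue. f x * u x * divergence X x))"

subsection \<open>Lie derivative\<close>

text \<open>
  By Fubini's theorem, \<open>s \<mapsto> g (flow \<Omega> X s x)\<close> is integrable over \<open>{0..t}\<close> for almost all \<open>(t, x)\<close> in
  the flow domain whenever \<open>g\<close> is in \<open>L\<^sup>1\<^bsub>loc\<^esub>(\<Omega>)\<close>, so that the default value of the Bochner integral
  plays no role here.
\<close>

definition is_lie_derivative :: "(real ^ 'n) set \<Rightarrow> (real ^ 'n \<Rightarrow> real ^ 'n) \<Rightarrow>
    (real ^ 'n \<Rightarrow> real) \<Rightarrow> (real ^ 'n \<Rightarrow> real) \<Rightarrow> bool" where
  "is_lie_derivative \<Omega> X f g \<longleftrightarrow>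
     (AE (t, x) in lebesgue. (t, x) \<in> flow_domain_pos \<Omega> X \<longrightarrow>
        f (flow \<Omega> X t x) - f x = (LINT s:{0..t}|lebesgue. g (flow \<Omega> X s x)))"

end

(*
  Near a compact subset of the domain the field X is replaced by a bounded, globally Lipschitz field
  Y with flow Phi. Each Phi t is a homeomorphism, and it and its inverse are Lipschitz with
  constant exp (L |t|), so by Vitali's covering theorem Phi t changes volumes by a factor between
  exp (- n L |t|) and exp (n L |t|). These bounds take the place of the Jacobian of the flow, and
  the equivalence follows by going round the circle (i), (ii), (iii), (i).

  (i) implies (ii): for a mollifier rho the function F * rho is smooth, so the fundamental theorem of
  calculus applies along orbits; Friedrichs' commutator lemma gives Y (F * rho) - G * rho -> 0 in L^1,
  and the volume bounds allow passing to the limit.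
  (ii) implies (iii): the difference quotient is an average of G o Phi s over 0 <= s <= t, and
  G o Phi s -> G in L^1.
  (iii) implies (i): the functionals F |-> integral ((F o Phi t - F) / t) u are bounded on L^1
  uniformly in t, because the volume factor is 1 + O(t), and converge on polynomials by integration
  by parts; so they converge for every F to - integral F div (u Y).
*)

theory Submission
  imports Defs
begin

text \<open>The field is only Lipschitz, so the proof avoids total derivatives of the field and of
  its flow. The divergence involves only diagonal partial derivatives, which exist almost everywhere
  as derivatives along lines; the covering argument that bounds volumes also proves this, applied to
  monotone functions of one variable. The volume factor of the flow enters only as
  \<open>1 + O(t)\<close>. Polynomials serve as approximants because they are dense in L^1 on a
  compact set and have a gradient on the whole space. Condition (ii) speaks of almost all times,
  (iii) of all small ones; the gap is closed by continuity in L^1 of F o Phi t in t. Conversely, one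
  cut-off field need not reach the whole flow domain: each point (t, x) gets a field adapted to its
  orbit on [0, t], and by Lindelof's theorem countably many of the resulting rectangles cover the
  domain. Since f and g are only Lebesgue measurable, they are replaced by Borel representatives.
  This is harmless along almost every orbit, because preimages of null sets under the flow are
  null.\<close>

section \<open>Images of small sets under Lipschitz maps\<close>

text \<open>The balls of the cover need only contain \<open>x\<close>, not be centred at it; this
  admits intervals with \<open>x\<close> as an endpoint later. Vitali's theorem selects countably
  many disjoint balls inside an open \<open>U\<close> of measure at most
  \<open>measure lebesgue S + e\<close>, so the sets \<open>T\<close> over them have total measure
  at most \<open>c\<close> times that. What the balls miss in \<open>S\<close> is null, and
  \<open>null\<close> keeps its image null.\<close>

lemma Vitali_image_outer_measure:
  fixes f :: "'a::euclidean_space \<Rightarrow> 'b::euclidean_space"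
  assumes S: "S \<in> lmeasurable" and "0 \<le> c" "0 < e"
    and null: "\<And>N. N \<subseteq> S \<Longrightarrow> negligible N \<Longrightarrow> negligible (f ` N)"
    and cov: "\<And>x d. x \<in> S \<Longrightarrow> 0 < d \<Longrightarrow> \<exists>a r T. 0 < r \<and> r < d \<and> x \<in> cball a r \<and>
      f ` (S \<inter> cball a r) \<subseteq> T \<and> T \<in> lmeasurable \<and>
      measure lebesgue T \<le> c * measure lebesgue (cball a r)"
  shows "\<exists>T\<in>lmeasurable. f ` S \<subseteq> T \<and> measure lebesgue T \<le> c * (measure lebesgue S + e)"
proof -
  obtain U where U: "open U" "S \<subseteq> U" "(U - S) \<in> lmeasurable" "emeasure lebesgue (U - S) < ennreal e"
    using sets_lebesgue_outer_open[of S e] S \<open>0 < e\<close> by (auto simp: fmeasurable_def)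
  have Ueq: "S \<union> (U - S) = U" using U by auto
  have Ul: "U \<in> lmeasurable" using fmeasurable.Un[OF S U(3)] unfolding Ueq .
  have "measure lebesgue (U - S) \<le> e"
    using U(3,4) \<open>0 < e\<close> by (simp add: emeasure_eq_measure2 ennreal_less_iff)
  moreover have "measure lebesgue U \<le> measure lebesgue S + measure lebesgue (U - S)"
    using measure_Un_le[of S lebesgue "U - S"] S U(3) unfolding Ueq by auto
  ultimately have mU: "measure lebesgue U \<le> measure lebesgue S + e" by linarith
  define P where "P a r T \<longleftrightarrow> f ` (S \<inter> cball a r) \<subseteq> T \<and> T \<in> lmeasurable \<and>
      measure lebesgue T \<le> c * measure lebesgue (cball a r)" for a r T
  define K where "K = {(a, r). 0 < r \<and> cball a r \<subseteq> U \<and> (\<exists>T. P a r T)}"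
  have Kcov: "\<exists>i. i \<in> K \<and> x \<in> cball (fst i) (snd i) \<and> snd i < d" if "x \<in> S" "0 < d" for x d
  proof -
    have "x \<in> U" using that(1) U(2) by (rule subsetD[rotated])
    then obtain k where k: "k > 0" "ball x k \<subseteq> U" by (rule openE[OF U(1)])
    \<comment> \<open>A ball of radius below \<open>k/2\<close> that contains \<open>x\<close> has
      diameter below \<open>k\<close> and hence stays in \<open>U\<close>.\<close>
    have "0 < min d (k/2)" using that(2) k(1) by simp
    from cov[OF that(1) this, folded P_def]
    obtain a r T where *: "0 < r" "r < min d (k/2)" "x \<in> cball a r" "P a r T" by (elim exE conjE)
    have "cball a r \<subseteq> ball x k"
    proof
      fix y assume "y \<in> cball a r"
      then have "dist x y \<le> r + r" using *(3) dist_triangle[of x y a] by (auto simp: dist_commute)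
      then show "y \<in> ball x k" using * by auto
    qed
    then show ?thesis using * k by (intro exI[of _ "(a,r)"]) (auto simp: K_def)
  qed
  have Kpos: "0 < snd i" if "i \<in> K" for i using that by (auto simp: K_def)
  obtain C where C: "countable C" "C \<subseteq> K"
    "pairwise (\<lambda>i j. disjnt (cball (fst i) (snd i)) (cball (fst j) (snd j))) C"
    "negligible (S - (\<Union>i\<in>C. cball (fst i) (snd i)))"
    by (rule Vitali_covering_theorem_cballs[of K snd S fst, OF Kpos Kcov])
  define T where "T i = (SOME T. P (fst i) (snd i) T)" for i
  have T: "P (fst i) (snd i) (T i)" if "i \<in> K" for i
  proof -
    have "\<exists>T. P (fst i) (snd i) T" using that by (auto simp: K_def)
    then show ?thesis unfolding T_def by (rule someI_ex)
  qed
  define N where "N = f ` (S - (\<Union>i\<in>C. cball (fst i) (snd i)))"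
  have N: "negligible N" unfolding N_def using null[OF _ C(4)] by blast
  define V where "V = (\<Union>i\<in>C. T i)"
  have Tl: "T i \<in> lmeasurable" if "i \<in> C" for i
    using T[of i] C(2) that unfolding P_def by blast
  \<comment> \<open>A bound that is uniform over finite subfamilies passes to the countable
    union.\<close>
  have fin: "measure lebesgue (\<Union>i\<in>I. T i) \<le> c * (measure lebesgue S + e)" if "I \<subseteq> C" "finite I" for I
  proof -
    have "measure lebesgue (\<Union>i\<in>I. T i) \<le> (\<Sum>i\<in>I. measure lebesgue (T i))"
      using that Tl by (intro measure_UNION_le) (auto simp: fmeasurableD)
    also have "\<dots> \<le> (\<Sum>i\<in>I. c * measure lebesgue (cball (fst i) (snd i)))"
      using that T C by (intro sum_mono) (auto simp: P_def)
    also have "\<dots> = c * measure lebesgue (\<Union>i\<in>I. cball (fst i) (snd i))"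
    proof -
      have "pairwise (\<lambda>i j. negligible (cball (fst i) (snd i) \<inter> cball (fst j) (snd j))) I"
        using C(3) that(1) unfolding pairwise_def disjnt_def by (metis negligible_empty subsetD)
      then show ?thesis using that(2)
        by (subst measure_negligible_finite_Union_image) (auto simp: sum_distrib_left)
    qed
    also have "\<dots> \<le> c * measure lebesgue U"
    proof (intro mult_left_mono measure_mono_fmeasurable)
      have "\<And>i. i \<in> K \<Longrightarrow> cball (fst i) (snd i) \<subseteq> U" by (auto simp: K_def)
      then show "(\<Union>i\<in>I. cball (fst i) (snd i)) \<subseteq> U" using that(1) C(2) by blast
      show "(\<Union>i\<in>I. cball (fst i) (snd i)) \<in> sets lebesgue"
        using that(2) by (intro sets.finite_UN) auto
    qed (use Ul \<open>0 \<le> c\<close> in auto)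
    also have "\<dots> \<le> c * (measure lebesgue S + e)" using mU \<open>0 \<le> c\<close> by (intro mult_left_mono)
    finally show ?thesis .
  qed
  have V: "V \<in> lmeasurable" "measure lebesgue V \<le> c * (measure lebesgue S + e)"
    unfolding V_def using fmeasurable_UN_bound[OF C(1) Tl fin] measure_UN_bound[OF C(1) Tl fin] by auto
  show ?thesis
  proof (intro bexI conjI)
    show "V \<union> N \<in> lmeasurable"
      using V N by (simp add: fmeasurable.Un negligible_imp_measurable)
    show "f ` S \<subseteq> V \<union> N"
    proof
      fix y assume "y \<in> f ` S"
      then obtain x where x: "x \<in> S" "y = f x" by auto
      show "y \<in> V \<union> N"
      proof (cases "\<exists>i\<in>C. x \<in> cball (fst i) (snd i)")
        case True
        then obtain i where "i \<in> C" "x \<in> cball (fst i) (snd i)" by auto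
        moreover have "P (fst i) (snd i) (T i)" using T[of i] C(2) \<open>i \<in> C\<close> by blast
        ultimately have "y \<in> T i" using x by (auto simp: P_def)
        then show ?thesis using \<open>i \<in> C\<close> by (auto simp: V_def)
      next
        case False then show ?thesis using x by (auto simp: N_def)
      qed
    qed
    have "measure lebesgue (V \<union> N) = measure lebesgue V"
      using V N by (intro measure_Un_null_set) (auto simp: negligible_iff_null_sets)
    then show "measure lebesgue (V \<union> N) \<le> c * (measure lebesgue S + e)" using V by simp
  qed
qed

text \<open>Lets \<open>e\<close> tend to 0. Measurability of the image is an assumption because the
  covering argument only yields a measurable superset.\<close>

lemma Vitali_image_measure:
  fixes f :: "'a::euclidean_space \<Rightarrow> 'b::euclidean_space"
  assumes S: "S \<in> lmeasurable" and c: "0 \<le> c"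
    and fS: "f ` S \<in> sets lebesgue"
    and null: "\<And>N. N \<subseteq> S \<Longrightarrow> negligible N \<Longrightarrow> negligible (f ` N)"
    and cov: "\<And>x d. x \<in> S \<Longrightarrow> 0 < d \<Longrightarrow> \<exists>a r T. 0 < r \<and> r < d \<and> x \<in> cball a r \<and>
      f ` (S \<inter> cball a r) \<subseteq> T \<and> T \<in> lmeasurable \<and>
      measure lebesgue T \<le> c * measure lebesgue (cball a r)"
  shows "f ` S \<in> lmeasurable \<and> measure lebesgue (f ` S) \<le> c * measure lebesgue S"
proof
  have *: "\<exists>T\<in>lmeasurable. f ` S \<subseteq> T \<and> measure lebesgue T \<le> c * (measure lebesgue S + e)" if "e > 0" for e
    using Vitali_image_outer_measure[OF S c that null cov] by blast
  show l: "f ` S \<in> lmeasurable" using *[of 1] fS by (auto intro: fmeasurableI2)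
  show "measure lebesgue (f ` S) \<le> c * measure lebesgue S"
  proof (rule field_le_epsilon)
    fix e :: real assume "e > 0"
    \<comment> \<open>The summand 1 keeps \<open>e'\<close> positive when
      \<open>c = 0\<close>.\<close>
    define e' where "e' = e / (c + 1)"
    have e': "e' > 0" "c * e' \<le> e"
      using \<open>e > 0\<close> c by (auto simp: e'_def field_simps)
    obtain T where T: "T\<in>lmeasurable" "f ` S \<subseteq> T" "measure lebesgue T \<le> c * (measure lebesgue S + e')"
      using *[OF e'(1)] by auto
    have "measure lebesgue (f ` S) \<le> measure lebesgue T"
      using T fS by (intro measure_mono_fmeasurable) auto
    also have "\<dots> \<le> c * measure lebesgue S + c * e'" using T by (simp add: algebra_simps)
    finally show "measure lebesgue (f ` S) \<le> c * measure lebesgue S + e" using e' by linarith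
  qed
qed

lemma negligible_lipschitz_image:
  fixes f :: "'a::euclidean_space \<Rightarrow> 'a"
  assumes "L-lipschitz_on UNIV f" "negligible N"
  shows "negligible (f ` N)"
proof (rule negligible_locally_Lipschitz_image[OF _ assms(2)])
  have "norm (f y - f x) \<le> L * norm (y - x)" for x y
    using lipschitz_onD[OF assms(1), of y x] by (simp add: dist_norm)
  then show "\<exists>T B. open T \<and> x \<in> T \<and> (\<forall>y\<in>N \<inter> T. norm (f y - f x) \<le> B * norm (y - x))" for x
    by (intro exI[of _ UNIV] exI[of _ L]) simp
qed simp

text \<open>A ball of radius \<open>r\<close> goes into a ball of radius \<open>L * r\<close>, whose
  volume is \<open>L ^ DIM('a)\<close> times as large; the covering lemma transfers this factor to
  measurable sets.\<close>

lemma lipschitz_image_measure: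
  fixes f :: "'a::euclidean_space \<Rightarrow> 'a"
  assumes L: "L-lipschitz_on UNIV f" and S: "S \<in> lmeasurable" and fS: "f ` S \<in> sets lebesgue"
  shows "f ` S \<in> lmeasurable \<and> measure lebesgue (f ` S) \<le> L ^ DIM('a) * measure lebesgue S"
proof (rule Vitali_image_measure[OF S _ fS])
  have L0: "0 \<le> L" using L by (rule lipschitz_on_nonneg)
  then show "0 \<le> L ^ DIM('a)" by simp
  show "\<And>N. N \<subseteq> S \<Longrightarrow> negligible N \<Longrightarrow> negligible (f ` N)"
    using negligible_lipschitz_image[OF L] .
  fix x :: 'a and d :: real assume "x \<in> S" "0 < d"
  have "f y \<in> cball (f x) (L * (d/2))" if "y \<in> cball x (d/2)" for y
  proof -
    have "dist (f x) (f y) \<le> L * dist x y" using lipschitz_onD[OF L] by auto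
    also have "\<dots> \<le> L * (d/2)" using that L0 by (intro mult_left_mono) auto
    finally show ?thesis by simp
  qed
  moreover have "measure lebesgue (cball (f x) (L * (d/2))) \<le> L ^ DIM('a) * measure lebesgue (cball x (d/2))"
    using L0 \<open>0 < d\<close> by (simp add: content_cball power_mult_distrib power_divide mult_ac)
  ultimately show "\<exists>a r T. 0 < r \<and> r < d \<and> x \<in> cball a r \<and> f ` (S \<inter> cball a r) \<subseteq> T \<and>
      T \<in> lmeasurable \<and> measure lebesgue T \<le> L ^ DIM('a) * measure lebesgue (cball a r)"
    using \<open>0 < d\<close> by (intro exI[of _ x] exI[of _ "d/2"] exI[of _ "cball (f x) (L * (d/2))"]) auto
qed

lemma emeasure_lborel_lmeasurable:
  fixes A :: "'a::euclidean_space set"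
  assumes "A \<in> lmeasurable" "A \<in> sets borel"
  shows "emeasure lborel A = ennreal (measure lebesgue A)"
  using emeasure_eq_measure2[OF assms(1)] assms(2) by simp

text \<open>The preimage under \<open>g\<close> is the image under its inverse \<open>f\<close>, so
  a Lipschitz bound for \<open>f\<close> controls preimages. In this form it compares the image
  measure of \<open>g\<close> with Lebesgue measure.\<close>

lemma lipschitz_inverse_vimage_emeasure:
  fixes f g :: "'a::euclidean_space \<Rightarrow> 'a"
  assumes L: "L-lipschitz_on UNIV f" and g: "continuous_on UNIV g"
    and inv: "\<And>x. f (g x) = x" "\<And>x. g (f x) = x" and A: "A \<in> sets borel"
  shows "emeasure lborel (g -` A) \<le> ennreal (L ^ DIM('a)) * emeasure lborel A"
proof (cases "emeasure lborel A = \<infinity>")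
  case True
  \<comment> \<open>In \<open>ennreal\<close>, 0 times infinity is 0, so the factor must be shown
    positive. With \<open>L = 0\<close> the map \<open>f\<close> would be constant, yet it is
    onto.\<close>
  have "L \<noteq> 0"
  proof
    assume "L = 0"
    obtain b :: 'a where b: "b \<noteq> 0" by (metis nonzero_Basis ex_in_conv nonempty_Basis)
    have "dist (f (g b)) (f (g 0)) \<le> L * dist (g b) (g 0)" using lipschitz_onD[OF L] by blast
    then show False using \<open>L = 0\<close> b inv by simp
  qed
  then have "ennreal (L ^ DIM('a)) > 0" using lipschitz_on_nonneg[OF L] by simp
  then show ?thesis using True \<open>L \<noteq> 0\<close> by (simp add: ennreal_mult_top)
next
  case False
  have im: "g -` A = f ` A"
  proof
    show "g -` A \<subseteq> f ` A" using inv(1) by (metis image_eqI subsetI vimageD)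
    show "f ` A \<subseteq> g -` A" using inv(2) by auto
  qed
  have b: "g -` A \<in> sets borel"
    using measurable_sets[OF borel_measurable_continuous_onI[OF g] A] by simp
  have Al: "A \<in> lmeasurable" using False A by (auto simp: fmeasurable_def less_top)
  note * = lipschitz_image_measure[OF L Al, folded im]
  have l: "g -` A \<in> lmeasurable" "measure lebesgue (g -` A) \<le> L ^ DIM('a) * measure lebesgue A"
    using * b by auto
  have "emeasure lborel (g -` A) = ennreal (measure lebesgue (g -` A))"
    using l(1) b by (rule emeasure_lborel_lmeasurable)
  also have "\<dots> \<le> ennreal (L ^ DIM('a) * measure lebesgue A)" using l(2) by (rule ennreal_leI)
  also have "\<dots> = ennreal (L ^ DIM('a)) * emeasure lborel A"
    using emeasure_lborel_lmeasurable[OF Al A] lipschitz_on_nonneg[OF L]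
    by (simp add: ennreal_mult)
  finally show ?thesis .
qed

section \<open>Line derivatives of Lipschitz functions\<close>

definition slope :: "('a::real_normed_vector \<Rightarrow> real) \<Rightarrow> 'a \<Rightarrow> 'a \<Rightarrow> real \<Rightarrow> real" where
  "slope v e x r = (v (x + r *\<^sub>R e) - v x) / r"

text \<open>Points with secant slopes below \<open>p\<close> at arbitrarily small scales, that is,
  roughly where the lower derivative is below \<open>p\<close>. A countable intersection of unions
  of open sets makes it Borel for continuous \<open>v\<close>. Upper derivatives above
  \<open>q\<close> are handled as \<open>low_slope\<close> of \<open>- v\<close> at level
  \<open>- q\<close>.\<close>

definition low_slope :: "('a::real_normed_vector \<Rightarrow> real) \<Rightarrow> 'a \<Rightarrow> real \<Rightarrow> 'a set" where
  "low_slope v e p = (\<Inter>k::nat. \<Union>r\<in>{r. r \<noteq> 0 \<and> \<bar>r\<bar> < inverse (real (Suc k))}. {x. slope v e x r < p})"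

lemma lipschitz_slope_bound:
  assumes L: "L-lipschitz_on UNIV v"
  shows "\<bar>slope v e x r\<bar> \<le> L * norm e"
proof (cases "r = 0")
  case False
  have "dist (v (x + r *\<^sub>R e)) (v x) \<le> L * dist (x + r *\<^sub>R e) x" using lipschitz_onD[OF L] by blast
  then show ?thesis using False by (simp add: slope_def dist_norm abs_divide field_simps)
qed (use lipschitz_on_nonneg[OF L] in \<open>simp add: slope_def\<close>)

lemma low_slopeD:
  assumes "x \<in> low_slope v e p" "0 < d"
  shows "\<exists>r. r \<noteq> 0 \<and> \<bar>r\<bar> < d \<and> slope v e x r < p"
proof -
  obtain k where k: "inverse (real (Suc k)) < d" using reals_Archimedean[OF assms(2)] by auto
  from assms(1) obtain r where "r \<noteq> 0" "\<bar>r\<bar> < inverse (real (Suc k))" "slope v e x r < p"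
    unfolding low_slope_def by blast
  then show ?thesis using k by (intro exI[of _ r]) auto
qed

lemma low_slopeI:
  assumes "\<And>d. 0 < d \<Longrightarrow> \<exists>r. r \<noteq> 0 \<and> \<bar>r\<bar> < d \<and> slope v e x r < p"
  shows "x \<in> low_slope v e p"
proof -
  have "\<exists>r. r \<noteq> 0 \<and> \<bar>r\<bar> < inverse (real (Suc k)) \<and> slope v e x r < p" for k
    by (rule assms) simp
  then show ?thesis unfolding low_slope_def by blast
qed

lemma low_slope_borel:
  assumes "continuous_on UNIV v"
  shows "low_slope v e p \<in> sets borel"
proof -
  have "open {x. slope v e x r < p}" for r
    unfolding slope_def
    by (cases "r = 0")
      (auto intro!: open_Collect_less continuous_intros continuous_on_compose2[OF assms])
  then show ?thesis unfolding low_slope_def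
    by (intro sets.countable_INT) (auto intro!: borel_open open_UN)
qed

text \<open>At a point of \<open>A\<close> some interval between \<open>x\<close> and
  \<open>x + r\<close> has slope below \<open>p\<close>, and monotonicity sends it into an interval
  at most \<open>p\<close> times as long. These intervals form a fine cover with \<open>x\<close> at
  an endpoint, as the covering lemma allows.\<close>

lemma low_slope_image_measure:
  fixes h :: "real \<Rightarrow> real"
  assumes mono: "\<And>x y. x \<le> y \<Longrightarrow> h x \<le> h y"
    and L: "L-lipschitz_on UNIV h"
    and A: "A \<in> lmeasurable" "A \<subseteq> low_slope h 1 p" and p: "0 \<le> p"
    and hA: "h ` A \<in> sets lebesgue"
  shows "h ` A \<in> lmeasurable \<and> measure lebesgue (h ` A) \<le> p * measure lebesgue A"
proof (rule Vitali_image_measure[OF A(1) p hA])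
  show "\<And>N. N \<subseteq> A \<Longrightarrow> negligible N \<Longrightarrow> negligible (h ` N)"
    using negligible_lipschitz_image[OF L] .
  fix x d :: real assume "x \<in> A" "0 < d"
  then obtain r where r: "r \<noteq> 0" "\<bar>r\<bar> < d" "slope h 1 x r < p"
    using A(2) low_slopeD by blast
  define a b where "a = min x (x + r)" and "b = max x (x + r)"
  have ab: "a < b" "b - a = \<bar>r\<bar>" using r by (auto simp: a_def b_def)
  have "h b - h a = slope h 1 x r * \<bar>r\<bar>"
    using r(1) by (cases "r > 0") (auto simp: slope_def a_def b_def)
  also have "\<dots> \<le> p * \<bar>r\<bar>" using r by (intro mult_right_mono) auto
  finally have hab: "h b - h a \<le> p * (b - a)" using ab by simp
  have cb: "cball ((a + b)/2) ((b - a)/2) = {a..b}" by (auto simp: dist_real_def field_simps)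
  show "\<exists>a r T. 0 < r \<and> r < d \<and> x \<in> cball a r \<and>
      h ` (A \<inter> cball a r) \<subseteq> T \<and> T \<in> lmeasurable \<and>
      measure lebesgue T \<le> p * measure lebesgue (cball a r)"
  proof (intro exI conjI)
    show "0 < (b - a)/2" "(b - a)/2 < d" using ab r by auto
    show "x \<in> cball ((a + b)/2) ((b - a)/2)" unfolding cb by (auto simp: a_def b_def)
    show "h ` (A \<inter> cball ((a + b)/2) ((b - a)/2)) \<subseteq> {h a..h b}"
      unfolding cb using mono by auto
    show "{h a..h b} \<in> lmeasurable" by simp
    show "measure lebesgue {h a..h b} \<le> p * measure lebesgue (cball ((a + b)/2) ((b - a)/2))"
      unfolding cb using hab ab mono[of a b] by simp
  qed
qed

lemma bilipschitz_real_inverse: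
  fixes h :: "real \<Rightarrow> real"
  assumes m: "0 < m" "\<And>x y. x \<le> y \<Longrightarrow> m * (y - x) \<le> h y - h x"
    and L: "L-lipschitz_on UNIV h"
  obtains g where "\<And>x. g (h x) = x" "\<And>y. h (g y) = y" "(1/m)-lipschitz_on UNIV g"
    "\<And>x y. x \<le> y \<Longrightarrow> g x \<le> g y"
proof -
  have cont: "continuous_on A h" for A
    using lipschitz_on_continuous_on[OF L] continuous_on_subset by blast
  have surj: "\<exists>x. h x = y" for y
  proof -
    \<comment> \<open>Slopes are at least \<open>m\<close>, so over a distance \<open>c\<close> the
      function moves by at least \<open>\<bar>y - h 0\<bar>\<close>; hence \<open>y\<close> lies
      between \<open>h (- c)\<close> and \<open>h c\<close>.\<close>
    define c where "c = \<bar>y - h 0\<bar> / m"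
    have c: "0 \<le> c" "m * c = \<bar>y - h 0\<bar>" using m by (auto simp: c_def)
    have "h (-c) \<le> y" "y \<le> h c" using m(2)[of "-c" 0] m(2)[of 0 c] c by auto
    then show ?thesis using IVT'[of h "-c" y c] c cont by auto
  qed
  define g where "g y = (SOME x. h x = y)" for y
  have hg: "h (g y) = y" for y unfolding g_def using someI_ex[OF surj] .
  have str: "m * \<bar>y - x\<bar> \<le> \<bar>h y - h x\<bar>" for x y
    using m(2)[of x y] m(2)[of y x] by (cases "x \<le> y") (auto simp: abs_if algebra_simps)
  have gh: "g (h x) = x" for x
    using str[of "g (h x)" x] hg[of "h x"] m(1) by (auto simp: mult_le_0_iff)
  have lip: "(1/m)-lipschitz_on UNIV g"
  proof (rule lipschitz_onI)
    fix x y
    show "dist (g x) (g y) \<le> 1 / m * dist x y"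
      using str[of "g x" "g y"] hg m(1) by (simp add: dist_real_def field_simps)
  qed (use m in auto)
  have "g x \<le> g y" if "x \<le> y" for x y
  proof (rule ccontr)
    assume "\<not> g x \<le> g y"
    then have "m * (g x - g y) \<le> x - y" "g x - g y > 0" using m(2)[of "g y" "g x"] hg by auto
    then have "m * (g x - g y) \<le> 0" using that by linarith
    then show False using \<open>g x - g y > 0\<close> m(1) by (simp add: mult_le_0_iff)
  qed
  then show thesis using that gh hg lip by blast
qed

text \<open>Slopes below \<open>p\<close> give the image of a bounded part \<open>A\<close> at most
  \<open>p\<close> times the measure of \<open>A\<close>. Slopes above \<open>q\<close> become
  slopes below \<open>1/q\<close> of the inverse function, so \<open>A\<close> has at most
  \<open>1/q\<close> times the measure of its image. As \<open>p < q\<close>, both hold only if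
  \<open>A\<close> is null.\<close>

lemma low_high_slope_null_bilipschitz:
  fixes h :: "real \<Rightarrow> real"
  assumes m: "0 < m" "\<And>x y. x \<le> y \<Longrightarrow> m * (y - x) \<le> h y - h x"
    and L: "L-lipschitz_on UNIV h" and pq: "0 < p" "p < q"
  shows "low_slope h 1 p \<inter> low_slope (\<lambda>x. - h x) 1 (-q) \<in> null_sets lborel"
proof -
  obtain g where gh: "\<And>x. g (h x) = x" and hg: "\<And>y. h (g y) = y"
    and g: "(1/m)-lipschitz_on UNIV g" and gmono: "\<And>x y. x \<le> y \<Longrightarrow> g x \<le> g y"
    using bilipschitz_real_inverse[OF m L] by metis
  have hmono: "h x \<le> h y" if "x \<le> y" for x y
  proof -
    have "0 \<le> m * (y - x)" using m(1) that by simp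
    then show ?thesis using m(2)[OF that] by linarith
  qed
  have ch: "continuous_on UNIV h" and cg: "continuous_on UNIV g"
    using lipschitz_on_continuous_on L g by auto
  have L0: "0 \<le> L" using L by (rule lipschitz_on_nonneg)
  define B where "B = low_slope h 1 p \<inter> low_slope (\<lambda>x. - h x) 1 (-q)"
  have Bb: "B \<in> sets borel" unfolding B_def
    by (intro sets.Int low_slope_borel continuous_intros ch)
  \<comment> \<open>Bounded pieces have finite measure, which the final cancellation
    requires.\<close>
  have null: "emeasure lborel (B \<inter> {-real n..real n}) = 0" for n :: nat
  proof -
    define A where "A = B \<inter> {-real n..real n}"
    have Ab: "A \<in> sets borel" unfolding A_def using Bb by simp
    have Al: "A \<in> lmeasurable"
      by (rule fmeasurableI2[of "{-real n..real n}"]) (use Ab in \<open>auto simp: A_def\<close>)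
    have im: "h ` A = g -` A"
    proof
      show "h ` A \<subseteq> g -` A" using gh by auto
      show "g -` A \<subseteq> h ` A" using hg by (metis image_eqI subsetI vimageD)
    qed
    have hAb: "h ` A \<in> sets lebesgue" unfolding im
      using measurable_sets[OF borel_measurable_continuous_onI[OF cg] Ab] by simp
    have 1: "h ` A \<in> lmeasurable \<and> measure lebesgue (h ` A) \<le> p * measure lebesgue A"
      by (rule low_slope_image_measure[OF hmono L Al _ _ hAb]) (use pq in \<open>auto simp: A_def B_def\<close>)
    have low: "h ` A \<subseteq> low_slope g 1 (1/q)"
    proof
      fix y assume "y \<in> h ` A"
      then obtain x where x: "y = h x" "x \<in> low_slope (\<lambda>x. - h x) 1 (-q)"
        by (auto simp: A_def B_def)
      show "y \<in> low_slope g 1 (1/q)"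
      proof (rule low_slopeI)
        fix d :: real assume "0 < d"
        \<comment> \<open>\<open>h\<close> expands distances by at most \<open>L\<close>, so a step
          below \<open>d / (L + 1)\<close> makes the increment \<open>s\<close> of \<open>h\<close>
          smaller than \<open>d\<close>.\<close>
        then have "d / (L + 1) > 0" using L0 by simp
        from low_slopeD[OF x(2) this] obtain r where
          r: "r \<noteq> 0" "\<bar>r\<bar> < d / (L + 1)" "slope (\<lambda>x. - h x) 1 x r < - q" by auto
        define s where "s = h (x + r) - h x"
        have sq: "s / r > q" using r(3)
          by (auto simp: slope_def s_def) (metis diff_divide_distrib minus_diff_eq minus_divide_left neg_less_iff_less)
        then have s0: "s \<noteq> 0" using pq by auto
        have "dist (h (x + r)) (h x) \<le> L * dist (x + r) x" using lipschitz_onD[OF L] by auto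
        then have "\<bar>s\<bar> \<le> L * \<bar>r\<bar>" by (simp add: s_def dist_real_def)
        also have "\<dots> \<le> (L + 1) * \<bar>r\<bar>" by (simp add: algebra_simps)
        also have "\<dots> < d" using r(2) L0 by (simp add: field_simps)
        finally have "\<bar>s\<bar> < d" .
        moreover have "slope g 1 y s = r / s"
          by (simp add: slope_def s_def x gh)
        moreover have "r / s < 1 / q"
        proof -
          have "inverse (s / r) < inverse q" using sq pq by (intro less_imp_inverse_less) auto
          then show ?thesis by (simp add: field_simps)
        qed
        ultimately show "\<exists>r. r \<noteq> 0 \<and> \<bar>r\<bar> < d \<and> slope g 1 y r < 1 / q"
          using s0 by (intro exI[of _ s]) auto
      qed
    qed
    have gi: "g ` (h ` A) = A" using gh by (simp add: image_image)
    have 2: "measure lebesgue (g ` (h ` A)) \<le> (1/q) * measure lebesgue (h ` A)"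
      using low_slope_image_measure[OF gmono g _ low] 1 pq Al gi by auto
    have "q * measure lebesgue A \<le> measure lebesgue (h ` A)"
      using 2 pq unfolding gi by (simp add: field_simps)
    then have "q * measure lebesgue A \<le> p * measure lebesgue A" using 1 by linarith
    then have "(q - p) * measure lebesgue A \<le> 0" by (simp add: algebra_simps)
    then have "measure lebesgue A = 0" using pq
      by (metis diff_gt_0_iff_gt measure_nonneg mult_le_0_iff not_less order_antisym)
    then show ?thesis using emeasure_lborel_lmeasurable[OF Al Ab] by (simp add: A_def)
  qed
  have "(\<Union>n. B \<inter> {-real n..real n}) \<in> null_sets lborel"
    using null Bb by (intro null_sets_UN) auto
  moreover have "(\<Union>n. B \<inter> {-real n..real n}) = B"
  proof -
    have "\<exists>n. x \<in> {-real n..real n}" for x :: real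
      using real_arch_simple[of "\<bar>x\<bar>"] by (auto simp: abs_le_iff minus_le_iff)
    then show ?thesis by blast
  qed
  ultimately show ?thesis by (simp add: B_def)
qed

text \<open>Adding the linear function \<open>2 * M * x\<close> with \<open>M > L\<close> shifts
  every slope by \<open>2 * M\<close> and makes the function increase at rate at least
  \<open>M\<close>, so the bilipschitz case applies. If the shifted level \<open>p + 2 * M\<close>
  is not positive, no slope lies below it.\<close>

lemma low_high_slope_null_real:
  fixes v :: "real \<Rightarrow> real"
  assumes L: "L-lipschitz_on UNIV v" and pq: "p < q"
  shows "low_slope v 1 p \<inter> low_slope (\<lambda>x. - v x) 1 (-q) \<in> null_sets lborel"
proof -
  define M where "M = L + 1"
  have M: "L < M" "0 < M" using lipschitz_on_nonneg[OF L] by (auto simp: M_def)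
  define h where "h x = v x + 2 * M * x" for x
  have sl: "slope h 1 x r = slope v 1 x r + 2 * M" if "r \<noteq> 0" for x r
    using that by (simp add: h_def slope_def field_simps)
  have sl': "slope (\<lambda>x. - h x) 1 x r = slope (\<lambda>x. - v x) 1 x r - 2 * M" if "r \<noteq> 0" for x r
    using that by (simp add: h_def slope_def field_simps)
  have lo: "low_slope v 1 p = low_slope h 1 (p + 2 * M)" for p
    unfolding low_slope_def using sl by (intro INF_cong SUP_cong) auto
  have hi: "low_slope (\<lambda>x. - v x) 1 (-q) = low_slope (\<lambda>x. - h x) 1 (-(q + 2 * M))" for q
    unfolding low_slope_def using sl' by (intro INF_cong SUP_cong) auto
  have vl: "\<bar>v y - v x\<bar> \<le> L * \<bar>y - x\<bar>" for x y
    using lipschitz_onD[OF L, of y x] by (auto simp: dist_real_def)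
  have hM: "M * (y - x) \<le> h y - h x" if "x \<le> y" for x y
  proof -
    have "L * (y - x) \<le> M * (y - x)" using M that by (intro mult_right_mono) auto
    then have "v x - v y \<le> M * (y - x)" using vl[of y x] that by auto
    then show ?thesis by (simp add: h_def algebra_simps)
  qed
  have hL: "(L + 2 * M)-lipschitz_on UNIV h"
  proof (rule lipschitz_onI)
    fix x y
    have "\<bar>h x - h y\<bar> \<le> \<bar>v x - v y\<bar> + \<bar>2 * M * (x - y)\<bar>" by (simp add: h_def algebra_simps)
    also have "\<dots> \<le> L * \<bar>x - y\<bar> + 2 * M * \<bar>x - y\<bar>" using vl[of x y] M by (simp add: abs_mult)
    finally show "dist (h x) (h y) \<le> (L + 2 * M) * dist x y"
      by (simp add: dist_real_def algebra_simps)
  qed (use M lipschitz_on_nonneg[OF L] in auto)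
  show ?thesis
  proof (cases "0 < p + 2 * M")
    case True
    then show ?thesis unfolding lo hi
      using pq by (intro low_high_slope_null_bilipschitz[OF M(2) hM hL]) auto
  next
    case False
    have "low_slope h 1 (p + 2 * M) = {}"
    proof (rule equals0I)
      fix x assume "x \<in> low_slope h 1 (p + 2 * M)"
      from low_slopeD[OF this zero_less_one] obtain r where r: "r \<noteq> 0" "slope h 1 x r < 0"
        using False by auto
      have "0 \<le> h y - h x" if "x \<le> y" for x y
        using order_trans[OF _ hM[OF that], of 0] M that by auto
      then have "0 \<le> slope h 1 x r"
        using r(1) by (cases "r > 0") (fastforce simp: slope_def zero_le_divide_iff)+
      then show False using r by simp
    qed
    then show ?thesis unfolding lo by simp
  qed
qed

section \<open>Almost everywhere differentiability along a direction\<close>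

text \<open>If the lower and upper derivatives in direction \<open>e\<close> differ, two rationals
  separate them. Ranging over the countably many rational pairs keeps the set Borel and
  null.\<close>

definition slope_gap :: "('a::real_normed_vector \<Rightarrow> real) \<Rightarrow> 'a \<Rightarrow> 'a set" where
  "slope_gap v e = (\<Union>p::rat. \<Union>q\<in>{p<..}.
     low_slope v e (of_rat p) \<inter> low_slope (\<lambda>x. - v x) e (- of_rat q))"

lemma slope_gap_null_real:
  fixes v :: "real \<Rightarrow> real"
  assumes L: "L-lipschitz_on UNIV v"
  shows "slope_gap v 1 \<in> null_sets lborel"
  unfolding slope_gap_def
  by (intro null_sets_UN' low_high_slope_null_real[OF L]) (auto simp: of_rat_less)

lemma slope_gap_borel:
  assumes "continuous_on UNIV v"
  shows "slope_gap v e \<in> sets borel"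
proof -
  have "(\<Union>q\<in>{p<..}. low_slope v e (of_rat p) \<inter> low_slope (\<lambda>x. - v x) e (- of_rat q)) \<in> sets borel" for p
    by (rule sets.countable_UN') (auto intro!: sets.Int low_slope_borel continuous_intros assms)
  then show ?thesis unfolding slope_gap_def by (intro sets.countable_UN) auto
qed

text \<open>Outside the gap set the lower and upper limits of the slopes agree as extended reals;
  the bound \<open>L\<close> makes the common value finite.\<close>

lemma differentiable_outside_slope_gap:
  assumes b: "\<And>r. \<bar>slope v e x r\<bar> \<le> L" and x: "x \<notin> slope_gap v e"
  shows "\<exists>D. ((\<lambda>s. v (x + s *\<^sub>R e)) has_field_derivative D) (at 0)"
proof -
  define f where "f r = ereal (slope v e x r)" for r
  define l u where "l = Liminf (at 0) f" and "u = Limsup (at 0) f"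
  have nt: "at (0::real) \<noteq> bot" by simp
  have lu: "l \<le> u" unfolding l_def u_def by (intro Liminf_le_Limsup nt)
  have lb: "ereal (- L) \<le> l" "u \<le> ereal L"
    unfolding l_def u_def f_def using b
    by (auto intro!: Liminf_bounded Limsup_bounded always_eventually simp: abs_le_iff minus_le_iff)
  have "\<not> l < u"
  proof
    assume "l < u"
    then obtain a b where ab: "l < ereal (real_of_rat a)" "real_of_rat a < real_of_rat b" "ereal (real_of_rat b) < u"
      using ereal_dense3 by (metis ereal_less_eq(3) less_ereal.simps(1))
    have "x \<in> low_slope v e (of_rat a)"
    proof (rule low_slopeI, rule ccontr)
      fix d :: real assume d: "0 < d" and "\<nexists>r. r \<noteq> 0 \<and> \<bar>r\<bar> < d \<and> slope v e x r < real_of_rat a"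
      then have "eventually (\<lambda>r. ereal (of_rat a) \<le> f r) (at 0)"
        unfolding eventually_at by (intro exI[of _ d]) (auto simp: f_def dist_real_def not_less)
      then have "ereal (of_rat a) \<le> l" unfolding l_def by (rule Liminf_bounded)
      then show False using ab by simp
    qed
    moreover have "x \<in> low_slope (\<lambda>x. - v x) e (- of_rat b)"
    proof (rule low_slopeI, rule ccontr)
      fix d :: real assume d: "0 < d" and *: "\<nexists>r. r \<noteq> 0 \<and> \<bar>r\<bar> < d \<and> slope (\<lambda>x. - v x) e x r < - real_of_rat b"
      have neg: "slope (\<lambda>x. - v x) e x r = - slope v e x r" for r
        by (simp add: slope_def minus_divide_left)
      have "eventually (\<lambda>r. f r \<le> ereal (of_rat b)) (at 0)"
        unfolding eventually_at using d *
        by (intro exI[of _ d]) (auto simp: f_def dist_real_def not_less neg)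
      then have "u \<le> ereal (of_rat b)" unfolding u_def by (rule Limsup_bounded)
      then show False using ab by simp
    qed
    ultimately have "x \<in> slope_gap v e"
      using ab(2) unfolding slope_gap_def by (auto simp: of_rat_less)
    then show False using x by simp
  qed
  then have "l = u" using lu by auto
  moreover obtain D where D: "l = ereal D" using lb lu by (cases l) auto
  ultimately have "(f \<longlongrightarrow> ereal D) (at 0)"
    unfolding l_def u_def by (intro Liminf_eq_Limsup nt) auto
  then have "(slope v e x \<longlongrightarrow> D) (at 0)" unfolding f_def by simp
  then show ?thesis unfolding DERIV_def slope_def by (intro exI[of _ D]) simp
qed

lemma nn_integral_lborel_translate:
  fixes f :: "'a::euclidean_space \<Rightarrow> ennreal"
  assumes [measurable]: "f \<in> borel_measurable borel"
  shows "(\<integral>\<^sup>+x. f (x + a) \<partial>lborel) = (\<integral>\<^sup>+x. f x \<partial>lborel)"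
proof -
  have "(\<integral>\<^sup>+x. f x \<partial>lborel) = (\<integral>\<^sup>+x. f x \<partial>distr lborel borel ((+) a))"
    by (simp add: lborel_distr_plus)
  also have "\<dots> = (\<integral>\<^sup>+x. f (x + a) \<partial>lborel)"
    by (subst nn_integral_distr) (auto simp: add.commute)
  finally show ?thesis ..
qed

text \<open>Fubini without splitting the space into a line and its complement: for each
  \<open>x\<close> the segment \<open>x + s *\<^sub>R e\<close> with \<open>s\<close> in
  \<open>{0..1}\<close> meets the gap set in a null set of parameters, and integrating over
  \<open>x\<close> first yields, by translation invariance, the measure of the gap set
  itself.\<close>

lemma slope_gap_null:
  fixes v :: "'a::euclidean_space \<Rightarrow> real"
  assumes L: "L-lipschitz_on UNIV v"
  shows "slope_gap v e \<in> null_sets lborel"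
proof -
  define N where "N = slope_gap v e"
  have cv: "continuous_on UNIV v" using L by (rule lipschitz_on_continuous_on)
  have N[measurable]: "N \<in> sets borel" unfolding N_def using cv by (rule slope_gap_borel)
  have line: "(\<integral>\<^sup>+s. indicator {0..1} s * indicator N (x + s *\<^sub>R e) \<partial>lborel) = (0::ennreal)" for x
  proof -
    define h where "h s = v (x + s *\<^sub>R e)" for s
    have hL: "(L * norm e)-lipschitz_on UNIV h"
    proof (rule lipschitz_onI)
      fix s t
      have "dist (h s) (h t) \<le> L * dist (x + s *\<^sub>R e) (x + t *\<^sub>R e)"
        unfolding h_def using lipschitz_onD[OF L] by blast
      also have "\<dots> = L * norm e * dist s t"
        by (simp add: dist_norm flip: scaleR_left_diff_distrib)
      finally show "dist (h s) (h t) \<le> L * norm e * dist s t" .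
    qed (use lipschitz_on_nonneg[OF L] in auto)
    have sl: "slope v e (x + s *\<^sub>R e) r = slope h 1 s r" "slope (\<lambda>x. - v x) e (x + s *\<^sub>R e) r = slope (\<lambda>x. - h x) 1 s r" for s r
      by (simp_all add: slope_def h_def algebra_simps)
    have "x + s *\<^sub>R e \<in> N \<longleftrightarrow> s \<in> slope_gap h 1" for s
      by (simp add: N_def slope_gap_def low_slope_def sl)
    then have "(\<integral>\<^sup>+s. indicator {0..1} s * indicator N (x + s *\<^sub>R e) \<partial>lborel)
        \<le> (\<integral>\<^sup>+s. indicator (slope_gap h 1) s \<partial>lborel)"
      by (intro nn_integral_mono) (auto simp: indicator_def)
    also have "\<dots> = 0"
      using slope_gap_null_real[OF hL] by (subst nn_integral_indicator) auto
    finally show ?thesis by simp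
  qed
  have "0 = (\<integral>\<^sup>+x. (\<integral>\<^sup>+s. indicator {0..1} s * indicator N (x + s *\<^sub>R e) \<partial>lborel) \<partial>(lborel :: 'a measure))"
    unfolding line by simp
  also have "\<dots> = (\<integral>\<^sup>+s. (\<integral>\<^sup>+x. indicator {0..1::real} s * indicator N (x + s *\<^sub>R e) \<partial>(lborel :: 'a measure)) \<partial>lborel)"
    by (rule lborel_pair.Fubini') measurable
  also have "\<dots> = (\<integral>\<^sup>+s. indicator {0..1::real} s * emeasure lborel N \<partial>lborel)"
  proof (intro nn_integral_cong)
    fix s :: real
    have "(\<integral>\<^sup>+x. indicator N (x + s *\<^sub>R e) \<partial>lborel) = emeasure lborel N"
      by (subst nn_integral_lborel_translate) auto
    then show "(\<integral>\<^sup>+x. indicator {0..1::real} s * indicator N (x + s *\<^sub>R e) \<partial>lborel) = indicator {0..1} s * emeasure lborel N"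
      by (subst nn_integral_cmult) auto
  qed
  also have "\<dots> = emeasure lborel N" by (subst nn_integral_multc) auto
  finally show ?thesis using N by (auto simp: N_def)
qed

theorem lipschitz_line_differentiable_AE:
  fixes v :: "'a::euclidean_space \<Rightarrow> real"
  assumes L: "L-lipschitz_on UNIV v"
  shows "AE x in lborel. \<exists>D. ((\<lambda>s. v (x + s *\<^sub>R e)) has_field_derivative D) (at 0)"
proof (rule AE_I'[OF slope_gap_null[OF L, of e]], clarsimp, rule ccontr)
  fix x assume x: "\<forall>D. \<not> ((\<lambda>s. v (x + s *\<^sub>R e)) has_real_derivative D) (at 0)" and "x \<notin> slope_gap v e"
  from differentiable_outside_slope_gap[OF lipschitz_slope_bound[OF L] \<open>x \<notin> slope_gap v e\<close>] show False using x by blast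
qed

section \<open>Integration by parts\<close>

lemma slope_sequence_limit:
  assumes "((\<lambda>s. v (x + s *\<^sub>R e)) has_field_derivative d) (at 0)"
  shows "(\<lambda>n. slope v e x (inverse (real (Suc n)))) \<longlonglongrightarrow> d"
proof -
  have "filterlim (\<lambda>n. inverse (real (Suc n))) (at 0) sequentially"
    by (intro filterlim_atI LIMSEQ_inverse_real_of_nat always_eventually) simp
  moreover have "(slope v e x \<longlongrightarrow> d) (at 0)"
    using assms by (simp add: DERIV_def slope_def[abs_def])
  ultimately show ?thesis by (rule filterlim_compose[rotated])
qed

lemma lipschitz_line_derivative_exists:
  fixes v :: "'a::euclidean_space \<Rightarrow> real"
  assumes L: "L-lipschitz_on UNIV v" and e: "norm e = 1"
  shows "\<exists>D\<in>borel_measurable borel. (\<forall>x. \<bar>D x\<bar> \<le> L) \<and>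
    (AE x in lborel. ((\<lambda>s. v (x + s *\<^sub>R e)) has_field_derivative D x) (at 0))"
proof -
  have cv[measurable]: "v \<in> borel_measurable borel"
    using lipschitz_on_continuous_on[OF L] by (rule borel_measurable_continuous_onI)
  define q where "q n x = slope v e x (inverse (real (Suc n)))" for n x
  have [measurable]: "q n \<in> borel_measurable borel" for n unfolding q_def slope_def by measurable
  \<comment> \<open>Limit of the slopes along \<open>1/(n+1)\<close>, cut off at \<open>L\<close>
    and \<open>- L\<close>: Borel and bounded everywhere, whatever \<open>lim\<close> returns where
    the sequence diverges, and equal to the derivative where that exists.\<close>
  define D where "D x = max (-L) (min L (lim (\<lambda>n. q n x)))" for x
  have L0: "0 \<le> L" using L by (rule lipschitz_on_nonneg)
  have qb: "\<bar>q n x\<bar> \<le> L" for n x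
    using lipschitz_slope_bound[OF L, of e x] e unfolding q_def by simp
  have "D \<in> borel_measurable borel" unfolding D_def by measurable
  moreover have "\<forall>x. \<bar>D x\<bar> \<le> L" unfolding D_def using L0 by auto
  moreover have "((\<lambda>s. v (x + s *\<^sub>R e)) has_field_derivative D x) (at 0)"
    if "((\<lambda>s. v (x + s *\<^sub>R e)) has_field_derivative d) (at 0)" for x d
  proof -
    have "(\<lambda>n. q n x) \<longlonglongrightarrow> d" unfolding q_def using that by (rule slope_sequence_limit)
    moreover from this have "\<bar>d\<bar> \<le> L"
      by (intro LIMSEQ_le_const2[OF tendsto_rabs]) (auto simp: qb)
    ultimately have "D x = d" unfolding D_def by (auto simp: limI abs_le_iff)
    then show ?thesis using that by simp
  qed
  then have "AE x in lborel. ((\<lambda>s. v (x + s *\<^sub>R e)) has_field_derivative D x) (at 0)"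
    using lipschitz_line_differentiable_AE[OF L, of e] by (auto elim!: eventually_mono)
  ultimately show ?thesis by blast
qed

lemma integrable_continuous_bounded_support:
  fixes v :: "'a::euclidean_space \<Rightarrow> real"
  assumes "continuous_on UNIV v" "\<And>x. R < norm x \<Longrightarrow> v x = 0"
  shows "integrable lborel v"
proof -
  have "integrable lborel (\<lambda>x. indicator (cball 0 R) x *\<^sub>R v x)"
    using assms(1) by (intro borel_integrable_compact) (auto intro: continuous_on_subset)
  moreover have "(\<lambda>x. indicator (cball 0 R) x *\<^sub>R v x) = v"
    using assms(2) by (auto simp: indicator_def fun_eq_iff not_le)
  ultimately show ?thesis by simp
qed

lemma integral_lborel_translate:
  fixes f :: "'a::euclidean_space \<Rightarrow> real"
  assumes [measurable]: "f \<in> borel_measurable borel"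
  shows "(\<integral>x. f (x + a) \<partial>lborel) = (\<integral>x. f x \<partial>lborel)"
    and "integrable lborel (\<lambda>x. f (x + a)) \<longleftrightarrow> integrable lborel f"
proof -
  have eq: "lborel = distr lborel borel ((+) a)" by (simp add: lborel_distr_plus)
  have "(\<integral>x. f x \<partial>lborel) = (\<integral>x. f x \<partial>distr lborel borel ((+) a))" by (simp flip: eq)
  also have "\<dots> = (\<integral>x. f (x + a) \<partial>lborel)" by (subst integral_distr) (auto simp: add.commute)
  finally show "(\<integral>x. f (x + a) \<partial>lborel) = (\<integral>x. f x \<partial>lborel)" ..
  have "integrable lborel f \<longleftrightarrow> integrable (distr lborel borel ((+) a)) f" by (simp flip: eq)
  also have "\<dots> \<longleftrightarrow> integrable lborel (\<lambda>x. f (x + a))"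
    by (subst integrable_distr_eq) (auto simp: add.commute)
  finally show "integrable lborel (\<lambda>x. f (x + a)) \<longleftrightarrow> integrable lborel f" ..
qed

text \<open>Each difference quotient has integral zero by translation invariance. Lipschitz
  continuity along \<open>e\<close> dominates the quotients, so their limit has integral zero
  too.\<close>

lemma integral_line_derivative_zero:
  fixes v :: "'a::euclidean_space \<Rightarrow> real"
  assumes v: "continuous_on UNIV v" "\<And>x. R < norm x \<Longrightarrow> v x = 0"
    and C: "\<And>x s. \<bar>v (x + s *\<^sub>R e) - v x\<bar> \<le> C * \<bar>s\<bar>"
    and D[measurable]: "D \<in> borel_measurable borel"
    and der: "AE x in lborel. ((\<lambda>s. v (x + s *\<^sub>R e)) has_field_derivative D x) (at 0)"
  shows "integrable lborel D \<and> (\<integral>x. D x \<partial>lborel) = 0"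
proof -
  have [measurable]: "v \<in> borel_measurable borel" using v(1) by (rule borel_measurable_continuous_onI)
  define q where "q n x = slope v e x (inverse (real (Suc n)))" for n x
  have [measurable]: "q n \<in> borel_measurable borel" for n unfolding q_def slope_def by measurable
  have vi: "integrable lborel v" using v by (rule integrable_continuous_bounded_support)
  have q0: "(\<integral>x. q n x \<partial>lborel) = 0" for n
    unfolding q_def slope_def using integral_lborel_translate[of v] vi
    by (simp add: Bochner_Integration.integral_diff)
  \<comment> \<open>The step lengths \<open>1/(n+1)\<close> are at most 1, so all quotients vanish
    outside the ball of radius \<open>R + norm e\<close>.\<close>
  define g where "g x = C * indicator (cball 0 (R + norm e)) x" for x :: 'a
  have gi: "integrable lborel g" unfolding g_def
    by (intro integrable_mult_right integrable_real_indicator emeasure_bounded_finite) auto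
  have qb: "AE x in lborel. norm (q n x) \<le> g x" for n
  proof (rule always_eventually, rule allI)
    fix x
    define s where "s = inverse (real (Suc n))"
    have s: "0 < s" "s \<le> 1" by (auto simp: s_def inverse_le_1_iff simp del: of_nat_Suc)
    have qs: "q n x = (v (x + s *\<^sub>R e) - v x) / s" by (simp only: q_def slope_def s_def)
    show "norm (q n x) \<le> g x"
    proof (cases "x \<in> cball 0 (R + norm e)")
      case True
      have "\<bar>v (x + s *\<^sub>R e) - v x\<bar> / s \<le> C" using C[of x s] s by (simp add: field_simps)
      then show ?thesis using True s by (simp add: qs g_def)
    next
      case False
      have "norm (s *\<^sub>R e) \<le> norm e" using s mult_left_le_one_le[of "norm e" s] by simp
      moreover have "norm x \<le> norm (x + s *\<^sub>R e) + norm (s *\<^sub>R e)"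
        using norm_triangle_ineq4[of "x + s *\<^sub>R e" "s *\<^sub>R e"] by simp
      moreover have "R + norm e < norm x" using False by simp
      ultimately have "R < norm (x + s *\<^sub>R e)" "R < norm x" using norm_ge_zero[of e] by linarith+
      then have "q n x = 0" using v(2) by (simp add: qs)
      then show ?thesis using False by (simp add: g_def)
    qed
  qed
  have lim: "AE x in lborel. (\<lambda>n. q n x) \<longlonglongrightarrow> D x"
    using der
  proof eventually_elim
    case (elim x)
    then show ?case unfolding q_def by (rule slope_sequence_limit)
  qed
  have "(\<lambda>n. \<integral>x. q n x \<partial>lborel) \<longlonglongrightarrow> (\<integral>x. D x \<partial>lborel)"
    by (rule integral_dominated_convergence[OF _ _ gi lim qb]) auto
  moreover have "integrable lborel D"
    by (rule integrable_dominated_convergence[OF _ _ gi lim qb]) auto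
  ultimately show ?thesis using LIMSEQ_unique[OF _ tendsto_const[of 0]] by (simp add: q0)
qed

section \<open>The divergence theorem for Lipschitz fields\<close>

text \<open>Differentiability along the coordinate axes with continuous derivatives: this is what
  iterated partial derivatives of a test function give directly, and what integration by parts
  uses.\<close>

definition axis_C1 :: "(real ^ 'n \<Rightarrow> real) \<Rightarrow> ('n \<Rightarrow> real ^ 'n \<Rightarrow> real) \<Rightarrow> bool" where
  "axis_C1 w w' \<longleftrightarrow> continuous_on UNIV w \<and> (\<forall>i. continuous_on UNIV (w' i)) \<and>
     (\<forall>i x. ((\<lambda>s. w (x + s *\<^sub>R axis i 1)) has_field_derivative w' i x) (at 0))"

lemma axis_C1_mult:
  assumes "axis_C1 u u'" "axis_C1 w w'"
  shows "axis_C1 (\<lambda>x. u x * w x) (\<lambda>i x. u' i x * w x + u x * w' i x)"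
  unfolding axis_C1_def
proof (intro conjI allI)
  fix i x
  show "((\<lambda>s. u (x + s *\<^sub>R axis i 1) * w (x + s *\<^sub>R axis i 1)) has_real_derivative
            u' i x * w x + u x * w' i x) (at 0)"
    using DERIV_mult[of "\<lambda>s. u (x + s *\<^sub>R axis i 1)" "u' i x" 0 UNIV "\<lambda>s. w (x + s *\<^sub>R axis i 1)" "w' i x"] assms
    by (simp add: axis_C1_def algebra_simps)
qed (use assms in \<open>auto simp: axis_C1_def intro!: continuous_intros\<close>)

lemma axis_C1_line:
  assumes "axis_C1 w w'"
  shows "((\<lambda>s. w (x + s *\<^sub>R axis i 1)) has_field_derivative w' i (x + t *\<^sub>R axis i 1)) (at t)"
proof -
  have "((\<lambda>s. w ((x + t *\<^sub>R axis i 1) + s *\<^sub>R axis i 1)) has_field_derivative w' i (x + t *\<^sub>R axis i 1)) (at 0)"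
    using assms by (simp add: axis_C1_def)
  moreover have "(\<lambda>s. w ((x + t *\<^sub>R axis i 1) + s *\<^sub>R axis i 1)) = (\<lambda>s. w (x + (s + t) *\<^sub>R axis i 1))"
    by (simp add: algebra_simps)
  ultimately show ?thesis
    using DERIV_shift[of "\<lambda>s. w (x + s *\<^sub>R axis i 1)" "w' i (x + t *\<^sub>R axis i 1)" 0 t] by simp
qed

lemma axis_C1_zero_on_open:
  assumes w: "axis_C1 w w'" and U: "open U" "\<And>y. y \<in> U \<Longrightarrow> w y = 0" and x: "x \<in> U"
  shows "w' i x = 0"
proof -
  have "isCont (\<lambda>s. x + s *\<^sub>R axis i 1) 0" by (intro continuous_intros)
  then have "((\<lambda>s. x + s *\<^sub>R axis i 1) \<longlongrightarrow> x) (nhds 0)"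
    unfolding isCont_def by (subst (asm) tendsto_at_iff_tendsto_nhds) simp_all
  then have "eventually (\<lambda>s. x + s *\<^sub>R axis i 1 \<in> U) (nhds 0)"
    using U(1) x by (rule topological_tendstoD)
  then have "eventually (\<lambda>s. w (x + s *\<^sub>R axis i 1) = 0) (nhds 0)"
    by (rule eventually_mono) (rule U(2))
  then have "((\<lambda>s. w (x + s *\<^sub>R axis i 1)) has_field_derivative 0) (at 0)"
    by (subst DERIV_cong_ev[OF refl _ refl]) auto
  then show ?thesis using w DERIV_unique unfolding axis_C1_def by blast
qed

lemma axis_C1_bounds:
  assumes w: "axis_C1 w w'" and b: "bounded {x. w x \<noteq> 0}"
  obtains B R where "0 \<le> B" "\<And>x. \<bar>w x\<bar> \<le> B" "\<And>i x. \<bar>w' i x\<bar> \<le> B"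
    "\<And>x. R < norm x \<Longrightarrow> w x = 0" "\<And>i x. R < norm x \<Longrightarrow> w' i x = 0"
proof -
  obtain R where R: "\<And>x. R < norm x \<Longrightarrow> w x = 0"
    using b unfolding bounded_iff by (metis (mono_tags, lifting) linorder_not_le mem_Collect_eq)
  have "open {x :: real ^ 'n. R < norm x}" by (intro open_Collect_less continuous_intros)
  then have R': "w' i x = 0" if "R < norm x" for i x
    by (rule axis_C1_zero_on_open[OF w]) (use R that in auto)
  have bd: "\<exists>B. \<forall>x. \<bar>f x\<bar> \<le> B" if "continuous_on UNIV f" "\<And>x. R < norm x \<Longrightarrow> f x = 0" for f :: "real ^ 'n \<Rightarrow> real"
  proof -
    have "bounded (f ` cball 0 R)"
      using that(1) by (intro compact_imp_bounded compact_continuous_image) (auto intro: continuous_on_subset)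
    then obtain B where "\<forall>x\<in>cball 0 R. \<bar>f x\<bar> \<le> B" by (auto simp: bounded_iff)
    then have "\<bar>f x\<bar> \<le> max B 0" for x
      using that(2)[of x] by (cases "R < norm x") (auto simp: le_max_iff_disj)
    then show ?thesis by blast
  qed
  obtain B1 where B1: "\<And>x. \<bar>w x\<bar> \<le> B1" using bd[of w] w R by (auto simp: axis_C1_def)
  have "\<exists>B. \<forall>x. \<bar>w' i x\<bar> \<le> B" for i
    by (rule bd) (use w R' in \<open>auto simp: axis_C1_def\<close>)
  then obtain B2 where B2: "\<And>i x. \<bar>w' i x\<bar> \<le> B2 i" by metis
  define B where "B = \<bar>B1\<bar> + (\<Sum>i\<in>UNIV. \<bar>B2 i\<bar>)"
  have 1: "\<bar>B1\<bar> \<le> B" unfolding B_def by (simp add: sum_nonneg)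
  have 2: "\<bar>B2 i\<bar> \<le> B" for i
    unfolding B_def using member_le_sum[of i UNIV "\<lambda>i. \<bar>B2 i\<bar>"] by simp
  show thesis
  proof (rule that[of B R])
    show "0 \<le> B" using 1 by linarith
    show "\<bar>w x\<bar> \<le> B" for x using B1[of x] 1 by linarith
    show "\<bar>w' i x\<bar> \<le> B" for i x using B2[of i x] 2[of i] by linarith
  qed (use R R' in auto)
qed

lemma axis_C1_axis_lipschitz:
  assumes w: "axis_C1 w w'" and B: "\<And>x. \<bar>w' i x\<bar> \<le> B"
  shows "\<bar>w (x + s *\<^sub>R axis i 1) - w x\<bar> \<le> B * \<bar>s\<bar>"
proof -
  have "norm (w (x + s *\<^sub>R axis i 1) - w (x + 0 *\<^sub>R axis i 1)) \<le> B * norm (s - 0)"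
    by (rule field_differentiable_bound[of UNIV "\<lambda>s. w (x + s *\<^sub>R axis i 1)" "\<lambda>s. w' i (x + s *\<^sub>R axis i 1)"])
      (auto intro: axis_C1_line[OF w] B)
  then show ?thesis by simp
qed

text \<open>Coordinates are changed from \<open>x\<close> to \<open>y\<close> one at a time:
  \<open>z A\<close> has the coordinates of \<open>y\<close> in \<open>A\<close> and those of
  \<open>x\<close> elsewhere, and each exchange is a move along one axis.\<close>

lemma axis_C1_lipschitz:
  fixes w :: "real ^ 'n \<Rightarrow> real"
  assumes w: "axis_C1 w w'" and B: "\<And>i x. \<bar>w' i x\<bar> \<le> B"
  shows "(B * real CARD('n))-lipschitz_on UNIV w"
proof (rule lipschitz_onI)
  have B0: "0 \<le> B" using B[of undefined undefined] by linarith
  then show "0 \<le> B * real CARD('n)" by simp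
  fix x y :: "real ^ 'n"
  define z where "z A = (\<chi> i. if i \<in> A then y $ i else x $ i)" for A
  have "\<bar>w (z A) - w x\<bar> \<le> (\<Sum>i\<in>A. B * \<bar>y $ i - x $ i\<bar>)" if "finite A" for A
    using that
  proof (induction A)
    case empty
    have "z {} = x" by (simp add: z_def vec_eq_iff)
    then show ?case by simp
  next
    case (insert i A)
    have "z (insert i A) = z A + (y $ i - x $ i) *\<^sub>R axis i 1"
      using insert(2) by (auto simp: z_def vec_eq_iff axis_def)
    then have "\<bar>w (z (insert i A)) - w (z A)\<bar> \<le> B * \<bar>y $ i - x $ i\<bar>"
      using axis_C1_axis_lipschitz[OF w B] by simp
    then show ?case using insert by simp
  qed
  from this[of UNIV] have "\<bar>w (z UNIV) - w x\<bar> \<le> (\<Sum>i\<in>UNIV. B * \<bar>y $ i - x $ i\<bar>)" by simp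
  also have "\<dots> \<le> (\<Sum>i\<in>(UNIV::'n set). B * norm (y - x))"
    using component_le_norm_cart[of "y - x"] B0 by (intro sum_mono mult_left_mono) auto
  finally show "dist (w x) (w y) \<le> B * real CARD('n) * dist x y"
    by (simp add: z_def dist_norm norm_minus_commute mult_ac)
qed

text \<open>Borel versions of the almost everywhere defined partial derivatives of a vector field.\<close>

definition diagonal_derivatives :: "(real ^ 'n \<Rightarrow> real ^ 'n) \<Rightarrow> ('n \<Rightarrow> real ^ 'n \<Rightarrow> real) \<Rightarrow> bool" where
  "diagonal_derivatives Z d \<longleftrightarrow> (\<forall>i. d i \<in> borel_measurable borel \<and>
    (AE x in lborel. ((\<lambda>s. Z (x + s *\<^sub>R axis i 1) $ i) has_field_derivative d i x) (at 0)))"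

lemma lipschitz_component:
  fixes Z :: "'a::metric_space \<Rightarrow> real ^ 'n"
  assumes "L-lipschitz_on S Z"
  shows "L-lipschitz_on S (\<lambda>x. Z x $ i)"
proof (rule lipschitz_onI)
  fix x y assume "x \<in> S" "y \<in> S"
  then show "dist (Z x $ i) (Z y $ i) \<le> L * dist x y"
    using lipschitz_onD[OF assms, of x y] dist_vec_nth_le[of "Z x" i "Z y"] by linarith
qed (rule lipschitz_on_nonneg[OF assms])

lemma diagonal_derivatives_exist:
  fixes Z :: "real ^ 'n \<Rightarrow> real ^ 'n"
  assumes L: "L-lipschitz_on UNIV Z"
  obtains d where "diagonal_derivatives Z d" "\<And>i x. \<bar>d i x\<bar> \<le> L"
proof -
  define P where "P i D \<longleftrightarrow> D \<in> borel_measurable borel \<and> (\<forall>x. \<bar>D x\<bar> \<le> L) \<and>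
    (AE x in lborel. ((\<lambda>s. Z (x + s *\<^sub>R axis i 1) $ i) has_field_derivative D x) (at 0))" for i D
  have "\<exists>D. P i D" for i
    using lipschitz_line_derivative_exists[OF lipschitz_component[OF L, of i], of "axis i 1"]
    unfolding P_def by auto
  then obtain d where d: "P i (d i)" for i by metis
  show thesis
  proof (rule that)
    show "diagonal_derivatives Z d" using d by (simp add: diagonal_derivatives_def P_def)
    show "\<bar>d i x\<bar> \<le> L" for i x using d[of i] by (simp add: P_def)
  qed
qed

text \<open>Each \<open>w x * Z x $ i\<close> is Lipschitz along axis \<open>i\<close> with bounded
  support, so its derivative there integrates to zero; summing over \<open>i\<close> gives the
  divergence theorem for \<open>w\<close> times \<open>Z\<close> from diagonal derivatives
  alone.\<close>

theorem integral_divergence_zero: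
  fixes Z :: "real ^ 'n \<Rightarrow> real ^ 'n"
  assumes L: "L-lipschitz_on UNIV Z" and M: "\<And>x. norm (Z x) \<le> M"
    and d: "diagonal_derivatives Z d"
    and w: "axis_C1 w w'" "bounded {x. w x \<noteq> 0}"
  shows "integrable lborel (\<lambda>x. \<Sum>i\<in>UNIV. w' i x * Z x $ i + w x * d i x)"
    and "(\<integral>x. (\<Sum>i\<in>UNIV. w' i x * Z x $ i + w x * d i x) \<partial>lborel) = 0"
proof -
  obtain B R where B: "0 \<le> B" "\<And>x. \<bar>w x\<bar> \<le> B" "\<And>i x. \<bar>w' i x\<bar> \<le> B"
    and R: "\<And>x. R < norm x \<Longrightarrow> w x = 0"
    using axis_C1_bounds[OF w] by metis
  have cZ: "continuous_on UNIV (\<lambda>x. Z x $ i)" for i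
    using lipschitz_on_continuous_on[OF lipschitz_component[OF L]] .
  have Zm: "\<bar>Z x $ i\<bar> \<le> M" for x i using component_le_norm_cart[of "Z x" i] M[of x] by linarith
  have *: "integrable lborel (\<lambda>x. w' i x * Z x $ i + w x * d i x) \<and>
      (\<integral>x. (w' i x * Z x $ i + w x * d i x) \<partial>lborel) = 0" for i
  proof (rule integral_line_derivative_zero[where v = "\<lambda>x. w x * Z x $ i" and e = "axis i 1" and R = R and C = "B * M + B * L"])
    show "continuous_on UNIV (\<lambda>x. w x * Z x $ i)"
      using w by (intro continuous_intros cZ) (simp add: axis_C1_def)
    show "w x * Z x $ i = 0" if "R < norm x" for x using R[OF that] by simp
    have [measurable]: "w \<in> borel_measurable borel" "w' i \<in> borel_measurable borel"
        "(\<lambda>x. Z x $ i) \<in> borel_measurable borel" "d i \<in> borel_measurable borel"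
      using w cZ[of i] d by (auto simp: axis_C1_def diagonal_derivatives_def intro!: borel_measurable_continuous_onI)
    show "(\<lambda>x. w' i x * Z x $ i + w x * d i x) \<in> borel_measurable borel" by measurable
    have "AE x in lborel. ((\<lambda>s. Z (x + s *\<^sub>R axis i 1) $ i) has_field_derivative d i x) (at 0)"
      using d by (simp add: diagonal_derivatives_def)
    then show "AE x in lborel. ((\<lambda>s. w (x + s *\<^sub>R axis i 1) * Z (x + s *\<^sub>R axis i 1) $ i) has_real_derivative
         w' i x * Z x $ i + w x * d i x) (at 0)"
    proof eventually_elim
      case (elim x)
      have "((\<lambda>s. w (x + s *\<^sub>R axis i 1)) has_real_derivative w' i x) (at 0)"
        using w by (simp add: axis_C1_def)
      from DERIV_mult[OF this elim] show ?case by (simp add: algebra_simps)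
    qed
    fix x :: "real ^ 'n" and s :: real
    define y where "y = x + s *\<^sub>R axis i 1"
    have "\<bar>Z y $ i - Z x $ i\<bar> \<le> L * dist y x"
      using lipschitz_onD[OF lipschitz_component[OF L, of i], of y x] by (simp add: dist_real_def)
    also have "dist y x = \<bar>s\<bar>" by (simp add: y_def dist_norm)
    finally have 1: "\<bar>Z y $ i - Z x $ i\<bar> \<le> L * \<bar>s\<bar>" .
    have 2: "\<bar>w y - w x\<bar> \<le> B * \<bar>s\<bar>" unfolding y_def by (rule axis_C1_axis_lipschitz[OF w(1) B(3)])
    \<comment> \<open>Product rule for increments; the two terms contribute \<open>B * M\<close> and
      \<open>B * L\<close> to the Lipschitz constant.\<close>
    have "w y * Z y $ i - w x * Z x $ i = (w y - w x) * Z y $ i + w x * (Z y $ i - Z x $ i)"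
      by (simp add: algebra_simps)
    then have "\<bar>w y * Z y $ i - w x * Z x $ i\<bar> \<le> \<bar>w y - w x\<bar> * \<bar>Z y $ i\<bar> + \<bar>w x\<bar> * \<bar>Z y $ i - Z x $ i\<bar>"
      by (metis abs_mult abs_triangle_ineq)
    also have "\<dots> \<le> (B * \<bar>s\<bar>) * M + B * (L * \<bar>s\<bar>)"
      using 1 2 B Zm[of y i] by (intro add_mono mult_mono) auto
    finally show "\<bar>w (x + s *\<^sub>R axis i 1) * Z (x + s *\<^sub>R axis i 1) $ i - w x * Z x $ i\<bar> \<le> (B * M + B * L) * \<bar>s\<bar>"
      by (simp add: y_def algebra_simps)
  qed
  show "integrable lborel (\<lambda>x. \<Sum>i\<in>UNIV. w' i x * Z x $ i + w x * d i x)"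
    using * by (intro Bochner_Integration.integrable_sum) auto
  show "(\<integral>x. (\<Sum>i\<in>UNIV. w' i x * Z x $ i + w x * d i x) \<partial>lborel) = 0"
    using * by (subst Bochner_Integration.integral_sum) auto
qed

lemma test_function_axis_C1:
  assumes "test_function \<Omega> u"
  shows "axis_C1 u (\<lambda>i. partial i u)" "bounded {x. u x \<noteq> 0}"
proof -
  have C: "C_k (Suc 0) u" using assms unfolding test_function_def by blast
  have D: "((\<lambda>s. u (x + s *\<^sub>R axis i 1)) has_field_derivative partial i u x) (at 0)" for i x
  proof -
    have "(\<lambda>s. u (x + s *\<^sub>R axis i 1)) differentiable (at 0)" using C by auto
    then show ?thesis unfolding partial_def using DERIV_deriv_iff_real_differentiable by blast
  qed
  show "axis_C1 u (\<lambda>i. partial i u)" unfolding axis_C1_def using C D by auto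
  show "bounded {x. u x \<noteq> 0}"
    using assms unfolding test_function_def by (meson bounded_subset closure_subset compact_imp_bounded)
qed

section \<open>Flows of globally Lipschitz fields\<close>

text \<open>The oriented integral from 0 to \<open>t\<close> for either sign of \<open>t\<close>: an
  integral over an empty or one-point interval is 0, so at most one term counts.\<close>

definition antideriv :: "(real \<Rightarrow> 'a::euclidean_space) \<Rightarrow> real \<Rightarrow> 'a" where
  "antideriv h t = integral {0..t} h - integral {t..0} h"

lemma antideriv_0 [simp]: "antideriv h 0 = 0"
  by (simp add: antideriv_def)

lemma antideriv_has_vector_derivative:
  assumes h: "continuous_on UNIV h"
  shows "(antideriv h has_vector_derivative h t) (at t)"
proof -
  \<comment> \<open>The integral from a fixed \<open>a\<close> to the left of 0 and \<open>t\<close>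
    differs from \<open>antideriv\<close> by a constant, and the fundamental theorem on
    \<open>{a..b}\<close> is two-sided at the interior point \<open>t\<close>.\<close>
  define a b where "a = - (\<bar>t\<bar> + 1)" and "b = \<bar>t\<bar> + 1"
  have ab: "a < t" "t < b" "a < 0" "0 < b" by (auto simp: a_def b_def)
  have int: "h integrable_on {u..v}" for u v
    using h by (intro integrable_continuous_real) (auto intro: continuous_on_subset)
  have eq: "antideriv h s = integral {a..s} h - integral {a..0} h" if "s \<in> {a<..<b}" for s
  proof (cases "0 \<le> s")
    case True
    then have "integral {a..0} h + integral {0..s} h = integral {a..s} h"
      using ab that int by (intro Henstock_Kurzweil_Integration.integral_combine) auto
    moreover have "integral {s..0} h = 0" using True by (cases "s = 0") auto
    ultimately show ?thesis by (simp add: antideriv_def algebra_simps)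
  next
    case False
    then have "integral {a..s} h + integral {s..0} h = integral {a..0} h"
      using ab that int by (intro Henstock_Kurzweil_Integration.integral_combine) auto
    moreover have "integral {0..s} h = 0" using False by auto
    ultimately show ?thesis by (simp add: antideriv_def algebra_simps)
  qed
  have "((\<lambda>u. integral {a..u} h) has_vector_derivative h t) (at t within {a..b})"
    using h ab by (intro integral_has_vector_derivative) (auto intro: continuous_on_subset)
  then have "((\<lambda>u. integral {a..u} h) has_vector_derivative h t) (at t)"
    using ab by (simp add: at_within_Icc_at)
  then have "((\<lambda>u. integral {a..u} h - integral {a..0} h) has_vector_derivative h t - 0) (at t)"
    by (intro has_vector_derivative_diff has_vector_derivative_const)
  then have "((\<lambda>u. integral {a..u} h - integral {a..0} h) has_vector_derivative h t) (at t)" by simp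
  then show ?thesis
    by (rule has_vector_derivative_transform_within_open[of _ _ _ "{a<..<b}"]) (use ab eq in auto)
qed

text \<open>In the norm weighted by \<open>exp (c * \<bar>t\<bar>)\<close> integration gains the
  factor \<open>1 / c\<close>, so a large \<open>c\<close> turns the Picard operator into a
  contraction on the whole time line.\<close>

lemma antideriv_exp_bound:
  fixes h :: "real \<Rightarrow> 'a::euclidean_space"
  assumes h: "continuous_on UNIV h" and c: "0 < c" and b: "\<And>s. norm (h s) \<le> B * exp (c * \<bar>s\<bar>)"
  shows "norm (antideriv h t) \<le> B / c * exp (c * \<bar>t\<bar>)"
proof -
  have B: "0 \<le> B" using order_trans[OF norm_ge_zero b[of 0]] by simp
  have pos: "norm (integral {0..t} h) \<le> B / c * exp (c * t)"
    if "0 \<le> t" "continuous_on UNIV h" "\<And>s. norm (h s) \<le> B * exp (c * \<bar>s\<bar>)"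
    for t and h :: "real \<Rightarrow> 'a"
  proof -
    have "((\<lambda>s. B * exp (c * s)) has_integral (B / c * exp (c * t) - B / c * exp (c * 0))) {0..t}"
      using c by (intro fundamental_theorem_of_calculus that)
        (auto intro!: derivative_eq_intros simp flip: has_real_derivative_iff_has_vector_derivative)
    moreover have "h integrable_on {0..t}"
      using that(2) by (intro integrable_continuous_real) (auto intro: continuous_on_subset)
    moreover have "norm (h s) \<le> B * exp (c * s)" if "s \<in> {0..t}" for s
      using that \<open>\<And>s. norm (h s) \<le> B * exp (c * \<bar>s\<bar>)\<close>[of s] by simp
    ultimately have "norm (integral {0..t} h) \<le> B / c * exp (c * t) - B / c * exp (c * 0)"
      using integral_norm_bound_integral[of h "{0..t}" "\<lambda>s. B * exp (c * s)"]
      by (auto simp: has_integral_iff)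
    moreover have "0 \<le> B / c * exp (c * 0)" using B c by simp
    ultimately show ?thesis by linarith
  qed
  show ?thesis
  proof (cases "0 \<le> t")
    case True
    then have "antideriv h t = integral {0..t} h" by (cases "t = 0") (auto simp: antideriv_def)
    then show ?thesis using pos[OF True h b] True by simp
  next
    case False
    \<comment> \<open>Reflection in 0 reduces negative times to \<open>pos\<close>.\<close>
    have "integral {t..0} h = integral {0..-t} (\<lambda>s. h (- s))"
      using Henstock_Kurzweil_Integration.integral_reflect_real[of "- t" 0 "\<lambda>s. h (- s)"] by simp
    then have "norm (antideriv h t) = norm (integral {0..-t} (\<lambda>s. h (- s)))"
      using False by (simp add: antideriv_def)
    also have "\<dots> \<le> B / c * exp (c * (- t))"
    proof (rule pos)
      show "continuous_on UNIV (\<lambda>s. h (- s))"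
        by (rule continuous_on_compose2[OF h]) (auto intro: continuous_intros)
      show "norm (h (- s)) \<le> B * exp (c * \<bar>s\<bar>)" for s using b[of "- s"] by simp
    qed (use False in auto)
    finally show ?thesis using False by simp
  qed
qed

lemma antideriv_diff:
  assumes "continuous_on UNIV f" "continuous_on UNIV g"
  shows "antideriv f t - antideriv g t = antideriv (\<lambda>s. f s - g s) t"
proof -
  have "f integrable_on {u..v}" "g integrable_on {u..v}" for u v
    using assms by (auto intro!: integrable_continuous_real intro: continuous_on_subset)
  then show ?thesis by (simp add: antideriv_def Henstock_Kurzweil_Integration.integral_diff)
qed

text \<open>Picard iteration in the exponentially weighted norm converges for all times at once and
  so gives the global solution directly.\<close>

theorem lipschitz_ode_solution_exists:
  fixes Y :: "'a::euclidean_space \<Rightarrow> 'a"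
  assumes L: "L-lipschitz_on UNIV Y"
  shows "\<exists>\<phi>. \<phi> 0 = x \<and> (\<forall>t. (\<phi> has_vector_derivative Y (\<phi> t)) (at t))"
proof -
  \<comment> \<open>Chosen so that \<open>L / c\<close> is at most 1/2, with \<open>c\<close>
    positive also for \<open>L = 0\<close>.\<close>
  define c where "c = 2 * (L + 1)"
  have L0: "0 \<le> L" using L by (rule lipschitz_on_nonneg)
  then have c: "0 < c" "L / c \<le> 1/2" by (auto simp: c_def field_simps)
  have cY: "continuous_on UNIV Y" using L by (rule lipschitz_on_continuous_on)
  define y where "y = rec_nat (\<lambda>t. x) (\<lambda>k z t. x + antideriv (\<lambda>s. Y (z s)) t)"
  have y0: "y 0 = (\<lambda>t. x)" and yS: "y (Suc k) = (\<lambda>t. x + antideriv (\<lambda>s. Y (y k s)) t)" for k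
    by (simp_all add: y_def)
  have cont_step: "continuous_on UNIV (\<lambda>t. x + antideriv (\<lambda>s. Y (z s)) t)" if "continuous_on UNIV z" for z
  proof -
    have "continuous_on UNIV (\<lambda>s. Y (z s))" using that by (intro continuous_on_compose2[OF cY]) auto
    from has_vector_derivative_continuous[OF antideriv_has_vector_derivative[OF this]]
    have "continuous_on UNIV (antideriv (\<lambda>s. Y (z s)))"
      by (intro continuous_at_imp_continuous_on ballI)
    then show ?thesis by (intro continuous_intros)
  qed
  have cy: "continuous_on UNIV (y k)" for k
    by (induction k) (simp_all only: y0 yS continuous_on_const cont_step)
  have cYy: "continuous_on UNIV (\<lambda>s. Y (z s))" if "continuous_on UNIV z" for z :: "real \<Rightarrow> 'a"
    using that by (intro continuous_on_compose2[OF cY]) auto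
  have contr: "norm (antideriv (\<lambda>s. Y (z s)) t - antideriv (\<lambda>s. Y (w s)) t) \<le> B / 2 * exp (c * \<bar>t\<bar>)"
    if z: "continuous_on UNIV z" "continuous_on UNIV w" and B: "\<And>s. norm (z s - w s) \<le> B * exp (c * \<bar>s\<bar>)" for z w B t
  proof -
    have "norm (Y (z s) - Y (w s)) \<le> (L * B) * exp (c * \<bar>s\<bar>)" for s
    proof -
      have "norm (Y (z s) - Y (w s)) \<le> L * norm (z s - w s)"
        using lipschitz_onD[OF L, of "z s" "w s"] by (simp add: dist_norm)
      also have "\<dots> \<le> L * (B * exp (c * \<bar>s\<bar>))" using B L0 by (intro mult_left_mono)
      finally show ?thesis by (simp add: mult_ac)
    qed
    then have "norm (antideriv (\<lambda>s. Y (z s) - Y (w s)) t) \<le> (L * B) / c * exp (c * \<bar>t\<bar>)"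
      using z cYy c by (intro antideriv_exp_bound continuous_intros) auto
    moreover have "(L * B) / c * exp (c * \<bar>t\<bar>) \<le> B / 2 * exp (c * \<bar>t\<bar>)"
    proof -
      have "0 \<le> B" using order_trans[OF norm_ge_zero B[of 0]] by simp
      then have "(L / c) * B \<le> 1/2 * B" using c by (intro mult_right_mono)
      then show ?thesis by (intro mult_right_mono) auto
    qed
    ultimately show ?thesis unfolding antideriv_diff[OF cYy[OF z(1)] cYy[OF z(2)]] by (rule order_trans)
  qed
  \<comment> \<open>Weighted size of the first Picard step, whose integrand is the constant
    \<open>Y x\<close>.\<close>
  define K where "K = norm (Y x) / c"
  have K0: "0 \<le> K" using c by (simp add: K_def)
  have step: "norm (y (Suc k) t - y k t) \<le> K * (1/2) ^ k * exp (c * \<bar>t\<bar>)" for k t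
  proof (induction k arbitrary: t)
    case 0
    have "norm (antideriv (\<lambda>s. Y x) t) \<le> norm (Y x) / c * exp (c * \<bar>t\<bar>)"
      by (rule antideriv_exp_bound) (use c in \<open>auto simp: mult_le_cancel_left1\<close>)
    then show ?case by (simp add: yS y0 K_def)
  next
    case (Suc k)
    have "norm (y (Suc (Suc k)) t - y (Suc k) t)
        = norm (antideriv (\<lambda>s. Y (y (Suc k) s)) t - antideriv (\<lambda>s. Y (y k s)) t)"
      by (subst yS, subst (2) yS) simp
    also have "\<dots> \<le> K * (1/2) ^ k / 2 * exp (c * \<bar>t\<bar>)"
      by (rule contr[OF cy cy Suc])
    finally show ?case by simp
  qed
  \<comment> \<open>The factor \<open>1 - (1/2) ^ m\<close> is that of a partial geometric sum and
    makes the induction on \<open>m\<close> close.\<close>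
  have tail: "norm (y (k + m) t - y k t) \<le> 2 * K * (1/2) ^ k * exp (c * \<bar>t\<bar>) * (1 - (1/2) ^ m)" for k m t
  proof (induction m)
    case (Suc m)
    have "norm (y (k + Suc m) t - y k t) \<le> norm (y (Suc (k + m)) t - y (k + m) t) + norm (y (k + m) t - y k t)"
      using norm_triangle_ineq[of "y (Suc (k + m)) t - y (k + m) t" "y (k + m) t - y k t"] by simp
    also have "\<dots> \<le> K * (1/2) ^ (k + m) * exp (c * \<bar>t\<bar>) + 2 * K * (1/2) ^ k * exp (c * \<bar>t\<bar>) * (1 - (1/2) ^ m)"
      by (intro add_mono step Suc)
    also have "\<dots> = 2 * K * (1/2) ^ k * exp (c * \<bar>t\<bar>) * (1 - (1/2) ^ Suc m)"
      by (simp add: power_add algebra_simps)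
    finally show ?case .
  qed simp
  have tail': "norm (y (k + m) t - y k t) \<le> 2 * K * exp (c * \<bar>t\<bar>) * (1/2) ^ k" for k m t
  proof -
    have "2 * K * (1/2) ^ k * exp (c * \<bar>t\<bar>) * (1 - (1/2) ^ m) \<le> 2 * K * (1/2) ^ k * exp (c * \<bar>t\<bar>) * 1"
      using K0 by (intro mult_left_mono) auto
    then show ?thesis using tail[where k=k and m=m and t=t] by (simp add: mult_ac)
  qed
  have small: "(\<lambda>k. 2 * K * e * (1/2) ^ k) \<longlonglongrightarrow> 0" for e
    by (intro tendsto_mult_right_zero LIMSEQ_power_zero) auto
  have "Cauchy (\<lambda>k. y k t)" for t
  proof (rule metric_CauchyI)
    fix e :: real assume "0 < e"
    then have "eventually (\<lambda>k. 2 * K * exp (c * \<bar>t\<bar>) * (1/2) ^ k < e / 2) sequentially"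
      using order_tendstoD(2)[OF small, of "e/2"] by simp
    then obtain N where N: "2 * K * exp (c * \<bar>t\<bar>) * (1/2) ^ N < e / 2"
      by (auto simp: eventually_sequentially)
    have "dist (y m t) (y N t) < e / 2" if "m \<ge> N" for m
      using tail'[of N "m - N" t] N that by (simp add: dist_norm)
    then have "dist (y m t) (y n t) < e" if "m \<ge> N" "n \<ge> N" for m n
      using dist_triangle_half_r that by (metis dist_commute)
    then show "\<exists>M. \<forall>m\<ge>M. \<forall>n\<ge>M. dist (y m t) (y n t) < e" by blast
  qed
  then have "\<exists>z. (\<lambda>k. y k t) \<longlonglongrightarrow> z" for t
    by (simp add: Cauchy_convergent_iff convergent_def)
  then obtain \<phi> where \<phi>: "\<And>t. (\<lambda>k. y k t) \<longlonglongrightarrow> \<phi> t" by metis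
  have \<phi>b: "norm (\<phi> t - y k t) \<le> 2 * K * exp (c * \<bar>t\<bar>) * (1/2) ^ k" for t k
  proof (rule LIMSEQ_le_const2)
    show "(\<lambda>m. norm (y (m + k) t - y k t)) \<longlonglongrightarrow> norm (\<phi> t - y k t)"
      by (intro tendsto_intros LIMSEQ_ignore_initial_segment \<phi>)
    show "\<exists>N. \<forall>n\<ge>N. norm (y (n + k) t - y k t) \<le> 2 * K * exp (c * \<bar>t\<bar>) * (1/2) ^ k"
      using tail'[of k _ t] by (auto simp: add.commute)
  qed
  have c\<phi>: "continuous_on UNIV \<phi>"
  proof -
    \<comment> \<open>The weight is bounded on bounded time intervals, so convergence is locally
      uniform and the limit continuous.\<close>
    have "continuous_on (ball 0 T) \<phi>" for T
    proof (rule uniform_limit_theorem)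
      show "\<forall>\<^sub>F k in sequentially. continuous_on (ball 0 T) (y k)"
        by (intro always_eventually allI continuous_on_subset[OF cy]) auto
      show "uniform_limit (ball 0 T) y \<phi> sequentially"
      proof (rule uniform_limitI)
        fix e :: real assume "0 < e"
        then have "eventually (\<lambda>k. 2 * K * exp (c * T) * (1/2) ^ k < e) sequentially"
          using order_tendstoD(2)[OF small] by simp
        then show "\<forall>\<^sub>F n in sequentially. \<forall>t\<in>ball 0 T. dist (y n t) (\<phi> t) < e"
        proof eventually_elim
          case (elim k)
          show ?case
          proof
            fix t assume "t \<in> ball (0::real) T"
            then have "2 * K * exp (c * \<bar>t\<bar>) * (1/2) ^ k \<le> 2 * K * exp (c * T) * (1/2) ^ k"
              using K0 c by (intro mult_right_mono mult_left_mono) auto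
            then show "dist (y k t) (\<phi> t) < e"
              using \<phi>b[of t k] elim by (simp add: dist_norm norm_minus_commute)
          qed
        qed
      qed
    qed simp
    then have "isCont \<phi> t" for t
      using continuous_on_interior[of "ball 0 (\<bar>t\<bar> + 1)" \<phi> t] by auto
    then show ?thesis by (simp add: continuous_at_imp_continuous_on)
  qed
  have fixp: "\<phi> t = x + antideriv (\<lambda>s. Y (\<phi> s)) t" for t
  proof -
    have "(\<lambda>k. y (Suc k) t) \<longlonglongrightarrow> x + antideriv (\<lambda>s. Y (\<phi> s)) t"
    proof (rule metric_LIMSEQ_I)
      fix e :: real assume "0 < e"
      then obtain N where N: "\<And>k. k \<ge> N \<Longrightarrow> 2 * K * exp (c * \<bar>t\<bar>) * (1/2) ^ k < e"
        using order_tendstoD(2)[OF small[of "exp (c * \<bar>t\<bar>)"], of e] by (auto simp: eventually_sequentially)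
      show "\<exists>N. \<forall>k\<ge>N. dist (y (Suc k) t) (x + antideriv (\<lambda>s. Y (\<phi> s)) t) < e"
      proof (intro exI allI impI)
        fix k assume k: "N \<le> k"
        have "norm (antideriv (\<lambda>s. Y (\<phi> s)) t - antideriv (\<lambda>s. Y (y k s)) t) \<le> (2 * K * (1/2) ^ k) / 2 * exp (c * \<bar>t\<bar>)"
          by (rule contr[OF c\<phi> cy]) (use \<phi>b[of _ k] in \<open>simp add: mult_ac\<close>)
        also have "\<dots> \<le> 2 * K * exp (c * \<bar>t\<bar>) * (1/2) ^ k" using K0 by simp
        also have "\<dots> < e" using N[OF k] .
        finally show "dist (y (Suc k) t) (x + antideriv (\<lambda>s. Y (\<phi> s)) t) < e"
          by (simp add: yS dist_norm norm_minus_commute)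
      qed
    qed
    then show ?thesis using \<phi>[of t] LIMSEQ_Suc LIMSEQ_unique by blast
  qed
  have "(\<phi> has_vector_derivative Y (\<phi> t)) (at t)" for t
  proof -
    have "((\<lambda>t. x + antideriv (\<lambda>s. Y (\<phi> s)) t) has_vector_derivative 0 + Y (\<phi> t)) (at t)"
      by (intro has_vector_derivative_add has_vector_derivative_const antideriv_has_vector_derivative cYy c\<phi>)
    moreover have "(\<lambda>t. x + antideriv (\<lambda>s. Y (\<phi> s)) t) = \<phi>" by (rule ext) (rule fixp[symmetric])
    ultimately show ?thesis by simp
  qed
  moreover have "\<phi> 0 = x" by (subst fixp) simp
  ultimately show ?thesis by blast
qed

section \<open>Gronwall's estimate and the flow as a group of Lipschitz maps\<close>

text \<open>Gronwall's inequality through the squared distance, which is differentiable even where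
  the curves meet: its derivative is at most \<open>2 * L\<close> times itself, so its product with
  \<open>exp (- 2 * L * t)\<close> does not increase. Only values of \<open>Y\<close> on the two
  curves are compared, so \<open>V\<close> may be any set that contains them.\<close>

lemma solution_distance_forward:
  fixes y z :: "real \<Rightarrow> 'a::euclidean_space"
  assumes L: "L-lipschitz_on V Y" and ab: "a \<le> b"
    and y: "\<And>t. t \<in> {a..b} \<Longrightarrow> (y has_vector_derivative Y (y t)) (at t) \<and> y t \<in> V"
    and z: "\<And>t. t \<in> {a..b} \<Longrightarrow> (z has_vector_derivative Y (z t)) (at t) \<and> z t \<in> V"
  shows "norm (y b - z b) \<le> exp (L * (b - a)) * norm (y a - z a)"
proof -
  define w where "w t = (y t - z t) \<bullet> (y t - z t) * exp (- 2 * L * t)" for t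
  have "w b \<le> w a"
  proof (rule DERIV_nonpos_imp_nonincreasing[OF ab])
    fix t assume t: "a \<le> t" "t \<le> b"
    define d where "d = 2 * ((Y (y t) - Y (z t)) \<bullet> (y t - z t)) - 2 * L * ((y t - z t) \<bullet> (y t - z t))"
    have "((\<lambda>t. y t - z t) has_derivative (\<lambda>h. h *\<^sub>R (Y (y t) - Y (z t)))) (at t)"
      using has_vector_derivative_diff[of y "Y (y t)" "at t" z "Y (z t)"] y[of t] z[of t] t
      by (simp add: has_vector_derivative_def)
    from has_derivative_inner[OF this this]
    have "((\<lambda>t. (y t - z t) \<bullet> (y t - z t)) has_real_derivative 2 * ((Y (y t) - Y (z t)) \<bullet> (y t - z t))) (at t)"
      unfolding has_field_derivative_def
      by (rule has_derivative_eq_rhs) (auto simp: inner_commute algebra_simps fun_eq_iff)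
    moreover have "((\<lambda>t. exp (- 2 * L * t)) has_real_derivative exp (- 2 * L * t) * (- 2 * L)) (at t)"
      by (auto intro!: derivative_eq_intros)
    ultimately have w': "(w has_real_derivative d * exp (- 2 * L * t)) (at t)"
      unfolding w_def by (rule DERIV_cong[OF DERIV_mult]) (simp add: d_def algebra_simps)
    have "d \<le> 0"
    proof -
      have "(Y (y t) - Y (z t)) \<bullet> (y t - z t) \<le> norm (Y (y t) - Y (z t)) * norm (y t - z t)"
        by (rule norm_cauchy_schwarz)
      also have "\<dots> \<le> (L * norm (y t - z t)) * norm (y t - z t)"
        using lipschitz_onD[OF L, of "y t" "z t"] y[of t] z[of t] t
        by (intro mult_right_mono) (auto simp: dist_norm)
      also have "\<dots> = L * ((y t - z t) \<bullet> (y t - z t))" by (simp add: dot_square_norm power2_eq_square)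
      finally show ?thesis by (simp add: d_def)
    qed
    then have "d * exp (- 2 * L * t) \<le> 0" by (simp add: mult_nonpos_nonneg)
    with w' show "\<exists>y. (w has_real_derivative y) (at t) \<and> y \<le> 0" by blast
  qed
  then have "(norm (y b - z b))\<^sup>2 * exp (- 2 * L * b) * exp (2 * L * b) \<le> (norm (y a - z a))\<^sup>2 * exp (- 2 * L * a) * exp (2 * L * b)"
    by (simp add: w_def dot_square_norm)
  then have "(norm (y b - z b))\<^sup>2 \<le> (norm (y a - z a))\<^sup>2 * (exp (2 * L * b) * exp (- 2 * L * a))"
    by (simp add: mult.assoc mult_exp_exp)
  also have "exp (2 * L * b) * exp (- 2 * L * a) = (exp (L * (b - a)))\<^sup>2"
    by (simp add: mult_exp_exp power2_eq_square algebra_simps)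
  finally have "(norm (y b - z b))\<^sup>2 \<le> (exp (L * (b - a)) * norm (y a - z a))\<^sup>2"
    by (simp add: power_mult_distrib mult.commute)
  then show ?thesis by (rule power2_le_imp_le) simp
qed

text \<open>Running backwards in time replaces \<open>Y\<close> by \<open>- Y\<close>, which has the
  same Lipschitz constant.\<close>

lemma solution_distance:
  fixes y z :: "real \<Rightarrow> 'a::euclidean_space"
  assumes L: "L-lipschitz_on V Y"
    and y: "\<And>t. t \<in> closed_segment a b \<Longrightarrow> (y has_vector_derivative Y (y t)) (at t) \<and> y t \<in> V"
    and z: "\<And>t. t \<in> closed_segment a b \<Longrightarrow> (z has_vector_derivative Y (z t)) (at t) \<and> z t \<in> V"
  shows "norm (y b - z b) \<le> exp (L * \<bar>b - a\<bar>) * norm (y a - z a)"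
proof (cases "a \<le> b")
  case True
  then show ?thesis using solution_distance_forward[OF L True, of y z] y z
    by (simp add: closed_segment_eq_real_ivl)
next
  case False
  have rev: "((\<lambda>s. u (- s)) has_vector_derivative - Y (u (- t))) (at t) \<and> u (- t) \<in> V"
    if "\<And>t. t \<in> closed_segment a b \<Longrightarrow> (u has_vector_derivative Y (u t)) (at t) \<and> u t \<in> V" "t \<in> {-a..-b}" for u t
  proof -
    have "-t \<in> closed_segment a b" using False that(2) by (auto simp: closed_segment_eq_real_ivl)
    then have u: "(u has_vector_derivative Y (u (- t))) (at (- t))" "u (- t) \<in> V" using that(1) by auto
    have "((\<lambda>s. - s) has_vector_derivative - 1) (at t)" by (auto intro!: derivative_eq_intros)
    from vector_diff_chain_at[OF this u(1)] show ?thesis using u(2) by (simp add: o_def)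
  qed
  have L': "L-lipschitz_on V (\<lambda>x. - Y x)"
    using L by (auto simp: lipschitz_on_def dist_minus)
  have "norm (y (- (- b)) - z (- (- b))) \<le> exp (L * (- b - (- a))) * norm (y (- (- a)) - z (- (- a)))"
    by (rule solution_distance_forward[OF L' _ rev[OF y] rev[OF z]]) (use False in auto)
  then show ?thesis using False by simp
qed

text \<open>Flow of a field that is bounded and Lipschitz on the whole space, as cut-offs provide
  it. The constants are parameters since they recur in every estimate: \<open>L\<close> governs
  distances and volumes, \<open>M\<close> the speed of points.\<close>

locale lipschitz_flow =
  fixes Y :: "'a::euclidean_space \<Rightarrow> 'a" and L M :: real and \<Phi> :: "real \<Rightarrow> 'a \<Rightarrow> 'a"
  assumes lip: "L-lipschitz_on UNIV Y"
    and bound: "norm (Y x) \<le> M"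
    and init: "\<Phi> 0 x = x"
    and deriv: "((\<lambda>t. \<Phi> t x) has_vector_derivative Y (\<Phi> t x)) (at t)"
begin

lemma L_nonneg: "0 \<le> L" using lip by (rule lipschitz_on_nonneg)

lemma M_nonneg: "0 \<le> M" using bound[of undefined] norm_ge_zero order_trans by blast

lemma flow_lipschitz: "(exp (L * \<bar>t\<bar>))-lipschitz_on UNIV (\<Phi> t)"
proof (rule lipschitz_onI)
  fix x y
  show "dist (\<Phi> t x) (\<Phi> t y) \<le> exp (L * \<bar>t\<bar>) * dist x y"
    using solution_distance[OF lip, of 0 t "\<lambda>t. \<Phi> t x" "\<lambda>t. \<Phi> t y"] deriv
    by (simp add: dist_norm init)
qed simp

lemma flow_add: "\<Phi> s (\<Phi> t x) = \<Phi> (s + t) x"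
proof -
  have "((\<lambda>s. \<Phi> (s + t) x) has_vector_derivative Y (\<Phi> (s + t) x)) (at s)" for s
  proof -
    have "((\<lambda>s. s + t) has_vector_derivative 1) (at s)" by (auto intro!: derivative_eq_intros)
    from vector_diff_chain_at[OF this deriv] show ?thesis by (simp add: o_def)
  qed
  then have "norm (\<Phi> s (\<Phi> t x) - \<Phi> (s + t) x) \<le> exp (L * \<bar>s - 0\<bar>) * norm (\<Phi> 0 (\<Phi> t x) - \<Phi> (0 + t) x)"
    using deriv by (intro solution_distance[OF lip, of 0 s "\<lambda>s. \<Phi> s (\<Phi> t x)" "\<lambda>s. \<Phi> (s + t) x"]) auto
  then show ?thesis by (simp add: init)
qed

lemma flow_inverse [simp]: "\<Phi> (- t) (\<Phi> t x) = x" "\<Phi> t (\<Phi> (- t) x) = x"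
  by (simp_all add: flow_add init)

lemma flow_speed: "dist (\<Phi> s x) (\<Phi> t x) \<le> M * \<bar>s - t\<bar>"
proof -
  have "norm (\<Phi> s x - \<Phi> t x) \<le> M * norm (s - t)"
    by (rule differentiable_bound[of UNIV "\<lambda>t. \<Phi> t x" "\<lambda>t h. h *\<^sub>R Y (\<Phi> t x)"])
      (use deriv bound M_nonneg in \<open>auto simp: has_vector_derivative_def onorm_scaleR_left onorm_id intro: onorm_scaleR_left\<close>)
  then show ?thesis by (simp add: dist_norm)
qed

lemma flow_continuous: "continuous_on UNIV (\<lambda>p. \<Phi> (fst p) (snd p))"
proof (intro continuous_at_imp_continuous_on ballI)
  fix p :: "real \<times> 'a"
  obtain t x where p: "p = (t, x)" by force
  have "((\<lambda>q. \<Phi> (fst q) (snd q)) \<longlongrightarrow> \<Phi> t x) (at p)"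
  proof (rule tendsto_dist_iff[THEN iffD2], rule tendsto_sandwich[OF _ _ tendsto_const])
    show "\<forall>\<^sub>F q in at p. dist (\<Phi> (fst q) (snd q)) (\<Phi> t x) \<le> M * \<bar>fst q - t\<bar> + exp (L * \<bar>t\<bar>) * dist (snd q) x"
    proof (rule always_eventually, rule allI)
      fix q :: "real \<times> 'a"
      have "dist (\<Phi> (fst q) (snd q)) (\<Phi> t x) \<le> dist (\<Phi> (fst q) (snd q)) (\<Phi> t (snd q)) + dist (\<Phi> t (snd q)) (\<Phi> t x)"
        by (rule dist_triangle)
      also have "\<dots> \<le> M * \<bar>fst q - t\<bar> + exp (L * \<bar>t\<bar>) * dist (snd q) x"
        using flow_speed lipschitz_onD[OF flow_lipschitz] by (intro add_mono) auto
      finally show "dist (\<Phi> (fst q) (snd q)) (\<Phi> t x) \<le> M * \<bar>fst q - t\<bar> + exp (L * \<bar>t\<bar>) * dist (snd q) x" .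
    qed
    have "((\<lambda>q. M * \<bar>fst q - t\<bar> + exp (L * \<bar>t\<bar>) * dist (snd q) x) \<longlongrightarrow> M * \<bar>fst p - t\<bar> + exp (L * \<bar>t\<bar>) * dist (snd p) x) (at p)"
      by (intro tendsto_intros)
    then show "((\<lambda>q. M * \<bar>fst q - t\<bar> + exp (L * \<bar>t\<bar>) * dist (snd q) x) \<longlongrightarrow> 0) (at p)" by (simp add: p)
  qed simp
  then show "isCont (\<lambda>p. \<Phi> (fst p) (snd p)) p" by (simp add: isCont_def p)
qed

lemma flow_continuous_space: "continuous_on UNIV (\<Phi> t)"
  using flow_lipschitz by (rule lipschitz_on_continuous_on)

lemma flow_continuous_time: "continuous_on UNIV (\<lambda>t. \<Phi> t x)"
  by (intro continuous_at_imp_continuous_on ballI has_vector_derivative_continuous[OF deriv])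

lemma flow_measurable_pair [measurable]: "(\<lambda>p. \<Phi> (fst p) (snd p)) \<in> borel_measurable (borel \<Otimes>\<^sub>M borel)"
  using borel_measurable_continuous_onI[OF flow_continuous] by (simp add: borel_prod)

lemma flow_measurable [measurable]:
  assumes "f \<in> borel_measurable N" "g \<in> borel_measurable N"
  shows "(\<lambda>p. \<Phi> (f p) (g p)) \<in> borel_measurable N"
proof -
  have "(\<lambda>p. (f p, g p)) \<in> measurable N (borel \<Otimes>\<^sub>M borel)" using assms by measurable
  from measurable_compose[OF this flow_measurable_pair] show ?thesis by simp
qed

lemma flow_vimage_emeasure:
  assumes "A \<in> sets borel"
  shows "emeasure lborel (\<Phi> t -` A) \<le> ennreal (exp (L * \<bar>t\<bar>) ^ DIM('a)) * emeasure lborel A"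
  by (rule lipschitz_inverse_vimage_emeasure[OF _ flow_continuous_space _ _ assms, of _ "\<Phi> (- t)"])
    (use flow_lipschitz[of "- t"] in auto)

end

section \<open>The maximal flow of a locally Lipschitz field\<close>

text \<open>The two orbit pieces up to \<open>t\<close> form a compact subset of
  \<open>\<Omega>\<close>, on which local Lipschitz continuity supplies a single constant;
  Gronwall's estimate then applies with equal initial values.\<close>

lemma solution_unique:
  assumes X: "locally_lipschitz_field \<Omega> X"
    and I: "solution \<Omega> X x I \<gamma>" and J: "solution \<Omega> X x J \<eta>" and t: "t \<in> I" "t \<in> J"
  shows "\<gamma> t = \<eta> t"
proof -
  have seg: "closed_segment 0 t \<subseteq> I" "closed_segment 0 t \<subseteq> J"
    using I J t closed_segment_subset is_interval_convex unfolding solution_def by metis+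
  define V where "V = \<gamma> ` closed_segment 0 t \<union> \<eta> ` closed_segment 0 t"
  have "continuous_on (closed_segment 0 t) \<gamma>" "continuous_on (closed_segment 0 t) \<eta>"
    using I J seg unfolding solution_def
    by (meson continuous_at_imp_continuous_on has_vector_derivative_continuous subsetD)+
  then have V: "compact V" unfolding V_def
    by (intro compact_Un compact_continuous_image) auto
  have "V \<subseteq> \<Omega>" using I J seg unfolding V_def solution_def by blast
  then have "local_lipschitz (UNIV :: real set) V (\<lambda>_. X)"
    using X unfolding locally_lipschitz_field_def by (rule local_lipschitz_subset[rotated -1]) auto
  then have "local_lipschitz {0::real} V (\<lambda>_. X)"
    by (rule local_lipschitz_subset) auto
  then obtain L where "L-lipschitz_on V X"
    using local_lipschitz_compact_implies_lipschitz[of "{0::real}" V "\<lambda>_. X"] V by auto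
  then have "norm (\<gamma> t - \<eta> t) \<le> exp (L * \<bar>t - 0\<bar>) * norm (\<gamma> 0 - \<eta> 0)"
    by (rule solution_distance) (use I J seg in \<open>auto simp: V_def solution_def\<close>)
  also have "\<gamma> 0 = \<eta> 0" using I J by (simp add: solution_def)
  finally show ?thesis by simp
qed

text \<open>Solutions agree where they overlap and their intervals share 0, so they glue to a
  solution on the union \<open>J\<close>. That \<open>J\<close> contains every solution interval is
  more than maximality demands and yields uniqueness of the maximal interval.\<close>

lemma maximal_solution_exists:
  assumes X: "locally_lipschitz_field \<Omega> X" and ex: "solution \<Omega> X x I0 \<gamma>0"
  shows "\<exists>J G. maximal_solution \<Omega> X x J G \<and> (\<forall>I \<gamma>. solution \<Omega> X x I \<gamma> \<longrightarrow> I \<subseteq> J)"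
proof -
  define J where "J = \<Union>{I. \<exists>\<gamma>. solution \<Omega> X x I \<gamma>}"
  define G where "G t = (SOME z. \<exists>I \<gamma>. solution \<Omega> X x I \<gamma> \<and> t \<in> I \<and> z = \<gamma> t)" for t
  have G: "G t = \<gamma> t" if "solution \<Omega> X x I \<gamma>" "t \<in> I" for I \<gamma> t
  proof -
    have "\<exists>I \<gamma>. solution \<Omega> X x I \<gamma> \<and> t \<in> I \<and> G t = \<gamma> t"
      unfolding G_def by (rule someI_ex) (use that in blast)
    then show ?thesis using solution_unique[OF X] that by metis
  qed
  have sub: "I \<subseteq> J" if "solution \<Omega> X x I \<gamma>" for I \<gamma> using that by (auto simp: J_def)
  have sol: "solution \<Omega> X x J G"
    unfolding solution_def
  proof (intro conjI ballI)
    show "open J" unfolding J_def by (intro open_Union) (auto simp: solution_def)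
    have "connected J" unfolding J_def
      by (rule connected_Union) (auto simp: solution_def is_interval_connected_1)
    then show "is_interval J" by (simp add: is_interval_connected_1)
    show "0 \<in> J" using sub[OF ex] ex by (auto simp: solution_def)
    show "G 0 = x" using G[OF ex] ex by (auto simp: solution_def)
    fix t assume "t \<in> J"
    then obtain I \<gamma> where I: "solution \<Omega> X x I \<gamma>" "t \<in> I" by (auto simp: J_def)
    then show "G t \<in> \<Omega>" using G[OF I] by (auto simp: solution_def)
    have "(\<gamma> has_vector_derivative X (G t)) (at t)" using I G[OF I] by (auto simp: solution_def)
    then show "(G has_vector_derivative X (G t)) (at t)"
      by (rule has_vector_derivative_transform_within_open[of _ _ _ I])
        (use I G in \<open>auto simp: solution_def\<close>)
  qed
  then have "maximal_solution \<Omega> X x J G"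
    unfolding maximal_solution_def using sub by blast
  then show ?thesis using sub by blast
qed

text \<open>Resolves the description operators in \<open>flow_interval\<close> and
  \<open>flow\<close>: uniqueness pins both down to the glued solution, of which every solution is a
  restriction.\<close>

lemma flow_solution:
  assumes X: "locally_lipschitz_field \<Omega> X" and ex: "solution \<Omega> X x I0 \<gamma>0"
  shows "solution \<Omega> X x (flow_interval \<Omega> X x) (\<lambda>t. flow \<Omega> X t x)"
    and "solution \<Omega> X x I \<gamma> \<Longrightarrow> I \<subseteq> flow_interval \<Omega> X x"
    and "solution \<Omega> X x I \<gamma> \<Longrightarrow> t \<in> I \<Longrightarrow> flow \<Omega> X t x = \<gamma> t"
proof -
  obtain J G where J: "maximal_solution \<Omega> X x J G" and sub: "\<And>I \<gamma>. solution \<Omega> X x I \<gamma> \<Longrightarrow> I \<subseteq> J"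
    using maximal_solution_exists[OF X ex] by blast
  have uniq: "I = J" if "maximal_solution \<Omega> X x I \<gamma>" for I \<gamma>
  proof -
    have s: "solution \<Omega> X x I \<gamma>" "solution \<Omega> X x J G" using that J by (auto simp: maximal_solution_def)
    have "I \<subseteq> J" using sub s by blast
    moreover have "\<forall>t\<in>I. G t = \<gamma> t" using solution_unique[OF X s(2,1)] \<open>I \<subseteq> J\<close> by blast
    ultimately show ?thesis using that s(2) unfolding maximal_solution_def by blast
  qed
  have FJ: "flow_interval \<Omega> X x = J"
    unfolding flow_interval_def using J uniq by (intro the_equality) blast+
  define \<gamma>' where "\<gamma>' = (SOME \<gamma>. maximal_solution \<Omega> X x (flow_interval \<Omega> X x) \<gamma>)"
  have "maximal_solution \<Omega> X x (flow_interval \<Omega> X x) \<gamma>'"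
    unfolding \<gamma>'_def by (rule someI[of _ G]) (use J FJ in simp)
  moreover have "(\<lambda>t. flow \<Omega> X t x) = \<gamma>'" by (simp add: flow_def \<gamma>'_def)
  ultimately show sol: "solution \<Omega> X x (flow_interval \<Omega> X x) (\<lambda>t. flow \<Omega> X t x)"
    by (simp add: maximal_solution_def)
  show I: "I \<subseteq> flow_interval \<Omega> X x" if "solution \<Omega> X x I \<gamma>" using sub[OF that] FJ by simp
  show "flow \<Omega> X t x = \<gamma> t" if "solution \<Omega> X x I \<gamma>" "t \<in> I"
    using solution_unique[OF X sol that(1)] I[OF that(1)] that(2) by blast
qed

text \<open>While an orbit of \<open>\<Phi>\<close> stays in \<open>V\<close> it solves the equation
  of \<open>X\<close> as well, so uniqueness identifies it with the maximal flow.\<close>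

lemma flow_eq_lipschitz_flow:
  fixes \<Omega> :: "(real ^ 'n) set"
  assumes X: "locally_lipschitz_field \<Omega> X"
    and Y: "lipschitz_flow Y L M \<Phi>" and V: "open V" "V \<subseteq> \<Omega>" "\<And>y. y \<in> V \<Longrightarrow> Y y = X y"
    and t: "0 \<le> t" "\<And>s. s \<in> {0..t} \<Longrightarrow> \<Phi> s x \<in> V"
  shows "{0..t} \<subseteq> flow_interval \<Omega> X x" "\<And>s. s \<in> {0..t} \<Longrightarrow> flow \<Omega> X s x = \<Phi> s x"
    and "solution \<Omega> X x (flow_interval \<Omega> X x) (\<lambda>t. flow \<Omega> X t x)"
proof -
  interpret lipschitz_flow Y L M \<Phi> by (rule Y)
  define S where "S = {s. \<Phi> s x \<in> V}"
  have "open S" unfolding S_def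
    using continuous_open_preimage[OF flow_continuous_time open_UNIV V(1), of x] by (simp add: vimage_def)
  \<comment> \<open>\<open>solution\<close> asks for an open interval around 0; the component of 0
    in the open set of times spent in \<open>V\<close> is one, and it contains
    \<open>{0..t}\<close>.\<close>
  define I where "I = connected_component_set S 0"
  have It: "{0..t} \<subseteq> I" unfolding I_def
    by (rule connected_component_maximal) (use t in \<open>auto simp: S_def\<close>)
  have IS: "I \<subseteq> S" unfolding I_def by (rule connected_component_subset)
  have sol: "solution \<Omega> X x I (\<lambda>t. \<Phi> t x)"
    unfolding solution_def
  proof (intro conjI ballI)
    show "open I" unfolding I_def using \<open>open S\<close> by (rule open_connected_component)
    show "is_interval I" unfolding I_def is_interval_connected_1 by simp
    show "0 \<in> I" using It t by auto
    fix s assume "s \<in> I"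
    then have "\<Phi> s x \<in> V" using IS by (auto simp: S_def)
    then show "\<Phi> s x \<in> \<Omega>" "((\<lambda>t. \<Phi> t x) has_vector_derivative X (\<Phi> s x)) (at s)"
      using V deriv[of x s] by auto
  qed (rule init)
  show "{0..t} \<subseteq> flow_interval \<Omega> X x" using flow_solution(2)[OF X sol sol] It by simp
  show "flow \<Omega> X s x = \<Phi> s x" if "s \<in> {0..t}" for s
    using flow_solution(3)[OF X sol sol] It that by blast
  show "solution \<Omega> X x (flow_interval \<Omega> X x) (\<lambda>t. flow \<Omega> X t x)"
    by (rule flow_solution(1)[OF X sol])
qed

text \<open>\<open>X\<close> is multiplied by a Lipschitz cut-off that is 1 up to distance
  \<open>d\<close> from \<open>K\<close> and 0 beyond \<open>2 * d\<close>. On the compact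
  neighbourhood \<open>W\<close> the field \<open>X\<close> is bounded and has one Lipschitz
  constant, so the product is bounded and Lipschitz on the whole space.\<close>

lemma cutoff_field_exists:
  fixes \<Omega> :: "(real ^ 'n) set"
  assumes \<Omega>: "open \<Omega>" and X: "locally_lipschitz_field \<Omega> X" and K: "compact K" "K \<noteq> {}" "K \<subseteq> \<Omega>"
  obtains Y L M \<Phi> d where "0 < d" "lipschitz_flow Y L M \<Phi>"
    "compact {x. infdist x K \<le> d}" "{x. infdist x K \<le> d} \<subseteq> \<Omega>"
    "\<And>x. infdist x K \<le> d \<Longrightarrow> Y x = X x"
proof -
  obtain e where e: "0 < e" "{x. infdist x K \<le> e} \<subseteq> \<Omega>"
    using compact_in_open_separated[OF K(2,1) \<Omega> K(3)] by blast
  define W where "W = {x. infdist x K \<le> e}"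
  obtain R where R: "\<And>x. x \<in> K \<Longrightarrow> norm x \<le> R"
    using compact_imp_bounded[OF K(1)] by (auto simp: bounded_iff)
  have cl: "closed {x. infdist x K \<le> r}" for r
    by (intro closed_Collect_le continuous_intros)
  have bd: "bounded {x. infdist x K \<le> r}" for r
  proof (rule boundedI)
    fix x assume x: "x \<in> {x. infdist x K \<le> r}"
    obtain y where y: "y \<in> K" "infdist x K = dist x y"
      using infdist_attains_inf[OF compact_imp_closed[OF K(1)] K(2)] by blast
    have "norm x \<le> norm y + dist x y" by (metis add.commute dist_norm norm_triangle_sub)
    then show "norm x \<le> R + r" using R[OF y(1)] y x by auto
  qed
  have cpt: "compact {x. infdist x K \<le> r}" for r using cl bd by (simp add: compact_eq_bounded_closed)
  have W: "compact W" unfolding W_def by (rule cpt)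
  have "local_lipschitz {0::real} W (\<lambda>_. X)"
    using X[unfolded locally_lipschitz_field_def] by (rule local_lipschitz_subset) (use e in \<open>auto simp: W_def\<close>)
  then obtain L0 where L0: "L0-lipschitz_on W X"
    using local_lipschitz_compact_implies_lipschitz[of "{0::real}" W "\<lambda>_. X"] W by auto
  have L00: "0 \<le> L0" using L0 by (rule lipschitz_on_nonneg)
  have "bounded (X ` W)"
    using W lipschitz_on_continuous_on[OF L0] by (intro compact_imp_bounded compact_continuous_image)
  then obtain M where M: "0 < M" "\<And>x. x \<in> W \<Longrightarrow> norm (X x) \<le> M" by (auto simp: bounded_pos)
  define d where "d = e / 2"
  have d: "0 < d" "e = 2 * d" using e by (auto simp: d_def)
  define \<theta> where "\<theta> x = max 0 (min 1 (2 - infdist x K / d))" for x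
  have \<theta>01: "0 \<le> \<theta> x" "\<theta> x \<le> 1" for x by (auto simp: \<theta>_def)
  have \<theta>lip: "\<bar>\<theta> x - \<theta> y\<bar> \<le> (1 / d) * dist x y" for x y
  proof -
    have "\<bar>\<theta> x - \<theta> y\<bar> \<le> \<bar>infdist x K / d - infdist y K / d\<bar>" unfolding \<theta>_def by linarith
    also have "\<dots> = (1 / d) * \<bar>infdist x K - infdist y K\<bar>"
      using d by (simp add: abs_divide flip: diff_divide_distrib)
    also have "\<dots> \<le> (1 / d) * dist x y"
      using infdist_triangle_abs[of x K y] d by (intro mult_left_mono) auto
    finally show ?thesis .
  qed
  have \<theta>0: "\<theta> x = 0" if "x \<notin> W" for x
    using that d by (auto simp: \<theta>_def W_def field_simps)
  have \<theta>1: "\<theta> x = 1" if "infdist x K \<le> d" for x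
    using that d by (auto simp: \<theta>_def field_simps)
  define Y where "Y x = (if x \<in> W then \<theta> x *\<^sub>R X x else 0)" for x
  have YM: "norm (Y x) \<le> M" for x
    using M(1) M(2)[of x] \<theta>01[of x] mult_left_le_one_le[of "norm (X x)" "\<theta> x"] by (auto simp: Y_def)
  define L where "L = M / d + L0"
  \<comment> \<open>For \<open>y\<close> outside \<open>W\<close> we have
    \<open>\<theta> y = 0\<close>, so \<open>\<theta> x\<close> is at most
    \<open>dist x y / d\<close>: extension by zero creates no jump at the boundary of
    \<open>W\<close>.\<close>
  have one: "norm (Y x) \<le> L * dist x y" if "x \<in> W" "y \<notin> W" for x y
  proof -
    have "norm (Y x) = \<theta> x * norm (X x)" using that \<theta>01 by (simp add: Y_def)
    also have "\<dots> \<le> (1 / d * dist x y) * M"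
      using \<theta>lip[of x y] \<theta>0[OF that(2)] \<theta>01[of x] M that by (intro mult_mono) auto
    also have "\<dots> \<le> L * dist x y" using L00 by (simp add: L_def algebra_simps)
    finally show ?thesis .
  qed
  have YL: "L-lipschitz_on UNIV Y"
  proof (rule lipschitz_onI)
    show "0 \<le> L" using M d L00 by (simp add: L_def)
    fix x y
    consider "x \<in> W" "y \<in> W" | "x \<in> W" "y \<notin> W" | "x \<notin> W" "y \<in> W" | "x \<notin> W" "y \<notin> W" by blast
    then show "dist (Y x) (Y y) \<le> L * dist x y"
    proof cases
      case 1
      have "Y x - Y y = (\<theta> x - \<theta> y) *\<^sub>R X x + \<theta> y *\<^sub>R (X x - X y)"
        using 1 by (simp add: Y_def algebra_simps)
      then have "norm (Y x - Y y) \<le> \<bar>\<theta> x - \<theta> y\<bar> * norm (X x) + \<theta> y * norm (X x - X y)"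
        using \<theta>01 norm_triangle_ineq[of "(\<theta> x - \<theta> y) *\<^sub>R X x" "\<theta> y *\<^sub>R (X x - X y)"] by simp
      also have "\<dots> \<le> (1 / d * dist x y) * M + 1 * (L0 * dist x y)"
        using \<theta>lip[of x y] \<theta>01 M 1 lipschitz_onD[OF L0 1] d
        by (intro add_mono mult_mono) (auto simp: dist_norm)
      also have "\<dots> = L * dist x y" by (simp add: L_def algebra_simps)
      finally show ?thesis by (simp add: dist_norm)
    next
      case 2 then show ?thesis using one[of x y] by (simp add: dist_norm Y_def)
    next
      case 3 then show ?thesis using one[of y x] by (simp add: dist_norm Y_def norm_minus_commute)
    next
      case 4 then show ?thesis using L00 M d by (simp add: Y_def L_def)
    qed
  qed
  have "\<forall>x. \<exists>\<phi>. \<phi> 0 = x \<and> (\<forall>t. (\<phi> has_vector_derivative Y (\<phi> t)) (at t))"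
    using lipschitz_ode_solution_exists[OF YL] by blast
  then obtain \<phi> where \<phi>: "\<And>x. \<phi> x 0 = x" "\<And>x t. (\<phi> x has_vector_derivative Y (\<phi> x t)) (at t)" by metis
  have lf: "lipschitz_flow Y L M (\<lambda>t x. \<phi> x t)"
    by unfold_locales (use YL YM \<phi> in auto)
  show thesis
  proof (rule that[OF d(1) lf cpt])
    show "{x. infdist x K \<le> d} \<subseteq> \<Omega>" using e d by auto
    show "Y x = X x" if "infdist x K \<le> d" for x
      using that \<theta>1 d by (auto simp: Y_def W_def)
  qed
qed

section \<open>Approximation and continuity in \<open>L\<^sup>1\<close>\<close>

text \<open>Valued in \<open>ennreal\<close>: a divergent integral is infinite instead of the
  default 0 of the Bochner integral, so estimates can be chained before integrability is
  known.\<close>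

definition l1 :: "('a::euclidean_space \<Rightarrow> real) \<Rightarrow> ennreal" where
  "l1 f = (\<integral>\<^sup>+x. ennreal \<bar>f x\<bar> \<partial>lborel)"

lemma l1_triangle:
  assumes [measurable]: "f \<in> borel_measurable borel" "g \<in> borel_measurable borel"
    and le: "\<And>x. \<bar>h x\<bar> \<le> \<bar>f x\<bar> + \<bar>g x\<bar>"
  shows "l1 h \<le> l1 f + l1 g"
proof -
  have "l1 h \<le> (\<integral>\<^sup>+x. ennreal \<bar>f x\<bar> + ennreal \<bar>g x\<bar> \<partial>lborel)"
    unfolding l1_def by (intro nn_integral_mono) (use le in \<open>auto simp flip: ennreal_plus intro: ennreal_leI\<close>)
  also have "\<dots> = l1 f + l1 g" unfolding l1_def by (rule nn_integral_add) auto
  finally show ?thesis .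
qed

lemma l1_triangle3:
  assumes [measurable]: "f \<in> borel_measurable borel" "g \<in> borel_measurable borel" "k \<in> borel_measurable borel"
    and le: "\<And>x. \<bar>h x\<bar> \<le> \<bar>f x\<bar> + \<bar>g x\<bar> + \<bar>k x\<bar>"
  shows "l1 h \<le> l1 f + l1 g + l1 k"
proof -
  have "l1 h \<le> l1 (\<lambda>x. \<bar>f x\<bar> + \<bar>g x\<bar>) + l1 k"
    by (rule l1_triangle) (use le in \<open>auto simp: abs_of_nonneg\<close>)
  moreover have "l1 (\<lambda>x. \<bar>f x\<bar> + \<bar>g x\<bar>) \<le> l1 f + l1 g"
    by (rule l1_triangle) auto
  ultimately show ?thesis by (meson add_right_mono order_trans)
qed

lemma l1_cmult:
  assumes [measurable]: "f \<in> borel_measurable borel"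
  shows "l1 (\<lambda>x. c * f x) = ennreal \<bar>c\<bar> * l1 f"
  unfolding l1_def by (subst nn_integral_cmult[symmetric]) (auto simp: abs_mult ennreal_mult)

lemma l1_integrable_iff:
  assumes "f \<in> borel_measurable borel"
  shows "integrable lborel f \<longleftrightarrow> l1 f < \<infinity>"
  using assms by (simp add: integrable_iff_bounded l1_def)

lemma l1_eq_integral:
  assumes "integrable lborel f"
  shows "l1 f = ennreal (\<integral>x. \<bar>f x\<bar> \<partial>lborel)"
  unfolding l1_def using assms by (intro nn_integral_eq_integral) auto

definition Cc_approximable :: "('a::euclidean_space \<Rightarrow> real) \<Rightarrow> bool" where
  "Cc_approximable F \<longleftrightarrow> (\<forall>e>0. \<exists>\<phi> R. continuous_on UNIV \<phi> \<and> (\<forall>x. R < norm x \<longrightarrow> \<phi> x = 0) \<and>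
     l1 (\<lambda>x. F x - \<phi> x) \<le> ennreal e)"

text \<open>Outer regularity of \<open>A\<close> and of its complement encloses \<open>A\<close>
  between a closed and an open set, and a large ball makes the support bounded. A Urysohn function
  for these sets differs from the indicator only on three sets of measure below
  \<open>e/3\<close>.\<close>

lemma Cc_approximable_indicator:
  fixes A :: "'a::euclidean_space set"
  assumes A: "A \<in> sets borel" "emeasure lborel A < \<infinity>"
  shows "Cc_approximable (indicator A)"
  unfolding Cc_approximable_def
proof (intro allI impI)
  fix e :: real assume e: "0 < e"
  obtain U where U: "open U" "A \<subseteq> U" "emeasure lborel (U - A) < ennreal (e/3)"
    using outer_regular_lborel[of A "e/3"] A e by auto
  obtain V where V: "open V" "- A \<subseteq> V" "emeasure lborel (V - (- A)) < ennreal (e/3)"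
    using outer_regular_lborel[of "- A" "e/3"] A e by auto
  have "(\<lambda>n. emeasure lborel (A - cball 0 (real n))) \<longlonglongrightarrow> emeasure lborel (\<Inter>n. A - cball 0 (real n))"
  proof (rule Lim_emeasure_decseq)
    show "decseq (\<lambda>n. A - cball 0 (real n))" by (auto simp: decseq_def)
    show "emeasure lborel (A - cball 0 (real n)) \<noteq> \<infinity>" for n
    proof -
      have "emeasure lborel (A - cball 0 (real n)) \<le> emeasure lborel A"
        using A by (intro emeasure_mono) auto
      then show ?thesis using A by (auto simp: top_unique)
    qed
  qed (use A in auto)
  moreover have "(\<Inter>n. A - cball 0 (real n)) = {}"
  proof -
    have "\<exists>n. x \<in> cball 0 (real n)" for x :: 'a using real_arch_simple[of "norm x"] by simp
    then show ?thesis by blast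
  qed
  ultimately have "(\<lambda>n. emeasure lborel (A - cball 0 (real n))) \<longlonglongrightarrow> 0"
    by (simp only: emeasure_empty)
  then have "eventually (\<lambda>n. emeasure lborel (A - cball 0 (real n)) < ennreal (e/3)) sequentially"
    using e by (intro order_tendstoD(2)) auto
  then obtain n where n: "emeasure lborel (A - cball 0 (real n)) < ennreal (e/3)"
    by (auto simp: eventually_sequentially)
  define S where "S = - V \<inter> cball 0 (real n)"
  define W where "W = U \<inter> ball 0 (real n + 1)"
  have "closed S" "closed (- W)" using U V by (auto simp: S_def W_def)
  moreover have "S \<inter> - W = {}" using U V by (auto simp: S_def W_def)
  ultimately obtain \<phi> :: "'a \<Rightarrow> real" where \<phi>: "continuous_on UNIV \<phi>" "\<And>x. \<phi> x \<in> closed_segment 1 0"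
    "\<And>x. x \<in> S \<Longrightarrow> \<phi> x = 1" "\<And>x. x \<in> - W \<Longrightarrow> \<phi> x = 0"
    using Urysohn[of S "- W" 1 0] by blast
  have \<phi>01: "0 \<le> \<phi> x" "\<phi> x \<le> 1" for x using \<phi>(2)[of x] by (auto simp: closed_segment_eq_real_ivl)
  have le: "ennreal \<bar>indicator A x - \<phi> x\<bar> \<le> indicator (U - A) x + indicator (V - (- A)) x + indicator (A - cball 0 (real n)) x" for x
  proof (cases "x \<in> U - A \<or> x \<in> V - (- A) \<or> x \<in> A - cball 0 (real n)")
    case True
    have "\<bar>indicator A x - \<phi> x\<bar> \<le> 1" using \<phi>01[of x] by (auto simp: indicator_def)
    then have "ennreal \<bar>indicator A x - \<phi> x\<bar> \<le> 1" by (metis ennreal_1 ennreal_leI)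
    also have "\<dots> \<le> indicator (U - A) x + indicator (V - (- A)) x + indicator (A - cball 0 (real n)) x"
      using True by (auto simp: indicator_def)
    finally show ?thesis .
  next
    case False
    then have "\<bar>indicator A x - \<phi> x\<bar> = 0"
      using \<phi>(3,4)[of x] U(2) by (cases "x \<in> A") (auto simp: S_def W_def)
    then show ?thesis by simp
  qed
  have "l1 (\<lambda>x. indicator A x - \<phi> x) \<le> (\<integral>\<^sup>+x. indicator (U - A) x + indicator (V - (- A)) x + indicator (A - cball 0 (real n)) x \<partial>lborel)"
    unfolding l1_def by (intro nn_integral_mono le)
  also have "\<dots> = emeasure lborel (U - A) + emeasure lborel (V - (- A)) + emeasure lborel (A - cball 0 (real n))"
  proof -
    have [measurable]: "U \<in> sets borel" "V \<in> sets borel" "A \<in> sets borel"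
        "cball 0 (real n) \<in> sets (borel :: 'a measure)" using U V A by auto
    have "(\<integral>\<^sup>+x. indicator (U - A) x + indicator (V - (- A)) x + indicator (A - cball 0 (real n)) x \<partial>lborel)
      = (\<integral>\<^sup>+x. indicator (U - A) x + indicator (V - (- A)) x \<partial>lborel) + (\<integral>\<^sup>+x. indicator (A - cball 0 (real n)) x \<partial>lborel)"
      by (rule nn_integral_add) measurable
    also have "(\<integral>\<^sup>+x. indicator (U - A) x + indicator (V - (- A)) x \<partial>lborel)
      = (\<integral>\<^sup>+x. indicator (U - A) x \<partial>lborel) + (\<integral>\<^sup>+x. indicator (V - (- A)) x \<partial>lborel)"
      by (rule nn_integral_add) measurable
    finally show ?thesis by simp
  qed
  also have "\<dots> \<le> ennreal (e/3) + ennreal (e/3) + ennreal (e/3)"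
    using U V n by (intro add_mono) auto
  also have "\<dots> = ennreal e" using e by (simp flip: ennreal_plus)
  finally have "l1 (\<lambda>x. indicator A x - \<phi> x) \<le> ennreal e" .
  moreover have "\<forall>x. real n + 1 < norm x \<longrightarrow> \<phi> x = 0" using \<phi>(4) by (auto simp: W_def)
  ultimately show "\<exists>\<phi> R. continuous_on UNIV \<phi> \<and> (\<forall>x. R < norm x \<longrightarrow> \<phi> x = 0) \<and>
     l1 (\<lambda>x. indicator A x - \<phi> x) \<le> ennreal e"
    using \<phi>(1) by blast
qed

lemma Cc_approximableD:
  assumes "Cc_approximable F" "0 < e"
  obtains \<phi> R where "continuous_on UNIV \<phi>" "\<And>x. R < norm x \<Longrightarrow> \<phi> x = 0" "l1 (\<lambda>x. F x - \<phi> x) \<le> ennreal e"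
  using assms unfolding Cc_approximable_def by blast

theorem Cc_dense_L1:
  fixes F :: "'a::euclidean_space \<Rightarrow> real"
  assumes "integrable lborel F"
  shows "Cc_approximable F"
  using assms
proof (induction F rule: integrable_induct)
  case (base A c)
  show ?case unfolding Cc_approximable_def
  proof (intro allI impI)
    fix e :: real assume e: "0 < e"
    have "Cc_approximable (indicator A)" using base by (intro Cc_approximable_indicator) auto
    then obtain \<phi> R where \<phi>: "continuous_on UNIV \<phi>" "\<And>x. R < norm x \<Longrightarrow> \<phi> x = 0"
        "l1 (\<lambda>x. indicator A x - \<phi> x) \<le> ennreal (e / (\<bar>c\<bar> + 1))"
      by (rule Cc_approximableD[of _ "e / (\<bar>c\<bar> + 1)"]) (use e in auto)
    have [measurable]: "\<phi> \<in> borel_measurable borel" using \<phi>(1) by (rule borel_measurable_continuous_onI)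
    have [measurable]: "A \<in> sets borel" using base by simp
    have "l1 (\<lambda>x. indicator A x *\<^sub>R c - c * \<phi> x) = l1 (\<lambda>x. c * (indicator A x - \<phi> x))"
      by (simp add: algebra_simps)
    also have "\<dots> = ennreal \<bar>c\<bar> * l1 (\<lambda>x. indicator A x - \<phi> x)" by (rule l1_cmult) measurable
    also have "\<dots> \<le> ennreal \<bar>c\<bar> * ennreal (e / (\<bar>c\<bar> + 1))" by (intro mult_left_mono \<phi>) auto
    also have "\<dots> \<le> ennreal e" using e by (subst ennreal_mult[symmetric]) (auto simp: field_simps intro!: ennreal_leI)
    finally show "\<exists>\<phi> R. continuous_on UNIV \<phi> \<and> (\<forall>x. R < norm x \<longrightarrow> \<phi> x = 0) \<and> l1 (\<lambda>x. indicator A x *\<^sub>R c - \<phi> x) \<le> ennreal e"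
      using \<phi>(1,2) by (intro exI[of _ "\<lambda>x. c * \<phi> x"] exI[of _ R]) (auto intro: continuous_intros)
  qed
next
  case (add f g)
  show ?case unfolding Cc_approximable_def
  proof (intro allI impI)
    fix e :: real assume e: "0 < e"
    obtain \<phi> R where \<phi>: "continuous_on UNIV \<phi>" "\<And>x. R < norm x \<Longrightarrow> \<phi> x = 0" "l1 (\<lambda>x. f x - \<phi> x) \<le> ennreal (e/2)"
      by (rule Cc_approximableD[OF add.IH(1), of "e/2"]) (use e in auto)
    obtain \<psi> S where \<psi>: "continuous_on UNIV \<psi>" "\<And>x. S < norm x \<Longrightarrow> \<psi> x = 0" "l1 (\<lambda>x. g x - \<psi> x) \<le> ennreal (e/2)"
      by (rule Cc_approximableD[OF add.IH(2), of "e/2"]) (use e in auto)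
    have [measurable]: "f \<in> borel_measurable borel" "g \<in> borel_measurable borel"
        "\<phi> \<in> borel_measurable borel" "\<psi> \<in> borel_measurable borel"
      using add \<phi>(1) \<psi>(1) by (auto intro: borel_measurable_continuous_onI)
    have "l1 (\<lambda>x. f x + g x - (\<phi> x + \<psi> x)) \<le> l1 (\<lambda>x. f x - \<phi> x) + l1 (\<lambda>x. g x - \<psi> x)"
      by (rule l1_triangle) auto
    also have "\<dots> \<le> ennreal (e/2) + ennreal (e/2)" by (intro add_mono \<phi> \<psi>)
    also have "\<dots> = ennreal e" using e by (simp flip: ennreal_plus)
    finally show "\<exists>\<phi> R. continuous_on UNIV \<phi> \<and> (\<forall>x. R < norm x \<longrightarrow> \<phi> x = 0) \<and> l1 (\<lambda>x. f x + g x - \<phi> x) \<le> ennreal e"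
      using \<phi>(1,2) \<psi>(1,2) by (intro exI[of _ "\<lambda>x. \<phi> x + \<psi> x"] exI[of _ "max R S"]) (auto intro: continuous_intros)
  qed
next
  case (lim f s)
  show ?case unfolding Cc_approximable_def
  proof (intro allI impI)
    fix e :: real assume e: "0 < e"
    have [measurable]: "f \<in> borel_measurable borel" "\<And>i. s i \<in> borel_measurable borel" using lim by auto
    have dom: "norm (\<bar>f x - s i x\<bar>) \<le> 3 * norm (f x)" for i x using lim.hyps(3)[of x i] by simp
    have "(\<lambda>i. \<integral>x. \<bar>f x - s i x\<bar> \<partial>lborel) \<longlonglongrightarrow> (\<integral>x. 0 \<partial>(lborel :: 'a measure))"
    proof (rule integral_dominated_convergence[where w = "\<lambda>x. 3 * norm (f x)"])
      show "integrable lborel (\<lambda>x. 3 * norm (f x))" using lim by auto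
      show "AE x in lborel. (\<lambda>i. \<bar>f x - s i x\<bar>) \<longlonglongrightarrow> 0"
      proof (rule always_eventually, rule allI)
        fix x
        have "(\<lambda>i. \<bar>f x - s i x\<bar>) \<longlonglongrightarrow> \<bar>f x - f x\<bar>" by (intro tendsto_intros lim.hyps(2)) simp
        then show "(\<lambda>i. \<bar>f x - s i x\<bar>) \<longlonglongrightarrow> 0" by simp
      qed
    qed (use dom in auto)
    then have "eventually (\<lambda>i. (\<integral>x. \<bar>f x - s i x\<bar> \<partial>lborel) < e/2) sequentially"
      using e by (intro order_tendstoD(2)) auto
    then obtain i where i: "(\<integral>x. \<bar>f x - s i x\<bar> \<partial>lborel) < e/2" by (auto simp: eventually_sequentially)
    have li: "l1 (\<lambda>x. f x - s i x) \<le> ennreal (e/2)"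
      using i lim by (subst l1_eq_integral) (auto intro: ennreal_leI)
    obtain \<phi> R where \<phi>: "continuous_on UNIV \<phi>" "\<And>x. R < norm x \<Longrightarrow> \<phi> x = 0" "l1 (\<lambda>x. s i x - \<phi> x) \<le> ennreal (e/2)"
      by (rule Cc_approximableD[OF lim.IH, of "e/2"]) (use e in auto)
    have [measurable]: "\<phi> \<in> borel_measurable borel" using \<phi>(1) by (rule borel_measurable_continuous_onI)
    have "l1 (\<lambda>x. f x - \<phi> x) \<le> l1 (\<lambda>x. f x - s i x) + l1 (\<lambda>x. s i x - \<phi> x)"
      by (rule l1_triangle) auto
    also have "\<dots> \<le> ennreal (e/2) + ennreal (e/2)" by (intro add_mono \<phi> li)
    also have "\<dots> = ennreal e" using e by (simp flip: ennreal_plus)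
    finally show "\<exists>\<phi> R. continuous_on UNIV \<phi> \<and> (\<forall>x. R < norm x \<longrightarrow> \<phi> x = 0) \<and> l1 (\<lambda>x. f x - \<phi> x) \<le> ennreal e"
      using \<phi>(1,2) by blast
  qed
qed

text \<open>Quantified over all near-identity maps \<open>\<psi>\<close> that enlarge integrals by
  at most the factor \<open>C\<close>, so that it serves both the translations in mollification and
  the flow. A compactly supported continuous approximation of \<open>F\<close> is uniformly
  continuous, and \<open>C\<close> controls the approximation error after composition with
  \<open>\<psi>\<close>.\<close>

theorem near_identity_L1_continuity:
  fixes F :: "'a::euclidean_space \<Rightarrow> real"
  assumes F: "integrable lborel F" and e: "0 < e" and C: "0 \<le> C"
  shows "\<exists>\<eta>>0. \<forall>\<psi>\<in>borel_measurable borel.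
    (\<forall>h\<in>borel_measurable borel. (\<integral>\<^sup>+x. h (\<psi> x) \<partial>lborel) \<le> ennreal C * (\<integral>\<^sup>+x. h x \<partial>lborel)) \<and>
    (\<forall>x. dist (\<psi> x) x \<le> \<eta>) \<longrightarrow> l1 (\<lambda>x. F (\<psi> x) - F x) \<le> ennreal e"
proof -
  define e1 where "e1 = e / (3 * (C + 1))"
  have e1: "0 < e1" "C * e1 \<le> e/3" "e1 \<le> e/3" using e C by (auto simp: e1_def field_simps)
  obtain \<phi> R' where \<phi>: "continuous_on UNIV \<phi>" "\<And>x. R' < norm x \<Longrightarrow> \<phi> x = 0" "l1 (\<lambda>x. F x - \<phi> x) \<le> ennreal e1"
    by (rule Cc_approximableD[OF Cc_dense_L1[OF F] e1(1)]) blast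
  define R where "R = max R' 0"
  have \<phi>0: "\<phi> x = 0" if "R < norm x" for x using \<phi>(2) that by (auto simp: R_def)
  have [measurable]: "\<phi> \<in> borel_measurable borel" using \<phi>(1) by (rule borel_measurable_continuous_onI)
  have [measurable]: "F \<in> borel_measurable borel" using F by auto
  define B where "B = cball (0::'a) (R + 1)"
  define m where "m = measure lborel B"
  have mB: "emeasure lborel B = ennreal m" unfolding m_def B_def
    using emeasure_bounded_finite[of "cball (0::'a) (R + 1)"] by (simp add: emeasure_eq_ennreal_measure less_top)
  define e2 where "e2 = e / (3 * (m + 1))"
  have m0: "0 \<le> m" by (simp add: m_def)
  have e2: "0 < e2" "m * e2 \<le> e/3" using e m0 by (auto simp: e2_def field_simps)
  \<comment> \<open>For \<open>x\<close> in \<open>B\<close> both \<open>x\<close> and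
    \<open>\<psi> x\<close> have norm at most \<open>R + 2\<close>, because \<open>\<eta>\<close>
    will be at most 1.\<close>
  have "uniformly_continuous_on (cball 0 (R + 2)) \<phi>"
    using \<phi>(1) by (intro compact_uniformly_continuous) (auto intro: continuous_on_subset)
  then obtain d where d: "0 < d" "\<And>x y. norm x \<le> R + 2 \<Longrightarrow> norm y \<le> R + 2 \<Longrightarrow> dist y x < d \<Longrightarrow> dist (\<phi> y) (\<phi> x) < e2"
    using e2(1) unfolding uniformly_continuous_on_def by (metis mem_cball_0)
  define \<eta> where "\<eta> = min 1 (d/2)"
  have \<eta>: "0 < \<eta>" "\<eta> \<le> 1" "\<eta> < d" using d(1) by (auto simp: \<eta>_def)
  have "l1 (\<lambda>x. F (\<psi> x) - F x) \<le> ennreal e"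
    if [measurable]: "\<psi> \<in> borel_measurable borel"
      and h: "\<forall>h\<in>borel_measurable borel. (\<integral>\<^sup>+x. h (\<psi> x) \<partial>lborel) \<le> ennreal C * (\<integral>\<^sup>+x. h x \<partial>lborel)"
      and \<psi>: "\<forall>x. dist (\<psi> x) x \<le> \<eta>" for \<psi>
  proof -
    have 1: "l1 (\<lambda>x. F (\<psi> x) - \<phi> (\<psi> x)) \<le> ennreal (e/3)"
    proof -
      have "l1 (\<lambda>x. F (\<psi> x) - \<phi> (\<psi> x)) \<le> ennreal C * l1 (\<lambda>x. F x - \<phi> x)"
        unfolding l1_def using h[rule_format, of "\<lambda>x. ennreal \<bar>F x - \<phi> x\<bar>"] by simp
      also have "\<dots> \<le> ennreal C * ennreal e1" by (intro mult_left_mono \<phi>) auto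
      also have "\<dots> \<le> ennreal (e/3)" using e1 C by (auto simp flip: ennreal_mult intro: ennreal_leI)
      finally show ?thesis .
    qed
    have 2: "l1 (\<lambda>x. \<phi> (\<psi> x) - \<phi> x) \<le> ennreal (e/3)"
    proof -
      have "ennreal \<bar>\<phi> (\<psi> x) - \<phi> x\<bar> \<le> ennreal e2 * indicator B x" for x
      proof (cases "x \<in> B")
        case True
        have "norm (\<psi> x) \<le> norm x + dist (\<psi> x) x" by (metis add.commute dist_norm norm_triangle_sub)
        then have "dist (\<phi> (\<psi> x)) (\<phi> x) < e2"
          using True \<psi>[rule_format, of x] \<eta> by (intro d(2)) (auto simp: B_def)
        then show ?thesis using True by (auto simp: dist_real_def intro: ennreal_leI)
      next
        case False
        have "norm x \<le> norm (\<psi> x) + dist (\<psi> x) x" by (metis add.commute dist_commute dist_norm norm_triangle_sub)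
        then have "R < norm (\<psi> x)" "R < norm x" using False \<psi>[rule_format, of x] \<eta> by (auto simp: B_def)
        then show ?thesis using \<phi>0 by simp
      qed
      then have "l1 (\<lambda>x. \<phi> (\<psi> x) - \<phi> x) \<le> (\<integral>\<^sup>+x. ennreal e2 * indicator B x \<partial>lborel)"
        unfolding l1_def by (intro nn_integral_mono)
      also have "\<dots> = ennreal e2 * emeasure lborel B"
        by (subst nn_integral_cmult_indicator) (auto simp: B_def)
      also have "\<dots> \<le> ennreal (e/3)" using e2 m0 by (auto simp: mB mult.commute simp flip: ennreal_mult intro: ennreal_leI)
      finally show ?thesis .
    qed
    have 3: "l1 (\<lambda>x. F x - \<phi> x) \<le> ennreal (e/3)" using \<phi>(3) e1 by (meson ennreal_leI order_trans)
    have "l1 (\<lambda>x. F (\<psi> x) - F x) \<le> l1 (\<lambda>x. F (\<psi> x) - \<phi> (\<psi> x)) + l1 (\<lambda>x. \<phi> (\<psi> x) - \<phi> x) + l1 (\<lambda>x. F x - \<phi> x)"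
      by (rule l1_triangle3) auto
    also have "\<dots> \<le> ennreal (e/3) + ennreal (e/3) + ennreal (e/3)" by (intro add_mono 1 2 3)
    also have "\<dots> = ennreal e" using e by (simp flip: ennreal_plus)
    finally show ?thesis .
  qed
  then show ?thesis using \<eta>(1) by blast
qed

section \<open>Gradients and polynomial approximation in L^1\<close>

text \<open>A total derivative with continuous coefficients: it implies \<open>axis_C1\<close> and
  is what the chain rule along orbits needs.\<close>

definition C1_gradient :: "(real ^ 'n \<Rightarrow> real) \<Rightarrow> ('n \<Rightarrow> real ^ 'n \<Rightarrow> real) \<Rightarrow> bool" where
  "C1_gradient w w' \<longleftrightarrow> (\<forall>i. continuous_on UNIV (w' i)) \<and>
     (\<forall>x. (w has_derivative (\<lambda>h. \<Sum>i\<in>UNIV. w' i x * h $ i)) (at x))"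

lemma C1_gradient_axis_C1:
  fixes w :: "real ^ 'n \<Rightarrow> real"
  assumes "C1_gradient w w'"
  shows "axis_C1 w w'"
  unfolding axis_C1_def
proof (intro conjI allI)
  have D: "(w has_derivative (\<lambda>h. \<Sum>i\<in>UNIV. w' i x * h $ i)) (at x)" for x
    using assms by (simp add: C1_gradient_def)
  then show "continuous_on UNIV w"
    by (intro continuous_at_imp_continuous_on ballI has_derivative_continuous)
  show "continuous_on UNIV (w' i)" for i using assms by (simp add: C1_gradient_def)
  fix i :: 'n and x :: "real ^ 'n"
  have "((\<lambda>s. x + s *\<^sub>R axis i 1) has_derivative (\<lambda>h. h *\<^sub>R axis i 1)) (at 0)"
    by (auto intro!: derivative_eq_intros)
  moreover have "(w has_derivative (\<lambda>h. \<Sum>i\<in>UNIV. w' i x * h $ i)) (at (x + 0 *\<^sub>R axis i 1))"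
    using D[of x] by simp
  ultimately have "((\<lambda>s. w (x + s *\<^sub>R axis i 1)) has_derivative (\<lambda>h. \<Sum>j\<in>UNIV. w' j x * (h *\<^sub>R axis i 1) $ j)) (at 0)"
    by (rule has_derivative_compose)
  then show "((\<lambda>s. w (x + s *\<^sub>R axis i 1)) has_real_derivative w' i x) (at 0)"
    unfolding has_field_derivative_def
    by (rule has_derivative_eq_rhs) (auto simp: axis_def if_distrib cong: if_cong)
qed

lemma C1_gradient_along_curve:
  assumes w: "C1_gradient w w'" and g: "(\<gamma> has_vector_derivative v) (at t)"
  shows "((\<lambda>s. w (\<gamma> s)) has_real_derivative (\<Sum>i\<in>UNIV. w' i (\<gamma> t) * v $ i)) (at t)"
proof -
  have "(\<gamma> has_derivative (\<lambda>h. h *\<^sub>R v)) (at t)" using g by (simp add: has_vector_derivative_def)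
  moreover have "(w has_derivative (\<lambda>h. \<Sum>i\<in>UNIV. w' i (\<gamma> t) * h $ i)) (at (\<gamma> t))"
    using w by (simp add: C1_gradient_def)
  ultimately have "((\<lambda>s. w (\<gamma> s)) has_derivative (\<lambda>h. \<Sum>i\<in>UNIV. w' i (\<gamma> t) * (h *\<^sub>R v) $ i)) (at t)"
    by (rule has_derivative_compose)
  then show ?thesis unfolding has_field_derivative_def
    by (rule has_derivative_eq_rhs) (auto simp: sum_distrib_left sum_distrib_right mult_ac fun_eq_iff)
qed

lemma real_polynomial_function_C1:
  fixes p :: "real ^ 'n \<Rightarrow> real"
  assumes "real_polynomial_function p"
  shows "\<exists>p'. C1_gradient p p'"
  using assms
proof (induction rule: real_polynomial_function.induct)
  case (linear f)
  interpret bounded_linear f by fact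
  have f: "f h = (\<Sum>i\<in>UNIV. f (axis i 1) * h $ i)" for h
  proof -
    have "f h = f (\<Sum>i\<in>UNIV. h $ i *\<^sub>R axis i 1)" by (simp add: basis_expansion flip: scalar_mult_eq_scaleR)
    also have "\<dots> = (\<Sum>i\<in>UNIV. f (axis i 1) * h $ i)" by (simp add: sum scaleR mult.commute)
    finally show ?thesis .
  qed
  have "(f has_derivative (\<lambda>h. \<Sum>i\<in>UNIV. f (axis i 1) * h $ i)) (at x)" for x
    by (rule has_derivative_eq_rhs[OF bounded_linear_imp_has_derivative[OF bounded_linear_axioms]]) (rule ext, rule f)
  then show ?case by (intro exI[of _ "\<lambda>i x. f (axis i 1)"]) (auto simp: C1_gradient_def)
next
  case (const c)
  show ?case by (intro exI[of _ "\<lambda>i x. 0"]) (auto simp: C1_gradient_def)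
next
  case (add f g)
  then obtain f' g' where "C1_gradient f f'" "C1_gradient g g'" by blast
  then show ?case
    by (intro exI[of _ "\<lambda>i x. f' i x + g' i x"])
      (auto simp: C1_gradient_def distrib_right sum.distrib intro!: continuous_intros has_derivative_add)
next
  case (mult f g)
  then obtain f' g' where fg: "C1_gradient f f'" "C1_gradient g g'" by blast
  have c: "continuous_on UNIV f" "continuous_on UNIV g"
    using fg[THEN C1_gradient_axis_C1] by (auto simp: axis_C1_def)
  have "((\<lambda>x. f x * g x) has_derivative (\<lambda>h. \<Sum>i\<in>UNIV. (f' i x * g x + f x * g' i x) * h $ i)) (at x)" for x
  proof -
    have "((\<lambda>x. f x * g x) has_derivative (\<lambda>h. f x * (\<Sum>i\<in>UNIV. g' i x * h $ i) + (\<Sum>i\<in>UNIV. f' i x * h $ i) * g x)) (at x)"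
      using fg by (intro has_derivative_mult) (auto simp: C1_gradient_def)
    then show ?thesis
      by (rule has_derivative_eq_rhs)
        (auto simp: fun_eq_iff sum_distrib_left sum_distrib_right algebra_simps simp flip: sum.distrib)
  qed
  then show ?case using fg c
    by (intro exI[of _ "\<lambda>i x. f' i x * g x + f x * g' i x"])
      (auto simp: C1_gradient_def intro!: continuous_intros)
qed

text \<open>A compactly supported continuous function is close to \<open>F\<close> in L^1, and
  Stone-Weierstrass replaces it on \<open>K\<close> by a polynomial. Off \<open>K\<close> the
  polynomial is out of control, hence the indicator.\<close>

lemma polynomials_dense_L1_compact:
  fixes F :: "real ^ 'n \<Rightarrow> real"
  assumes F: "integrable lborel F" and K: "compact K" and e: "0 < e"
  obtains p p' where "C1_gradient p p'" "l1 (\<lambda>x. indicator K x * (F x - p x)) \<le> ennreal e"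
proof -
  obtain \<phi> R where \<phi>: "continuous_on UNIV \<phi>" "\<And>x. R < norm x \<Longrightarrow> \<phi> x = 0" "l1 (\<lambda>x. F x - \<phi> x) \<le> ennreal (e/2)"
    by (rule Cc_approximableD[OF Cc_dense_L1[OF F], of "e/2"]) (use e in auto)
  define m where "m = measure lborel K"
  have m: "0 \<le> m" "emeasure lborel K = ennreal m"
    using K emeasure_bounded_finite[OF compact_imp_bounded[OF K]] by (auto simp: m_def emeasure_eq_ennreal_measure less_top)
  define e2 where "e2 = e / (2 * (m + 1))"
  have e2: "0 < e2" "e2 * m \<le> e/2" using e m by (auto simp: e2_def field_simps)
  obtain p where p: "real_polynomial_function p" "\<And>x. x \<in> K \<Longrightarrow> \<bar>\<phi> x - p x\<bar> < e2"
    using Stone_Weierstrass_real_polynomial_function[OF K continuous_on_subset[OF \<phi>(1)] e2(1)] by blast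
  obtain p' where p': "C1_gradient p p'" using real_polynomial_function_C1[OF p(1)] by blast
  have Kb[measurable]: "K \<in> sets borel" using K by (simp add: compact_imp_closed)
  have "continuous_on UNIV p" using C1_gradient_axis_C1[OF p'] by (simp add: axis_C1_def)
  then have [measurable]: "p \<in> borel_measurable borel" "\<phi> \<in> borel_measurable borel" "F \<in> borel_measurable borel"
    using \<phi>(1) F by (auto intro: borel_measurable_continuous_onI)
  have "l1 (\<lambda>x. indicator K x * (F x - p x)) \<le> l1 (\<lambda>x. F x - \<phi> x) + l1 (\<lambda>x. indicator K x * (\<phi> x - p x))"
    by (rule l1_triangle) (auto simp: indicator_def)
  also have "l1 (\<lambda>x. indicator K x * (\<phi> x - p x)) \<le> (\<integral>\<^sup>+x. ennreal e2 * indicator K x \<partial>lborel)"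
    unfolding l1_def
  proof (intro nn_integral_mono)
    fix x show "ennreal \<bar>indicat_real K x * (\<phi> x - p x)\<bar> \<le> ennreal e2 * indicator K x"
      using p(2)[of x] by (auto simp: indicator_def intro: ennreal_leI)
  qed
  also have "\<dots> = ennreal (e2 * m)" using m e2 by (subst nn_integral_cmult_indicator) (auto simp flip: ennreal_mult)
  also have "l1 (\<lambda>x. F x - \<phi> x) + ennreal (e2 * m) \<le> ennreal (e/2) + ennreal (e/2)"
    using \<phi>(3) e2 by (intro add_mono ennreal_leI) auto
  also have "\<dots> = ennreal e" using e by (simp flip: ennreal_plus)
  finally show thesis using that p' by (simp add: add_left_mono)
qed

section \<open>The flow acting on L^1\<close>

context lipschitz_flow
begin

text \<open>The volume bound for all Borel sets is an inequality between measures, so it passes to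
  all nonnegative integrands.\<close>

lemma nn_integral_flow_le:
  assumes [measurable]: "h \<in> borel_measurable borel"
  shows "(\<integral>\<^sup>+x. h (\<Phi> t x) \<partial>lborel) \<le> ennreal (exp (L * \<bar>t\<bar>) ^ DIM('a)) * (\<integral>\<^sup>+x. h x \<partial>lborel)"
proof -
  have m[measurable]: "\<Phi> t \<in> borel_measurable borel"
    using flow_continuous_space by (rule borel_measurable_continuous_onI)
  let ?c = "ennreal (exp (L * \<bar>t\<bar>) ^ DIM('a))"
  have "(\<integral>\<^sup>+x. h (\<Phi> t x) \<partial>lborel) = (\<integral>\<^sup>+x. h x \<partial>distr lborel borel (\<Phi> t))"
    by (subst nn_integral_distr) auto
  also have "\<dots> \<le> (\<integral>\<^sup>+x. h x \<partial>scale_measure ?c lborel)"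
  proof (rule nn_integral_mono_measure)
    show "distr lborel borel (\<Phi> t) \<le> scale_measure ?c lborel"
    proof (subst le_measure)
      show "\<forall>A\<in>sets (distr lborel borel (\<Phi> t)). emeasure (distr lborel borel (\<Phi> t)) A \<le> emeasure (scale_measure ?c lborel) A"
        using flow_vimage_emeasure[of _ t] by (auto simp: emeasure_distr)
    qed auto
  qed auto
  also have "\<dots> = ?c * (\<integral>\<^sup>+x. h x \<partial>lborel)" by (subst nn_integral_scale_measure) auto
  finally show ?thesis .
qed

lemma l1_flow_le:
  assumes [measurable]: "f \<in> borel_measurable borel"
  shows "l1 (\<lambda>x. f (\<Phi> t x)) \<le> ennreal (exp (L * \<bar>t\<bar>) ^ DIM('a)) * l1 f"
  unfolding l1_def by (rule nn_integral_flow_le) measurable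

lemma integrable_flow:
  assumes f: "integrable lborel f"
  shows "integrable lborel (\<lambda>x. f (\<Phi> t x) :: real)"
proof -
  have [measurable]: "f \<in> borel_measurable borel" "\<Phi> t \<in> borel_measurable borel"
    using f flow_continuous_space by (auto intro: borel_measurable_continuous_onI)
  have "l1 f < \<infinity>" using f l1_integrable_iff[of f] by simp
  then have "ennreal (exp (L * \<bar>t\<bar>) ^ DIM('a)) * l1 f < \<infinity>" by (simp add: ennreal_mult_less_top)
  then show ?thesis using l1_flow_le[of f t] by (subst l1_integrable_iff) (auto simp: le_less_trans)
qed

theorem flow_strongly_continuous:
  fixes F :: "'a \<Rightarrow> real"
  assumes F: "integrable lborel F" and e: "0 < e"
  shows "\<exists>\<tau>>0. \<forall>t. \<bar>t\<bar> \<le> \<tau> \<longrightarrow> l1 (\<lambda>x. F (\<Phi> t x) - F x) \<le> ennreal e"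
proof -
  let ?C = "exp L ^ DIM('a)"
  obtain \<eta> where \<eta>: "0 < \<eta>" and *: "\<And>\<psi>. \<psi> \<in> borel_measurable borel \<Longrightarrow>
      (\<forall>h\<in>borel_measurable borel. (\<integral>\<^sup>+x. h (\<psi> x) \<partial>lborel) \<le> ennreal ?C * (\<integral>\<^sup>+x. h x \<partial>lborel)) \<Longrightarrow>
      (\<forall>x. dist (\<psi> x) x \<le> \<eta>) \<Longrightarrow> l1 (\<lambda>x. F (\<psi> x) - F x) \<le> ennreal e"
    using near_identity_L1_continuity[OF F e, of ?C] by auto
  \<comment> \<open>\<open>\<tau> \<le> 1\<close> makes \<open>exp L ^ DIM('a)\<close> a uniform
    volume factor, and points move by at most \<open>M * \<tau> \<le> \<eta>\<close>; the 1 in the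
    denominator covers \<open>M = 0\<close>.\<close>
  define \<tau> where "\<tau> = min 1 (\<eta> / (M + 1))"
  have \<tau>: "0 < \<tau>" "\<tau> \<le> 1" "M * \<tau> \<le> \<eta>"
  proof -
    show "0 < \<tau>" "\<tau> \<le> 1" using \<eta> M_nonneg by (auto simp: \<tau>_def)
    have "M * \<tau> \<le> (M + 1) * \<tau>" using \<open>0 < \<tau>\<close> by (intro mult_right_mono) auto
    also have "\<dots> \<le> (M + 1) * (\<eta> / (M + 1))" using M_nonneg by (intro mult_left_mono) (auto simp: \<tau>_def)
    finally show "M * \<tau> \<le> \<eta>" using M_nonneg by simp
  qed
  have "l1 (\<lambda>x. F (\<Phi> t x) - F x) \<le> ennreal e" if t: "\<bar>t\<bar> \<le> \<tau>" for t
  proof (rule *)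
    show "\<Phi> t \<in> borel_measurable borel" using flow_continuous_space by (rule borel_measurable_continuous_onI)
    have "exp (L * \<bar>t\<bar>) \<le> exp L" using t \<tau> L_nonneg by (simp add: mult_left_le)
    then have "exp (L * \<bar>t\<bar>) ^ DIM('a) \<le> ?C" by (intro power_mono) auto
    then have c: "ennreal (exp (L * \<bar>t\<bar>) ^ DIM('a)) \<le> ennreal ?C" by (rule ennreal_leI)
    show "\<forall>h\<in>borel_measurable borel. (\<integral>\<^sup>+x. h (\<Phi> t x) \<partial>lborel) \<le> ennreal ?C * (\<integral>\<^sup>+x. h x \<partial>lborel)"
      using nn_integral_flow_le[of _ t] mult_right_mono[OF c] order_trans by fastforce
    show "\<forall>x. dist (\<Phi> t x) x \<le> \<eta>"
    proof
      fix x
      have "dist (\<Phi> t x) x \<le> M * \<bar>t\<bar>" using flow_speed[of t x 0] by (simp add: init)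
      also have "\<dots> \<le> M * \<tau>" using t M_nonneg by (intro mult_left_mono)
      finally show "dist (\<Phi> t x) x \<le> \<eta>" using \<tau> by linarith
    qed
  qed
  then show ?thesis using \<tau>(1) by blast
qed

end

section \<open>Difference quotients of functions with a Lie derivative\<close>

lemma l1_mono_AE:
  assumes "AE x in lborel. \<bar>f x\<bar> \<le> \<bar>g x\<bar>"
  shows "l1 f \<le> l1 g"
  unfolding l1_def by (intro nn_integral_mono_AE) (use assms in \<open>auto elim!: eventually_mono intro: ennreal_leI\<close>)

lemma uncurried_measurable:
  assumes "(\<lambda>p. H (fst p) (snd p)) \<in> borel_measurable (borel \<Otimes>\<^sub>M borel)"
    "f \<in> borel_measurable N" "g \<in> borel_measurable N"
  shows "(\<lambda>p. H (f p) (g p)) \<in> borel_measurable N"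
proof -
  have "(\<lambda>p. (f p, g p)) \<in> measurable N (borel \<Otimes>\<^sub>M borel)" using assms by measurable
  from measurable_compose[OF this assms(1)] show ?thesis by simp
qed

lemma time_integral_Tonelli:
  fixes H :: "real \<Rightarrow> 'a::euclidean_space \<Rightarrow> real"
  assumes m: "(\<lambda>p. H (fst p) (snd p)) \<in> borel_measurable (borel \<Otimes>\<^sub>M borel)"
    and t: "0 \<le> t" and B: "\<And>s. s \<in> {0..t} \<Longrightarrow> l1 (H s) \<le> B"
  shows "(\<integral>\<^sup>+x. (\<integral>\<^sup>+s. indicator {0..t} s * ennreal \<bar>H s x\<bar> \<partial>lborel) \<partial>lborel) \<le> ennreal t * B"
proof -
  note [measurable] = uncurried_measurable[OF m]
  have "(\<integral>\<^sup>+x. (\<integral>\<^sup>+s. indicator {0..t} s * ennreal \<bar>H s x\<bar> \<partial>lborel) \<partial>lborel)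
      = (\<integral>\<^sup>+s. (\<integral>\<^sup>+x. indicator {0..t} s * ennreal \<bar>H s x\<bar> \<partial>lborel) \<partial>lborel)"
    by (rule lborel_pair.Fubini') measurable
  also have "\<dots> = (\<integral>\<^sup>+s. indicator {0..t} s * l1 (H s) \<partial>lborel)"
    unfolding l1_def by (intro nn_integral_cong nn_integral_cmult) measurable
  also have "\<dots> \<le> (\<integral>\<^sup>+s. B * indicator {0..t} s \<partial>lborel)"
    by (intro nn_integral_mono) (use B in \<open>auto simp: indicator_def\<close>)
  also have "\<dots> = ennreal t * B"
    using t by (subst nn_integral_cmult_indicator) (auto simp: mult.commute)
  finally show ?thesis .
qed

lemma time_integrable_AE:
  fixes H :: "real \<Rightarrow> 'a::euclidean_space \<Rightarrow> real"
  assumes m: "(\<lambda>p. H (fst p) (snd p)) \<in> borel_measurable (borel \<Otimes>\<^sub>M borel)"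
    and t: "0 \<le> t" and B: "\<And>s. s \<in> {0..t} \<Longrightarrow> l1 (H s) \<le> B" "B < \<infinity>"
  shows "AE x in lborel. set_integrable lborel {0..t} (\<lambda>s. H s x)"
proof -
  note [measurable] = uncurried_measurable[OF m]
  have "ennreal t * B < \<infinity>" using B(2) by (simp add: ennreal_mult_less_top)
  then have "(\<integral>\<^sup>+x. (\<integral>\<^sup>+s. indicator {0..t} s * ennreal \<bar>H s x\<bar> \<partial>lborel) \<partial>lborel) < \<infinity>"
    using time_integral_Tonelli[OF m t B(1)] by (rule le_less_trans[rotated])
  moreover have "(\<lambda>x. \<integral>\<^sup>+s. indicator {0..t} s * ennreal \<bar>H s x\<bar> \<partial>lborel) \<in> borel_measurable lborel"
    by measurable
  ultimately have "AE x in lborel. (\<integral>\<^sup>+s. indicator {0..t} s * ennreal \<bar>H s x\<bar> \<partial>lborel) \<noteq> \<infinity>"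
    by (intro nn_integral_PInf_AE) auto
  then show ?thesis
  proof eventually_elim
    case (elim x)
    have "(\<integral>\<^sup>+s. ennreal (norm (indicat_real {0..t} s *\<^sub>R H s x)) \<partial>lborel)
        = (\<integral>\<^sup>+s. indicator {0..t} s * ennreal \<bar>H s x\<bar> \<partial>lborel)"
      by (intro nn_integral_cong) (auto simp: indicator_def)
    then show ?case using elim unfolding set_integrable_def
      by (intro integrableI_bounded) (auto simp: less_top)
  qed
qed

lemma time_integral_measurable:
  fixes H :: "real \<Rightarrow> 'a::euclidean_space \<Rightarrow> real"
  assumes m: "(\<lambda>p. H (fst p) (snd p)) \<in> borel_measurable (borel \<Otimes>\<^sub>M borel)"
  shows "(\<lambda>x. LINT s:{0..t}|lborel. H s x) \<in> borel_measurable borel"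
proof -
  note [measurable] = uncurried_measurable[OF m]
  have "(\<lambda>x. LINT s:{0..t}|lborel. H s x) \<in> borel_measurable lborel"
    unfolding set_lebesgue_integral_def
    by (rule lborel.borel_measurable_lebesgue_integral) measurable
  then show ?thesis by simp
qed

text \<open>Minkowski's integral inequality, by Tonelli. Where the time integral does not exist, its
  default value 0 satisfies the bound trivially.\<close>

lemma l1_time_integral_le:
  fixes H :: "real \<Rightarrow> 'a::euclidean_space \<Rightarrow> real"
  assumes m: "(\<lambda>p. H (fst p) (snd p)) \<in> borel_measurable (borel \<Otimes>\<^sub>M borel)"
    and t: "0 \<le> t" and B: "\<And>s. s \<in> {0..t} \<Longrightarrow> l1 (H s) \<le> B"
  shows "l1 (\<lambda>x. LINT s:{0..t}|lborel. H s x) \<le> ennreal t * B"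
proof -
  have "ennreal \<bar>LINT s:{0..t}|lborel. H s x\<bar> \<le> (\<integral>\<^sup>+s. indicator {0..t} s * ennreal \<bar>H s x\<bar> \<partial>lborel)" for x
  proof (cases "set_integrable lborel {0..t} (\<lambda>s. H s x)")
    case True
    have "ennreal (norm (LINT s:{0..t}|lborel. H s x)) \<le> (\<integral>\<^sup>+s. ennreal (norm (indicat_real {0..t} s *\<^sub>R H s x)) \<partial>lborel)"
      using True unfolding set_lebesgue_integral_def set_integrable_def by (rule integral_norm_bound_ennreal)
    also have "\<dots> = (\<integral>\<^sup>+s. indicator {0..t} s * ennreal \<bar>H s x\<bar> \<partial>lborel)"
      by (intro nn_integral_cong) (auto simp: indicator_def)
    finally show ?thesis by simp
  next
    case False
    then show ?thesis
      by (simp add: set_lebesgue_integral_def set_integrable_def not_integrable_integral_eq)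
  qed
  then have "l1 (\<lambda>x. LINT s:{0..t}|lborel. H s x) \<le> (\<integral>\<^sup>+x. (\<integral>\<^sup>+s. indicator {0..t} s * ennreal \<bar>H s x\<bar> \<partial>lborel) \<partial>lborel)"
    unfolding l1_def by (intro nn_integral_mono)
  also have "\<dots> \<le> ennreal t * B" by (rule time_integral_Tonelli[OF m t B])
  finally show ?thesis .
qed

context lipschitz_flow
begin

lemma l1_flow_le_bound:
  assumes "f \<in> borel_measurable borel" "\<bar>t\<bar> \<le> T"
  shows "l1 (\<lambda>x. f (\<Phi> t x)) \<le> ennreal (exp (L * T) ^ DIM('a)) * l1 f"
proof -
  have "exp (L * \<bar>t\<bar>) ^ DIM('a) \<le> exp (L * T) ^ DIM('a)"
    using assms(2) L_nonneg by (intro power_mono) (auto intro: mult_left_mono)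
  then have "ennreal (exp (L * \<bar>t\<bar>) ^ DIM('a)) * l1 f \<le> ennreal (exp (L * T) ^ DIM('a)) * l1 f"
    by (intro mult_right_mono ennreal_leI) auto
  then show ?thesis using l1_flow_le[OF assms(1), of t] by (rule order_trans[rotated])
qed

lemma flow_pair_compose_measurable:
  assumes "G \<in> borel_measurable borel"
  shows "(\<lambda>p. G (\<Phi> (fst p) (snd p)) :: real) \<in> borel_measurable (borel \<Otimes>\<^sub>M borel)"
  by (rule measurable_compose[OF flow_measurable_pair assms])

lemma orbit_integrable_AE:
  assumes G: "integrable lborel G" and t: "0 \<le> t"
  shows "AE x in lborel. set_integrable lborel {0..t} (\<lambda>s. G (\<Phi> s x) :: real)"
proof (rule time_integrable_AE[OF flow_pair_compose_measurable t])
  show Gm: "G \<in> borel_measurable borel" using G by auto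
  show "l1 (\<lambda>x. G (\<Phi> s x)) \<le> ennreal (exp (L * t) ^ DIM('a)) * l1 G" if "s \<in> {0..t}" for s
    using that by (intro l1_flow_le_bound Gm) auto
  have "l1 G < \<infinity>" using G l1_integrable_iff[OF Gm] by simp
  then show "ennreal (exp (L * t) ^ DIM('a)) * l1 G < \<infinity>" by (simp add: ennreal_mult_less_top)
qed

text \<open>By the group law the increment from \<open>s\<close> to \<open>t\<close> is the
  increment over \<open>t - s\<close> composed with \<open>\<Phi> s\<close>, which costs at most the
  volume factor for \<open>T\<close>; hence one \<open>r\<close> serves all
  \<open>s\<close>.\<close>

lemma flow_increment_l1:
  assumes F: "integrable lborel F" and T: "0 < T" and e: "0 < e"
  shows "\<exists>r>0. \<forall>s t. \<bar>s\<bar> \<le> T \<longrightarrow> \<bar>t - s\<bar> \<le> r \<longrightarrow> l1 (\<lambda>x. F (\<Phi> t x) - F (\<Phi> s x)) \<le> ennreal e"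
proof -
  let ?C = "exp (L * T) ^ DIM('a)"
  have [measurable]: "F \<in> borel_measurable borel" "\<Phi> s \<in> borel_measurable borel" for s
    using F flow_continuous_space by (auto intro: borel_measurable_continuous_onI)
  have "0 < e / ?C" using e by simp
  from flow_strongly_continuous[OF F this] obtain r where r: "0 < r"
    "\<And>t. \<bar>t\<bar> \<le> r \<Longrightarrow> l1 (\<lambda>x. F (\<Phi> t x) - F x) \<le> ennreal (e / ?C)" by blast
  have "l1 (\<lambda>x. F (\<Phi> t x) - F (\<Phi> s x)) \<le> ennreal e" if "\<bar>s\<bar> \<le> T" "\<bar>t - s\<bar> \<le> r" for s t
  proof -
    have "l1 (\<lambda>x. F (\<Phi> t x) - F (\<Phi> s x)) = l1 (\<lambda>x. (\<lambda>y. F (\<Phi> (t - s) y) - F y) (\<Phi> s x))"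
      by (simp add: flow_add)
    also have "\<dots> \<le> ennreal ?C * l1 (\<lambda>y. F (\<Phi> (t - s) y) - F y)"
      by (rule l1_flow_le_bound) (use that in auto)
    also have "\<dots> \<le> ennreal ?C * ennreal (e / ?C)" using r(2) that by (intro mult_left_mono) auto
    also have "\<dots> = ennreal e" using e by (simp flip: ennreal_mult)
    finally show ?thesis .
  qed
  then show ?thesis using r(1) by blast
qed

text \<open>For almost every small \<open>t\<close> the error \<open>D t\<close> is, on
  \<open>W\<close>, the time integral of \<open>G (\<Phi> s x) - G x\<close>, of L^1 norm at most
  \<open>t * e\<close>. The hypothesis leaves a null set of times open; each of those is a limit of
  good times from below, and every term of \<open>D t\<close> depends continuously on
  \<open>t\<close> in L^1.\<close>

theorem lie_derivative_imp_quotient_limit: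
  fixes F G :: "'a \<Rightarrow> real"
  assumes F: "integrable lborel F" and G: "integrable lborel G" and W: "W \<in> sets borel" and \<tau>: "0 < \<tau>"
    and ae: "AE t in lborel. 0 < t \<and> t < \<tau> \<longrightarrow>
      (AE x in lborel. x \<in> W \<longrightarrow> F (\<Phi> t x) - F x = (LINT s:{0..t}|lborel. G (\<Phi> s x)))"
    and e: "0 < e"
  shows "\<exists>\<delta>>0. \<forall>t. 0 < t \<and> t < \<delta> \<longrightarrow> l1 (\<lambda>x. indicator W x * ((F (\<Phi> t x) - F x) / t - G x)) \<le> ennreal e"
proof -
  have [measurable]: "F \<in> borel_measurable borel" "G \<in> borel_measurable borel" "W \<in> sets borel"
      "\<Phi> s \<in> borel_measurable borel" for s
    using F G W flow_continuous_space by (auto intro: borel_measurable_continuous_onI)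
  note Gm = flow_pair_compose_measurable[of G]
  have Hm: "(\<lambda>p. G (\<Phi> (fst p) (snd p)) - G (snd p)) \<in> borel_measurable (borel \<Otimes>\<^sub>M borel)"
    by measurable
  obtain s0 where s0: "0 < s0" "\<And>s. \<bar>s\<bar> \<le> s0 \<Longrightarrow> l1 (\<lambda>x. G (\<Phi> s x) - G x) \<le> ennreal e"
    using flow_strongly_continuous[OF G e] by blast
  define \<delta> where "\<delta> = min \<tau> s0"
  \<comment> \<open>The error multiplied by \<open>t\<close>, so that neighbouring times can be
    compared before dividing.\<close>
  define D where "D t x = indicator W x * (F (\<Phi> t x) - F x - t * G x)" for t x
  have [measurable]: "D t \<in> borel_measurable borel" for t unfolding D_def by measurable
  have good: "l1 (D t) \<le> ennreal t * ennreal e"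
    if t: "0 < t" "t < \<delta>" and aet: "AE x in lborel. x \<in> W \<longrightarrow> F (\<Phi> t x) - F x = (LINT s:{0..t}|lborel. G (\<Phi> s x))" for t
  proof -
    have "AE x in lborel. \<bar>D t x\<bar> \<le> \<bar>LINT s:{0..t}|lborel. G (\<Phi> s x) - G x\<bar>"
      using aet orbit_integrable_AE[OF G less_imp_le[OF t(1)]]
    proof eventually_elim
      case (elim x)
      have "(LINT s:{0..t}|lborel. G (\<Phi> s x) - G x) = (LINT s:{0..t}|lborel. G (\<Phi> s x)) - (LINT s:{0..t}|lborel. G x)"
        using elim t by (intro set_integral_diff) (auto simp: set_integrable_def)
      also have "(LINT s:{0..t}|lborel. G x) = t * G x"
        using t by (simp add: set_lebesgue_integral_def)
      finally show ?case using elim by (auto simp: D_def indicator_def)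
    qed
    then have "l1 (D t) \<le> l1 (\<lambda>x. LINT s:{0..t}|lborel. G (\<Phi> s x) - G x)" by (rule l1_mono_AE)
    also have "\<dots> \<le> ennreal t * ennreal e"
      using t s0(2) by (intro l1_time_integral_le Hm) (auto simp: \<delta>_def)
    finally show ?thesis .
  qed
  have all: "l1 (D t) \<le> ennreal (t * e)" if t: "0 < t" "t < \<delta>" for t
  proof (rule ennreal_le_epsilon)
    fix \<epsilon> :: real assume \<epsilon>: "0 < \<epsilon>"
    obtain r where r: "0 < r" "\<And>s u. \<bar>s\<bar> \<le> t \<Longrightarrow> \<bar>u - s\<bar> \<le> r \<Longrightarrow> l1 (\<lambda>x. F (\<Phi> u x) - F (\<Phi> s x)) \<le> ennreal (\<epsilon>/2)"
      using flow_increment_l1[OF F t(1), of "\<epsilon>/2"] \<epsilon> by auto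
    define g where "g = (\<integral>x. \<bar>G x\<bar> \<partial>lborel)"
    have g: "l1 G = ennreal g" "0 \<le> g" unfolding g_def using l1_eq_integral[OF G] by auto
    \<comment> \<open>\<open>\<rho> \<le> r\<close> controls the change of \<open>F\<close> along
      the flow, \<open>\<rho> \<le> t\<close> keeps \<open>s\<close> positive, and the last bound
      makes \<open>(t - s) * G x\<close> small in L^1.\<close>
    define \<rho> where "\<rho> = min (min r t) (\<epsilon> / (2 * (g + 1)))"
    have \<rho>: "0 < \<rho>" "\<rho> \<le> r" "\<rho> \<le> t" using r t \<epsilon> g by (auto simp: \<rho>_def)
    have \<rho>g: "\<rho> * g \<le> \<epsilon>/2"
    proof -
      have "\<rho> * g \<le> \<rho> * (g + 1)" using \<rho> by (intro mult_left_mono) auto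
      also have "\<dots> \<le> \<epsilon> / (2 * (g + 1)) * (g + 1)" using g by (intro mult_right_mono) (auto simp: \<rho>_def)
      also have "\<dots> = \<epsilon>/2"
      proof -
        have "g + 1 \<noteq> 0" using g by simp
        then show ?thesis by (simp add: divide_simps)
      qed
      finally show ?thesis .
    qed
    \<comment> \<open>The interval below \<open>t\<close> has positive measure, so it cannot consist
      of exceptional times only.\<close>
    obtain s where s: "t - \<rho> < s" "s < t"
        "AE x in lborel. x \<in> W \<longrightarrow> F (\<Phi> s x) - F x = (LINT s:{0..s}|lborel. G (\<Phi> s x))"
    proof (rule ccontr)
      assume "\<not> thesis"
      then have no: "\<not> (AE x in lborel. x \<in> W \<longrightarrow> F (\<Phi> s x) - F x = (LINT s:{0..s}|lborel. G (\<Phi> s x)))"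
        if "s \<in> {t - \<rho><..<t}" for s using that \<open>\<And>s. \<lbrakk>t - \<rho> < s; s < t; AE x in lborel. x \<in> W \<longrightarrow> F (\<Phi> s x) - F x = (LINT s:{0..s}|lborel. G (\<Phi> s x))\<rbrakk> \<Longrightarrow> thesis\<close> by auto
      from ae have "AE s in lborel. s \<notin> {t - \<rho><..<t}"
      proof eventually_elim
        case (elim s)
        then show ?case using no[of s] t \<rho> by (auto simp: \<delta>_def)
      qed
      then have "{t - \<rho><..<t} \<in> null_sets lborel" by (simp add: AE_iff_null_sets)
      then show False using \<rho> by (auto simp: null_sets_def)
    qed
    have "l1 (D t) \<le> l1 (\<lambda>x. F (\<Phi> t x) - F (\<Phi> s x)) + l1 (D s) + l1 (\<lambda>x. (t - s) * G x)"
    proof (rule l1_triangle3)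
      fix x
      have "D t x = indicator W x * (F (\<Phi> t x) - F (\<Phi> s x)) + D s x - indicator W x * ((t - s) * G x)"
        by (simp add: D_def algebra_simps)
      then show "\<bar>D t x\<bar> \<le> \<bar>F (\<Phi> t x) - F (\<Phi> s x)\<bar> + \<bar>D s x\<bar> + \<bar>(t - s) * G x\<bar>"
        by (auto simp: indicator_def)
    qed auto
    also have "\<dots> \<le> ennreal (\<epsilon>/2) + ennreal s * ennreal e + ennreal (\<epsilon>/2)"
    proof (intro add_mono)
      show "l1 (\<lambda>x. F (\<Phi> t x) - F (\<Phi> s x)) \<le> ennreal (\<epsilon>/2)" by (rule r(2)) (use s \<rho> t in auto)
      show "l1 (D s) \<le> ennreal s * ennreal e" by (rule good) (use s \<rho> t in auto)
      have "l1 (\<lambda>x. (t - s) * G x) = ennreal ((t - s) * g)"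
        using s g by (subst l1_cmult) (auto simp flip: ennreal_mult)
      also have "\<dots> \<le> ennreal (\<rho> * g)" using s g by (intro ennreal_leI mult_right_mono) auto
      also have "\<dots> \<le> ennreal (\<epsilon>/2)" using \<rho>g by (rule ennreal_leI)
      finally show "l1 (\<lambda>x. (t - s) * G x) \<le> ennreal (\<epsilon>/2)" .
    qed
    also have "\<dots> = ennreal (s * e + \<epsilon>)"
      using s \<rho> e \<epsilon> by (simp flip: ennreal_plus ennreal_mult)
    also have "\<dots> \<le> ennreal (t * e + \<epsilon>)" using s e by (intro ennreal_leI) auto
    also have "\<dots> = ennreal (t * e) + ennreal \<epsilon>" using t e \<epsilon> by simp
    finally show "l1 (D t) \<le> ennreal (t * e) + ennreal \<epsilon>" .
  qed
  have "l1 (\<lambda>x. indicator W x * ((F (\<Phi> t x) - F x) / t - G x)) \<le> ennreal e" if t: "0 < t" "t < \<delta>" for t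
  proof -
    have "l1 (\<lambda>x. indicator W x * ((F (\<Phi> t x) - F x) / t - G x)) = l1 (\<lambda>x. (1 / t) * D t x)"
      using t by (simp add: D_def field_simps)
    also have "\<dots> = ennreal (1 / t) * l1 (D t)" using t by (subst l1_cmult) auto
    also have "\<dots> \<le> ennreal (1 / t) * ennreal (t * e)" by (intro mult_left_mono all t) auto
    also have "\<dots> = ennreal e" using t e by (simp flip: ennreal_mult)
    finally show ?thesis .
  qed
  moreover have "0 < \<delta>" using \<tau> s0 by (simp add: \<delta>_def)
  ultimately show ?thesis by blast
qed

end

section \<open>Weak limits of difference quotients\<close>

lemma l1_le_imp_integral_le:
  assumes "integrable lborel f" "integrable lborel g" "l1 f \<le> ennreal c * l1 g" "0 \<le> c"
  shows "(\<integral>x. \<bar>f x\<bar> \<partial>lborel) \<le> c * (\<integral>x. \<bar>g x\<bar> \<partial>lborel)"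
  using assms(3) unfolding l1_eq_integral[OF assms(1)] l1_eq_integral[OF assms(2)]
  using assms(4) by (auto simp flip: ennreal_mult simp: ennreal_le_iff)

lemma integrable_bounded_mult:
  fixes f g :: "'a::euclidean_space \<Rightarrow> real"
  assumes "integrable lborel f" "g \<in> borel_measurable borel" "\<And>x. \<bar>g x\<bar> \<le> B"
  shows "integrable lborel (\<lambda>x. f x * g x)"
proof (rule Bochner_Integration.integrable_bound[where f = "\<lambda>x. B * f x"])
  show "integrable lborel (\<lambda>x. B * f x)" using assms by auto
  show "(\<lambda>x. f x * g x) \<in> borel_measurable lborel" using assms by auto
  have "\<bar>f x\<bar> * \<bar>g x\<bar> \<le> B * \<bar>f x\<bar>" for x
    using mult_left_mono[OF assms(3)[of x], of "\<bar>f x\<bar>"] by (simp add: mult.commute)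
  moreover have "0 \<le> B" using assms(3)[of undefined] by linarith
  ultimately show "AE x in lborel. norm (f x * g x) \<le> norm (B * f x)"
    by (simp add: abs_mult)
qed

lemma integral_abs_bounded_mult:
  fixes f g :: "'a::euclidean_space \<Rightarrow> real"
  assumes "integrable lborel f" "g \<in> borel_measurable borel" "\<And>x. \<bar>g x\<bar> \<le> B"
  shows "(\<integral>x. \<bar>f x * g x\<bar> \<partial>lborel) \<le> B * (\<integral>x. \<bar>f x\<bar> \<partial>lborel)"
proof -
  have "(\<integral>x. \<bar>f x * g x\<bar> \<partial>lborel) \<le> (\<integral>x. B * \<bar>f x\<bar> \<partial>lborel)"
  proof (rule integral_mono)
    show "integrable lborel (\<lambda>x. \<bar>f x * g x\<bar>)"
      using integrable_bounded_mult[OF assms] by (rule integrable_abs)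
    show "integrable lborel (\<lambda>x. B * \<bar>f x\<bar>)" using assms by auto
    show "\<bar>f x * g x\<bar> \<le> B * \<bar>f x\<bar>" for x
      using mult_left_mono[OF assms(3)[of x], of "\<bar>f x\<bar>"] by (simp add: abs_mult mult.commute)
  qed
  then show ?thesis by simp
qed

lemma abs_integral_bounded_mult:
  fixes f g :: "'a::euclidean_space \<Rightarrow> real"
  assumes "integrable lborel f" "g \<in> borel_measurable borel" "\<And>x. \<bar>g x\<bar> \<le> B"
  shows "\<bar>\<integral>x. f x * g x \<partial>lborel\<bar> \<le> B * (\<integral>x. \<bar>f x\<bar> \<partial>lborel)"
  by (rule order_trans[OF integral_abs_bound integral_abs_bounded_mult[OF assms]])

context lipschitz_flow
begin

text \<open>The volume bound for \<open>\<Phi> t\<close> and for its inverse gives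
  \<open>b \<le> c * a\<close> and \<open>a \<le> c * b\<close> for the two integrals. The second
  yields the lower bound \<open>(2 - c) * a \<le> b\<close>, because
  \<open>(2 - c) * c \<le> 1\<close>; for \<open>c > 2\<close> its left side is not
  positive.\<close>

lemma flow_integral_change_nonneg:
  assumes k: "integrable lborel k" and pos: "\<And>x. 0 \<le> k x"
  shows "\<bar>(\<integral>x. k (\<Phi> t x) \<partial>lborel) - (\<integral>x. k x \<partial>lborel)\<bar> \<le> (exp (L * \<bar>t\<bar>) ^ DIM('a) - 1) * (\<integral>x. k x \<partial>lborel)"
proof -
  define c where "c = exp (L * \<bar>t\<bar>) ^ DIM('a)"
  have c: "1 \<le> c" unfolding c_def using L_nonneg by (intro one_le_power) auto
  have km: "k \<in> borel_measurable borel" using k by auto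
  have kt: "integrable lborel (\<lambda>x. k (\<Phi> t x))" using k by (rule integrable_flow)
  have ktm: "(\<lambda>x. k (\<Phi> t x)) \<in> borel_measurable borel" using kt by auto
  define a b where "a = (\<integral>x. k x \<partial>lborel)" and "b = (\<integral>x. k (\<Phi> t x) \<partial>lborel)"
  have a0: "0 \<le> a" unfolding a_def using pos by auto
  have "(\<integral>x. \<bar>k (\<Phi> t x)\<bar> \<partial>lborel) \<le> c * (\<integral>x. \<bar>k x\<bar> \<partial>lborel)"
    using l1_flow_le[OF km, of t] c by (intro l1_le_imp_integral_le k kt) (auto simp: c_def)
  then have 1: "b \<le> c * a" using pos by (simp add: a_def b_def)
  have "(\<integral>x. \<bar>k (\<Phi> t (\<Phi> (- t) x))\<bar> \<partial>lborel) \<le> c * (\<integral>x. \<bar>k (\<Phi> t x)\<bar> \<partial>lborel)"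
    using l1_flow_le[OF ktm, of "- t"] c k by (intro l1_le_imp_integral_le kt) (auto simp: c_def)
  then have 2: "a \<le> c * b" using pos by (simp add: a_def b_def)
  have "a - b \<le> (c - 1) * a"
  proof -
    have "(2 - c) * (c * b) \<le> b"
    proof -
      have "(2 - c) * c \<le> 1" using zero_le_power2[of "c - 1"] by (simp add: power2_eq_square algebra_simps)
      moreover have "0 \<le> b" unfolding b_def using pos by auto
      ultimately show ?thesis using mult_right_mono[of "(2 - c) * c" 1 b] by (simp add: mult.assoc)
    qed
    moreover have "(2 - c) * a \<le> b"
    proof (cases "c \<le> 2")
      case True
      then have "(2 - c) * a \<le> (2 - c) * (c * b)" using 2 by (intro mult_left_mono) auto
      then show ?thesis using calculation by linarith
    next
      case False
      have "0 \<le> b" unfolding b_def using pos by auto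
      moreover have "(2 - c) * a \<le> 0" using False a0 by (simp add: mult_nonpos_nonneg)
      ultimately show ?thesis by linarith
    qed
    ultimately show ?thesis by (simp add: algebra_simps)
  qed
  moreover have "b - a \<le> (c - 1) * a" using 1 by (simp add: algebra_simps)
  ultimately show ?thesis by (simp add: a_def b_def c_def)
qed

lemma flow_integral_change:
  assumes k: "integrable lborel k"
  shows "\<bar>(\<integral>x. k (\<Phi> t x) \<partial>lborel) - (\<integral>x. k x \<partial>lborel)\<bar> \<le> (exp (L * \<bar>t\<bar>) ^ DIM('a) - 1) * (\<integral>x. \<bar>k x\<bar> \<partial>lborel)"
proof -
  define p n where "p x = max (k x) 0" and "n x = max (- k x) 0" for x
  have p: "integrable lborel p" and n: "integrable lborel n" unfolding p_def n_def using k by auto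
  have pt: "integrable lborel (\<lambda>x. p (\<Phi> t x))" "integrable lborel (\<lambda>x. n (\<Phi> t x))"
    using p n by (auto intro: integrable_flow)
  have k': "k x = p x - n x" "\<bar>k x\<bar> = p x + n x" for x by (auto simp: p_def n_def)
  have "(\<integral>x. k (\<Phi> t x) \<partial>lborel) - (\<integral>x. k x \<partial>lborel) =
      ((\<integral>x. p (\<Phi> t x) \<partial>lborel) - (\<integral>x. p x \<partial>lborel)) - ((\<integral>x. n (\<Phi> t x) \<partial>lborel) - (\<integral>x. n x \<partial>lborel))"
    unfolding k' using p n pt by simp
  moreover have "\<bar>(\<integral>x. p (\<Phi> t x) \<partial>lborel) - (\<integral>x. p x \<partial>lborel)\<bar> \<le> (exp (L * \<bar>t\<bar>) ^ DIM('a) - 1) * (\<integral>x. p x \<partial>lborel)"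
    by (rule flow_integral_change_nonneg[OF p]) (simp add: p_def)
  moreover have "\<bar>(\<integral>x. n (\<Phi> t x) \<partial>lborel) - (\<integral>x. n x \<partial>lborel)\<bar> \<le> (exp (L * \<bar>t\<bar>) ^ DIM('a) - 1) * (\<integral>x. n x \<partial>lborel)"
    by (rule flow_integral_change_nonneg[OF n]) (simp add: n_def)
  moreover have "(\<integral>x. \<bar>k x\<bar> \<partial>lborel) = (\<integral>x. p x \<partial>lborel) + (\<integral>x. n x \<partial>lborel)"
    unfolding k'(2) using p n by simp
  ultimately show ?thesis unfolding abs_le_iff by (simp add: algebra_simps)
qed

text \<open>From \<open>exp x - 1 \<le> x * exp x\<close>: for times in the unit interval the volume
  defect is at most linear in \<open>t\<close>.\<close>

lemma exp_power_minus_one_le: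
  assumes "0 \<le> t" "t \<le> 1"
  shows "exp (L * \<bar>t\<bar>) ^ DIM('a) - 1 \<le> real DIM('a) * L * exp (real DIM('a) * L) * t"
proof -
  define m where "m = real DIM('a) * L"
  have m: "0 \<le> m" using L_nonneg by (simp add: m_def)
  have "exp (L * \<bar>t\<bar>) ^ DIM('a) = exp (m * t)" using assms by (simp add: m_def exp_of_nat_mult[symmetric] mult_ac)
  moreover have "exp (m * t) - 1 \<le> m * exp m * t"
  proof -
    have "1 + (- (m * t)) \<le> exp (- (m * t))" by (rule exp_ge_add_one_self)
    then have "(1 + (- (m * t))) * exp (m * t) \<le> exp (- (m * t)) * exp (m * t)" by (intro mult_right_mono) auto
    then have "exp (m * t) - 1 \<le> (m * t) * exp (m * t)" by (simp add: mult_exp_exp algebra_simps)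
    also have "\<dots> \<le> (m * t) * exp m" using assms m by (intro mult_left_mono) (auto simp: mult_left_le)
    finally show ?thesis by (simp add: mult_ac)
  qed
  ultimately show ?thesis by (simp add: m_def)
qed

text \<open>The difference quotients are equicontinuous as functionals on \<open>L\<^sup>1\<close>: the flow changes volume by
  a factor \<open>1 + O(t)\<close> only, which replaces the Jacobian of the flow.\<close>

lemma weak_quotient_bound:
  assumes u: "u \<in> borel_measurable borel" "\<And>x. \<bar>u x\<bar> \<le> B" "Lu-lipschitz_on UNIV u"
  shows "\<exists>C\<ge>0. \<forall>H t. integrable lborel H \<longrightarrow> 0 < t \<longrightarrow> t \<le> 1 \<longrightarrow>
    \<bar>\<integral>x. (H (\<Phi> t x) - H x) / t * u x \<partial>lborel\<bar> \<le> C * (\<integral>x. \<bar>H x\<bar> \<partial>lborel)"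
proof -
  define C1 where "C1 = exp L ^ DIM('a)"
  define C2 where "C2 = real DIM('a) * L * exp (real DIM('a) * L)"
  have B0: "0 \<le> B" using u(2)[of undefined] by linarith
  have Lu0: "0 \<le> Lu" using u(3) by (rule lipschitz_on_nonneg)
  have C2: "0 \<le> C2" using L_nonneg by (simp add: C2_def)
  have "\<bar>\<integral>x. (H (\<Phi> t x) - H x) / t * u x \<partial>lborel\<bar> \<le> (Lu * M * C1 + C2 * B) * (\<integral>x. \<bar>H x\<bar> \<partial>lborel)"
    if H: "integrable lborel H" and t: "0 < t" "t \<le> 1" for H t
  proof -
    define h where "h = (\<integral>x. \<bar>H x\<bar> \<partial>lborel)"
    have h0: "0 \<le> h" by (simp add: h_def)
    have [measurable]: "H \<in> borel_measurable borel" "u \<in> borel_measurable borel" "\<Phi> t \<in> borel_measurable borel"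
      using H u flow_continuous_space by (auto intro: borel_measurable_continuous_onI)
    have Ht: "integrable lborel (\<lambda>x. H (\<Phi> t x))" using H by (rule integrable_flow)
    have Hu: "integrable lborel (\<lambda>x. H x * u x)" by (rule integrable_bounded_mult[OF H u(1,2)])
    have Hut: "integrable lborel (\<lambda>x. H (\<Phi> t x) * u (\<Phi> t x))" using integrable_flow[OF Hu] by simp
    have Htu: "integrable lborel (\<lambda>x. H (\<Phi> t x) * u x)" by (rule integrable_bounded_mult[OF Ht u(1,2)])
    have d: "\<bar>u x - u (\<Phi> t x)\<bar> \<le> Lu * M * t" for x
    proof -
      have "dist (u x) (u (\<Phi> t x)) \<le> Lu * dist x (\<Phi> t x)" using lipschitz_onD[OF u(3)] by auto
      also have "\<dots> \<le> Lu * (M * t)" using flow_speed[of 0 x t] t Lu0 by (intro mult_left_mono) (auto simp: init)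
      finally show ?thesis by (simp add: dist_real_def mult.assoc)
    qed
    have e1: "exp (L * \<bar>t\<bar>) ^ DIM('a) \<le> C1" unfolding C1_def
      using t L_nonneg by (intro power_mono) (auto simp: mult_left_le)
    have "(\<integral>x. \<bar>H (\<Phi> t x)\<bar> \<partial>lborel) \<le> exp (L * \<bar>t\<bar>) ^ DIM('a) * h" unfolding h_def
      using l1_flow_le[of H t] by (intro l1_le_imp_integral_le Ht H) auto
    also have "\<dots> \<le> C1 * h" using e1 h0 by (intro mult_right_mono)
    finally have Hth: "(\<integral>x. \<bar>H (\<Phi> t x)\<bar> \<partial>lborel) \<le> C1 * h" .
    have "\<bar>\<integral>x. H (\<Phi> t x) * (u x - u (\<Phi> t x)) \<partial>lborel\<bar> \<le> (Lu * M * t) * (\<integral>x. \<bar>H (\<Phi> t x)\<bar> \<partial>lborel)"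
      by (rule abs_integral_bounded_mult[OF Ht _ d]) measurable
    also have "\<dots> \<le> (Lu * M * t) * (C1 * h)" using Hth Lu0 M_nonneg t by (intro mult_left_mono) auto
    finally have 1: "\<bar>\<integral>x. H (\<Phi> t x) * (u x - u (\<Phi> t x)) \<partial>lborel\<bar> \<le> t * (Lu * M * C1 * h)" by (simp add: mult_ac)
    have Huh: "(\<integral>x. \<bar>H x * u x\<bar> \<partial>lborel) \<le> B * h"
      unfolding h_def by (rule integral_abs_bounded_mult[OF H u(1,2)])
    have "\<bar>(\<integral>x. H (\<Phi> t x) * u (\<Phi> t x) \<partial>lborel) - (\<integral>x. H x * u x \<partial>lborel)\<bar>
        \<le> (exp (L * \<bar>t\<bar>) ^ DIM('a) - 1) * (\<integral>x. \<bar>H x * u x\<bar> \<partial>lborel)"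
      using flow_integral_change[OF Hu] by simp
    also have "\<dots> \<le> (C2 * t) * (B * h)"
      using exp_power_minus_one_le[of t] t Huh C2 B0 h0 by (intro mult_mono) (auto simp: C2_def)
    finally have 2: "\<bar>(\<integral>x. H (\<Phi> t x) * u (\<Phi> t x) \<partial>lborel) - (\<integral>x. H x * u x \<partial>lborel)\<bar> \<le> t * (C2 * B * h)"
      by (simp add: mult_ac)
    \<comment> \<open>Moving the test function along with the flow leaves two terms: one with
      \<open>u x - u (\<Phi> t x)\<close>, governed by the Lipschitz constant of \<open>u\<close>,
      and the change of the integral of \<open>H x * u x\<close>, governed by the volume defect.
      Both are of order \<open>t\<close>, which cancels the denominator.\<close>
    have "(\<integral>x. (H (\<Phi> t x) - H x) * u x \<partial>lborel) = (\<integral>x. H (\<Phi> t x) * u x \<partial>lborel) - (\<integral>x. H x * u x \<partial>lborel)"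
      using Htu Hu by (simp add: left_diff_distrib)
    also have "\<dots> = (\<integral>x. H (\<Phi> t x) * (u x - u (\<Phi> t x)) \<partial>lborel) + ((\<integral>x. H (\<Phi> t x) * u (\<Phi> t x) \<partial>lborel) - (\<integral>x. H x * u x \<partial>lborel))"
      using Htu Hut by (simp add: right_diff_distrib)
    finally have "\<bar>\<integral>x. (H (\<Phi> t x) - H x) * u x \<partial>lborel\<bar> \<le> t * (Lu * M * C1 * h) + t * (C2 * B * h)"
      using 1 2 by linarith
    also have "\<dots> = t * ((Lu * M * C1 + C2 * B) * h)" by (simp add: algebra_simps)
    finally have 3: "\<bar>\<integral>x. (H (\<Phi> t x) - H x) * u x \<partial>lborel\<bar> \<le> t * ((Lu * M * C1 + C2 * B) * h)" .
    have "(\<integral>x. (H (\<Phi> t x) - H x) / t * u x \<partial>lborel) = (\<integral>x. (H (\<Phi> t x) - H x) * u x \<partial>lborel) / t"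
      by simp
    then show ?thesis using 3 t by (simp add: h_def abs_divide field_simps)
  qed
  moreover have "0 \<le> Lu * M * C1 + C2 * B" using Lu0 M_nonneg C2 B0 by (simp add: C1_def)
  ultimately show ?thesis by blast
qed

end

text \<open>Orbits from \<open>S\<close> stay in \<open>K\<close> up to time \<open>\<tau>\<close>,
  so the indicators equal 1 along them, and the mean value theorem turns the quotient into
  \<open>g\<close> at an intermediate orbit point. Uniform continuity of \<open>g\<close> on
  \<open>K\<close> makes the convergence uniform on \<open>S\<close>.\<close>

lemma weak_quotient_polynomial:
  fixes Y :: "real ^ 'n \<Rightarrow> real ^ 'n"
  assumes Y: "lipschitz_flow Y L M \<Phi>"
    and p: "C1_gradient p p'" and K: "compact K"
    and u: "u \<in> borel_measurable borel" "\<And>x. \<bar>u x\<bar> \<le> B" "\<And>x. x \<notin> S \<Longrightarrow> u x = 0"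
    and \<tau>: "0 < \<tau>" "\<And>x t. x \<in> S \<Longrightarrow> 0 \<le> t \<Longrightarrow> t \<le> \<tau> \<Longrightarrow> \<Phi> t x \<in> K"
  shows "((\<lambda>t. \<integral>x. (indicator K (\<Phi> t x) * p (\<Phi> t x) - indicator K x * p x) / t * u x \<partial>lborel) \<longlongrightarrow>
    (\<integral>x. (\<Sum>i\<in>UNIV. p' i x * Y x $ i) * u x \<partial>lborel)) (at_right 0)"
proof -
  interpret lipschitz_flow Y L M \<Phi> by (rule Y)
  define g where "g x = (\<Sum>i\<in>UNIV. p' i x * Y x $ i)" for x
  have cY: "continuous_on UNIV Y" using lip by (rule lipschitz_on_continuous_on)
  have cg: "continuous_on UNIV g" unfolding g_def
    using p cY by (auto simp: C1_gradient_def intro!: continuous_intros)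
  have cp: "continuous_on UNIV p" using C1_gradient_axis_C1[OF p] by (simp add: axis_C1_def)
  have SK: "S \<subseteq> K" using \<tau>(2)[of _ 0] \<tau>(1) by (auto simp: init)
  have Kb[measurable]: "K \<in> sets borel" using K by (simp add: compact_imp_closed)
  have [measurable]: "p \<in> borel_measurable borel" "g \<in> borel_measurable borel" "u \<in> borel_measurable borel"
      "\<Phi> t \<in> borel_measurable borel" for t
    using u cp cg flow_continuous_space by (auto intro: borel_measurable_continuous_onI)
  have B0: "0 \<le> B" using u(2)[of undefined] by linarith
  have intK: "integrable lborel (\<lambda>x. indicator K x * f x)" if "continuous_on UNIV f" for f :: "real ^ 'n \<Rightarrow> real"
    using borel_integrable_compact[OF K continuous_on_subset[OF that subset_UNIV]] by simp
  define m where "m = measure lborel K"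
  have m: "0 \<le> m" "integrable lborel (indicat_real K)" "(\<integral>x. indicat_real K x \<partial>lborel) = m"
    using intK[of "\<lambda>x. 1"] by (auto simp: m_def)
  have main: "\<exists>\<delta>>0. \<forall>t. 0 < t \<and> t < \<delta> \<longrightarrow>
      \<bar>(\<integral>x. (indicator K (\<Phi> t x) * p (\<Phi> t x) - indicator K x * p x) / t * u x \<partial>lborel) - (\<integral>x. g x * u x \<partial>lborel)\<bar> \<le> e * B * m"
    if e: "0 < e" for e
  proof -
    have "uniformly_continuous_on K g" using cg K by (intro compact_uniformly_continuous) (auto intro: continuous_on_subset)
    then obtain d where d: "0 < d" "\<And>x y. x \<in> K \<Longrightarrow> y \<in> K \<Longrightarrow> dist y x < d \<Longrightarrow> dist (g y) (g x) < e"
      using e unfolding uniformly_continuous_on_def by metis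
    \<comment> \<open>Points move at speed at most \<open>M\<close>, so within this time they move
      by less than \<open>d\<close>.\<close>
    define \<delta> where "\<delta> = min \<tau> (d / (M + 1))"
    have \<delta>: "0 < \<delta>" "\<delta> \<le> \<tau>" using \<tau> d M_nonneg by (auto simp: \<delta>_def)
    have M\<delta>: "M * t < d" if "0 < t" "t < \<delta>" for t
    proof -
      have "M * t \<le> (M + 1) * t" using that by (intro mult_right_mono) auto
      also have "\<dots> < (M + 1) * (d / (M + 1))" using that M_nonneg by (intro mult_strict_left_mono) (auto simp: \<delta>_def)
      finally show ?thesis using M_nonneg by simp
    qed
    have "\<bar>(\<integral>x. (indicator K (\<Phi> t x) * p (\<Phi> t x) - indicator K x * p x) / t * u x \<partial>lborel) - (\<integral>x. g x * u x \<partial>lborel)\<bar> \<le> e * B * m"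
      if t: "0 < t" "t < \<delta>" for t
    proof -
      define q where "q x = (indicator K (\<Phi> t x) * p (\<Phi> t x) - indicator K x * p x) / t" for x
      have qg: "\<bar>q x - g x\<bar> \<le> e" if x: "x \<in> S" for x
      proof -
        have "((\<lambda>s. p (\<Phi> s x)) has_real_derivative g (\<Phi> s x)) (at s)" for s
          using C1_gradient_along_curve[OF p deriv] by (simp add: g_def)
        then obtain z where z: "0 < z" "z < t" "p (\<Phi> t x) - p (\<Phi> 0 x) = (t - 0) * g (\<Phi> z x)"
          using MVT2[of 0 t "\<lambda>s. p (\<Phi> s x)" "\<lambda>s. g (\<Phi> s x)"] t by auto
        have "\<Phi> t x \<in> K" "\<Phi> z x \<in> K" "x \<in> K" using \<tau>(2)[OF x] z t \<delta> SK x by auto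
        then have "q x = g (\<Phi> z x)" using z t by (simp add: q_def init)
        moreover have "dist (g (\<Phi> z x)) (g x) < e"
        proof (rule d(2))
          have "dist (\<Phi> z x) x \<le> M * z" using flow_speed[of z x 0] z by (simp add: init)
          then show "dist (\<Phi> z x) x < d" using M\<delta>[of z] z t by simp
        qed fact+
        ultimately show ?thesis by (simp add: dist_real_def)
      qed
      have pw: "\<bar>(q x - g x) * u x\<bar> \<le> (e * B) * indicator K x" for x
      proof (cases "x \<in> S")
        case True
        have "\<bar>q x - g x\<bar> * \<bar>u x\<bar> \<le> e * B" using qg[OF True] u(2)[of x] e by (intro mult_mono) auto
        then show ?thesis using True SK by (auto simp: abs_mult)
      next
        case False
        then show ?thesis using u(3)[of x] e B0 by (simp add: indicator_def)
      qed
      have qi: "integrable lborel q" unfolding q_def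
        using integrable_flow[OF intK[OF cp], of t] intK[OF cp] by (intro integrable_divide Bochner_Integration.integrable_diff) auto
      have qu: "integrable lborel (\<lambda>x. q x * u x)" by (rule integrable_bounded_mult[OF qi u(1,2)])
      have "integrable lborel (\<lambda>x. (indicator K x * g x) * u x)" by (rule integrable_bounded_mult[OF intK[OF cg] u(1,2)])
      moreover have "(\<lambda>x. (indicator K x * g x) * u x) = (\<lambda>x. g x * u x)"
        using u(3) SK by (fastforce simp: indicator_def)
      ultimately have gu: "integrable lborel (\<lambda>x. g x * u x)" by simp
      have "(\<integral>x. q x * u x \<partial>lborel) - (\<integral>x. g x * u x \<partial>lborel) = (\<integral>x. (q x - g x) * u x \<partial>lborel)"
        using qu gu by (simp add: left_diff_distrib)
      also have "\<bar>\<dots>\<bar> \<le> (\<integral>x. \<bar>(q x - g x) * u x\<bar> \<partial>lborel)" by (rule integral_abs_bound)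
      also have "\<dots> \<le> (\<integral>x. (e * B) * indicator K x \<partial>lborel)"
        using qu gu m by (intro integral_mono pw integrable_abs) (auto simp: left_diff_distrib)
      also have "\<dots> = e * B * m" using m by simp
      finally show ?thesis by (simp add: q_def)
    qed
    then show ?thesis using \<delta>(1) by blast
  qed
  show ?thesis unfolding g_def[symmetric]
  proof (rule tendstoI)
    fix e :: real assume e: "0 < e"
    define e' where "e' = e / (2 * (B * m + 1))"
    have Bm: "0 \<le> B * m" using B0 m by simp
    have e': "0 < e'" "e' * B * m < e"
    proof -
      show "0 < e'" using e Bm by (simp add: e'_def)
      then have "e' * (B * m) \<le> e' * (B * m + 1)" by (intro mult_left_mono) auto
      also have "\<dots> = e / 2"
      proof -
        have "B * m + 1 \<noteq> 0" using Bm by linarith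
        then show ?thesis by (simp add: e'_def divide_simps)
      qed
      finally show "e' * B * m < e" using e by (simp add: mult.assoc)
    qed
    from main[OF e'(1)] obtain \<delta> where "0 < \<delta>" "\<And>t. 0 < t \<and> t < \<delta> \<Longrightarrow>
      \<bar>(\<integral>x. (indicator K (\<Phi> t x) * p (\<Phi> t x) - indicator K x * p x) / t * u x \<partial>lborel) - (\<integral>x. g x * u x \<partial>lborel)\<bar> \<le> e' * B * m" by blast
    then show "\<forall>\<^sub>F t in at_right 0. dist (\<integral>x. (indicator K (\<Phi> t x) * p (\<Phi> t x) - indicator K x * p x) / t * u x \<partial>lborel)
        (\<integral>x. g x * u x \<partial>lborel) < e"
      unfolding eventually_at_right_field using e'(2) by (intro exI[of _ \<delta>]) (fastforce simp: dist_real_def)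
  qed
qed

text \<open>The truncated polynomial \<open>P\<close> may jump at the boundary of \<open>K\<close>,
  but up to time \<open>\<tau>\<close> orbits that start where \<open>u\<close> is not zero stay in
  \<open>K\<close> and do not see the jump. The limit for \<open>P\<close> is the derivative of
  \<open>p\<close> along \<open>Y\<close> paired with \<open>u\<close>; the divergence theorem for
  \<open>p * u\<close> times \<open>Y\<close> moves it onto \<open>u\<close>.\<close>

theorem weak_quotient_limit:
  fixes Y :: "real ^ 'n \<Rightarrow> real ^ 'n"
  assumes Y: "lipschitz_flow Y L M \<Phi>" and dv: "diagonal_derivatives Y dv" "\<And>i x. \<bar>dv i x\<bar> \<le> L"
    and F: "integrable lborel F" "\<And>x. x \<notin> K \<Longrightarrow> F x = 0" and K: "compact K"
    and u: "axis_C1 u u'" "bounded {x. u x \<noteq> 0}" "\<And>x. x \<notin> S \<Longrightarrow> u x = 0"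
    and \<tau>: "0 < \<tau>" "\<And>x t. x \<in> S \<Longrightarrow> 0 \<le> t \<Longrightarrow> t \<le> \<tau> \<Longrightarrow> \<Phi> t x \<in> K"
  shows "((\<lambda>t. \<integral>x. (F (\<Phi> t x) - F x) / t * u x \<partial>lborel) \<longlongrightarrow>
    - (\<integral>x. F x * (\<Sum>i\<in>UNIV. u' i x * Y x $ i + u x * dv i x) \<partial>lborel)) (at_right 0)"
proof -
  interpret lipschitz_flow Y L M \<Phi> by (rule Y)
  obtain B R where B: "0 \<le> B" "\<And>x. \<bar>u x\<bar> \<le> B" "\<And>i x. \<bar>u' i x\<bar> \<le> B"
    using axis_C1_bounds[OF u(1,2)] by metis
  have cu: "continuous_on UNIV u" "continuous_on UNIV (u' i)" for i using u(1) by (auto simp: axis_C1_def)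
  have cY: "continuous_on UNIV Y" using lip by (rule lipschitz_on_continuous_on)
  have um: "u \<in> borel_measurable borel" using cu(1) by (rule borel_measurable_continuous_onI)
  have [measurable]: "dv i \<in> borel_measurable borel" for i using dv(1) by (simp add: diagonal_derivatives_def)
  have [measurable]: "u \<in> borel_measurable borel" "u' i \<in> borel_measurable borel" "(\<lambda>x. Y x $ i) \<in> borel_measurable borel"
      "F \<in> borel_measurable borel" "\<Phi> t \<in> borel_measurable borel" for i t
    using cu cY F flow_continuous_space by (auto intro!: borel_measurable_continuous_onI continuous_intros)
  have SK: "S \<subseteq> K" using \<tau>(2)[of _ 0] \<tau>(1) by (auto simp: init)
  have [measurable]: "K \<in> sets borel" using K by (simp add: compact_imp_closed)
  define D where "D x = (\<Sum>i\<in>UNIV. u' i x * Y x $ i + u x * dv i x)" for x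
  have Dm[measurable]: "D \<in> borel_measurable borel" unfolding D_def by measurable
  define BD where "BD = real CARD('n) * (B * M + B * L)"
  have DB: "\<bar>D x\<bar> \<le> BD" for x
  proof -
    have "\<bar>D x\<bar> \<le> (\<Sum>i\<in>UNIV. \<bar>u' i x * Y x $ i + u x * dv i x\<bar>)" unfolding D_def by (rule sum_abs)
    also have "\<dots> \<le> (\<Sum>i\<in>(UNIV::'n set). B * M + B * L)"
    proof (rule sum_mono)
      fix i
      have "\<bar>Y x $ i\<bar> \<le> M" using component_le_norm_cart[of "Y x" i] bound[of x] by linarith
      then have "\<bar>u' i x\<bar> * \<bar>Y x $ i\<bar> \<le> B * M" "\<bar>u x\<bar> * \<bar>dv i x\<bar> \<le> B * L"
        using B dv(2)[of i x] by (auto intro!: mult_mono)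
      then show "\<bar>u' i x * Y x $ i + u x * dv i x\<bar> \<le> B * M + B * L"
        using abs_triangle_ineq[of "u' i x * Y x $ i" "u x * dv i x"] by (simp add: abs_mult)
    qed
    finally show ?thesis by (simp add: BD_def)
  qed
  have BD0: "0 \<le> BD" using DB[of undefined] by linarith
  have D0: "D x = 0" if "x \<notin> K" for x
  proof -
    have "u' i x = 0" for i
      by (rule axis_C1_zero_on_open[OF u(1), of "- K"]) (use that K SK u(3) in \<open>auto simp: compact_imp_closed\<close>)
    moreover have "u x = 0" using u(3)[of x] that SK by blast
    ultimately show ?thesis by (simp add: D_def)
  qed
  obtain C where C: "0 \<le> C" "\<And>H t. integrable lborel H \<Longrightarrow> 0 < t \<Longrightarrow> t \<le> 1 \<Longrightarrow>
      \<bar>\<integral>x. (H (\<Phi> t x) - H x) / t * u x \<partial>lborel\<bar> \<le> C * (\<integral>x. \<bar>H x\<bar> \<partial>lborel)"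
    using weak_quotient_bound[OF um B(2) axis_C1_lipschitz[OF u(1) B(3)]] by blast
  show ?thesis unfolding D_def[symmetric]
  proof (rule tendstoI)
    fix e :: real assume e: "0 < e"
    \<comment> \<open>\<open>C\<close> bounds the quotient functionals and \<open>BD\<close> the
      limit functional, so the remainder \<open>H\<close> contributes at most
      \<open>(C + BD) * \<epsilon>\<close>.\<close>
    define \<epsilon> where "\<epsilon> = e / (2 * (C + BD + 1))"
    have \<epsilon>: "0 < \<epsilon>" "(C + BD) * \<epsilon> \<le> e / 2"
    proof -
      show "0 < \<epsilon>" using e C BD0 by (simp add: \<epsilon>_def)
      then have "(C + BD) * \<epsilon> \<le> (C + BD + 1) * \<epsilon>" by (intro mult_right_mono) auto
      also have "\<dots> = e / 2"
      proof -
        have "C + BD + 1 \<noteq> 0" using C BD0 by linarith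
        then show ?thesis by (simp add: \<epsilon>_def divide_simps)
      qed
      finally show "(C + BD) * \<epsilon> \<le> e / 2" .
    qed
    obtain p p' where p: "C1_gradient p p'" "l1 (\<lambda>x. indicator K x * (F x - p x)) \<le> ennreal \<epsilon>"
      by (rule polynomials_dense_L1_compact[OF F(1) K \<epsilon>(1)])
    define P where "P x = indicator K x * p x" for x
    define H where "H x = indicator K x * (F x - p x)" for x
    have cp: "continuous_on UNIV p" using C1_gradient_axis_C1[OF p(1)] by (simp add: axis_C1_def)
    have [measurable]: "p \<in> borel_measurable borel" using cp by (rule borel_measurable_continuous_onI)
    have Pi: "integrable lborel P" unfolding P_def
      using borel_integrable_compact[OF K continuous_on_subset[OF cp subset_UNIV]] by simp
    have FPH: "F x = P x + H x" for x using F(2)[of x] by (simp add: P_def H_def indicator_def)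
    have Hi: "integrable lborel H"
    proof -
      have "integrable lborel (\<lambda>x. F x - P x)" using F(1) Pi by auto
      then show ?thesis using FPH by simp
    qed
    have Hl: "(\<integral>x. \<bar>H x\<bar> \<partial>lborel) \<le> \<epsilon>"
      using p(2) \<epsilon>(1) unfolding H_def[symmetric] l1_eq_integral[OF Hi] by simp
    have lim: "((\<lambda>t. \<integral>x. (P (\<Phi> t x) - P x) / t * u x \<partial>lborel) \<longlongrightarrow> - (\<integral>x. P x * D x \<partial>lborel)) (at_right 0)"
    proof -
      define g where "g x = (\<Sum>i\<in>UNIV. p' i x * Y x $ i)" for x
      have w: "axis_C1 (\<lambda>x. p x * u x) (\<lambda>i x. p' i x * u x + p x * u' i x)"
        by (rule axis_C1_mult[OF C1_gradient_axis_C1[OF p(1)] u(1)])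
      have wb: "bounded {x. p x * u x \<noteq> 0}" by (rule bounded_subset[OF u(2)]) auto
      have eq: "(\<Sum>i\<in>UNIV. (p' i x * u x + p x * u' i x) * Y x $ i + p x * u x * dv i x) = g x * u x + P x * D x" for x
      proof -
        have 1: "P x * D x = p x * D x" using D0[of x] by (cases "x \<in> K") (simp_all add: P_def)
        have 2: "p x * D x = (\<Sum>i\<in>UNIV. p x * (u' i x * Y x $ i + u x * dv i x))"
          by (simp add: D_def sum_distrib_left)
        have 3: "g x * u x = (\<Sum>i\<in>UNIV. p' i x * Y x $ i * u x)" by (simp add: g_def sum_distrib_right)
        show ?thesis unfolding 1 2 3 sum.distrib[symmetric] by (intro sum.cong) (simp_all add: algebra_simps)
      qed
      note div = integral_divergence_zero[OF lip bound dv(1) w wb, unfolded eq]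
      have PD: "integrable lborel (\<lambda>x. P x * D x)" by (rule integrable_bounded_mult[OF Pi Dm DB])
      have gu: "integrable lborel (\<lambda>x. g x * u x)"
        using Bochner_Integration.integrable_diff[OF div(1) PD] by simp
      have "(\<integral>x. g x * u x \<partial>lborel) = - (\<integral>x. P x * D x \<partial>lborel)"
        using div(2) PD gu by simp
      then show ?thesis
        using weak_quotient_polynomial[OF Y p(1) K um B(2) u(3) \<tau>] by (simp add: g_def P_def)
    qed
    have "eventually (\<lambda>t. dist (\<integral>x. (P (\<Phi> t x) - P x) / t * u x \<partial>lborel) (- (\<integral>x. P x * D x \<partial>lborel)) < e / 2) (at_right 0)"
      using lim e by (intro tendstoD) auto
    moreover have "eventually (\<lambda>t. 0 < t \<and> t < 1) (at_right (0::real))"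
      by (auto simp: eventually_at_right_field intro: exI[of _ 1])
    ultimately show "\<forall>\<^sub>F t in at_right 0. dist (\<integral>x. (F (\<Phi> t x) - F x) / t * u x \<partial>lborel) (- (\<integral>x. F x * D x \<partial>lborel)) < e"
    proof eventually_elim
      case (elim t)
      have i: "integrable lborel (\<lambda>x. (h (\<Phi> t x) - h x) / t * u x)" if "integrable lborel h" for h
        using that integrable_flow[OF that, of t] by (intro integrable_bounded_mult[OF _ um B(2)]) auto
      have 1: "(\<integral>x. (F (\<Phi> t x) - F x) / t * u x \<partial>lborel) =
          (\<integral>x. (P (\<Phi> t x) - P x) / t * u x \<partial>lborel) + (\<integral>x. (H (\<Phi> t x) - H x) / t * u x \<partial>lborel)"
        unfolding FPH using i[OF Pi] i[OF Hi]
        by (subst Bochner_Integration.integral_add[symmetric]) (auto simp: algebra_simps add_divide_distrib diff_divide_distrib)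
      have 2: "(\<integral>x. F x * D x \<partial>lborel) = (\<integral>x. P x * D x \<partial>lborel) + (\<integral>x. H x * D x \<partial>lborel)"
        unfolding FPH using integrable_bounded_mult[OF Pi Dm DB] integrable_bounded_mult[OF Hi Dm DB]
        by (subst Bochner_Integration.integral_add[symmetric]) (auto simp: algebra_simps)
      have 3: "\<bar>\<integral>x. (H (\<Phi> t x) - H x) / t * u x \<partial>lborel\<bar> \<le> C * \<epsilon>"
        using C(2)[OF Hi, of t] elim mult_left_mono[OF Hl C(1)] by linarith
      have 4: "\<bar>\<integral>x. H x * D x \<partial>lborel\<bar> \<le> BD * \<epsilon>"
        using abs_integral_bounded_mult[OF Hi Dm DB] mult_left_mono[OF Hl BD0] by linarith
      have "C * \<epsilon> + BD * \<epsilon> \<le> e / 2" using \<epsilon>(2) by (simp add: distrib_right)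
      then show ?case using elim 3 4 unfolding 1 2 dist_real_def by linarith
    qed
  qed
qed

section \<open>Mollifiers\<close>

text \<open>With the polynomial \<open>P\<close> and the exponent \<open>m\<close> as parameters the
  family is closed under differentiation, so smoothness of all orders, also at the end points,
  follows from a single derivative lemma.\<close>

definition bump :: "real poly \<Rightarrow> nat \<Rightarrow> real \<Rightarrow> real" where
  "bump P m s = (if s\<^sup>2 < 1 then exp (- inverse (1 - s\<^sup>2)) * poly P s * inverse (1 - s\<^sup>2) ^ m else 0)"

text \<open>Numerator of the derivative over the common denominator
  \<open>(1 - s^2) ^ (m + 2)\<close>; \<open>[:1, 0, -1:]\<close> is \<open>1 - s^2\<close> and
  \<open>[:0, 2:]\<close> is \<open>2 * s\<close>. The terms come from differentiating
  \<open>P\<close>, the exponential and the power, in this order.\<close>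

definition bump_deriv_poly :: "real poly \<Rightarrow> nat \<Rightarrow> real poly" where
  "bump_deriv_poly P m = pderiv P * [:1, 0, -1:]\<^sup>2 - [:0, 2:] * P + of_nat m * [:0, 2:] * P * [:1, 0, -1:]"

lemma power_fact_le_exp:
  assumes "0 \<le> (y::real)"
  shows "y ^ k / fact k \<le> exp y"
proof -
  have "(\<Sum>n\<in>{k}. y ^ n /\<^sub>R fact n) \<le> (\<Sum>n. y ^ n /\<^sub>R fact n)"
    using assms by (intro sum_le_suminf sums_summable[OF exp_converges]) auto
  also have "\<dots> = exp y" by (rule sums_unique[OF exp_converges, symmetric])
  finally show ?thesis by (simp add: divide_inverse mult.commute)
qed

text \<open>One term of the exponential series at \<open>inverse w\<close>. Taking degree
  \<open>m + 2\<close> instead of \<open>m\<close> leaves a factor \<open>w^2\<close>, which later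
  forces the derivative at the end points to vanish.\<close>

lemma exp_neg_inverse_le:
  assumes w: "0 < (w::real)"
  shows "exp (- inverse w) * inverse w ^ m \<le> fact (m + 2) * w\<^sup>2"
proof -
  define K :: real where "K = fact (m + 2)"
  have "inverse w ^ (m + 2) / K \<le> exp (inverse w)"
    unfolding K_def by (rule power_fact_le_exp) (use w in simp)
  moreover have "0 < K" by (simp only: K_def fact_gt_zero)
  ultimately have "inverse w ^ (m + 2) \<le> K * exp (inverse w)" by (simp only: pos_divide_le_eq mult.commute)
  then have "exp (- inverse w) * inverse w ^ (m + 2) \<le> exp (- inverse w) * (K * exp (inverse w))"
    by (intro mult_left_mono) auto
  also have "\<dots> = K" by (simp add: exp_minus)
  finally have "(exp (- inverse w) * inverse w ^ (m + 2)) * w\<^sup>2 \<le> K * w\<^sup>2"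
    by (intro mult_right_mono) auto
  moreover have "inverse w ^ (m + 2) * w\<^sup>2 = inverse w ^ m"
  proof -
    have "inverse w ^ 2 * w\<^sup>2 = 1" using w by (simp flip: power_mult_distrib)
    then show ?thesis by (simp only: power_add mult.assoc mult_1_right)
  qed
  ultimately show ?thesis by (simp only: K_def mult.assoc)
qed

lemma has_real_derivative_zero_quadratic:
  fixes f :: "real \<Rightarrow> real"
  assumes "\<And>r. \<bar>f r\<bar> \<le> C * (r - s)\<^sup>2"
  shows "(f has_real_derivative 0) (at s)"
proof -
  have f0: "f s = 0" using assms[of s] by simp
  have "((\<lambda>h. (f (s + h) - f s) / h) \<longlongrightarrow> 0) (at 0)"
  proof (rule Lim_null_comparison)
    show "\<forall>\<^sub>F h in at 0. norm ((f (s + h) - f s) / h) \<le> C * \<bar>h\<bar>"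
    proof (rule always_eventually, rule allI)
      fix h
      show "norm ((f (s + h) - f s) / h) \<le> C * \<bar>h\<bar>"
      proof (cases "h = 0")
        case False
        have "\<bar>f (s + h)\<bar> \<le> (C * \<bar>h\<bar>) * \<bar>h\<bar>" using assms[of "s + h"] by (simp add: power2_eq_square abs_mult_self_eq mult.assoc)
        then show ?thesis using False f0 by (simp add: abs_divide pos_divide_le_eq)
      qed simp
    qed
    have "((\<lambda>h. C * \<bar>h\<bar>) \<longlongrightarrow> C * \<bar>0\<bar>) (at (0::real))" by (intro tendsto_intros)
    then show "((\<lambda>h. C * \<bar>h\<bar>) \<longlongrightarrow> 0) (at (0::real))" by simp
  qed
  then show ?thesis by (simp add: DERIV_def)
qed

text \<open>Inside the interval \<open>1 - r^2\<close> is at most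
  \<open>2 * \<bar>r - s\<bar>\<close>, so the spare square becomes a quadratic bound in
  \<open>r - s\<close>.\<close>

lemma bump_boundary_bound:
  assumes "s\<^sup>2 = 1"
  shows "\<exists>C. \<forall>r. \<bar>bump P m r\<bar> \<le> C * (r - s)\<^sup>2"
proof -
  have "bounded (poly P ` {-1..1})"
    by (intro compact_imp_bounded compact_continuous_image continuous_intros) auto
  then obtain B where "\<forall>r\<in>{-1..1}. norm (poly P r) \<le> B" unfolding bounded_iff by auto
  then have B: "\<bar>poly P r\<bar> \<le> B" if "r \<in> {-1..1}" for r using that by simp
  have B0: "0 \<le> B" using B[of 0] by auto
  define K :: real where "K = fact (m + 2)"
  have K0: "0 \<le> K" by (simp only: K_def fact_ge_zero)
  have "\<bar>bump P m r\<bar> \<le> (4 * B * K) * (r - s)\<^sup>2" for r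
  proof (cases "r\<^sup>2 < 1")
    case True
    define w where "w = 1 - r\<^sup>2"
    have w: "0 < w" using True by (simp add: w_def)
    have r: "\<bar>r\<bar> < 1" using True by (simp add: abs_square_less_1)
    have s: "s = 1 \<or> s = -1" using assms by (simp add: power2_eq_1_iff)
    have w2: "w \<le> 2 * \<bar>r - s\<bar>"
      using s
    proof
      assume "s = 1"
      have "w = (1 - r) * (1 + r)" by (simp add: w_def power2_eq_square algebra_simps)
      also have "\<dots> \<le> (1 - r) * 2" using r by (intro mult_left_mono) auto
      finally show ?thesis using r \<open>s = 1\<close> by auto
    next
      assume "s = -1"
      have "w = (1 + r) * (1 - r)" by (simp add: w_def power2_eq_square algebra_simps)
      also have "\<dots> \<le> (1 + r) * 2" using r by (intro mult_left_mono) auto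
      finally show ?thesis using r \<open>s = -1\<close> by auto
    qed
    have "\<bar>bump P m r\<bar> = \<bar>poly P r\<bar> * (exp (- inverse w) * inverse w ^ m)"
      using True w by (simp add: bump_def w_def[symmetric] abs_mult)
    also have "\<dots> \<le> B * (K * w\<^sup>2)"
    proof (rule mult_mono)
      show "\<bar>poly P r\<bar> \<le> B" using r by (intro B) auto
    qed (use w B0 exp_neg_inverse_le[OF w, of m, folded K_def] in auto)
    also have "\<dots> \<le> B * (K * (2 * \<bar>r - s\<bar>)\<^sup>2)"
      using B0 K0 w w2 by (intro mult_left_mono power_mono) auto
    also have "\<dots> = (4 * B * K) * (r - s)\<^sup>2" by (simp add: power_mult_distrib)
    finally show ?thesis .
  qed (use B0 K0 in \<open>simp add: bump_def\<close>)
  then show ?thesis by blast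
qed

lemma bump_has_derivative:
  "(bump P m has_real_derivative bump (bump_deriv_poly P m) (m + 2) s) (at s)"
proof -
  consider "s\<^sup>2 < 1" | "s\<^sup>2 = 1" | "1 < s\<^sup>2" by linarith
  then show ?thesis
  proof cases
    case 1
    define v where "v = (\<lambda>s::real. inverse (1 - s\<^sup>2))"
    have ne: "1 - s\<^sup>2 \<noteq> 0" using 1 by simp
    have vw: "v s * (1 - s\<^sup>2) = 1" using ne by (simp add: v_def)
    have dv: "(v has_real_derivative 2 * s * (v s)\<^sup>2) (at s)"
      unfolding v_def using ne
      by (auto intro!: derivative_eq_intros simp: power2_eq_square field_simps)
    \<comment> \<open>For \<open>m = 0\<close> the truncated subtraction in \<open>m - 1\<close> is
      harmless because of the factor \<open>real m\<close>.\<close>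
    have pow: "real m * v s ^ (m - 1) * (v s)\<^sup>2 = real m * v s ^ (m + 2) * (1 - s\<^sup>2)"
    proof (cases m)
      case (Suc k)
      have "v s ^ (m + 2) * (1 - s\<^sup>2) = v s ^ (m + 1) * (v s * (1 - s\<^sup>2))" by (simp add: mult_ac)
      then have "v s ^ (m + 2) * (1 - s\<^sup>2) = v s ^ (m + 1)" by (simp only: vw mult_1_right)
      moreover have "v s ^ (m - 1) * (v s)\<^sup>2 = v s ^ (m + 1)"
        by (simp add: Suc flip: power_add)
      ultimately show ?thesis by (simp only: mult.assoc)
    qed simp
    \<comment> \<open>Brings the summands to the common power \<open>m + 2\<close> of
      \<open>v s\<close>.\<close>
    have pow0: "v s ^ m = v s ^ (m + 2) * (1 - s\<^sup>2)\<^sup>2"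
    proof -
      have "v s ^ (m + 2) * (1 - s\<^sup>2)\<^sup>2 = v s ^ m * (v s * (1 - s\<^sup>2))\<^sup>2"
        by (simp add: power_add power2_eq_square mult_ac)
      then show ?thesis unfolding vw by simp
    qed
    have "((\<lambda>r. exp (- v r) * poly P r * v r ^ m) has_real_derivative
       exp (- v s) * (- (2 * s * (v s)\<^sup>2)) * poly P s * v s ^ m
       + exp (- v s) * poly (pderiv P) s * v s ^ m
       + exp (- v s) * poly P s * (real m * v s ^ (m - 1) * (2 * s * (v s)\<^sup>2))) (at s)"
      by (rule derivative_eq_intros dv poly_DERIV refl)+ (simp add: algebra_simps)
    moreover have "exp (- v s) * (- (2 * s * (v s)\<^sup>2)) * poly P s * v s ^ m
       + exp (- v s) * poly (pderiv P) s * v s ^ m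
       + exp (- v s) * poly P s * (real m * v s ^ (m - 1) * (2 * s * (v s)\<^sup>2))
       = exp (- v s) * poly (bump_deriv_poly P m) s * v s ^ (m + 2)"
    proof -
      have a: "(v s)\<^sup>2 * v s ^ m = v s ^ (m + 2)" by (simp only: power_add mult.commute)
      have "exp (- v s) * (- (2 * s * (v s)\<^sup>2)) * poly P s * v s ^ m = exp (- v s) * (- (2 * s) * poly P s) * ((v s)\<^sup>2 * v s ^ m)"
        by (simp add: mult_ac)
      also have "\<dots> = exp (- v s) * (- (2 * s) * poly P s) * v s ^ (m + 2)" unfolding a ..
      finally have 1: "exp (- v s) * (- (2 * s * (v s)\<^sup>2)) * poly P s * v s ^ m = exp (- v s) * (- (2 * s) * poly P s) * v s ^ (m + 2)" .
      have 2: "exp (- v s) * poly (pderiv P) s * v s ^ m = exp (- v s) * (poly (pderiv P) s * (1 - s\<^sup>2)\<^sup>2) * v s ^ (m + 2)"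
        by (subst pow0) (simp add: mult_ac)
      have "exp (- v s) * poly P s * (real m * v s ^ (m - 1) * (2 * s * (v s)\<^sup>2)) = exp (- v s) * poly P s * 2 * s * (real m * v s ^ (m - 1) * (v s)\<^sup>2)"
        by (simp add: mult_ac)
      also have "\<dots> = exp (- v s) * (real m * (2 * s) * poly P s * (1 - s\<^sup>2)) * v s ^ (m + 2)"
        unfolding pow by (simp add: mult_ac)
      finally have 3: "exp (- v s) * poly P s * (real m * v s ^ (m - 1) * (2 * s * (v s)\<^sup>2)) = exp (- v s) * (real m * (2 * s) * poly P s * (1 - s\<^sup>2)) * v s ^ (m + 2)" .
      have q: "poly [:1, 0, -1:] s = 1 - s\<^sup>2" by (simp add: power2_eq_square)
      have 4: "poly (bump_deriv_poly P m) s = poly (pderiv P) s * (1 - s\<^sup>2)\<^sup>2 - 2 * s * poly P s + real m * (2 * s) * poly P s * (1 - s\<^sup>2)"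
        unfolding bump_deriv_poly_def by (simp only: poly_add poly_diff poly_mult poly_power q) (simp add: poly_of_nat mult_ac)
      show ?thesis unfolding 1 2 3 4 by (simp add: algebra_simps)
    qed
    ultimately have "((\<lambda>r. exp (- v r) * poly P r * v r ^ m) has_real_derivative bump (bump_deriv_poly P m) (m + 2) s) (at s)"
      using 1 by (simp add: bump_def v_def)
    moreover have "open {r::real. r\<^sup>2 < 1}" by (intro open_Collect_less continuous_intros)
    ultimately show ?thesis
      by (rule has_field_derivative_transform_within_open) (use 1 in \<open>auto simp: bump_def v_def\<close>)
  next
    case 2
    obtain C where "\<And>r. \<bar>bump P m r\<bar> \<le> C * (r - s)\<^sup>2" using bump_boundary_bound[OF 2] by blast
    then have "(bump P m has_real_derivative 0) (at s)" by (rule has_real_derivative_zero_quadratic)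
    then show ?thesis using 2 by (simp add: bump_def)
  next
    case 3
    have "((\<lambda>r. 0) has_real_derivative 0) (at s)" by simp
    moreover have "open {r::real. 1 < r\<^sup>2}" by (intro open_Collect_less continuous_intros)
    ultimately have "(bump P m has_real_derivative 0) (at s)"
      by (rule has_field_derivative_transform_within_open) (use 3 in \<open>auto simp: bump_def\<close>)
    then show ?thesis using 3 by (simp add: bump_def)
  qed
qed

lemma smooth_bump_exists:
  obtains b :: "nat \<Rightarrow> real \<Rightarrow> real" and c B :: real where
    "\<And>k s. (b k has_real_derivative b (Suc k) s) (at s)"
    "\<And>k s. 1 \<le> \<bar>s\<bar> \<Longrightarrow> b k s = 0" "\<And>s. 0 \<le> b 0 s"
    "0 < c" "\<And>s. \<bar>s\<bar> \<le> 1/2 \<Longrightarrow> c \<le> b 0 s" "\<And>s. \<bar>b 0 s\<bar> \<le> B" "\<And>s. \<bar>b 1 s\<bar> \<le> B"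
proof -
  \<comment> \<open>Iterates the derivative lemma on pairs of numerator polynomial and
    exponent.\<close>
  define Pm where "Pm = rec_nat (1::real poly, 0::nat) (\<lambda>k (P, m). (bump_deriv_poly P m, m + 2))"
  define b where "b k = bump (fst (Pm k)) (snd (Pm k))" for k
  have bd: "(b k has_real_derivative b (Suc k) s) (at s)" for k s
    using bump_has_derivative[of "fst (Pm k)" "snd (Pm k)" s]
    by (simp add: b_def Pm_def case_prod_unfold)
  have b0: "b k s = 0" if "1 \<le> \<bar>s\<bar>" for k s
    using that abs_square_less_1[of s] by (simp add: b_def bump_def)
  have bb: "\<exists>B. \<forall>s. \<bar>b k s\<bar> \<le> B" for k
  proof -
    have "continuous_on {-1..1} (b k)"
      by (intro continuous_at_imp_continuous_on ballI DERIV_isCont[OF bd])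
    then have "bounded (b k ` {-1..1})" by (intro compact_imp_bounded compact_continuous_image) auto
    then obtain B where "\<forall>s\<in>{-1..1}. norm (b k s) \<le> B" unfolding bounded_iff by auto
    then have B: "\<bar>b k s\<bar> \<le> B" if "s \<in> {-1..1}" for s using that by simp
    have "\<bar>b k s\<bar> \<le> \<bar>B\<bar>" for s
    proof (cases "1 \<le> \<bar>s\<bar>")
      case False
      then have "\<bar>b k s\<bar> \<le> B" by (intro B) auto
      then show ?thesis by linarith
    qed (simp add: b0)
    then show ?thesis by blast
  qed
  obtain B0 B1 where B: "\<And>s. \<bar>b 0 s\<bar> \<le> B0" "\<And>s. \<bar>b 1 s\<bar> \<le> B1" using bb by metis
  have b00: "b 0 s = (if s\<^sup>2 < 1 then exp (- inverse (1 - s\<^sup>2)) else 0)" for s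
    by (simp add: b_def Pm_def bump_def)
  show thesis
  \<comment> \<open>\<open>exp (- 4 / 3)\<close> is the value of the bump at
    \<open>\<bar>s\<bar> = 1/2\<close>, its minimum over the middle half of the interval.\<close>
  proof (rule that[of b "exp (- 4 / 3)" "max B0 B1"])
    show "exp (- 4 / 3) \<le> b 0 s" if "\<bar>s\<bar> \<le> 1/2" for s
    proof -
      have "\<bar>s\<bar>\<^sup>2 \<le> (1/2)\<^sup>2" using that by (intro power_mono) auto
      then have s: "s\<^sup>2 \<le> 1/4" by (simp add: power2_eq_square)
      then have "inverse (1 - s\<^sup>2) \<le> inverse (3/4)" by (intro le_imp_inverse_le) auto
      then show ?thesis using s by (simp add: b00)
    qed
    show "\<bar>b 0 s\<bar> \<le> max B0 B1" "\<bar>b 1 s\<bar> \<le> max B0 B1" for s using B(1)[of s] B(2)[of s] by linarith+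
  qed (use bd b0 in \<open>auto simp: b00\<close>)
qed

section \<open>Mollifiers as products of one-variable bumps\<close>

lemma axis_component: "(x + s *\<^sub>R axis i 1) $ j = (if j = i then x $ j + s else x $ j)"
  for x :: "real ^ 'n"
  by (simp add: axis_def)

lemma product_partial:
  fixes B :: "'n::finite \<Rightarrow> nat \<Rightarrow> real \<Rightarrow> real"
  assumes B: "\<And>j k s. (B j k has_real_derivative B j (Suc k) s) (at s)"
  shows "((\<lambda>s. \<Prod>j\<in>UNIV. B j (m j) ((x + s *\<^sub>R axis i 1) $ j)) has_real_derivative
    (\<Prod>j\<in>UNIV. B j ((m(i := Suc (m i))) j) (x $ j))) (at 0)"
proof -
  have "(\<Prod>j\<in>UNIV. B j (m j) ((x + s *\<^sub>R axis i 1) $ j)) = B i (m i) (x $ i + s) * (\<Prod>j\<in>UNIV-{i}. B j (m j) (x $ j))" for s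
    unfolding axis_component by (subst prod.remove[of _ i]) auto
  moreover have "(\<Prod>j\<in>UNIV. B j ((m(i := Suc (m i))) j) (x $ j)) = B i (Suc (m i)) (x $ i) * (\<Prod>j\<in>UNIV-{i}. B j (m j) (x $ j))"
    by (subst prod.remove[of _ i]) auto
  moreover have "((\<lambda>s. B i (m i) (x $ i + s)) has_real_derivative B i (Suc (m i)) (x $ i)) (at 0)"
    using DERIV_shift[of "B i (m i)" "B i (Suc (m i)) (x $ i)" 0 "x $ i"] B[of i "m i" "x $ i"] by (simp add: add.commute)
  ultimately show ?thesis by (auto intro!: DERIV_cmult_right)
qed

text \<open>A partial derivative of a product of one-variable functions is again such a product,
  with the multi-index raised at one place, so the induction runs over all \<open>m\<close> at
  once.\<close>

lemma product_C_k:
  fixes B :: "'n::finite \<Rightarrow> nat \<Rightarrow> real \<Rightarrow> real"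
  assumes B: "\<And>j k s. (B j k has_real_derivative B j (Suc k) s) (at s)"
  shows "C_k k (\<lambda>x. \<Prod>j\<in>UNIV. B j (m j) (x $ j))"
proof (induction k arbitrary: m)
  have cB: "continuous_on UNIV (B j k)" for j k
    by (intro continuous_at_imp_continuous_on ballI DERIV_isCont[OF B])
  have cont: "continuous_on UNIV (\<lambda>x. \<Prod>j\<in>UNIV. B j (m j) (x $ j))" for m
  proof (rule continuous_on_prod)
    fix j
    have "continuous_on UNIV (\<lambda>x::real ^ 'n. x $ j)" by (intro continuous_intros)
    then show "continuous_on UNIV (\<lambda>x. B j (m j) (x $ j))"
      by (rule continuous_on_compose2[OF cB]) simp
  qed
  {
    case 0
    show ?case unfolding C_k.simps by (rule cont)
  next
    case (Suc k)
    have "partial i (\<lambda>x. \<Prod>j\<in>UNIV. B j (m j) (x $ j)) = (\<lambda>x. \<Prod>j\<in>UNIV. B j ((m(i := Suc (m i))) j) (x $ j))" for i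
      unfolding partial_def by (rule ext) (rule DERIV_imp_deriv[OF product_partial[of B, OF B]])
    then have "C_k k (partial i (\<lambda>x. \<Prod>j\<in>UNIV. B j (m j) (x $ j)))" for i
      using Suc[of "m(i := Suc (m i))"] by (simp only:)
    moreover have "(\<lambda>s. \<Prod>j\<in>UNIV. B j (m j) ((x + s *\<^sub>R axis i 1) $ j)) differentiable (at 0)" for i x
      using product_partial[of B, OF B] unfolding real_differentiable_def by blast
    ultimately show ?case unfolding C_k.simps by (intro conjI allI cont)
  }
qed

lemma C_k_cmult:
  assumes "C_k k u"
  shows "C_k k (\<lambda>x. c * u x)"
  using assms
proof (induction k arbitrary: u)
  case (Suc k)
  have D: "((\<lambda>s. u (x + s *\<^sub>R axis i 1)) has_real_derivative partial i u x) (at 0)" for x i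
    using Suc.prems unfolding partial_def by (simp add: DERIV_deriv_iff_real_differentiable)
  then have D': "((\<lambda>s. c * u (x + s *\<^sub>R axis i 1)) has_real_derivative c * partial i u x) (at 0)" for x i
    by (rule DERIV_cmult)
  then have "partial i (\<lambda>x. c * u x) = (\<lambda>x. c * partial i u x)" for i
    unfolding partial_def[of i "\<lambda>x. c * u x"] by (intro ext DERIV_imp_deriv)
  moreover have "(\<lambda>s. c * u (x + s *\<^sub>R axis i 1)) differentiable (at 0)" for x i
    using D' unfolding real_differentiable_def by blast
  ultimately show ?case using Suc by (auto intro: continuous_intros)
qed (auto intro: continuous_intros)

text \<open>The bound \<open>C\<close> concerns the first moment of the gradient, a quantity that
  does not change under scaling and therefore can be uniform in \<open>\<delta>\<close>; the
  commutator estimate rests on it. The last clause makes \<open>\<rho> (x - y)\<close>, as a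
  function of \<open>y\<close>, admissible as a test function.\<close>

definition mollifier :: "real \<Rightarrow> real \<Rightarrow> (real ^ 'n \<Rightarrow> real) \<Rightarrow> ('n \<Rightarrow> real ^ 'n \<Rightarrow> real) \<Rightarrow> bool" where
  "mollifier C \<delta> \<rho> \<rho>' \<longleftrightarrow> C1_gradient \<rho> \<rho>' \<and> (\<forall>z. 0 \<le> \<rho> z) \<and> l1 \<rho> = 1 \<and>
     (\<forall>z. \<delta> < norm z \<longrightarrow> \<rho> z = 0 \<and> (\<forall>i. \<rho>' i z = 0)) \<and>
     (\<forall>i. l1 (\<lambda>z. norm z * \<rho>' i z) \<le> ennreal C) \<and>
     (\<forall>x k. C_k k (\<lambda>y. \<rho> (x - y)))"

text \<open>On a box of side \<open>2 * \<epsilon>\<close> the gradient of the product is of order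
  \<open>1 / \<epsilon>\<close> and \<open>norm z\<close> of order \<open>\<epsilon>\<close>, while
  the volume of the box and the normalising integral are both of order
  \<open>\<epsilon> ^ N\<close>. The scale cancels, so \<open>C\<close> can be chosen before
  \<open>\<delta>\<close>.\<close>

theorem mollifier_exists:
  "\<exists>C\<ge>0. \<forall>\<delta>>0. \<exists>(\<rho> :: real ^ 'n \<Rightarrow> real) \<rho>'. mollifier C \<delta> \<rho> \<rho>'"
proof -
  obtain b :: "nat \<Rightarrow> real \<Rightarrow> real" and c B where
    bd: "\<And>k s. (b k has_real_derivative b (Suc k) s) (at s)" and
    b0: "\<And>k s. 1 \<le> \<bar>s\<bar> \<Longrightarrow> b k s = 0" and bpos: "\<And>s. 0 \<le> b 0 s" and
    c: "0 < c" "\<And>s. \<bar>s\<bar> \<le> 1/2 \<Longrightarrow> c \<le> b 0 s" and bB: "\<And>s. \<bar>b 0 s\<bar> \<le> B" "\<And>s. \<bar>b 1 s\<bar> \<le> B"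
    by (rule smooth_bump_exists) blast
  have B0: "0 \<le> B" using bB(1)[of 0] by linarith
  have bc: "continuous_on UNIV (b k)" for k by (intro continuous_at_imp_continuous_on ballI DERIV_isCont[OF bd])
  define N where "N = CARD('n)"
  have N: "0 < N" by (simp add: N_def)
  \<comment> \<open>\<open>N * B ^ N\<close> bounds \<open>norm z * \<bar>R' i z\<bar>\<close>,
    \<open>2 ^ N\<close> comes from the volume of the outer box, and \<open>c ^ N\<close> from the
    lower bound for the integral over the inner box.\<close>
  define C where "C = real N * B ^ N * 2 ^ N / c ^ N"
  have C0: "0 \<le> C" using B0 c by (simp add: C_def)
  have "\<exists>(\<rho> :: real ^ 'n \<Rightarrow> real) \<rho>'. mollifier C \<delta> \<rho> \<rho>'" if \<delta>: "0 < \<delta>" for \<delta>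
  proof -
    \<comment> \<open>The norm is at most the sum of the coordinates in absolute value, so the box
      of half-side \<open>\<delta> / N\<close> lies in the ball of radius
      \<open>\<delta>\<close>.\<close>
    define \<epsilon> where "\<epsilon> = \<delta> / real N"
    have \<epsilon>: "0 < \<epsilon>" "\<delta> = real N * \<epsilon>" using \<delta> N by (auto simp: \<epsilon>_def)
    define R :: "real ^ 'n \<Rightarrow> real" where "R z = (\<Prod>j\<in>UNIV. b 0 (z $ j / \<epsilon>))" for z
    define R' :: "'n \<Rightarrow> real ^ 'n \<Rightarrow> real" where "R' i z = (1 / \<epsilon>) * b 1 (z $ i / \<epsilon>) * (\<Prod>j\<in>UNIV-{i}. b 0 (z $ j / \<epsilon>))" for i z
    have grad: "C1_gradient R R'"
      unfolding C1_gradient_def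
    proof (intro conjI allI)
      show "continuous_on UNIV (R' i)" for i
        unfolding R'_def using \<epsilon>
        by (auto intro!: continuous_intros continuous_on_prod continuous_on_compose2[OF bc])
      fix x :: "real ^ 'n"
      have "((\<lambda>z. b 0 (z $ j / \<epsilon>)) has_derivative (\<lambda>h. (1 / \<epsilon>) * b 1 (x $ j / \<epsilon>) * h $ j)) (at x)" for j
      proof -
        have "((\<lambda>z. z $ j / \<epsilon>) has_derivative (\<lambda>h. h $ j / \<epsilon>)) (at x)"
          by (intro bounded_linear_imp_has_derivative bounded_linear_compose[OF bounded_linear_divide bounded_linear_vec_nth])
        moreover have "(b 0 has_derivative (\<lambda>h. b 1 (x $ j / \<epsilon>) * h)) (at (x $ j / \<epsilon>))"
          using bd[of 0 "x $ j / \<epsilon>"] by (simp add: has_field_derivative_def)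
        ultimately have "((\<lambda>z. b 0 (z $ j / \<epsilon>)) has_derivative (\<lambda>h. b 1 (x $ j / \<epsilon>) * (h $ j / \<epsilon>))) (at x)"
          by (rule has_derivative_compose)
        then show ?thesis by (simp add: mult_ac)
      qed
      then have "(R has_derivative (\<lambda>h. \<Sum>i\<in>UNIV. ((1 / \<epsilon>) * b 1 (x $ i / \<epsilon>) * h $ i) * (\<Prod>j\<in>UNIV-{i}. b 0 (x $ j / \<epsilon>)))) (at x)"
        unfolding R_def by (rule has_derivative_prod)
      then show "(R has_derivative (\<lambda>h. \<Sum>i\<in>UNIV. R' i x * h $ i)) (at x)"
        by (rule has_derivative_eq_rhs) (simp add: R'_def mult_ac)
    qed
    \<comment> \<open>\<open>Q\<close> contains the support; on \<open>q\<close>, with half the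
      side, each factor of \<open>R\<close> is at least \<open>c\<close>.\<close>
    define Q :: "(real ^ 'n) set" where "Q = cbox (\<chi> i. - \<epsilon>) (\<chi> i. \<epsilon>)"
    define q :: "(real ^ 'n) set" where "q = cbox (\<chi> i. - (\<epsilon>/2)) (\<chi> i. \<epsilon>/2)"
    have Qe: "emeasure lborel (Q :: (real ^ 'n) set) = ennreal ((2 * \<epsilon>) ^ N)" "emeasure lborel (q :: (real ^ 'n) set) = ennreal (\<epsilon> ^ N)"
    proof -
      have ne: "cbox (\<chi> i. - r) (\<chi> i. r) \<noteq> ({} :: (real ^ 'n) set)" if "0 < r" for r :: real
        using that by (auto simp: interval_ne_empty_cart)
      have "measure lborel (cbox (\<chi> i. - r) (\<chi> i. r) :: (real ^ 'n) set) = (2 * r) ^ N" if "0 < r" for r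
        using that by (subst content_cbox_cart[OF ne]) (auto simp: N_def)
      then have *: "emeasure lborel (cbox (\<chi> i. - r) (\<chi> i. r) :: (real ^ 'n) set) = ennreal ((2 * r) ^ N)" if "0 < r" for r
      proof -
        have fin: "emeasure lborel (cbox (\<chi> i. - r) (\<chi> i. r) :: (real ^ 'n) set) \<noteq> top"
          using emeasure_lborel_cbox_finite by (simp add: less_top)
        show ?thesis unfolding emeasure_eq_ennreal_measure[OF fin] \<open>\<And>r. 0 < r \<Longrightarrow> measure lborel (cbox (\<chi> i. - r) (\<chi> i. r) :: (real ^ 'n) set) = (2 * r) ^ N\<close>[OF that] ..
      qed
      show "emeasure lborel (Q :: (real ^ 'n) set) = ennreal ((2 * \<epsilon>) ^ N)"
        unfolding Q_def by (rule *[OF \<epsilon>(1)])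
      show "emeasure lborel (q :: (real ^ 'n) set) = ennreal (\<epsilon> ^ N)"
        using *[of "\<epsilon>/2"] \<epsilon>(1) unfolding q_def by simp
    qed
    have mem: "z \<in> cbox (\<chi> i. - r) (\<chi> i. r) \<longleftrightarrow> (\<forall>j. \<bar>z $ j\<bar> \<le> r)" for z :: "real ^ 'n" and r
      unfolding mem_box_cart by (auto simp: abs_le_iff minus_le_iff)
    have memQ: "z \<in> Q \<longleftrightarrow> (\<forall>j. \<bar>z $ j\<bar> \<le> \<epsilon>)" for z unfolding Q_def by (rule mem)
    have memq: "z \<in> q \<longleftrightarrow> (\<forall>j. \<bar>z $ j\<bar> \<le> \<epsilon>/2)" for z unfolding q_def by (rule mem)
    have Rout: "R z = 0 \<and> (\<forall>i. R' i z = 0)" if out: "\<not> (\<forall>j. \<bar>z $ j\<bar> < \<epsilon>)" for z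
    proof -
      from out obtain j where "\<epsilon> \<le> \<bar>z $ j\<bar>" by (auto simp: not_less)
      then have j: "b k (z $ j / \<epsilon>) = 0" for k using \<epsilon> by (intro b0) (simp add: abs_divide)
      have "R z = 0" unfolding R_def using j by (auto intro!: prod_zero)
      moreover have "R' i z = 0" for i
      proof (cases "i = j")
        case False
        then have "(\<Prod>j\<in>UNIV-{i}. b 0 (z $ j / \<epsilon>)) = 0" using j by (intro prod_zero) auto
        then show ?thesis by (simp add: R'_def)
      qed (use j in \<open>simp add: R'_def\<close>)
      ultimately show ?thesis by blast
    qed
    have nrm: "norm z \<le> real N * \<epsilon>" if "\<forall>j. \<bar>z $ j\<bar> \<le> \<epsilon>" for z :: "real ^ 'n"
    proof -
      have "norm z \<le> (\<Sum>j\<in>UNIV. \<bar>z $ j\<bar>)" by (rule norm_le_l1_cart)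
      also have "\<dots> \<le> (\<Sum>j\<in>(UNIV :: 'n set). \<epsilon>)" using that by (intro sum_mono) auto
      finally show ?thesis by (simp add: N_def)
    qed
    have Rpos: "0 \<le> R z" for z unfolding R_def using bpos by (intro prod_nonneg) auto
    have cR: "continuous_on UNIV R" using C1_gradient_axis_C1[OF grad] by (simp add: axis_C1_def)
    have cR': "continuous_on UNIV (R' i)" for i using grad by (simp add: C1_gradient_def)
    have [measurable]: "R \<in> borel_measurable borel" "R' i \<in> borel_measurable borel" for i
      using cR cR' by (auto intro: borel_measurable_continuous_onI)
    have [measurable]: "Q \<in> sets (borel :: (real ^ 'n) measure)" "q \<in> sets (borel :: (real ^ 'n) measure)" by (auto simp: Q_def q_def)
    have "integrable lborel R"
    proof (rule integrable_continuous_bounded_support[OF cR])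
      fix z :: "real ^ 'n" assume "real N * \<epsilon> < norm z"
      then have "\<not> (\<forall>j. \<bar>z $ j\<bar> < \<epsilon>)" using nrm[of z] by (metis less_le_not_le order_less_imp_le)
      then show "R z = 0" using Rout by blast
    qed
    then have lR: "l1 R = ennreal (\<integral>x. R x \<partial>lborel)" using l1_eq_integral[of R] Rpos by simp
    define I where "I = (\<integral>x. R x \<partial>lborel)"
    have I: "c ^ N * \<epsilon> ^ N \<le> I"
    proof -
      have "ennreal (c ^ N * \<epsilon> ^ N) = (\<integral>\<^sup>+z. ennreal (c ^ N) * indicator (q :: (real ^ 'n) set) z \<partial>lborel)"
        using c \<epsilon> Qe by (subst nn_integral_cmult_indicator) (auto simp: ennreal_mult)
      also have "\<dots> \<le> l1 R" unfolding l1_def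
      proof (intro nn_integral_mono)
        fix z :: "real ^ 'n"
        show "ennreal (c ^ N) * indicator q z \<le> ennreal \<bar>R z\<bar>"
        proof (cases "z \<in> q")
          case True
          have "(\<Prod>j\<in>(UNIV :: 'n set). c) \<le> R z" unfolding R_def
          proof (rule prod_mono)
            fix j :: 'n
            have "\<bar>z $ j / \<epsilon>\<bar> \<le> 1/2" using True \<epsilon> by (simp add: memq abs_divide field_simps)
            then show "0 \<le> c \<and> c \<le> b 0 (z $ j / \<epsilon>)" using c by simp
          qed
          then show ?thesis using True Rpos[of z] by (auto simp: N_def intro: ennreal_leI)
        qed simp
      qed
      finally have "ennreal (c ^ N * \<epsilon> ^ N) \<le> ennreal I" unfolding lR I_def[symmetric] .
      moreover have "0 \<le> I" unfolding I_def using Rpos by simp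
      ultimately show ?thesis by (simp add: ennreal_le_iff)
    qed
    have Ip: "0 < I" using I c \<epsilon> by (smt (verit) mult_pos_pos zero_less_power)
    have R'b: "\<bar>R' i z\<bar> \<le> B ^ N / \<epsilon>" for i z
    proof -
      have "\<bar>R' i z\<bar> = (1 / \<epsilon>) * (\<bar>b 1 (z $ i / \<epsilon>)\<bar> * (\<Prod>j\<in>UNIV-{i}. \<bar>b 0 (z $ j / \<epsilon>)\<bar>))"
        using \<epsilon> by (simp add: R'_def abs_mult abs_prod)
      also have "\<dots> \<le> (1 / \<epsilon>) * (B * (\<Prod>j\<in>UNIV-{i}. B))"
        using \<epsilon> bB B0 by (intro mult_left_mono mult_mono prod_mono prod_nonneg) auto
      also have "B * (\<Prod>j\<in>UNIV-{i}. B) = (\<Prod>j\<in>(UNIV::'n set). B)" by (subst (2) prod.remove[of _ i]) auto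
      finally show ?thesis by (simp add: N_def)
    qed
    have R'l: "l1 (\<lambda>z. norm z * R' i z) \<le> ennreal (real N * B ^ N * (2 * \<epsilon>) ^ N)" for i
    proof -
      have "l1 (\<lambda>z. norm z * R' i z) \<le> (\<integral>\<^sup>+z. ennreal (real N * B ^ N) * indicator (Q :: (real ^ 'n) set) z \<partial>lborel)"
        unfolding l1_def
      proof (intro nn_integral_mono)
        fix z :: "real ^ 'n"
        show "ennreal \<bar>norm z * R' i z\<bar> \<le> ennreal (real N * B ^ N) * indicator Q z"
        proof (cases "z \<in> Q")
          case True
          have "norm z * \<bar>R' i z\<bar> \<le> (real N * \<epsilon>) * (B ^ N / \<epsilon>)"
            using nrm[of z] True \<epsilon> R'b[of i z] by (intro mult_mono) (auto simp: memQ)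
          then show ?thesis using True \<epsilon> by (auto simp: abs_mult intro!: ennreal_leI)
        next
          case False
          then have "\<not> (\<forall>j. \<bar>z $ j\<bar> < \<epsilon>)" using memQ less_imp_le by blast
          then show ?thesis using Rout[of z] by simp
        qed
      qed
      also have "\<dots> = ennreal (real N * B ^ N * (2 * \<epsilon>) ^ N)"
        using \<epsilon> B0 Qe by (subst nn_integral_cmult_indicator) (auto simp flip: ennreal_mult)
      finally show ?thesis .
    qed
    have Ck: "C_k k (\<lambda>y. (1 / I) * R (x - y))" for k x
    proof (rule C_k_cmult)
      \<comment> \<open>Iterated derivatives in \<open>s\<close> of the one-variable factors of
        \<open>R (x - y)\<close>; each differentiation brings out a factor
        \<open>- 1 / \<epsilon>\<close>.\<close>
      define BB where "BB j k s = (- 1 / \<epsilon>) ^ k * b k ((x $ j - s) / \<epsilon>)" for j k s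
      have "(BB j k has_real_derivative BB j (Suc k) s) (at s)" for j k s
      proof -
        have "((\<lambda>s. (x $ j - s) / \<epsilon>) has_real_derivative - 1 / \<epsilon>) (at s)"
          using \<epsilon>(1) by (auto intro!: derivative_eq_intros)
        from DERIV_chain2[OF bd this]
        have "((\<lambda>s. b k ((x $ j - s) / \<epsilon>)) has_real_derivative b (Suc k) ((x $ j - s) / \<epsilon>) * (- 1 / \<epsilon>)) (at s)" .
        from DERIV_cmult[OF this, of "(- 1 / \<epsilon>) ^ k"] show ?thesis by (simp add: BB_def[abs_def] mult_ac)
      qed
      from product_C_k[of BB, OF this, of k "\<lambda>_. 0"] show "C_k k (\<lambda>y. R (x - y))"
        by (simp add: BB_def R_def)
    qed
    have "mollifier C \<delta> (\<lambda>z. (1 / I) * R z) (\<lambda>i z. (1 / I) * R' i z)"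
      unfolding mollifier_def
    proof (intro conjI allI impI)
      show "C1_gradient (\<lambda>z. (1 / I) * R z) (\<lambda>i z. (1 / I) * R' i z)"
        unfolding C1_gradient_def
      proof (intro conjI allI)
        show "continuous_on UNIV (\<lambda>z. (1 / I) * R' i z)" for i by (intro continuous_intros cR')
        fix x
        have "(R has_derivative (\<lambda>h. \<Sum>i\<in>UNIV. R' i x * h $ i)) (at x)" using grad by (simp add: C1_gradient_def)
        then have "((\<lambda>z. (1 / I) * R z) has_derivative (\<lambda>h. (1 / I) * (\<Sum>i\<in>UNIV. R' i x * h $ i))) (at x)"
          by (rule has_derivative_mult_right)
        then show "((\<lambda>z. (1 / I) * R z) has_derivative (\<lambda>h. \<Sum>i\<in>UNIV. (1 / I) * R' i x * h $ i)) (at x)"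
          by (rule has_derivative_eq_rhs) (simp add: sum_distrib_left mult_ac)
      qed
      show "0 \<le> (1 / I) * R z" for z using Ip Rpos by simp
      have "l1 (\<lambda>z. (1 / I) * R z) = ennreal (1 / I) * l1 R" using Ip by (subst l1_cmult) auto
      also have "\<dots> = ennreal (1 / I * I)" using Ip by (subst ennreal_mult) (auto simp: lR I_def)
      finally show "l1 (\<lambda>z. (1 / I) * R z) = 1" using Ip by simp
      have out: "\<not> (\<forall>j. \<bar>z $ j\<bar> < \<epsilon>)" if "\<delta> < norm z" for z :: "real ^ 'n"
        using nrm[of z] that \<epsilon>(2) by (metis less_le_not_le order_less_imp_le)
      show "(1 / I) * R z = 0" if "\<delta> < norm z" for z using Rout[OF out[OF that]] by simp
      show "(1 / I) * R' i z = 0" if "\<delta> < norm z" for i z using Rout[OF out[OF that]] by simp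
      show "l1 (\<lambda>z. norm z * ((1 / I) * R' i z)) \<le> ennreal C" for i
      proof -
        have "l1 (\<lambda>z. norm z * ((1 / I) * R' i z)) = l1 (\<lambda>z. (1 / I) * (norm z * R' i z))" by (simp add: mult_ac)
        also have "\<dots> = ennreal (1 / I) * l1 (\<lambda>z. norm z * R' i z)" using Ip by (subst l1_cmult) auto
        also have "\<dots> \<le> ennreal (1 / I) * ennreal (real N * B ^ N * (2 * \<epsilon>) ^ N)" by (intro mult_left_mono R'l) auto
        also have "\<dots> = ennreal (real N * B ^ N * (2 * \<epsilon>) ^ N / I)" using Ip B0 \<epsilon> by (subst ennreal_mult[symmetric]) auto
        also have "\<dots> \<le> ennreal C"
        proof (rule ennreal_leI)
          have "real N * B ^ N * (2 * \<epsilon>) ^ N / I \<le> real N * B ^ N * (2 * \<epsilon>) ^ N / (c ^ N * \<epsilon> ^ N)"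
            using I c \<epsilon> B0 by (intro divide_left_mono) (auto intro!: mult_pos_pos Ip)
          also have "\<dots> = C"
          proof -
            have "\<epsilon> \<noteq> 0" using \<epsilon>(1) by linarith
            then show ?thesis by (simp add: C_def power_mult_distrib)
          qed
          finally show "real N * B ^ N * (2 * \<epsilon>) ^ N / I \<le> C" .
        qed
        finally show ?thesis .
      qed
    qed (rule Ck)
    then show ?thesis by blast
  qed
  then show ?thesis using C0 by blast
qed

section \<open>Friedrichs' commutator lemma\<close>

lemma ennreal_abs_integral_le:
  fixes f :: "'a \<Rightarrow> real"
  shows "ennreal \<bar>\<integral>x. f x \<partial>M\<bar> \<le> (\<integral>\<^sup>+x. ennreal \<bar>f x\<bar> \<partial>M)"
proof (cases "integrable M f")
  case True
  then show ?thesis using integral_norm_bound_ennreal[of M f] by simp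
next
  case False
  then show ?thesis by (simp add: not_integrable_integral_eq)
qed

lemma nn_integral_lborel_diff:
  fixes f :: "'a::euclidean_space \<Rightarrow> ennreal"
  assumes [measurable]: "f \<in> borel_measurable borel"
  shows "(\<integral>\<^sup>+x. f (x - a) \<partial>lborel) = (\<integral>\<^sup>+x. f x \<partial>lborel)"
  using nn_integral_lborel_translate[of f "- a"] by simp

lemma nn_integral_lborel_reflect:
  fixes f :: "'a::euclidean_space \<Rightarrow> ennreal"
  assumes [measurable]: "f \<in> borel_measurable borel"
  shows "(\<integral>\<^sup>+y. f (x - y) \<partial>lborel) = (\<integral>\<^sup>+y. f y \<partial>lborel)"
proof -
  have "(\<integral>\<^sup>+y. f y \<partial>lborel) = (\<integral>\<^sup>+y. f y \<partial>density (distr lborel borel (\<lambda>y. x + (-1) *\<^sub>R y)) (\<lambda>_. \<bar>-1 :: real\<bar> ^ DIM('a)))"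
    by (subst lborel_affine[of "-1" x]) auto
  also have "\<dots> = (\<integral>\<^sup>+y. f (x - y) \<partial>lborel)"
    by (subst nn_integral_density) (auto simp: nn_integral_distr)
  finally show ?thesis ..
qed

text \<open>Young's inequality: the kernel is dominated by the convolution kernel
  \<open>k (x - y)\<close>, and integrating in \<open>x\<close> first produces
  \<open>l1 k\<close>.\<close>

lemma l1_kernel_le:
  fixes H :: "'a::euclidean_space \<Rightarrow> real"
  assumes [measurable]: "H \<in> borel_measurable borel" "k \<in> borel_measurable borel"
    and \<kappa>: "\<And>x y. \<bar>\<kappa> x y\<bar> \<le> k (x - y)" and C: "l1 k \<le> C"
  shows "l1 (\<lambda>x. \<integral>y. H y * \<kappa> x y \<partial>lborel) \<le> C * l1 H"
proof -
  have k0: "0 \<le> k z" for z using order_trans[OF abs_ge_zero \<kappa>[of z 0]] by simp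
  have "ennreal \<bar>\<integral>y. H y * \<kappa> x y \<partial>lborel\<bar> \<le> (\<integral>\<^sup>+y. ennreal \<bar>H y\<bar> * ennreal (k (x - y)) \<partial>lborel)" for x
  proof -
    have "ennreal \<bar>\<integral>y. H y * \<kappa> x y \<partial>lborel\<bar> \<le> (\<integral>\<^sup>+y. ennreal \<bar>H y * \<kappa> x y\<bar> \<partial>lborel)" by (rule ennreal_abs_integral_le)
    also have "\<dots> \<le> (\<integral>\<^sup>+y. ennreal \<bar>H y\<bar> * ennreal (k (x - y)) \<partial>lborel)"
      using \<kappa> k0 by (intro nn_integral_mono) (auto simp: abs_mult simp flip: ennreal_mult intro!: ennreal_leI mult_left_mono)
    finally show ?thesis .
  qed
  then have "l1 (\<lambda>x. \<integral>y. H y * \<kappa> x y \<partial>lborel) \<le> (\<integral>\<^sup>+x. (\<integral>\<^sup>+y. ennreal \<bar>H y\<bar> * ennreal (k (x - y)) \<partial>lborel) \<partial>lborel)"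
    unfolding l1_def by (intro nn_integral_mono)
  also have "\<dots> = (\<integral>\<^sup>+y. (\<integral>\<^sup>+x. ennreal \<bar>H y\<bar> * ennreal (k (x - y)) \<partial>lborel) \<partial>lborel)"
    by (rule lborel_pair.Fubini') measurable
  also have "\<dots> = (\<integral>\<^sup>+y. ennreal \<bar>H y\<bar> * l1 k \<partial>lborel)"
  proof (intro nn_integral_cong)
    fix y
    have "(\<integral>\<^sup>+x. ennreal (k (x - y)) \<partial>lborel) = l1 k"
      using nn_integral_lborel_diff[of "\<lambda>z. ennreal (k z)" y] k0 by (simp add: l1_def)
    then show "(\<integral>\<^sup>+x. ennreal \<bar>H y\<bar> * ennreal (k (x - y)) \<partial>lborel) = ennreal \<bar>H y\<bar> * l1 k"
      by (subst nn_integral_cmult) auto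
  qed
  also have "\<dots> = l1 k * l1 H" by (subst nn_integral_multc) (auto simp: l1_def mult.commute)
  also have "\<dots> \<le> C * l1 H" using C by (intro mult_right_mono) auto
  finally show ?thesis .
qed

lemma mollifier_props:
  assumes "mollifier C \<delta> \<rho> \<rho>'"
  shows "C1_gradient \<rho> \<rho>'" "axis_C1 \<rho> \<rho>'" "0 \<le> \<rho> z" "l1 \<rho> = 1" "\<delta> < norm z \<Longrightarrow> \<rho> z = 0" "\<delta> < norm z \<Longrightarrow> \<rho>' i z = 0"
    "l1 (\<lambda>z. norm z * \<rho>' i z) \<le> ennreal C" "\<rho> \<in> borel_measurable borel" "\<rho>' i \<in> borel_measurable borel"
    "bounded {z. \<rho> z \<noteq> 0}"
proof -
  show g: "C1_gradient \<rho> \<rho>'" and "0 \<le> \<rho> z" and "l1 \<rho> = 1" and z: "\<delta> < norm z \<Longrightarrow> \<rho> z = 0"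
    and "\<delta> < norm z \<Longrightarrow> \<rho>' i z = 0" and "l1 (\<lambda>z. norm z * \<rho>' i z) \<le> ennreal C" for z
    using assms by (auto simp: mollifier_def)
  show a: "axis_C1 \<rho> \<rho>'" using g by (rule C1_gradient_axis_C1)
  then show "\<rho> \<in> borel_measurable borel" "\<rho>' i \<in> borel_measurable borel"
    by (auto simp: axis_C1_def intro: borel_measurable_continuous_onI)
  show "bounded {z. \<rho> z \<noteq> 0}"
    by (rule boundedI[of _ \<delta>]) (use z in \<open>auto simp: not_le[symmetric]\<close>)
qed

lemma mollifier_bound:
  assumes "mollifier C \<delta> \<rho> \<rho>'"
  obtains B where "0 \<le> B" "\<And>z. \<bar>\<rho> z\<bar> \<le> B" "\<And>i z. \<bar>\<rho>' i z\<bar> \<le> B"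
proof (rule axis_C1_bounds[OF mollifier_props(2,10)[OF assms]])
  fix B R
  assume "0 \<le> B" "\<And>x. \<bar>\<rho> x\<bar> \<le> B" "\<And>i x. \<bar>\<rho>' i x\<bar> \<le> B"
  then show thesis by (rule that)
qed

lemma mollifier_integral:
  assumes "mollifier C \<delta> \<rho> \<rho>'"
  shows "integrable lborel (\<lambda>y. \<rho> (x - y))" "(\<integral>y. \<rho> (x - y) \<partial>lborel) = 1"
proof -
  note m = mollifier_props[OF assms]
  have [measurable]: "\<rho> \<in> borel_measurable borel" by (rule m)
  have "(\<integral>\<^sup>+y. ennreal (\<rho> (x - y)) \<partial>lborel) = (\<integral>\<^sup>+y. ennreal (\<rho> y) \<partial>lborel)"
    using nn_integral_lborel_reflect[of "\<lambda>z. ennreal (\<rho> z)" x] by simp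
  also have "\<dots> = 1" using m(3,4) by (simp add: l1_def)
  finally have *: "(\<integral>\<^sup>+y. ennreal (\<rho> (x - y)) \<partial>lborel) = 1" .
  then show "integrable lborel (\<lambda>y. \<rho> (x - y))" using m(3) by (intro integrableI_nonneg) auto
  show "(\<integral>y. \<rho> (x - y) \<partial>lborel) = 1"
    using * m(3) by (subst integral_eq_nn_integral) auto
qed

lemma mollifier_reflected_axis_C1:
  assumes "mollifier C \<delta> \<rho> \<rho>'"
  shows "axis_C1 (\<lambda>y. \<rho> (x - y)) (\<lambda>i y. - \<rho>' i (x - y))"
  unfolding axis_C1_def
proof (intro conjI allI)
  note m = mollifier_props[OF assms]
  show "continuous_on UNIV (\<lambda>y. \<rho> (x - y))" "continuous_on UNIV (\<lambda>y. - \<rho>' i (x - y))" for i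
    using m(2) by (auto simp: axis_C1_def intro!: continuous_intros intro: continuous_on_compose2)
  fix i y
  have "((\<lambda>s. x - (y + s *\<^sub>R axis i 1)) has_vector_derivative - axis i 1) (at 0)"
    by (auto intro!: derivative_eq_intros)
  from C1_gradient_along_curve[OF m(1) this]
  show "((\<lambda>s. \<rho> (x - (y + s *\<^sub>R axis i 1))) has_real_derivative - \<rho>' i (x - y)) (at 0)"
    by (rule DERIV_cong) (simp add: axis_def if_distrib sum_negf cong: if_cong)
qed

text \<open>Since the mollifier has mass 1, the error is an average of translation differences of
  \<open>G\<close> over shifts of length at most \<open>\<delta>\<close>, each small in L^1. The
  choice of \<open>\<delta>1\<close> sees only sign, mass and support of the mollifier, so it is
  uniform in \<open>C\<close> and \<open>\<rho>\<close>.\<close>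

theorem mollification_converges:
  fixes G :: "real ^ 'n \<Rightarrow> real"
  assumes G: "integrable lborel G" and e: "0 < e"
  shows "\<exists>\<delta>1>0. \<forall>C \<delta> \<rho> \<rho>'. mollifier C \<delta> \<rho> \<rho>' \<and> \<delta> \<le> \<delta>1 \<longrightarrow>
    l1 (\<lambda>x. (\<integral>y. G y * \<rho> (x - y) \<partial>lborel) - G x) \<le> ennreal e"
proof -
  have [measurable]: "G \<in> borel_measurable borel" using G by auto
  obtain \<eta> where \<eta>: "0 < \<eta>" and *: "\<And>\<psi>. \<psi> \<in> borel_measurable borel \<Longrightarrow>
    (\<forall>h\<in>borel_measurable borel. (\<integral>\<^sup>+x. h (\<psi> x) \<partial>lborel) \<le> ennreal 1 * (\<integral>\<^sup>+x. h x \<partial>lborel)) \<Longrightarrow>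
    (\<forall>x. dist (\<psi> x) x \<le> \<eta>) \<Longrightarrow> l1 (\<lambda>x. G (\<psi> x) - G x) \<le> ennreal e"
    using near_identity_L1_continuity[OF G e, of 1] by auto
  have tr: "l1 (\<lambda>x. G (x + z) - G x) \<le> ennreal e" if "norm z \<le> \<eta>" for z
    by (rule *) (use that in \<open>auto simp: nn_integral_lborel_translate dist_norm\<close>)
  have "l1 (\<lambda>x. (\<integral>y. G y * \<rho> (x - y) \<partial>lborel) - G x) \<le> ennreal e"
    if mol: "mollifier C \<delta> \<rho> \<rho>'" and \<delta>: "\<delta> \<le> \<eta>" for C \<delta> \<rho> \<rho>'
  proof -
    note m = mollifier_props[OF mol]
    have [measurable]: "\<rho> \<in> borel_measurable borel" by (rule m)
    obtain B where B: "\<And>z. \<bar>\<rho> z\<bar> \<le> B" by (rule mollifier_bound[OF mol]) blast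
    have eq: "(\<integral>y. G y * \<rho> (x - y) \<partial>lborel) - G x = (\<integral>y. (G y - G x) * \<rho> (x - y) \<partial>lborel)" for x
    proof -
      have "integrable lborel (\<lambda>y. G y * \<rho> (x - y))" by (rule integrable_bounded_mult[OF G _ B]) measurable
      moreover have "integrable lborel (\<lambda>y. G x * \<rho> (x - y))" using mollifier_integral(1)[OF mol] by auto
      ultimately have "(\<integral>y. (G y - G x) * \<rho> (x - y) \<partial>lborel) = (\<integral>y. G y * \<rho> (x - y) \<partial>lborel) - (\<integral>y. G x * \<rho> (x - y) \<partial>lborel)"
        by (simp add: left_diff_distrib)
      then show ?thesis using mollifier_integral(2)[OF mol, of x] by simp
    qed
    have "l1 (\<lambda>x. (\<integral>y. G y * \<rho> (x - y) \<partial>lborel) - G x)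
        \<le> (\<integral>\<^sup>+x. (\<integral>\<^sup>+y. ennreal (\<bar>G y - G x\<bar> * \<rho> (x - y)) \<partial>lborel) \<partial>lborel)"
      unfolding eq l1_def
    proof (intro nn_integral_mono)
      fix x
      have "ennreal \<bar>\<integral>y. (G y - G x) * \<rho> (x - y) \<partial>lborel\<bar> \<le> (\<integral>\<^sup>+y. ennreal \<bar>(G y - G x) * \<rho> (x - y)\<bar> \<partial>lborel)"
        by (rule ennreal_abs_integral_le)
      then show "ennreal \<bar>\<integral>y. (G y - G x) * \<rho> (x - y) \<partial>lborel\<bar> \<le> (\<integral>\<^sup>+y. ennreal (\<bar>G y - G x\<bar> * \<rho> (x - y)) \<partial>lborel)"
        using m(3) by (simp add: abs_mult)
    qed
    also have "\<dots> = (\<integral>\<^sup>+y. (\<integral>\<^sup>+x. ennreal (\<bar>G y - G x\<bar> * \<rho> (x - y)) \<partial>lborel) \<partial>lborel)"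
      by (rule lborel_pair.Fubini') measurable
    also have "\<dots> = (\<integral>\<^sup>+y. (\<integral>\<^sup>+z. ennreal (\<bar>G y - G (z + y)\<bar> * \<rho> z) \<partial>lborel) \<partial>lborel)"
    proof (rule nn_integral_cong)
      fix y
      show "(\<integral>\<^sup>+x. ennreal (\<bar>G y - G x\<bar> * \<rho> (x - y)) \<partial>lborel) = (\<integral>\<^sup>+z. ennreal (\<bar>G y - G (z + y)\<bar> * \<rho> z) \<partial>lborel)"
        by (subst nn_integral_lborel_translate[of "\<lambda>x. ennreal (\<bar>G y - G x\<bar> * \<rho> (x - y))" y, symmetric]) auto
    qed
    also have "\<dots> = (\<integral>\<^sup>+z. (\<integral>\<^sup>+y. ennreal (\<bar>G y - G (z + y)\<bar> * \<rho> z) \<partial>lborel) \<partial>lborel)"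
    proof -
      have "(\<lambda>p. fst p + snd p :: real ^ 'n) \<in> measurable (lborel \<Otimes>\<^sub>M lborel) borel"
        by (intro borel_measurable_add) simp_all
      from measurable_compose[OF this \<open>G \<in> borel_measurable borel\<close>]
      have [measurable]: "(\<lambda>p. G (fst p + snd p)) \<in> borel_measurable (lborel \<Otimes>\<^sub>M lborel)" .
      have [measurable]: "(\<lambda>p. G (snd p)) \<in> borel_measurable (lborel \<Otimes>\<^sub>M lborel)"
          "(\<lambda>p. \<rho> (fst p)) \<in> borel_measurable (lborel \<Otimes>\<^sub>M lborel)"
        by (intro measurable_compose[OF measurable_snd] measurable_compose[OF measurable_fst], simp)+
      have "(\<lambda>p. ennreal (\<bar>G (snd p) - G (fst p + snd p)\<bar> * \<rho> (fst p))) \<in> borel_measurable (lborel \<Otimes>\<^sub>M lborel)"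
        by measurable
      then have "(\<lambda>(z, y). ennreal (\<bar>G y - G (z + y)\<bar> * \<rho> z)) \<in> borel_measurable (lborel \<Otimes>\<^sub>M lborel)"
        by (simp add: case_prod_unfold)
      then show ?thesis by (rule lborel_pair.Fubini')
    qed
    also have "\<dots> \<le> (\<integral>\<^sup>+z. ennreal e * ennreal (\<rho> z) \<partial>lborel)"
    proof (intro nn_integral_mono)
      fix z
      have "(\<integral>\<^sup>+y. ennreal (\<bar>G y - G (z + y)\<bar> * \<rho> z) \<partial>lborel) = l1 (\<lambda>y. G (y + z) - G y) * ennreal (\<rho> z)"
        unfolding l1_def using m(3)
        by (subst nn_integral_multc[symmetric]) (auto simp: ennreal_mult abs_minus_commute add.commute intro!: nn_integral_cong)
      also have "\<dots> \<le> ennreal e * ennreal (\<rho> z)"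
      proof (cases "norm z \<le> \<delta>")
        case True
        then show ?thesis using tr[of z] \<delta> by (intro mult_right_mono) auto
      qed (use m(5)[of z] in simp)
      finally show "(\<integral>\<^sup>+y. ennreal (\<bar>G y - G (z + y)\<bar> * \<rho> z) \<partial>lborel) \<le> ennreal e * ennreal (\<rho> z)" .
    qed
    also have "\<dots> = ennreal e * l1 \<rho>" using m(3) by (subst nn_integral_cmult) (auto simp: l1_def)
    also have "\<dots> = ennreal e" using m(4) by simp
    finally show ?thesis .
  qed
  then show ?thesis using \<eta> by blast
qed

text \<open>The derivative along \<open>Y\<close> of the mollified \<open>H\<close>, minus the
  mollified distribution \<open>Y H\<close>; in the latter the derivative is moved onto
  \<open>\<rho> (x - y)\<close>, which produces the divergence term. Written as one integral, the
  gradient of \<open>\<rho>\<close> appears only next to the small factor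
  \<open>Y x - Y y\<close>.\<close>

definition commutator :: "(real ^ 'n \<Rightarrow> real ^ 'n) \<Rightarrow> ('n \<Rightarrow> real ^ 'n \<Rightarrow> real) \<Rightarrow> (real ^ 'n \<Rightarrow> real) \<Rightarrow>
    ('n \<Rightarrow> real ^ 'n \<Rightarrow> real) \<Rightarrow> (real ^ 'n \<Rightarrow> real) \<Rightarrow> real ^ 'n \<Rightarrow> real" where
  "commutator Y dv \<rho> \<rho>' H x =
     (\<integral>y. H y * (\<Sum>i\<in>UNIV. (Y x $ i - Y y $ i) * \<rho>' i (x - y) + \<rho> (x - y) * dv i y) \<partial>lborel)"

context
  fixes Y :: "real ^ 'n \<Rightarrow> real ^ 'n" and L M :: real and \<Phi> :: "real \<Rightarrow> real ^ 'n \<Rightarrow> real ^ 'n"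
    and dv :: "'n \<Rightarrow> real ^ 'n \<Rightarrow> real"
  assumes flow: "lipschitz_flow Y L M \<Phi>"
    and dv: "diagonal_derivatives Y dv" "\<And>i x. \<bar>dv i x\<bar> \<le> L"
begin

interpretation lipschitz_flow Y L M \<Phi> by (rule flow)

lemma dv_measurable [measurable]: "dv i \<in> borel_measurable borel"
  using dv(1) by (simp add: diagonal_derivatives_def)

lemma field_component_measurable [measurable]: "(\<lambda>x. Y x $ i) \<in> borel_measurable borel"
  using lipschitz_on_continuous_on[OF lip] by (auto intro!: borel_measurable_continuous_onI continuous_intros)

lemma field_component_bound: "\<bar>Y x $ i\<bar> \<le> M"
  using component_le_norm_cart[of "Y x" i] bound[of x] by linarith

lemma field_component_lip: "\<bar>Y x $ i - Y y $ i\<bar> \<le> L * norm (x - y)"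
  using lipschitz_onD[OF lipschitz_component[OF lip, of i], of x y] by (simp add: dist_norm)

text \<open>Lipschitz continuity of \<open>Y\<close> bounds the gradient part of the kernel by
  \<open>L * \<bar>norm z * \<rho>' i z\<bar>\<close> at \<open>z = x - y\<close>, of L^1 norm at
  most \<open>L * C\<close> for every radius; the divergence part adds \<open>L\<close>. Young's
  inequality does the rest.\<close>

lemma commutator_l1_le:
  assumes mol: "mollifier C \<delta> \<rho> \<rho>'" and C: "0 \<le> C" and [measurable]: "H \<in> borel_measurable borel"
  shows "l1 (commutator Y dv \<rho> \<rho>' H) \<le> ennreal (real CARD('n) * (L * C + L)) * l1 H"
proof -
  note m = mollifier_props[OF mol]
  have [measurable]: "\<rho> \<in> borel_measurable borel" "\<rho>' i \<in> borel_measurable borel" for i by (rule m)+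
  define k where "k z = (\<Sum>i\<in>UNIV. L * \<bar>norm z * \<rho>' i z\<bar> + L * \<bar>\<rho> z\<bar>)" for z
  have [measurable]: "k \<in> borel_measurable borel" unfolding k_def by measurable
  have "l1 k \<le> ennreal (real CARD('n) * (L * C + L))"
  proof -
    have "l1 k = (\<integral>\<^sup>+z. (\<Sum>i\<in>UNIV. ennreal L * ennreal \<bar>norm z * \<rho>' i z\<bar> + ennreal L * ennreal \<bar>\<rho> z\<bar>) \<partial>lborel)"
      unfolding l1_def
    proof (intro nn_integral_cong)
      fix z
      have "0 \<le> k z" unfolding k_def using L_nonneg by (intro sum_nonneg) auto
      then have "ennreal \<bar>k z\<bar> = (\<Sum>i\<in>UNIV. ennreal (L * \<bar>norm z * \<rho>' i z\<bar> + L * \<bar>\<rho> z\<bar>))"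
        unfolding k_def using L_nonneg by (subst sum_ennreal) auto
      then show "ennreal \<bar>k z\<bar> = (\<Sum>i\<in>UNIV. ennreal L * ennreal \<bar>norm z * \<rho>' i z\<bar> + ennreal L * ennreal \<bar>\<rho> z\<bar>)"
        using L_nonneg by (simp add: ennreal_plus ennreal_mult)
    qed
    also have "\<dots> = (\<Sum>i\<in>UNIV. \<integral>\<^sup>+z. ennreal L * ennreal \<bar>norm z * \<rho>' i z\<bar> + ennreal L * ennreal \<bar>\<rho> z\<bar> \<partial>lborel)"
      by (rule nn_integral_sum) measurable
    also have "\<dots> = (\<Sum>i\<in>UNIV. ennreal L * l1 (\<lambda>z. norm z * \<rho>' i z) + ennreal L * l1 \<rho>)"
      by (intro sum.cong refl) (simp add: nn_integral_add nn_integral_cmult l1_def)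
    also have "\<dots> \<le> (\<Sum>i\<in>(UNIV :: 'n set). ennreal L * ennreal C + ennreal L * 1)"
      using m(4,7) by (intro sum_mono add_mono mult_left_mono) auto
    also have "\<dots> = (\<Sum>i\<in>(UNIV :: 'n set). ennreal (L * C + L))"
      using L_nonneg C by (simp add: ennreal_plus ennreal_mult)
    also have "\<dots> = ennreal (\<Sum>i\<in>(UNIV :: 'n set). L * C + L)"
      using L_nonneg C by (intro sum_ennreal) auto
    finally show ?thesis by simp
  qed
  moreover have "\<bar>\<Sum>i\<in>UNIV. (Y x $ i - Y y $ i) * \<rho>' i (x - y) + \<rho> (x - y) * dv i y\<bar> \<le> k (x - y)" for x y
  proof -
    have "\<bar>(Y x $ i - Y y $ i) * \<rho>' i (x - y) + \<rho> (x - y) * dv i y\<bar>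
        \<le> L * \<bar>norm (x - y) * \<rho>' i (x - y)\<bar> + L * \<bar>\<rho> (x - y)\<bar>" for i
    proof -
      have "\<bar>Y x $ i - Y y $ i\<bar> * \<bar>\<rho>' i (x - y)\<bar> \<le> (L * norm (x - y)) * \<bar>\<rho>' i (x - y)\<bar>"
        using field_component_lip by (intro mult_right_mono) auto
      moreover have "\<bar>\<rho> (x - y)\<bar> * \<bar>dv i y\<bar> \<le> \<bar>\<rho> (x - y)\<bar> * L" using dv(2) by (intro mult_left_mono) auto
      ultimately show ?thesis
        using abs_triangle_ineq[of "(Y x $ i - Y y $ i) * \<rho>' i (x - y)" "\<rho> (x - y) * dv i y"]
        by (simp add: abs_mult mult_ac)
    qed
    then show ?thesis unfolding k_def by (intro order_trans[OF sum_abs] sum_mono)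
  qed
  ultimately show ?thesis unfolding commutator_def by (intro l1_kernel_le[where k = k]) auto
qed

lemma commutator_integrable:
  assumes mol: "mollifier C \<delta> \<rho> \<rho>'" and H: "integrable lborel H"
  shows "integrable lborel (\<lambda>y. H y * (\<Sum>i\<in>UNIV. (Y x $ i - Y y $ i) * \<rho>' i (x - y) + \<rho> (x - y) * dv i y))"
    and "integrable lborel (\<lambda>y. H y * (\<Sum>i\<in>UNIV. Y z $ i * \<rho>' i (x - y)))"
    and "integrable lborel (\<lambda>y. H y * (\<Sum>i\<in>UNIV. Y y $ i * \<rho>' i (x - y)))"
    and "integrable lborel (\<lambda>y. H y * (\<rho> (x - y) * (\<Sum>i\<in>UNIV. dv i y)))"
proof -
  note m = mollifier_props[OF mol]
  have [measurable]: "\<rho> \<in> borel_measurable borel" "\<rho>' i \<in> borel_measurable borel" for i by (rule m)+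
  obtain B where B: "0 \<le> B" "\<And>z. \<bar>\<rho> z\<bar> \<le> B" "\<And>i z. \<bar>\<rho>' i z\<bar> \<le> B" by (rule mollifier_bound[OF mol]) blast
  have 1: "\<bar>\<Sum>i\<in>UNIV. a i * \<rho>' i (x - y)\<bar> \<le> real CARD('n) * (M * B)" if "\<And>i. \<bar>a i\<bar> \<le> M" for y and a :: "'n \<Rightarrow> real"
  proof -
    have "\<bar>\<Sum>i\<in>UNIV. a i * \<rho>' i (x - y)\<bar> \<le> (\<Sum>i\<in>(UNIV :: 'n set). M * B)"
      using B that M_nonneg by (intro order_trans[OF sum_abs] sum_mono) (auto simp: abs_mult intro!: mult_mono)
    then show ?thesis by simp
  qed
  have 2: "\<bar>\<Sum>i\<in>UNIV. dv i y\<bar> \<le> real CARD('n) * L" for y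
  proof -
    have "\<bar>\<Sum>i\<in>UNIV. dv i y\<bar> \<le> (\<Sum>i\<in>(UNIV :: 'n set). L)"
      by (rule order_trans[OF sum_abs sum_mono]) (rule dv(2))
    then show ?thesis by simp
  qed
  have i1: "integrable lborel (\<lambda>y. H y * (\<Sum>i\<in>UNIV. Y z $ i * \<rho>' i (x - y)))" for z
    by (rule integrable_bounded_mult[OF H _ 1]) (use field_component_bound in auto)
  show "integrable lborel (\<lambda>y. H y * (\<Sum>i\<in>UNIV. Y z $ i * \<rho>' i (x - y)))" by (rule i1)
  show i2: "integrable lborel (\<lambda>y. H y * (\<Sum>i\<in>UNIV. Y y $ i * \<rho>' i (x - y)))"
    by (rule integrable_bounded_mult[OF H _ 1]) (use field_component_bound in auto)
  show i3: "integrable lborel (\<lambda>y. H y * (\<rho> (x - y) * (\<Sum>i\<in>UNIV. dv i y)))"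
  proof (rule integrable_bounded_mult[OF H, where B = "B * (real CARD('n) * L)"])
    show "\<bar>\<rho> (x - y) * (\<Sum>i\<in>UNIV. dv i y)\<bar> \<le> B * (real CARD('n) * L)" for y
      using B 2 unfolding abs_mult by (intro mult_mono) auto
  qed measurable
  have "(\<lambda>y. H y * (\<Sum>i\<in>UNIV. (Y x $ i - Y y $ i) * \<rho>' i (x - y) + \<rho> (x - y) * dv i y)) =
      (\<lambda>y. H y * (\<Sum>i\<in>UNIV. Y x $ i * \<rho>' i (x - y)) - H y * (\<Sum>i\<in>UNIV. Y y $ i * \<rho>' i (x - y)) + H y * (\<rho> (x - y) * (\<Sum>i\<in>UNIV. dv i y)))"
    by (rule ext) (simp add: sum.distrib sum_subtractf sum_distrib_left left_diff_distrib right_diff_distrib distrib_left)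
  then show "integrable lborel (\<lambda>y. H y * (\<Sum>i\<in>UNIV. (Y x $ i - Y y $ i) * \<rho>' i (x - y) + \<rho> (x - y) * dv i y))"
    using i1[of x] i2 i3 by auto
qed

text \<open>Separates the derivative of the mollification, which is the first integral, from the two
  terms that the distributional equation produces for the test function
  \<open>\<rho> (x - y)\<close>.\<close>

lemma commutator_split:
  assumes mol: "mollifier C \<delta> \<rho> \<rho>'" and H: "integrable lborel H"
  shows "commutator Y dv \<rho> \<rho>' H x = (\<integral>y. H y * (\<Sum>i\<in>UNIV. Y x $ i * \<rho>' i (x - y)) \<partial>lborel)
    - (\<integral>y. H y * (\<Sum>i\<in>UNIV. Y y $ i * \<rho>' i (x - y)) \<partial>lborel) + (\<integral>y. H y * (\<rho> (x - y) * (\<Sum>i\<in>UNIV. dv i y)) \<partial>lborel)"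
proof -
  have "(\<lambda>y. H y * (\<Sum>i\<in>UNIV. (Y x $ i - Y y $ i) * \<rho>' i (x - y) + \<rho> (x - y) * dv i y)) =
      (\<lambda>y. H y * (\<Sum>i\<in>UNIV. Y x $ i * \<rho>' i (x - y)) - H y * (\<Sum>i\<in>UNIV. Y y $ i * \<rho>' i (x - y)) + H y * (\<rho> (x - y) * (\<Sum>i\<in>UNIV. dv i y)))"
    by (rule ext) (simp add: sum.distrib sum_subtractf sum_distrib_left left_diff_distrib right_diff_distrib distrib_left)
  then show ?thesis unfolding commutator_def using commutator_integrable(2-4)[OF mol H] by simp
qed

text \<open>With \<open>x\<close> frozen, the divergence theorem for
  \<open>\<rho> (x - y) * p y\<close> times \<open>Z y = Y x - Y y\<close> moves the derivative from
  \<open>\<rho>\<close> to \<open>p\<close> and absorbs the divergence term. What is left carries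
  the factor \<open>Z y\<close>, of size \<open>L * \<delta>\<close> on the support of the
  kernel.\<close>

lemma commutator_C1_bound:
  assumes mol: "mollifier C \<delta> \<rho> \<rho>'" and p: "C1_gradient p p'" and \<delta>: "0 < \<delta>"
    and K: "cball x \<delta> \<subseteq> K" and B: "\<And>i y. y \<in> K \<Longrightarrow> \<bar>p' i y\<bar> \<le> B" and B0: "0 \<le> B"
  shows "\<bar>commutator Y dv \<rho> \<rho>' (\<lambda>y. indicator K y * p y) x\<bar> \<le> real CARD('n) * (L * \<delta> * B)"
proof -
  note m = mollifier_props[OF mol]
  define Z where "Z y = Y x - Y y" for y
  define w' where "w' i y = - \<rho>' i (x - y) * p y + \<rho> (x - y) * p' i y" for i y
  have cp: "axis_C1 p p'" using p by (rule C1_gradient_axis_C1)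
  \<comment> \<open>The kernel vanishes off \<open>K\<close>, so the indicator disappears and only
    the continuously differentiable \<open>p\<close> remains.\<close>
  have out: "\<rho> (x - y) = 0" "\<rho>' i (x - y) = 0" if "y \<notin> K" for y i
  proof -
    have "y \<notin> cball x \<delta>" using K that by blast
    then have "\<delta> < norm (x - y)" by (simp add: dist_norm)
    then show "\<rho> (x - y) = 0" "\<rho>' i (x - y) = 0" using m(5,6) by auto
  qed
  have w: "axis_C1 (\<lambda>y. \<rho> (x - y) * p y) w'"
    unfolding w'_def by (rule axis_C1_mult[OF mollifier_reflected_axis_C1[OF mol] cp])
  have wb: "bounded {y. \<rho> (x - y) * p y \<noteq> 0}"
  proof (rule bounded_subset[OF bounded_cball])
    show "{y. \<rho> (x - y) * p y \<noteq> 0} \<subseteq> cball x \<delta>"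
      using m(5) by (auto simp: dist_norm) (meson not_le)
  qed
  have ZL: "L-lipschitz_on UNIV Z"
    using lip by (auto simp: lipschitz_on_def Z_def dist_norm norm_minus_commute)
  have ZM: "norm (Z y) \<le> 2 * M" for y
    using norm_triangle_ineq4[of "Y x" "Y y"] bound[of x] bound[of y] by (simp add: Z_def)
  have dZ: "diagonal_derivatives Z (\<lambda>i y. - dv i y)"
    unfolding diagonal_derivatives_def
  proof (intro allI conjI)
    fix i
    show "(\<lambda>y. - dv i y) \<in> borel_measurable borel" by measurable
    have "AE y in lborel. ((\<lambda>s. Y (y + s *\<^sub>R axis i 1) $ i) has_field_derivative dv i y) (at 0)"
      using dv(1) by (simp add: diagonal_derivatives_def)
    then show "AE y in lborel. ((\<lambda>s. Z (y + s *\<^sub>R axis i 1) $ i) has_field_derivative - dv i y) (at 0)"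
    proof eventually_elim
      case (elim y)
      from DERIV_diff[OF DERIV_const[of "Y x $ i"] elim] show ?case by (simp add: Z_def)
    qed
  qed
  define a where "a y = indicator K y * p y * (\<Sum>i\<in>UNIV. (Y x $ i - Y y $ i) * \<rho>' i (x - y) + \<rho> (x - y) * dv i y)" for y
  define b where "b y = \<rho> (x - y) * (\<Sum>i\<in>UNIV. p' i y * Z y $ i)" for y
  have eq: "(\<Sum>i\<in>UNIV. w' i y * Z y $ i + \<rho> (x - y) * p y * - dv i y) = b y - a y" for y
  proof -
    have "a y = p y * (\<Sum>i\<in>UNIV. (Y x $ i - Y y $ i) * \<rho>' i (x - y) + \<rho> (x - y) * dv i y)"
      using out[of y] by (cases "y \<in> K") (simp_all add: a_def)
    also have "\<dots> = (\<Sum>i\<in>UNIV. p y * ((Y x $ i - Y y $ i) * \<rho>' i (x - y) + \<rho> (x - y) * dv i y))"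
      by (rule sum_distrib_left)
    finally have 1: "a y = (\<Sum>i\<in>UNIV. p y * ((Y x $ i - Y y $ i) * \<rho>' i (x - y) + \<rho> (x - y) * dv i y))" .
    have 2: "b y = (\<Sum>i\<in>UNIV. \<rho> (x - y) * (p' i y * Z y $ i))" unfolding b_def by (rule sum_distrib_left)
    show ?thesis unfolding 1 2 sum_subtractf[symmetric]
      by (intro sum.cong refl) (simp add: w'_def Z_def algebra_simps)
  qed
  note div = integral_divergence_zero[OF ZL ZM dZ w wb, unfolded eq]
  have bb: "\<bar>b y\<bar> \<le> real CARD('n) * (L * \<delta> * B) * \<rho> (x - y)" for y
  proof (cases "norm (x - y) \<le> \<delta>")
    case True
    then have "y \<in> K" using K by (auto simp: dist_norm)
    have "\<bar>Z y $ i\<bar> \<le> L * \<delta>" for i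
      using field_component_lip[of x i y] mult_left_mono[OF True L_nonneg] by (simp add: Z_def)
    then have "\<bar>\<Sum>i\<in>UNIV. p' i y * Z y $ i\<bar> \<le> (\<Sum>i\<in>(UNIV :: 'n set). B * (L * \<delta>))"
      using B[OF \<open>y \<in> K\<close>] B0 by (intro order_trans[OF sum_abs] sum_mono) (auto simp: abs_mult intro!: mult_mono)
    then have "\<bar>\<Sum>i\<in>UNIV. p' i y * Z y $ i\<bar> \<le> real CARD('n) * (L * \<delta> * B)" by (simp add: mult_ac)
    then have "\<rho> (x - y) * \<bar>\<Sum>i\<in>UNIV. p' i y * Z y $ i\<bar> \<le> \<rho> (x - y) * (real CARD('n) * (L * \<delta> * B))"
      using m(3) by (intro mult_left_mono)
    then show ?thesis using m(3)[of "x - y"] by (simp add: b_def abs_mult mult.commute)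
  next
    case False
    then show ?thesis using m(5)[of "x - y"] by (simp add: b_def)
  qed
  have [measurable]: "\<rho> \<in> borel_measurable borel" "p' i \<in> borel_measurable borel" for i
    using m(8) cp by (auto simp: axis_C1_def intro: borel_measurable_continuous_onI)
  have gi: "integrable lborel (\<lambda>y. real CARD('n) * (L * \<delta> * B) * \<rho> (x - y))"
    using mollifier_integral(1)[OF mol] by auto
  have bi: "integrable lborel b"
  proof (rule Bochner_Integration.integrable_bound[OF gi])
    show "b \<in> borel_measurable lborel" unfolding b_def Z_def by simp
    show "AE y in lborel. norm (b y) \<le> norm (real CARD('n) * (L * \<delta> * B) * \<rho> (x - y))"
      using bb by (auto intro!: always_eventually order_trans[OF _ abs_ge_self])
  qed
  have "integrable lborel (\<lambda>y. b y - (b y - a y))" using bi div(1) by (rule Bochner_Integration.integrable_diff)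
  then have ai: "integrable lborel a" by simp
  have ab: "(\<integral>y. a y \<partial>lborel) = (\<integral>y. b y \<partial>lborel)" using div(2) ai bi by simp
  have "commutator Y dv \<rho> \<rho>' (\<lambda>y. indicator K y * p y) x = (\<integral>y. a y \<partial>lborel)"
    by (simp only: commutator_def a_def)
  also have "\<bar>\<dots>\<bar> \<le> (\<integral>y. real CARD('n) * (L * \<delta> * B) * \<rho> (x - y) \<partial>lborel)"
    unfolding ab using bi gi bb by (intro order_trans[OF integral_abs_bound] integral_mono) auto
  also have "\<dots> = real CARD('n) * (L * \<delta> * B) * (\<integral>y. \<rho> (x - y) \<partial>lborel)"
    by (rule integral_mult_right_zero)
  also have "\<dots> = real CARD('n) * (L * \<delta> * B)" by (simp only: mollifier_integral(2)[OF mol] mult_1_right)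
  finally show ?thesis .
qed

text \<open>Friedrichs' lemma: the commutators are uniformly bounded on \<open>L\<^sup>1\<close> and tend to zero on polynomials.\<close>

theorem commutator_converges:
  assumes F: "integrable lborel F" "\<And>x. x \<notin> K \<Longrightarrow> F x = 0" and K: "compact K"
    and S: "S \<in> sets borel" and \<delta>0: "0 < \<delta>0" "\<And>x. x \<in> S \<Longrightarrow> cball x \<delta>0 \<subseteq> K"
    and C: "0 \<le> C" and e: "0 < e"
  shows "\<exists>\<delta>1>0. \<forall>\<delta> \<rho> \<rho>'. 0 < \<delta> \<and> \<delta> \<le> \<delta>1 \<and> mollifier C \<delta> \<rho> \<rho>' \<longrightarrow>
    l1 (\<lambda>x. indicator S x * commutator Y dv \<rho> \<rho>' F x) \<le> ennreal e"
proof -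
  have [measurable]: "K \<in> sets borel" "S \<in> sets borel" "F \<in> borel_measurable borel"
    using K S F by (auto simp: compact_imp_closed)
  define A where "A = real CARD('n) * (L * C + L)"
  have A: "0 \<le> A" using L_nonneg C by (simp add: A_def)
  \<comment> \<open>\<open>A\<close> is the uniform bound of the commutators on L^1; it turns the
    approximation error into at most \<open>e / 2\<close>.\<close>
  define \<epsilon> where "\<epsilon> = e / (2 * (A + 1))"
  have \<epsilon>: "0 < \<epsilon>" "A * \<epsilon> \<le> e / 2"
  proof -
    show "0 < \<epsilon>" using e A by (simp add: \<epsilon>_def)
    then have "A * \<epsilon> \<le> (A + 1) * \<epsilon>" by (intro mult_right_mono) auto
    also have "\<dots> = e / 2"
    proof -
      have "A + 1 \<noteq> 0" using A by linarith
      then show ?thesis by (simp add: \<epsilon>_def divide_simps)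
    qed
    finally show "A * \<epsilon> \<le> e / 2" .
  qed
  obtain p p' where p: "C1_gradient p p'" "l1 (\<lambda>x. indicator K x * (F x - p x)) \<le> ennreal \<epsilon>"
    by (rule polynomials_dense_L1_compact[OF F(1) K \<epsilon>(1)])
  have cp: "continuous_on UNIV p" "continuous_on UNIV (p' i)" for i
    using C1_gradient_axis_C1[OF p(1)] by (auto simp: axis_C1_def)
  have [measurable]: "p \<in> borel_measurable borel" using cp by (auto intro: borel_measurable_continuous_onI)
  define P where "P = (\<lambda>x. indicator K x * p x)"
  define H where "H = (\<lambda>x. indicator K x * (F x - p x))"
  have Pi: "integrable lborel P" unfolding P_def
    using borel_integrable_compact[OF K continuous_on_subset[OF cp(1) subset_UNIV]] by simp
  have HF: "H = (\<lambda>x. F x - P x)" using F(2) by (auto simp: P_def H_def indicator_def fun_eq_iff)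
  have Hi: "integrable lborel H" unfolding HF using F(1) Pi by (rule Bochner_Integration.integrable_diff)
  have "bounded (p' i ` K)" for i
    using K cp(2)[of i] by (intro compact_imp_bounded compact_continuous_image) (auto intro: continuous_on_subset)
  then have "\<exists>b. \<forall>y\<in>K. \<bar>p' i y\<bar> \<le> b" for i by (auto simp: bounded_iff)
  then obtain b where b: "\<And>i y. y \<in> K \<Longrightarrow> \<bar>p' i y\<bar> \<le> b i" by metis
  define B where "B = (\<Sum>i\<in>UNIV. \<bar>b i\<bar>)"
  have B: "\<bar>p' i y\<bar> \<le> B" if "y \<in> K" for i y
    using b[OF that, of i] member_le_sum[of i UNIV "\<lambda>i. \<bar>b i\<bar>"] by (simp add: B_def)
  have B0: "0 \<le> B" unfolding B_def by (rule sum_nonneg) simp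
  define \<mu> where "\<mu> = measure lborel K"
  have \<mu>: "0 \<le> \<mu>" "emeasure lborel K = ennreal \<mu>"
    using emeasure_bounded_finite[OF compact_imp_bounded[OF K]] by (auto simp: \<mu>_def emeasure_eq_ennreal_measure less_top)
  \<comment> \<open>L^1 bound per unit of \<open>\<delta>\<close> for the polynomial part, from its
    pointwise bound on \<open>S\<close>, a subset of \<open>K\<close>.\<close>
  define N where "N = real CARD('n) * (L * B) * \<mu>"
  have N0: "0 \<le> N" using L_nonneg B0 \<mu> by (simp add: N_def)
  define \<delta>1 where "\<delta>1 = min \<delta>0 (e / (2 * (N + 1)))"
  have \<delta>1: "0 < \<delta>1" "\<delta>1 \<le> \<delta>0" using \<delta>0 e N0 by (auto simp: \<delta>1_def)
  have N\<delta>: "N * \<delta>1 \<le> e / 2"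
  proof -
    have "N * \<delta>1 \<le> (N + 1) * \<delta>1" using \<delta>1 by (intro mult_right_mono) auto
    also have "\<dots> \<le> (N + 1) * (e / (2 * (N + 1)))" using N0 by (intro mult_left_mono) (auto simp: \<delta>1_def)
    also have "\<dots> = e / 2"
    proof -
      have "N + 1 \<noteq> 0" using N0 by linarith
      then show ?thesis by (simp add: divide_simps)
    qed
    finally show ?thesis .
  qed
  have "l1 (\<lambda>x. indicator S x * commutator Y dv \<rho> \<rho>' F x) \<le> ennreal e"
    if \<delta>: "0 < \<delta>" "\<delta> \<le> \<delta>1" and mol: "mollifier C \<delta> \<rho> \<rho>'" for \<delta> \<rho> \<rho>'
  proof -
    have [measurable]: "\<rho> \<in> borel_measurable borel" "\<rho>' i \<in> borel_measurable borel" for i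
      by (rule mollifier_props[OF mol])+
    have Hm[measurable]: "H \<in> borel_measurable borel" "P \<in> borel_measurable borel" using Hi Pi by auto
    have cm[measurable]: "commutator Y dv \<rho> \<rho>' h \<in> borel_measurable borel" if [measurable]: "h \<in> borel_measurable borel" for h
    proof -
      have "commutator Y dv \<rho> \<rho>' h \<in> borel_measurable lborel"
        unfolding commutator_def[abs_def] by (rule lborel.borel_measurable_lebesgue_integral) measurable
      then show ?thesis by simp
    qed
    have add: "commutator Y dv \<rho> \<rho>' F x = commutator Y dv \<rho> \<rho>' P x + commutator Y dv \<rho> \<rho>' H x" for x
      unfolding commutator_def using commutator_integrable(1)[OF mol Pi, of x] commutator_integrable(1)[OF mol Hi, of x]
      by (subst Bochner_Integration.integral_add[symmetric]) (auto simp: HF algebra_simps)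
    have bnd: "\<bar>indicator S x * commutator Y dv \<rho> \<rho>' P x\<bar> \<le> (real CARD('n) * (L * \<delta> * B)) * indicator K x" for x
    proof (cases "x \<in> S")
      case True
      have "cball x \<delta> \<subseteq> K" using \<delta>0(2)[OF True] \<delta> \<delta>1 by (auto simp: subset_iff)
      moreover from this have "x \<in> K" using \<delta>(1) by auto
      ultimately show ?thesis
        using commutator_C1_bound[OF mol p(1) \<delta>(1) \<open>cball x \<delta> \<subseteq> K\<close> B B0] True by (simp add: P_def)
    qed (use L_nonneg B0 \<delta> in simp)
    have "l1 (\<lambda>x. indicator S x * commutator Y dv \<rho> \<rho>' P x) \<le> (\<integral>\<^sup>+x. ennreal (real CARD('n) * (L * \<delta> * B)) * indicator K x \<partial>lborel)"
      unfolding l1_def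
    proof (intro nn_integral_mono)
      fix x
      show "ennreal \<bar>indicator S x * commutator Y dv \<rho> \<rho>' P x\<bar> \<le> ennreal (real CARD('n) * (L * \<delta> * B)) * indicator K x"
        using bnd[of x] by (cases "x \<in> K") (simp_all add: ennreal_leI)
    qed
    also have "\<dots> = ennreal (N * \<delta>)"
      using L_nonneg B0 \<delta> \<mu> by (subst nn_integral_cmult_indicator) (auto simp: N_def mult_ac simp flip: ennreal_mult)
    also have "\<dots> \<le> ennreal (e / 2)" using N\<delta> mult_left_mono[OF \<delta>(2) N0] by (intro ennreal_leI) linarith
    finally have 1: "l1 (\<lambda>x. indicator S x * commutator Y dv \<rho> \<rho>' P x) \<le> ennreal (e / 2)" .
    have "l1 (commutator Y dv \<rho> \<rho>' H) \<le> ennreal A * l1 H" unfolding A_def by (rule commutator_l1_le[OF mol C Hm(1)])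
    also have "\<dots> \<le> ennreal A * ennreal \<epsilon>" using p(2) by (intro mult_left_mono) (auto simp: H_def)
    also have "\<dots> \<le> ennreal (e / 2)" using A \<epsilon> by (auto simp flip: ennreal_mult intro: ennreal_leI)
    finally have 2: "l1 (commutator Y dv \<rho> \<rho>' H) \<le> ennreal (e / 2)" .
    have "l1 (\<lambda>x. indicator S x * commutator Y dv \<rho> \<rho>' F x)
        \<le> l1 (\<lambda>x. indicator S x * commutator Y dv \<rho> \<rho>' P x) + l1 (commutator Y dv \<rho> \<rho>' H)"
      by (rule l1_triangle) (auto simp: add indicator_def)
    also have "\<dots> \<le> ennreal (e / 2) + ennreal (e / 2)" by (intro add_mono 1 2)
    also have "\<dots> = ennreal e" using e by (simp flip: ennreal_plus)
    finally show ?thesis .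
  qed
  then show ?thesis using \<delta>1(1) by blast
qed

end

section \<open>Distributional derivatives along the flow\<close>

lemma FTC_interval_lborel:
  fixes f F :: "real \<Rightarrow> real"
  assumes t: "0 \<le> t" and F: "\<And>s. (F has_real_derivative f s) (at s)" and f: "continuous_on UNIV f"
  shows "(LINT s:{0..t}|lborel. f s) = F t - F 0"
proof -
  have "(\<integral>s. f s * indicator {0..t} s \<partial>lborel) = F t - F 0"
    using f by (intro integral_FTC_Icc_real t F) (auto simp: continuous_on_eq_continuous_at)
  then show ?thesis by (simp add: set_lebesgue_integral_def mult.commute)
qed

context
  fixes Y :: "real ^ 'n \<Rightarrow> real ^ 'n" and L M :: real and \<Phi> :: "real \<Rightarrow> real ^ 'n \<Rightarrow> real ^ 'n"
    and dv :: "'n \<Rightarrow> real ^ 'n \<Rightarrow> real"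
  assumes flow: "lipschitz_flow Y L M \<Phi>"
    and dv: "diagonal_derivatives Y dv" "\<And>i x. \<bar>dv i x\<bar> \<le> L"
begin

interpretation lipschitz_flow Y L M \<Phi> by (rule flow)

text \<open>Fubini in place of differentiation under the integral: for each \<open>y\<close> the
  fundamental theorem applies to \<open>\<rho> (\<Phi> s x - y)\<close> as a function of
  \<open>s\<close>, and then the order of integration is exchanged. The result holds for every
  \<open>x\<close>.\<close>

lemma mollification_increment:
  assumes mol: "mollifier C \<delta> \<rho> \<rho>'" and F: "integrable lborel F" and t: "0 \<le> t"
  shows "set_integrable lborel {0..t} (\<lambda>s. \<integral>y. F y * (\<Sum>i\<in>UNIV. Y (\<Phi> s x) $ i * \<rho>' i (\<Phi> s x - y)) \<partial>lborel)"
    and "(LINT s:{0..t}|lborel. \<integral>y. F y * (\<Sum>i\<in>UNIV. Y (\<Phi> s x) $ i * \<rho>' i (\<Phi> s x - y)) \<partial>lborel)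
      = (\<integral>y. F y * \<rho> (\<Phi> t x - y) \<partial>lborel) - (\<integral>y. F y * \<rho> (x - y) \<partial>lborel)"
proof -
  note m = mollifier_props[OF mol]
  obtain B where B: "0 \<le> B" "\<And>z. \<bar>\<rho> z\<bar> \<le> B" "\<And>i z. \<bar>\<rho>' i z\<bar> \<le> B" by (rule mollifier_bound[OF mol]) blast
  have cY: "continuous_on UNIV Y" using lip by (rule lipschitz_on_continuous_on)
  have c\<rho>: "continuous_on UNIV \<rho>" "continuous_on UNIV (\<rho>' i)" for i using m(2) by (auto simp: axis_C1_def)
  define g where "g s y = (\<Sum>i\<in>UNIV. Y (\<Phi> s x) $ i * \<rho>' i (\<Phi> s x - y))" for s y
  have cg: "continuous_on UNIV (\<lambda>p. g (fst p) (snd p))"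
  proof -
    have 1: "continuous_on UNIV (\<lambda>p::real \<times> (real ^ 'n). \<Phi> (fst p) x)"
      by (rule continuous_on_compose2[OF flow_continuous_time]) (auto intro: continuous_intros)
    have 2: "continuous_on UNIV (\<lambda>p::real \<times> (real ^ 'n). Y (\<Phi> (fst p) x) $ i)" for i
      by (intro continuous_on_component continuous_on_compose2[OF cY 1]) auto
    have 3: "continuous_on UNIV (\<lambda>p. \<rho>' i (\<Phi> (fst p) x - snd p))" for i
      by (rule continuous_on_compose2[OF c\<rho>(2)]) (auto intro!: continuous_intros 1)
    show ?thesis unfolding g_def by (intro continuous_on_sum continuous_on_mult 2 3)
  qed
  have gm[measurable]: "(\<lambda>p. g (fst p) (snd p)) \<in> borel_measurable (borel \<Otimes>\<^sub>M borel)"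
    using borel_measurable_continuous_onI[OF cg] by (simp add: borel_prod)
  have [measurable]: "F \<in> borel_measurable borel" using F by auto
  define G where "G = real CARD('n) * (M * B)"
  have G0: "0 \<le> G" using M_nonneg B by (simp add: G_def)
  have gb: "\<bar>g s y\<bar> \<le> G" for s y
  proof -
    have "\<bar>g s y\<bar> \<le> (\<Sum>i\<in>(UNIV :: 'n set). M * B)" unfolding g_def
    proof (rule order_trans[OF sum_abs sum_mono])
      fix i
      have "\<bar>Y (\<Phi> s x) $ i\<bar> \<le> M" using component_le_norm_cart[of "Y (\<Phi> s x)" i] bound[of "\<Phi> s x"] by linarith
      then show "\<bar>Y (\<Phi> s x) $ i * \<rho>' i (\<Phi> s x - y)\<bar> \<le> M * B"
        unfolding abs_mult using B M_nonneg by (intro mult_mono) auto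
    qed
    then show ?thesis by (simp add: G_def)
  qed
  \<comment> \<open>The integrand on the product of time and space; it is integrable because
    \<open>g\<close> is bounded, \<open>F\<close> is integrable and the time interval is
    finite.\<close>
  define h where "h p = indicator {0..t} (fst p) * (F (snd p) * g (fst p) (snd p))" for p
  have hm[measurable]: "h \<in> borel_measurable (lborel \<Otimes>\<^sub>M lborel)"
  proof -
    have "(\<lambda>p. g (fst p) (snd p)) \<in> borel_measurable (lborel \<Otimes>\<^sub>M lborel)" using gm by simp
    then show ?thesis unfolding h_def by measurable
  qed
  have hi: "integrable (lborel \<Otimes>\<^sub>M lborel) h"
  proof (rule integrableI_bounded[OF hm])
    have "(\<integral>\<^sup>+p. ennreal (norm (h p)) \<partial>(lborel \<Otimes>\<^sub>M lborel)) = (\<integral>\<^sup>+s. (\<integral>\<^sup>+y. ennreal \<bar>h (s, y)\<bar> \<partial>lborel) \<partial>lborel)"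
      by (subst lborel.nn_integral_fst[symmetric]) auto
    also have "\<dots> \<le> (\<integral>\<^sup>+s. (ennreal G * l1 F) * indicator {0..t} s \<partial>lborel)"
    proof (rule nn_integral_mono)
      fix s
      have "(\<integral>\<^sup>+y. ennreal \<bar>h (s, y)\<bar> \<partial>lborel) \<le> (\<integral>\<^sup>+y. ennreal G * indicator {0..t} s * ennreal \<bar>F y\<bar> \<partial>lborel)"
      proof (rule nn_integral_mono)
        fix y
        have "\<bar>F y * g s y\<bar> \<le> G * \<bar>F y\<bar>"
          using mult_left_mono[OF gb[of s y], of "\<bar>F y\<bar>"] by (simp add: abs_mult mult.commute)
        then show "ennreal \<bar>h (s, y)\<bar> \<le> ennreal G * indicator {0..t} s * ennreal \<bar>F y\<bar>"
          using G0 by (auto simp: h_def indicator_def simp flip: ennreal_mult intro!: ennreal_leI)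
      qed
      also have "\<dots> = (ennreal G * l1 F) * indicator {0..t} s"
        by (subst nn_integral_cmult) (auto simp: l1_def mult_ac)
      finally show "(\<integral>\<^sup>+y. ennreal \<bar>h (s, y)\<bar> \<partial>lborel) \<le> (ennreal G * l1 F) * indicator {0..t} s" .
    qed
    also have "\<dots> = ennreal G * l1 F * ennreal t" using t by (subst nn_integral_cmult_indicator) auto
    also have "\<dots> < \<infinity>" using F l1_integrable_iff[of F] by (simp add: ennreal_mult_less_top)
    finally show "(\<integral>\<^sup>+p. ennreal (norm (h p)) \<partial>(lborel \<Otimes>\<^sub>M lborel)) < \<infinity>" .
  qed
  have h1: "(\<integral>y. h (s, y) \<partial>lborel) = indicat_real {0..t} s *\<^sub>R (\<integral>y. F y * g s y \<partial>lborel)" for s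
    by (simp add: h_def)
  have "integrable lborel (\<lambda>s. \<integral>y. h (s, y) \<partial>lborel)"
    using lborel_pair.integrable_fst'[OF hi] .
  then show "set_integrable lborel {0..t} (\<lambda>s. \<integral>y. F y * (\<Sum>i\<in>UNIV. Y (\<Phi> s x) $ i * \<rho>' i (\<Phi> s x - y)) \<partial>lborel)"
    unfolding set_integrable_def h1 g_def .
  have inner: "(\<integral>s. h (s, y) \<partial>lborel) = F y * \<rho> (\<Phi> t x - y) - F y * \<rho> (x - y)" for y
  proof -
    have "((\<lambda>s. \<rho> (\<Phi> s x - y)) has_real_derivative g s y) (at s)" for s
    proof -
      have "((\<lambda>s. \<Phi> s x - y) has_vector_derivative Y (\<Phi> s x) - 0) (at s)"
        by (intro has_vector_derivative_diff deriv has_vector_derivative_const)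
      from C1_gradient_along_curve[OF m(1) this] show ?thesis by (simp add: g_def mult.commute)
    qed
    moreover have "continuous_on UNIV (\<lambda>s. g s y)"
    proof -
      have "continuous_on UNIV (\<lambda>s::real. (s, y))" by (intro continuous_intros)
      from continuous_on_compose2[OF cg this] show ?thesis by simp
    qed
    ultimately have "(LINT s:{0..t}|lborel. g s y) = \<rho> (\<Phi> t x - y) - \<rho> (\<Phi> 0 x - y)"
      by (rule FTC_interval_lborel[OF t])
    then have "F y * (\<integral>s. indicat_real {0..t} s * g s y \<partial>lborel) = F y * (\<rho> (\<Phi> t x - y) - \<rho> (x - y))"
      by (simp add: set_lebesgue_integral_def init)
    moreover have "(\<integral>s. h (s, y) \<partial>lborel) = F y * (\<integral>s. indicat_real {0..t} s * g s y \<partial>lborel)"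
      by (subst integral_mult_right_zero[symmetric]) (simp add: h_def mult_ac)
    ultimately show ?thesis by (simp add: right_diff_distrib)
  qed
  have "(LINT s:{0..t}|lborel. \<integral>y. F y * g s y \<partial>lborel) = (\<integral>s. (\<integral>y. h (s, y) \<partial>lborel) \<partial>lborel)"
    by (simp only: set_lebesgue_integral_def h1)
  also have "\<dots> = (\<integral>y. (\<integral>s. h (s, y) \<partial>lborel) \<partial>lborel)"
    by (rule lborel_pair.Fubini_integral[symmetric]) (use hi in simp)
  also have "\<dots> = (\<integral>y. F y * \<rho> (\<Phi> t x - y) - F y * \<rho> (x - y) \<partial>lborel)" unfolding inner ..
  also have "\<dots> = (\<integral>y. F y * \<rho> (\<Phi> t x - y) \<partial>lborel) - (\<integral>y. F y * \<rho> (x - y) \<partial>lborel)"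
  proof (rule Bochner_Integration.integral_diff)
    have [measurable]: "\<rho> \<in> borel_measurable borel" by (rule m)
    show "integrable lborel (\<lambda>y. F y * \<rho> (z - y))" for z
      by (rule integrable_bounded_mult[OF F _ B(2)]) measurable
    then show "integrable lborel (\<lambda>y. F y * \<rho> (x - y))" .
  qed
  finally show "(LINT s:{0..t}|lborel. \<integral>y. F y * (\<Sum>i\<in>UNIV. Y (\<Phi> s x) $ i * \<rho>' i (\<Phi> s x - y)) \<partial>lborel)
      = (\<integral>y. F y * \<rho> (\<Phi> t x - y) \<partial>lborel) - (\<integral>y. F y * \<rho> (x - y) \<partial>lborel)" unfolding g_def .
qed

text \<open>The increment formula is exact for the mollification of \<open>F\<close>, with
  derivative \<open>Q\<close> along the flow. Passing to \<open>F\<close> and \<open>G\<close> costs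
  the mollification error \<open>E\<close> at both ends of the orbit and the time integral of
  \<open>D\<close>; on \<open>S\<close> the difference \<open>Q x - G x\<close> is the commutator
  plus the mollification error of \<open>G\<close>. All of this is small in L^1 and remains so under
  the flow.\<close>

theorem distr_derivative_imp_increment:
  assumes F: "integrable lborel F" "\<And>x. x \<notin> K \<Longrightarrow> F x = 0" and G: "integrable lborel G" and K: "compact K"
    and S: "S \<in> sets borel" and \<delta>0: "0 < \<delta>0" "\<And>x. x \<in> S \<Longrightarrow> cball x \<delta>0 \<subseteq> K"
    and U: "U \<in> sets borel" "\<And>x s. x \<in> U \<Longrightarrow> s \<in> {0..T} \<Longrightarrow> \<Phi> s x \<in> S"
    and C: "0 \<le> C" "\<And>\<delta>. 0 < \<delta> \<Longrightarrow> \<exists>(\<rho> :: real ^ 'n \<Rightarrow> real) \<rho>'. mollifier C \<delta> \<rho> \<rho>'"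
    and weak: "\<And>\<delta> \<rho> \<rho>' x. 0 < \<delta> \<Longrightarrow> \<delta> \<le> \<delta>0 \<Longrightarrow> mollifier C \<delta> \<rho> \<rho>' \<Longrightarrow> x \<in> S \<Longrightarrow>
      (\<integral>y. G y * \<rho> (x - y) \<partial>lborel) = (\<integral>y. F y * (\<Sum>i\<in>UNIV. Y y $ i * \<rho>' i (x - y)) \<partial>lborel)
        - (\<integral>y. F y * (\<rho> (x - y) * (\<Sum>i\<in>UNIV. dv i y)) \<partial>lborel)"
    and t: "t \<in> {0..T}"
  shows "AE x in lborel. x \<in> U \<longrightarrow> F (\<Phi> t x) - F x = (LINT s:{0..t}|lborel. G (\<Phi> s x))"
proof -
  have [measurable]: "F \<in> borel_measurable borel" "G \<in> borel_measurable borel" "S \<in> sets borel" "U \<in> sets borel"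
      "\<Phi> s \<in> borel_measurable borel" "(\<lambda>x. Y x $ i) \<in> borel_measurable borel" for s i
    using F G S U flow_continuous_space lipschitz_on_continuous_on[OF lip]
    by (auto intro!: borel_measurable_continuous_onI continuous_intros)
  have t0: "0 \<le> t" "t \<le> T" using t by auto
  define res where "res = (\<lambda>x. indicator U x * (F (\<Phi> t x) - F x - (LINT s:{0..t}|lborel. G (\<Phi> s x))))"
  have LGm: "(\<lambda>x. LINT s:{0..t}|lborel. G (\<Phi> s x)) \<in> borel_measurable borel"
    by (rule time_integral_measurable[OF flow_pair_compose_measurable]) measurable
  have resm: "res \<in> borel_measurable borel" unfolding res_def using LGm by measurable
  \<comment> \<open>Volume factor of the flow up to time \<open>T\<close>; it bounds the
    compositions with \<open>\<Phi> s\<close> below.\<close>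
  define A where "A = exp (L * T) ^ CARD('n)"
  have A: "0 \<le> A" by (simp add: A_def)
  \<comment> \<open>The coefficient collects \<open>E\<close> at time \<open>t\<close>,
    \<open>E\<close> at time 0, and the time integral of \<open>D\<close>, which has norm at most
    \<open>2 * e\<close>.\<close>
  have est: "l1 res \<le> ennreal ((A + 1 + 2 * T * A) * e)" if e: "0 < e" for e
  proof -
    obtain d1 where d1: "0 < d1" "\<And>\<delta> \<rho> \<rho>'. mollifier C \<delta> \<rho> \<rho>' \<Longrightarrow> \<delta> \<le> d1 \<Longrightarrow>
        l1 (\<lambda>x. (\<integral>y. F y * \<rho> (x - y) \<partial>lborel) - F x) \<le> ennreal e"
      using mollification_converges[OF F(1) e] by blast
    obtain d2 where d2: "0 < d2" "\<And>\<delta> \<rho> \<rho>'. mollifier C \<delta> \<rho> \<rho>' \<Longrightarrow> \<delta> \<le> d2 \<Longrightarrow>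
        l1 (\<lambda>x. (\<integral>y. G y * \<rho> (x - y) \<partial>lborel) - G x) \<le> ennreal e"
      using mollification_converges[OF G e] by blast
    obtain d3 where d3: "0 < d3" "\<And>\<delta> \<rho> \<rho>'. 0 < \<delta> \<Longrightarrow> \<delta> \<le> d3 \<Longrightarrow> mollifier C \<delta> \<rho> \<rho>' \<Longrightarrow>
        l1 (\<lambda>x. indicator S x * commutator Y dv \<rho> \<rho>' F x) \<le> ennreal e"
      using commutator_converges[OF flow dv F K S \<delta>0 C(1) e] by blast
    define \<delta> where "\<delta> = min (min d1 d2) (min d3 \<delta>0)"
    have \<delta>: "0 < \<delta>" "\<delta> \<le> d1" "\<delta> \<le> d2" "\<delta> \<le> d3" "\<delta> \<le> \<delta>0"
      using d1 d2 d3 \<delta>0 by (auto simp: \<delta>_def)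
    obtain \<rho> :: "real ^ 'n \<Rightarrow> real" and \<rho>' where mol: "mollifier C \<delta> \<rho> \<rho>'" using C(2)[OF \<delta>(1)] by blast
    have [measurable]: "\<rho> \<in> borel_measurable borel" "\<rho>' i \<in> borel_measurable borel" for i
      by (rule mollifier_props[OF mol])+
    define m where "m = (\<lambda>H x. \<integral>y. H y * \<rho> (x - y) \<partial>(lborel :: (real ^ 'n) measure))"
    define Q where "Q = (\<lambda>x. \<integral>y. F y * (\<Sum>i\<in>UNIV. Y x $ i * \<rho>' i (x - y)) \<partial>lborel)"
    have mm[measurable]: "m H \<in> borel_measurable borel" if [measurable]: "H \<in> borel_measurable borel" for H
    proof -
      have "m H \<in> borel_measurable lborel"
        unfolding m_def by (rule lborel.borel_measurable_lebesgue_integral) measurable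
      then show ?thesis by simp
    qed
    have Qm[measurable]: "Q \<in> borel_measurable borel"
    proof -
      have "Q \<in> borel_measurable lborel"
        unfolding Q_def by (rule lborel.borel_measurable_lebesgue_integral) measurable
      then show ?thesis by simp
    qed
    define E where "E = (\<lambda>x. m F x - F x)"
    define D where "D = (\<lambda>x. indicator S x * (Q x - G x))"
    have [measurable]: "E \<in> borel_measurable borel" "D \<in> borel_measurable borel"
      unfolding E_def D_def by measurable
    have El: "l1 E \<le> ennreal e" unfolding E_def m_def by (rule d1(2)[OF mol \<delta>(2)])
    have Dl: "l1 D \<le> ennreal (2 * e)"
    proof -
      have "\<bar>D x\<bar> \<le> \<bar>indicator S x * commutator Y dv \<rho> \<rho>' F x\<bar> + \<bar>m G x - G x\<bar>" for x
      proof (cases "x \<in> S")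
        case True
        \<comment> \<open>The distributional equation tested with \<open>\<rho> (x - y)\<close>
          merges the last two terms of the split commutator into the mollified
          \<open>G\<close>.\<close>
        have "Q x = commutator Y dv \<rho> \<rho>' F x + m G x"
          using commutator_split[OF flow dv mol F(1), of x] weak[OF \<delta>(1) \<delta>(5) mol True] by (simp add: Q_def m_def)
        then show ?thesis using True by (simp add: D_def)
      qed (simp add: D_def)
      moreover have "commutator Y dv \<rho> \<rho>' F \<in> borel_measurable borel"
      proof -
        have [measurable]: "dv i \<in> borel_measurable borel" for i using dv(1) by (simp add: diagonal_derivatives_def)
        have "commutator Y dv \<rho> \<rho>' F \<in> borel_measurable lborel"
          unfolding commutator_def[abs_def] by (rule lborel.borel_measurable_lebesgue_integral) measurable
        then show ?thesis by simp
      qed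
      ultimately have "l1 D \<le> l1 (\<lambda>x. indicator S x * commutator Y dv \<rho> \<rho>' F x) + l1 (\<lambda>x. m G x - G x)"
        by (intro l1_triangle) auto
      also have "\<dots> \<le> ennreal e + ennreal e"
        using d3(2)[OF \<delta>(1) \<delta>(4) mol] d2(2)[OF mol \<delta>(3)] by (intro add_mono) (auto simp: m_def)
      also have "\<dots> = ennreal (2 * e)" using e by (simp flip: ennreal_plus)
      finally show ?thesis .
    qed
    have "AE x in lborel. \<bar>res x\<bar> \<le> \<bar>\<bar>E (\<Phi> t x)\<bar> + \<bar>E x\<bar> + \<bar>LINT s:{0..t}|lborel. D (\<Phi> s x)\<bar>\<bar>"
      using orbit_integrable_AE[OF G t0(1)]
    proof eventually_elim
      case (elim x)
      show ?case
      proof (cases "x \<in> U")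
        case True
        have inc: "(LINT s:{0..t}|lborel. Q (\<Phi> s x)) = m F (\<Phi> t x) - m F x"
          and Qi: "set_integrable lborel {0..t} (\<lambda>s. Q (\<Phi> s x))"
          using mollification_increment[OF mol F(1) t0(1), of x] by (simp_all add: Q_def m_def)
        have "(LINT s:{0..t}|lborel. D (\<Phi> s x)) = (LINT s:{0..t}|lborel. Q (\<Phi> s x) - G (\<Phi> s x))"
          unfolding set_lebesgue_integral_def
        proof (rule Bochner_Integration.integral_cong[OF refl])
          fix s
          show "indicat_real {0..t} s *\<^sub>R D (\<Phi> s x) = indicat_real {0..t} s *\<^sub>R (Q (\<Phi> s x) - G (\<Phi> s x))"
          proof (cases "s \<in> {0..t}")
            case s: True
            then have "\<Phi> s x \<in> S" using U(2)[OF True, of s] t0 by auto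
            then show ?thesis by (simp add: D_def)
          qed simp
        qed
        also have "\<dots> = (LINT s:{0..t}|lborel. Q (\<Phi> s x)) - (LINT s:{0..t}|lborel. G (\<Phi> s x))"
          using Qi elim by (rule set_integral_diff)
        finally have "res x = (LINT s:{0..t}|lborel. D (\<Phi> s x)) - E (\<Phi> t x) + E x"
          using True inc by (simp add: res_def E_def)
        then show ?thesis by linarith
      qed (simp add: res_def)
    qed
    then have "l1 res \<le> l1 (\<lambda>x. \<bar>E (\<Phi> t x)\<bar> + \<bar>E x\<bar> + \<bar>LINT s:{0..t}|lborel. D (\<Phi> s x)\<bar>)" by (rule l1_mono_AE)
    also have "\<dots> \<le> l1 (\<lambda>x. E (\<Phi> t x)) + l1 E + l1 (\<lambda>x. LINT s:{0..t}|lborel. D (\<Phi> s x))"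
    proof (rule l1_triangle3)
      show "(\<lambda>x. LINT s:{0..t}|lborel. D (\<Phi> s x)) \<in> borel_measurable borel"
        by (rule time_integral_measurable[OF flow_pair_compose_measurable]) measurable
    qed auto
    also have "\<dots> \<le> ennreal (A * e) + ennreal e + ennreal (T * (A * (2 * e)))"
    proof (intro add_mono El)
      have "l1 (\<lambda>x. E (\<Phi> t x)) \<le> ennreal A * l1 E"
        using l1_flow_le_bound[of E t T] t0 by (simp add: A_def)
      also have "\<dots> \<le> ennreal A * ennreal e" by (intro mult_left_mono El) simp
      finally show "l1 (\<lambda>x. E (\<Phi> t x)) \<le> ennreal (A * e)" using A e by (simp add: ennreal_mult)
      have "l1 (\<lambda>x. LINT s:{0..t}|lborel. D (\<Phi> s x)) \<le> ennreal t * (ennreal A * ennreal (2 * e))"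
      proof (rule l1_time_integral_le[OF flow_pair_compose_measurable t0(1)])
        fix s assume s: "s \<in> {0..t}"
        have "l1 (\<lambda>x. D (\<Phi> s x)) \<le> ennreal A * l1 D"
          using l1_flow_le_bound[of D s T] s t0 by (simp add: A_def)
        also have "\<dots> \<le> ennreal A * ennreal (2 * e)" by (intro mult_left_mono Dl) simp
        finally show "l1 (\<lambda>x. D (\<Phi> s x)) \<le> ennreal A * ennreal (2 * e)" .
      qed measurable
      also have "\<dots> = ennreal (t * (A * (2 * e)))" using t0 A e by (simp add: ennreal_mult)
      also have "\<dots> \<le> ennreal (T * (A * (2 * e)))" using t0 A e by (intro ennreal_leI mult_right_mono) auto
      finally show "l1 (\<lambda>x. LINT s:{0..t}|lborel. D (\<Phi> s x)) \<le> ennreal (T * (A * (2 * e)))" .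
    qed
    also have "\<dots> = ennreal (A * e + e + T * (A * (2 * e)))"
      using A e t0 by (simp add: ennreal_plus)
    also have "A * e + e + T * (A * (2 * e)) = (A + 1 + 2 * T * A) * e" by (simp add: algebra_simps)
    finally show ?thesis .
  qed
  have "l1 res \<le> 0"
  proof (rule ennreal_le_epsilon)
    fix e :: real assume e: "0 < e"
    define c where "c = A + 1 + 2 * T * A"
    have "0 \<le> 2 * T * A" using A t0 by simp
    then have c: "0 < c" using A unfolding c_def by linarith
    have "l1 res \<le> ennreal (c * (e / c))" unfolding c_def by (rule est) (use e c in \<open>simp add: c_def\<close>)
    then show "l1 res \<le> 0 + ennreal e" using c by simp
  qed
  then have "(\<integral>\<^sup>+x. ennreal \<bar>res x\<bar> \<partial>lborel) = 0" by (simp add: l1_def)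
  then have "AE x in lborel. ennreal \<bar>res x\<bar> = 0" using resm by (subst (asm) nn_integral_0_iff_AE) auto
  then show ?thesis
    by eventually_elim (auto simp: res_def)
qed

end

section \<open>Localisation\<close>

text \<open>On compact subsets \<open>f\<close> is Lebesgue measurable; an exhaustion by compact
  sets exhibits \<open>indicator \<Omega> x * f x\<close> as a pointwise limit, and a Lebesgue
  measurable function has a Borel version.\<close>

lemma L1loc_borel_representative:
  fixes \<Omega> :: "(real ^ 'n) set"
  assumes \<Omega>: "open \<Omega>" and f: "L1loc \<Omega> f"
  shows "\<exists>f'\<in>borel_measurable borel. AE x in lborel. x \<in> \<Omega> \<longrightarrow> f x = f' x"
proof -
  obtain C :: "nat \<Rightarrow> (real ^ 'n) set" where C: "\<And>n. compact (C n)" "\<And>n. C n \<subseteq> \<Omega>"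
      "\<And>K. compact K \<Longrightarrow> K \<subseteq> \<Omega> \<Longrightarrow> \<exists>N. \<forall>n\<ge>N. K \<subseteq> C n"
    by (rule open_Union_compact_subsets[OF \<Omega>]) blast
  define h where "h n x = indicator (C n) x *\<^sub>R f x" for n x
  have "h n \<in> borel_measurable lebesgue" for n
    using f C(1,2)[of n] unfolding L1loc_def set_integrable_def h_def by auto
  moreover have "(\<lambda>n. h n x) \<longlonglongrightarrow> indicator \<Omega> x * f x" for x
  proof (cases "x \<in> \<Omega>")
    case True
    then obtain N where "\<forall>n\<ge>N. {x} \<subseteq> C n" using C(3)[of "{x}"] by auto
    then have "eventually (\<lambda>n. h n x = indicator \<Omega> x * f x) sequentially"
      using True by (auto simp: eventually_sequentially h_def intro!: exI[of _ N])
    then show ?thesis by (rule tendsto_eventually)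
  next
    case False
    then have "h n x = 0" for n using C(2)[of n] by (auto simp: h_def indicator_def)
    then show ?thesis using False by simp
  qed
  ultimately have "(\<lambda>x. indicator \<Omega> x * f x) \<in> borel_measurable lebesgue"
    by (rule borel_measurable_LIMSEQ_real[rotated])
  from completion_ex_borel_measurable_real[OF this]
  obtain f' where f': "f' \<in> borel_measurable lborel" "AE x in lborel. indicator \<Omega> x * f x = f' x" by blast
  from f'(2) have "AE x in lborel. x \<in> \<Omega> \<longrightarrow> f x = f' x" by eventually_elim auto
  then show ?thesis using f'(1) by auto
qed

text \<open>Measurability is assumed of \<open>h'\<close> only; completeness of Lebesgue measure
  passes it on to \<open>h\<close>.\<close>

lemma lebesgue_integral_eq_lborel:
  fixes h h' :: "'a::euclidean_space \<Rightarrow> real"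
  assumes h': "h' \<in> borel_measurable borel" and ae: "AE x in lborel. h x = h' x"
  shows "(\<integral>x. h x \<partial>lebesgue) = (\<integral>x. h' x \<partial>lborel)"
proof -
  have m': "h' \<in> borel_measurable lebesgue" using h' by (simp add: measurable_completion)
  have ae': "AE x in lebesgue. h x = h' x" using ae by (rule AE_completion)
  have "AE x in lebesgue. h' x = h x" using ae' by eventually_elim simp
  then have m: "h \<in> borel_measurable lebesgue" by (rule borel_measurable_AE[OF m'])
  have "(\<integral>x. h x \<partial>lebesgue) = (\<integral>x. h' x \<partial>lebesgue)" by (rule integral_cong_AE[OF m m' ae'])
  also have "\<dots> = (\<integral>x. h' x \<partial>lborel)" using h' by (intro integral_completion) simp
  finally show ?thesis .
qed

lemma L1loc_integrable_representative:
  fixes f f' :: "real ^ 'n \<Rightarrow> real"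
  assumes f: "L1loc \<Omega> f" and K: "compact K" "K \<subseteq> \<Omega>"
    and f': "f' \<in> borel_measurable borel" "AE x in lborel. x \<in> \<Omega> \<longrightarrow> f x = f' x"
  shows "integrable lborel (\<lambda>x. indicator K x * f' x)"
proof -
  have [measurable]: "K \<in> sets borel" "f' \<in> borel_measurable borel" using K f' by (auto simp: compact_imp_closed)
  have i: "integrable lebesgue (\<lambda>x. indicator K x *\<^sub>R f x)"
    using f K unfolding L1loc_def set_integrable_def by blast
  have m: "(\<lambda>x. indicator K x * f' x) \<in> borel_measurable lborel" by measurable
  have "AE x in lebesgue. indicator K x *\<^sub>R f x = indicator K x * f' x"
    using AE_completion[OF f'(2)] by eventually_elim (use K in \<open>auto simp: indicator_def\<close>)
  then have "integrable lebesgue (\<lambda>x. indicator K x * f' x)"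
    using i m by (subst integrable_cong_AE[symmetric, where f = "\<lambda>x. indicator K x *\<^sub>R f x"])
      (auto simp: measurable_completion)
  then show ?thesis using integrable_completion[OF m] by simp
qed

lemma (in lipschitz_flow) flow_vimage_null:
  assumes N: "N \<in> null_sets lborel"
  shows "\<Phi> t -` N \<in> null_sets lborel"
proof -
  have "N \<in> sets borel" "emeasure lborel N = 0" using N by auto
  moreover have "\<Phi> t -` N \<in> sets borel"
    using measurable_sets[OF borel_measurable_continuous_onI[OF flow_continuous_space] \<open>N \<in> sets borel\<close>] by simp
  ultimately show ?thesis using flow_vimage_emeasure[of N t] by (auto simp: null_sets_def)
qed

text \<open>Null sets have null preimages under every \<open>\<Phi> t\<close>, so by Fubini almost
  every orbit spends almost no time in \<open>N\<close>. This is why exchanging \<open>f\<close> and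
  \<open>g\<close> for representatives does not affect time integrals along almost every
  orbit.\<close>

lemma (in lipschitz_flow) orbit_AE_notin:
  assumes N: "N \<in> null_sets lborel"
  shows "AE p in lborel \<Otimes>\<^sub>M lborel. \<Phi> (fst p) (snd p) \<notin> N"
    and "AE x in lborel. AE s in lborel. \<Phi> s x \<notin> N"
proof -
  have Nb[measurable]: "N \<in> sets borel" using N by auto
  have 1: "AE t in lborel. AE x in lborel. \<Phi> t x \<notin> N"
  proof (rule AE_I2)
    fix t show "AE x in lborel. \<Phi> t x \<notin> N"
      using AE_not_in[OF flow_vimage_null[OF N, of t]] by simp
  qed
  have "(\<lambda>p. \<Phi> (fst p) (snd p)) \<in> measurable (lborel \<Otimes>\<^sub>M lborel) borel"
    using flow_measurable_pair by simp
  then have m: "{p \<in> space (lborel \<Otimes>\<^sub>M lborel). \<Phi> (fst p) (snd p) \<notin> N} \<in> sets (lborel \<Otimes>\<^sub>M lborel)"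
    by measurable
  show "AE p in lborel \<Otimes>\<^sub>M lborel. \<Phi> (fst p) (snd p) \<notin> N"
    using lborel_pair.AE_pair_measure[OF m] 1 by simp
  show "AE x in lborel. AE s in lborel. \<Phi> s x \<notin> N"
    using lborel_pair.AE_commute[OF m] 1 by simp
qed

lemma AE_lborel_pair_snd:
  fixes P :: "'b::euclidean_space \<Rightarrow> bool"
  assumes "AE x in lborel. P x"
  shows "AE p in (lborel :: 'a::euclidean_space measure) \<Otimes>\<^sub>M lborel. P (snd p)"
proof -
  obtain Z where Z: "{x \<in> space lborel. \<not> P x} \<subseteq> Z" "emeasure lborel Z = 0" "Z \<in> sets lborel"
    using assms by (rule AE_E)
  have Zn: "Z \<in> null_sets lborel" using Z by auto
  then have [measurable]: "Z \<in> sets borel" by auto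
  have "AE p in (lborel :: 'a measure) \<Otimes>\<^sub>M lborel. snd p \<notin> Z"
  proof -
    have "{p \<in> space ((lborel :: 'a measure) \<Otimes>\<^sub>M lborel). snd p \<notin> Z} \<in> sets (lborel \<Otimes>\<^sub>M lborel)" by measurable
    moreover have "AE x in (lborel :: 'a measure). AE y in lborel. snd (x, y) \<notin> Z"
      using AE_not_in[OF Zn] by simp
    ultimately show ?thesis by (rule lborel_pair.AE_pair_measure)
  qed
  then show ?thesis
  proof eventually_elim
    case (elim p)
    then show ?case using Z(1) by auto
  qed
qed

section \<open>Charts: transfer to the global flow near a compact set\<close>

text \<open>Bundles what carries statements near \<open>K\<close> over to the global flow: a cut-off
  field equal to \<open>X\<close> up to distance \<open>d\<close>, its diagonal derivatives, and
  Borel representatives of \<open>f\<close> and \<open>g\<close> off a common null set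
  \<open>N\<close>.\<close>

locale field_chart = lipschitz_flow Y L M \<Phi> for Y :: "real ^ 'n \<Rightarrow> real ^ 'n" and L M \<Phi> +
  fixes \<Omega> :: "(real ^ 'n) set" and X :: "real ^ 'n \<Rightarrow> real ^ 'n" and K :: "(real ^ 'n) set" and d :: real
    and dv :: "'n \<Rightarrow> real ^ 'n \<Rightarrow> real" and f g f' g' :: "real ^ 'n \<Rightarrow> real" and N :: "(real ^ 'n) set"
  assumes field: "locally_lipschitz_field \<Omega> X"
    and d_pos: "0 < d" and compact_nbhd: "compact {x. infdist x K \<le> d}" and nbhd_subset: "{x. infdist x K \<le> d} \<subseteq> \<Omega>"
    and Y_eq_X: "infdist x K \<le> d \<Longrightarrow> Y x = X x"
    and dv: "diagonal_derivatives Y dv" "\<bar>dv i x\<bar> \<le> L"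
    and L1: "L1loc \<Omega> f" "L1loc \<Omega> g"
    and rep: "f' \<in> borel_measurable borel" "g' \<in> borel_measurable borel"
      "N \<in> null_sets lborel" "x \<in> \<Omega> \<Longrightarrow> x \<notin> N \<Longrightarrow> f x = f' x" "x \<in> \<Omega> \<Longrightarrow> x \<notin> N \<Longrightarrow> g x = g' x"
begin

definition Kd where "Kd = {x. infdist x K \<le> d}"
definition V where "V = {x. infdist x K < d}"
text \<open>Truncation to the compact set \<open>Kd\<close> turns local integrability into
  integrability on the whole space; a jump at the boundary of \<open>Kd\<close> is not met by orbits
  that remain in \<open>V\<close>.\<close>

definition F where "F x = indicator Kd x * f' x"
definition G where "G x = indicator Kd x * g' x"

lemma V_open: "open V"
  unfolding V_def by (intro open_Collect_less continuous_intros)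

lemma V_Kd: "V \<subseteq> Kd" "Kd \<subseteq> \<Omega>" "V \<subseteq> \<Omega>"
  using nbhd_subset by (auto simp: V_def Kd_def)

lemma Kd_compact: "compact Kd"
  using compact_nbhd by (simp add: Kd_def)

lemma AE_N: "AE x in lborel. x \<notin> N" using rep(3) by (rule AE_not_in)

lemma F_integrable: "integrable lborel F"
  unfolding F_def by (rule L1loc_integrable_representative[OF L1(1) Kd_compact V_Kd(2) rep(1)])
    (use AE_N in eventually_elim, use rep(4) in auto)

lemma G_integrable: "integrable lborel G"
  unfolding G_def by (rule L1loc_integrable_representative[OF L1(2) Kd_compact V_Kd(2) rep(2)])
    (use AE_N in eventually_elim, use rep(5) in auto)

lemma F_zero: "x \<notin> Kd \<Longrightarrow> F x = 0" by (simp add: F_def)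

lemma F_measurable [measurable]: "F \<in> borel_measurable borel" using F_integrable by auto
lemma G_measurable [measurable]: "G \<in> borel_measurable borel" using G_integrable by auto

lemma F_eq: "x \<in> V \<Longrightarrow> x \<notin> N \<Longrightarrow> F x = f x" and G_eq: "x \<in> V \<Longrightarrow> x \<notin> N \<Longrightarrow> G x = g x"
  using V_Kd rep(4,5) by (auto simp: F_def G_def indicator_def)

lemma near_K:
  assumes "infdist x K \<le> r" "0 \<le> s" "M * s < d - r"
  shows "\<Phi> s x \<in> V"
proof -
  have "infdist (\<Phi> s x) K \<le> infdist x K + dist (\<Phi> s x) x" by (rule infdist_triangle)
  also have "dist (\<Phi> s x) x \<le> M * s" using flow_speed[of s x 0] assms(2) by (simp add: init)
  finally show ?thesis using assms by (simp add: V_def)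
qed

lemma flow_in_V:
  assumes "0 \<le> t" "\<And>s. s \<in> {0..t} \<Longrightarrow> \<Phi> s x \<in> V"
  shows "(t, x) \<in> flow_domain \<Omega> X" "\<And>s. s \<in> {0..t} \<Longrightarrow> flow \<Omega> X s x = \<Phi> s x"
proof -
  have VY: "Y y = X y" if "y \<in> V" for y using that Y_eq_X by (simp add: V_def)
  note * = flow_eq_lipschitz_flow[OF field lipschitz_flow_axioms V_open V_Kd(3) VY assms]
  have "x \<in> \<Omega>" using assms(2)[of 0] assms(1) V_Kd(3) by (auto simp: init)
  then show "(t, x) \<in> flow_domain \<Omega> X" using *(1) assms(1) by (auto simp: flow_domain_def)
  show "flow \<Omega> X s x = \<Phi> s x" if "s \<in> {0..t}" for s by (rule *(2)) (use that in auto)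
qed

text \<open>The orbit stays where both flows and both pairs of functions agree. The three conditions
  on \<open>N\<close> guard the initial point, the end point and almost every time on the
  orbit.\<close>

lemma increment_eq_iff:
  assumes t: "0 \<le> t" "\<And>s. s \<in> {0..t} \<Longrightarrow> \<Phi> s x \<in> V"
    and N: "x \<notin> N" "\<Phi> t x \<notin> N" "AE s in lborel. \<Phi> s x \<notin> N"
  shows "f (flow \<Omega> X t x) - f x = (LINT s:{0..t}|lebesgue. g (flow \<Omega> X s x)) \<longleftrightarrow>
    F (\<Phi> t x) - F x = (LINT s:{0..t}|lborel. G (\<Phi> s x))"
proof -
  note fl = flow_in_V(2)[OF t]
  have "f (flow \<Omega> X t x) = F (\<Phi> t x)" using fl[of t] t N F_eq by simp
  moreover have "f x = F x" using t(2)[of 0] t(1) N F_eq by (simp add: init)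
  moreover have "(LINT s:{0..t}|lebesgue. g (flow \<Omega> X s x)) = (LINT s:{0..t}|lborel. G (\<Phi> s x))"
    unfolding set_lebesgue_integral_def
  proof (rule lebesgue_integral_eq_lborel)
    have [measurable]: "(\<lambda>s. \<Phi> s x) \<in> borel_measurable borel"
      using flow_continuous_time by (rule borel_measurable_continuous_onI)
    show "(\<lambda>s. indicat_real {0..t} s *\<^sub>R G (\<Phi> s x)) \<in> borel_measurable borel" by measurable
    show "AE s in lborel. indicat_real {0..t} s *\<^sub>R g (flow \<Omega> X s x) = indicat_real {0..t} s *\<^sub>R G (\<Phi> s x)"
      using N(3) by eventually_elim (use fl t(2) G_eq in \<open>auto simp: indicator_def\<close>)
  qed
  ultimately show ?thesis by simp
qed

lemma quotient_integral_eq: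
  assumes W: "W \<in> sets borel" and t: "0 \<le> t" "\<And>x s. x \<in> W \<Longrightarrow> s \<in> {0..t} \<Longrightarrow> \<Phi> s x \<in> V"
  shows "(LINT x:W|lebesgue. \<bar>diff_quotient \<Omega> X t f x - g x\<bar>)
    = (\<integral>x. \<bar>indicator W x * ((F (\<Phi> t x) - F x) / t - G x)\<bar> \<partial>lborel)"
  unfolding set_lebesgue_integral_def
proof (rule lebesgue_integral_eq_lborel)
  have [measurable]: "W \<in> sets borel" "\<Phi> t \<in> borel_measurable borel"
    using W flow_continuous_space by (auto intro: borel_measurable_continuous_onI)
  show "(\<lambda>x. \<bar>indicator W x * ((F (\<Phi> t x) - F x) / t - G x)\<bar>) \<in> borel_measurable borel" by measurable
  have "AE x in lborel. \<Phi> t x \<notin> N"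
    using AE_not_in[OF flow_vimage_null[OF rep(3), of t]] by simp
  with AE_N show "AE x in lborel. indicat_real W x *\<^sub>R \<bar>diff_quotient \<Omega> X t f x - g x\<bar>
      = \<bar>indicator W x * ((F (\<Phi> t x) - F x) / t - G x)\<bar>"
  proof eventually_elim
    case (elim x)
    show ?case
    proof (cases "x \<in> W")
      case True
      have "\<Phi> t x \<in> V" "x \<in> V" using t(2)[OF True, of t] t(2)[OF True, of 0] t(1) by (auto simp: init)
      moreover have "flow \<Omega> X t x = \<Phi> t x" using flow_in_V(2)[OF t(1) t(2)[OF True]] t(1) by simp
      ultimately show ?thesis using True elim F_eq G_eq by (simp add: diff_quotient_def)
    qed simp
  qed
qed

text \<open>Derivatives are local: \<open>V\<close> is open and the fields agree on it, so the
  derivatives chosen for \<open>Y\<close> are those of \<open>X\<close> there.\<close>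

lemma divergence_eq_AE: "AE x in lborel. x \<in> V \<longrightarrow> divergence X x = (\<Sum>i\<in>UNIV. dv i x)"
proof -
  have "AE x in lborel. \<forall>i\<in>UNIV. ((\<lambda>s. Y (x + s *\<^sub>R axis i 1) $ i) has_field_derivative dv i x) (at 0)"
    using dv(1) by (intro AE_finite_allI) (auto simp: diagonal_derivatives_def)
  then show ?thesis
  proof eventually_elim
    case (elim x)
    show ?case
    proof
      assume x: "x \<in> V"
      have "partial i (\<lambda>y. X y $ i) x = dv i x" for i
        unfolding partial_def
      proof (rule DERIV_imp_deriv)
        have "isCont (\<lambda>s. x + s *\<^sub>R axis i 1) 0" by (intro continuous_intros)
        then have "((\<lambda>s. x + s *\<^sub>R axis i 1) \<longlongrightarrow> x) (nhds 0)"
          unfolding isCont_def by (subst (asm) tendsto_at_iff_tendsto_nhds) simp_all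
        then have "eventually (\<lambda>s. x + s *\<^sub>R axis i 1 \<in> V) (nhds 0)"
          using V_open x by (rule topological_tendstoD)
        then have "eventually (\<lambda>s. X (x + s *\<^sub>R axis i 1) $ i = Y (x + s *\<^sub>R axis i 1) $ i) (nhds 0)"
          by (rule eventually_mono) (simp add: V_def Y_eq_X)
        then show "((\<lambda>s. X (x + s *\<^sub>R axis i 1) $ i) has_field_derivative dv i x) (at 0)"
          using elim by (subst DERIV_cong_ev[OF refl _ refl]) auto
      qed
      then show "divergence X x = (\<Sum>i\<in>UNIV. dv i x)" by (simp add: divergence_def)
    qed
  qed
qed

lemma distr_terms_eq:
  assumes u: "axis_C1 u u'" and supp: "closure {x. u x \<noteq> 0} \<subseteq> V"
  shows "(LINT x:\<Omega>|lebesgue. g x * u x) = (\<integral>x. G x * u x \<partial>lborel)"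
    and "(LINT x:\<Omega>|lebesgue. f x * apply_field X u x) = (\<integral>x. F x * (\<Sum>i\<in>UNIV. Y x $ i * u' i x) \<partial>lborel)"
    and "(LINT x:\<Omega>|lebesgue. f x * u x * divergence X x) = (\<integral>x. F x * (u x * (\<Sum>i\<in>UNIV. dv i x)) \<partial>lborel)"
proof -
  have cY: "continuous_on UNIV Y" using lip by (rule lipschitz_on_continuous_on)
  have [measurable]: "u \<in> borel_measurable borel" "u' i \<in> borel_measurable borel" "dv i \<in> borel_measurable borel"
      "(\<lambda>x. Y x $ i) \<in> borel_measurable borel" for i
    using u dv(1) cY by (auto simp: axis_C1_def diagonal_derivatives_def intro!: borel_measurable_continuous_onI continuous_intros)
  have u0: "u x = 0" if "x \<notin> V" for x using that supp closure_subset[of "{x. u x \<noteq> 0}"] by blast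
  have u'0: "u' i x = 0" if "x \<notin> V" for i x
    by (rule axis_C1_zero_on_open[OF u, of "- closure {x. u x \<noteq> 0}"])
      (use that supp closure_subset[of "{x. u x \<noteq> 0}"] in auto)
  have part: "partial i u x = u' i x" for i x
    unfolding partial_def using u by (intro DERIV_imp_deriv) (simp add: axis_C1_def)
  \<comment> \<open>Outside \<open>V\<close> the fields may differ, but there the derivatives of
    \<open>u\<close> vanish.\<close>
  have a: "apply_field X u x = (\<Sum>i\<in>UNIV. Y x $ i * u' i x)" for x
  proof (cases "x \<in> V")
    case True
    then show ?thesis by (simp add: apply_field_def part Y_eq_X V_def)
  qed (simp add: apply_field_def part u'0)
  show "(LINT x:\<Omega>|lebesgue. g x * u x) = (\<integral>x. G x * u x \<partial>lborel)"
    unfolding set_lebesgue_integral_def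
  proof (rule lebesgue_integral_eq_lborel)
    show "AE x in lborel. indicat_real \<Omega> x *\<^sub>R (g x * u x) = G x * u x"
      using AE_N
    proof eventually_elim
      case (elim x)
      then show ?case using V_Kd(3) u0[of x] G_eq[of x] by (cases "x \<in> V") auto
    qed
  qed measurable
  show "(LINT x:\<Omega>|lebesgue. f x * apply_field X u x) = (\<integral>x. F x * (\<Sum>i\<in>UNIV. Y x $ i * u' i x) \<partial>lborel)"
    unfolding set_lebesgue_integral_def a
  proof (rule lebesgue_integral_eq_lborel)
    show "AE x in lborel. indicat_real \<Omega> x *\<^sub>R (f x * (\<Sum>i\<in>UNIV. Y x $ i * u' i x)) = F x * (\<Sum>i\<in>UNIV. Y x $ i * u' i x)"
      using AE_N
    proof eventually_elim
      case (elim x)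
      then show ?case using V_Kd(3) u'0[of x] F_eq[of x] by (cases "x \<in> V") auto
    qed
  qed measurable
  show "(LINT x:\<Omega>|lebesgue. f x * u x * divergence X x) = (\<integral>x. F x * (u x * (\<Sum>i\<in>UNIV. dv i x)) \<partial>lborel)"
    unfolding set_lebesgue_integral_def
  proof (rule lebesgue_integral_eq_lborel)
    show "AE x in lborel. indicat_real \<Omega> x *\<^sub>R (f x * u x * divergence X x) = F x * (u x * (\<Sum>i\<in>UNIV. dv i x))"
      using AE_N divergence_eq_AE
    proof eventually_elim
      case (elim x)
      then show ?case using V_Kd(3) u0[of x] F_eq[of x] by (cases "x \<in> V") auto
    qed
  qed measurable
qed

lemma lie_derivative_imp_limit:
  assumes lie: "is_lie_derivative \<Omega> X f g" and W: "W \<in> sets borel" "W \<subseteq> K"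
  shows "((\<lambda>t. LINT x:W|lebesgue. \<bar>diff_quotient \<Omega> X t f x - g x\<bar>) \<longlongrightarrow> 0) (at_right 0)"
proof -
  \<comment> \<open>In time less than \<open>\<tau>\<close> a point of \<open>K\<close> moves by
    less than \<open>d\<close>, so orbits from \<open>W\<close> stay in \<open>V\<close>.\<close>
  define \<tau> where "\<tau> = d / (M + 1)"
  have \<tau>: "0 < \<tau>" using d_pos M_nonneg by (simp add: \<tau>_def)
  have M\<tau>: "M * s < d - 0" if "0 \<le> s" "s < \<tau>" for s
  proof -
    have "M * s \<le> (M + 1) * s" using that by (intro mult_right_mono) auto
    also have "\<dots> < (M + 1) * \<tau>" using that M_nonneg by (intro mult_strict_left_mono) auto
    finally show ?thesis using M_nonneg by (simp add: \<tau>_def)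
  qed
  have inV: "\<Phi> s x \<in> V" if "x \<in> W" "0 \<le> s" "s < \<tau>" for x s
    by (rule near_K[of x 0]) (use that M\<tau> W in auto)
  have "AE p in lborel. (case p of (t, x) \<Rightarrow> (t, x) \<in> flow_domain_pos \<Omega> X \<longrightarrow>
        f (flow \<Omega> X t x) - f x = (LINT s:{0..t}|lebesgue. g (flow \<Omega> X s x)))"
    using lie unfolding is_lie_derivative_def by (simp only: AE_completion_iff)
  then have "AE p in lborel \<Otimes>\<^sub>M lborel. (case p of (t, x) \<Rightarrow> (t, x) \<in> flow_domain_pos \<Omega> X \<longrightarrow>
        f (flow \<Omega> X t x) - f x = (LINT s:{0..t}|lebesgue. g (flow \<Omega> X s x)))"
    by (simp only: lborel_prod)
  \<comment> \<open>Fubini for null sets: almost all pairs become, for almost all \<open>t\<close>,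
    almost all \<open>x\<close>.\<close>
  from lborel_pair.AE_pair[OF this]
  have "AE t in lborel. AE x in lborel. (t, x) \<in> flow_domain_pos \<Omega> X \<longrightarrow>
        f (flow \<Omega> X t x) - f x = (LINT s:{0..t}|lebesgue. g (flow \<Omega> X s x))" by simp
  then have ae: "AE t in lborel. 0 < t \<and> t < \<tau> \<longrightarrow>
      (AE x in lborel. x \<in> W \<longrightarrow> F (\<Phi> t x) - F x = (LINT s:{0..t}|lborel. G (\<Phi> s x)))"
  proof eventually_elim
    case (elim t)
    show ?case
    proof
      assume t: "0 < t \<and> t < \<tau>"
      have "AE x in lborel. \<Phi> t x \<notin> N"
        using AE_not_in[OF flow_vimage_null[OF rep(3), of t]] by simp
      with elim AE_N orbit_AE_notin(2)[OF rep(3)]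
      show "AE x in lborel. x \<in> W \<longrightarrow> F (\<Phi> t x) - F x = (LINT s:{0..t}|lborel. G (\<Phi> s x))"
      proof eventually_elim
        case (elim x)
        show ?case
        proof
          assume x: "x \<in> W"
          have V: "\<Phi> s x \<in> V" if "s \<in> {0..t}" for s using inV[OF x, of s] that t by auto
          have t0: "0 \<le> t" using t by simp
          have "(t, x) \<in> flow_domain_pos \<Omega> X"
            using flow_in_V(1)[OF t0 V] t by (auto simp: flow_domain_pos_def)
          then show "F (\<Phi> t x) - F x = (LINT s:{0..t}|lborel. G (\<Phi> s x))"
            using elim increment_eq_iff[OF t0 V] by blast
        qed
      qed
    qed
  qed
  show ?thesis
  proof (rule tendstoI)
    fix e :: real assume e: "0 < e"
    have "0 < e / 2" using e by simp
    from lie_derivative_imp_quotient_limit[OF F_integrable G_integrable W(1) \<tau> ae this]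
    obtain \<delta> where \<delta>: "0 < \<delta>" "\<And>t. 0 < t \<Longrightarrow> t < \<delta> \<Longrightarrow>
        l1 (\<lambda>x. indicator W x * ((F (\<Phi> t x) - F x) / t - G x)) \<le> ennreal (e/2)" by blast
    have "dist (LINT x:W|lebesgue. \<bar>diff_quotient \<Omega> X t f x - g x\<bar>) 0 < e" if t: "0 < t" "t < min \<delta> \<tau>" for t
    proof -
      define h where "h = (\<lambda>x. indicator W x * ((F (\<Phi> t x) - F x) / t - G x))"
      have "integrable lborel (\<lambda>x. (F (\<Phi> t x) - F x) / t - G x)"
        using F_integrable G_integrable integrable_flow[OF F_integrable, of t] by auto
      then have hi: "integrable lborel h"
        unfolding h_def using integrable_mult_indicator[of W lborel "\<lambda>x. (F (\<Phi> t x) - F x) / t - G x"] W(1) by simp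
      have "l1 h \<le> ennreal (e/2)" unfolding h_def using \<delta>(2) t by simp
      then have "(\<integral>x. \<bar>h x\<bar> \<partial>lborel) \<le> e/2"
        unfolding l1_eq_integral[OF hi] using e by (subst (asm) ennreal_le_iff) auto
      moreover have "(LINT x:W|lebesgue. \<bar>diff_quotient \<Omega> X t f x - g x\<bar>) = (\<integral>x. \<bar>h x\<bar> \<partial>lborel)"
        unfolding h_def by (rule quotient_integral_eq[OF W(1)]) (use t inV in auto)
      ultimately show ?thesis using e by simp
    qed
    then show "\<forall>\<^sub>F t in at_right 0. dist (LINT x:W|lebesgue. \<bar>diff_quotient \<Omega> X t f x - g x\<bar>) 0 < e"
      unfolding eventually_at_right_field using \<delta>(1) \<tau> by (intro exI[of _ "min \<delta> \<tau>"]) auto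
  qed
qed

text \<open>The pairings of the difference quotients with \<open>u\<close> have two limits: one from
  \<open>weak_quotient_limit\<close>, the other the pairing of \<open>G\<close> with
  \<open>u\<close>, because the quotients converge in L^1 near the support of \<open>u\<close>.
  Their equality is the distributional equation.\<close>

lemma limit_imp_distr_equation:
  assumes u: "axis_C1 u u'" "bounded {x. u x \<noteq> 0}" and supp: "closure {x. u x \<noteq> 0} \<subseteq> K"
    and lim: "((\<lambda>t. LINT x:{x. infdist x K < d / 2}|lebesgue. \<bar>diff_quotient \<Omega> X t f x - g x\<bar>) \<longlongrightarrow> 0) (at_right 0)"
  shows "(LINT x:\<Omega>|lebesgue. g x * u x) = - (LINT x:\<Omega>|lebesgue. f x * apply_field X u x)
          - (LINT x:\<Omega>|lebesgue. f x * u x * divergence X x)"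
proof -
  \<comment> \<open>Condition (iii) concerns open sets, hence a neighbourhood of \<open>K\<close>;
    stopping at distance \<open>d / 2\<close> leaves room for orbits inside
    \<open>V\<close>.\<close>
  define W where "W = {x. infdist x K < d / 2}"
  have "open W" unfolding W_def by (intro open_Collect_less continuous_intros)
  then have Wb[measurable]: "W \<in> sets borel" by simp
  define \<tau> where "\<tau> = d / (2 * (M + 1))"
  have \<tau>: "0 < \<tau>" using d_pos M_nonneg by (simp add: \<tau>_def)
  have M\<tau>: "M * s < d - d / 2" if "0 \<le> s" "s \<le> \<tau>" for s
  proof -
    have "M * s \<le> M * \<tau>" using that M_nonneg by (intro mult_left_mono)
    also have "\<dots> < (M + 1) * \<tau>" using \<tau> by (intro mult_strict_right_mono) auto
    also have "\<dots> = d / 2"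
    proof -
      have "M + 1 \<noteq> 0" using M_nonneg by linarith
      then show ?thesis by (simp add: \<tau>_def divide_simps)
    qed
    finally show ?thesis by simp
  qed
  have inV: "\<Phi> s x \<in> V" if "x \<in> W" "0 \<le> s" "s \<le> \<tau>" for x s
    by (rule near_K[of x "d / 2"]) (use that M\<tau> in \<open>auto simp: W_def\<close>)
  have KW: "K \<subseteq> W" using d_pos by (auto simp: W_def)
  obtain B R where B: "0 \<le> B" "\<And>x. \<bar>u x\<bar> \<le> B" using axis_C1_bounds[OF u] by metis
  have um[measurable]: "u \<in> borel_measurable borel" using u(1) by (auto simp: axis_C1_def intro: borel_measurable_continuous_onI)
  have u0: "u x = 0" if "x \<notin> K" for x using that supp closure_subset[of "{x. u x \<noteq> 0}"] by blast
  have lim1: "((\<lambda>t. \<integral>x. (F (\<Phi> t x) - F x) / t * u x \<partial>lborel) \<longlongrightarrow>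
      - (\<integral>x. F x * (\<Sum>i\<in>UNIV. u' i x * Y x $ i + u x * dv i x) \<partial>lborel)) (at_right 0)"
    by (rule weak_quotient_limit[OF lipschitz_flow_axioms dv F_integrable F_zero Kd_compact u u0 \<tau>])
      (use inV KW V_Kd(1) in blast)+
  have lim2: "((\<lambda>t. \<integral>x. (F (\<Phi> t x) - F x) / t * u x \<partial>lborel) \<longlongrightarrow> (\<integral>x. G x * u x \<partial>lborel)) (at_right 0)"
  proof (rule Lim_transform)
    show "((\<lambda>t. \<integral>x. G x * u x \<partial>lborel) \<longlongrightarrow> (\<integral>x. G x * u x \<partial>lborel)) (at_right 0)" by simp
    show "((\<lambda>t. (\<integral>x. (F (\<Phi> t x) - F x) / t * u x \<partial>lborel) - (\<integral>x. G x * u x \<partial>lborel)) \<longlongrightarrow> 0) (at_right 0)"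
    proof (rule Lim_null_comparison)
      have "((\<lambda>t. B * (LINT x:W|lebesgue. \<bar>diff_quotient \<Omega> X t f x - g x\<bar>)) \<longlongrightarrow> B * 0) (at_right 0)"
        by (intro tendsto_mult_left) (use lim in \<open>simp add: W_def\<close>)
      then show "((\<lambda>t. B * (LINT x:W|lebesgue. \<bar>diff_quotient \<Omega> X t f x - g x\<bar>)) \<longlongrightarrow> 0) (at_right 0)" by simp
      have "norm ((\<integral>x. (F (\<Phi> t x) - F x) / t * u x \<partial>lborel) - (\<integral>x. G x * u x \<partial>lborel))
          \<le> B * (LINT x:W|lebesgue. \<bar>diff_quotient \<Omega> X t f x - g x\<bar>)" if t: "0 < t" "t < \<tau>" for t
      proof -
        define q where "q = (\<lambda>x. (F (\<Phi> t x) - F x) / t)"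
        define h where "h = (\<lambda>x. indicator W x * (q x - G x))"
        have qi: "integrable lborel q" unfolding q_def
          using F_integrable integrable_flow[OF F_integrable, of t] by auto
        then have hi: "integrable lborel h"
          unfolding h_def using integrable_mult_indicator[of W lborel "\<lambda>x. q x - G x"] G_integrable by simp
        have qu: "integrable lborel (\<lambda>x. q x * u x)" "integrable lborel (\<lambda>x. G x * u x)"
          by (rule integrable_bounded_mult[OF qi um B(2)], rule integrable_bounded_mult[OF G_integrable um B(2)])
        have "(\<integral>x. q x * u x \<partial>lborel) - (\<integral>x. G x * u x \<partial>lborel) = (\<integral>x. q x * u x - G x * u x \<partial>lborel)"
          by (rule Bochner_Integration.integral_diff[OF qu, symmetric])
        also have "\<dots> = (\<integral>x. h x * u x \<partial>lborel)"
        proof (rule Bochner_Integration.integral_cong[OF refl])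
          fix x show "q x * u x - G x * u x = h x * u x"
            using u0[of x] KW by (cases "x \<in> W") (auto simp: h_def left_diff_distrib)
        qed
        finally have "norm ((\<integral>x. q x * u x \<partial>lborel) - (\<integral>x. G x * u x \<partial>lborel)) \<le> B * (\<integral>x. \<bar>h x\<bar> \<partial>lborel)"
          using abs_integral_bounded_mult[OF hi um B(2)] by simp
        moreover have "(LINT x:W|lebesgue. \<bar>diff_quotient \<Omega> X t f x - g x\<bar>) = (\<integral>x. \<bar>h x\<bar> \<partial>lborel)"
          unfolding h_def q_def by (rule quotient_integral_eq[OF Wb]) (use t inV in auto)
        ultimately show ?thesis by (simp add: q_def)
      qed
      then show "\<forall>\<^sub>F t in at_right 0. norm ((\<integral>x. (F (\<Phi> t x) - F x) / t * u x \<partial>lborel) - (\<integral>x. G x * u x \<partial>lborel))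
          \<le> B * (LINT x:W|lebesgue. \<bar>diff_quotient \<Omega> X t f x - g x\<bar>)"
        unfolding eventually_at_right_field using \<tau> by blast
    qed
  qed
  have main: "(\<integral>x. G x * u x \<partial>lborel) = - (\<integral>x. F x * (\<Sum>i\<in>UNIV. u' i x * Y x $ i + u x * dv i x) \<partial>lborel)"
    by (rule tendsto_unique[OF _ lim2 lim1]) simp
  obtain B1 R1 where B1: "0 \<le> B1" "\<And>i x. \<bar>u' i x\<bar> \<le> B1" using axis_C1_bounds[OF u] by metis
  have [measurable]: "u' i \<in> borel_measurable borel" "dv i \<in> borel_measurable borel" "(\<lambda>x. Y x $ i) \<in> borel_measurable borel" for i
    using u(1) dv(1) lipschitz_on_continuous_on[OF lip]
    by (auto simp: axis_C1_def diagonal_derivatives_def intro!: borel_measurable_continuous_onI continuous_intros)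
  have i1: "integrable lborel (\<lambda>x. F x * (\<Sum>i\<in>UNIV. Y x $ i * u' i x))"
  proof (rule integrable_bounded_mult[OF F_integrable, where B = "real CARD('n) * (M * B1)"])
    fix x
    have "\<bar>\<Sum>i\<in>UNIV. Y x $ i * u' i x\<bar> \<le> (\<Sum>i\<in>(UNIV :: 'n set). M * B1)"
    proof (rule order_trans[OF sum_abs sum_mono])
      fix i
      have "\<bar>Y x $ i\<bar> \<le> M" using component_le_norm_cart[of "Y x" i] bound[of x] by linarith
      then show "\<bar>Y x $ i * u' i x\<bar> \<le> M * B1" unfolding abs_mult using B1 M_nonneg by (intro mult_mono) auto
    qed
    then show "\<bar>\<Sum>i\<in>UNIV. Y x $ i * u' i x\<bar> \<le> real CARD('n) * (M * B1)" by simp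
  qed measurable
  have i2: "integrable lborel (\<lambda>x. F x * (u x * (\<Sum>i\<in>UNIV. dv i x)))"
  proof (rule integrable_bounded_mult[OF F_integrable, where B = "B * (real CARD('n) * L)"])
    fix x
    have "\<bar>\<Sum>i\<in>UNIV. dv i x\<bar> \<le> (\<Sum>i\<in>(UNIV :: 'n set). L)" by (rule order_trans[OF sum_abs sum_mono]) (rule dv(2))
    then show "\<bar>u x * (\<Sum>i\<in>UNIV. dv i x)\<bar> \<le> B * (real CARD('n) * L)"
      unfolding abs_mult using B by (intro mult_mono) auto
  qed measurable
  have "(\<lambda>x. F x * (\<Sum>i\<in>UNIV. u' i x * Y x $ i + u x * dv i x)) =
      (\<lambda>x. F x * (\<Sum>i\<in>UNIV. Y x $ i * u' i x) + F x * (u x * (\<Sum>i\<in>UNIV. dv i x)))"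
    by (rule ext) (simp add: sum.distrib sum_distrib_left distrib_left mult.commute)
  then have "(\<integral>x. F x * (\<Sum>i\<in>UNIV. u' i x * Y x $ i + u x * dv i x) \<partial>lborel) =
      (\<integral>x. F x * (\<Sum>i\<in>UNIV. Y x $ i * u' i x) \<partial>lborel) + (\<integral>x. F x * (u x * (\<Sum>i\<in>UNIV. dv i x)) \<partial>lborel)"
    using i1 i2 by simp
  moreover have "closure {x. u x \<noteq> 0} \<subseteq> V" using supp d_pos by (auto simp: V_def)
  ultimately show ?thesis using main distr_terms_eq[OF u(1)] by simp
qed

text \<open>The increment formula is available for every single \<open>t\<close> and almost every
  \<open>x\<close>; joint measurability of the exceptional set turns this into almost every
  pair.\<close>

lemma distr_imp_lie_on_rectangle:
  assumes distr: "is_distr_derivative \<Omega> X f g"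
    and U: "open U" "\<And>x s. x \<in> U \<Longrightarrow> s \<in> {0..T} \<Longrightarrow> infdist (\<Phi> s x) K < d / 2"
  shows "AE p in lebesgue. p \<in> {0<..<T} \<times> U \<longrightarrow>
    f (flow \<Omega> X (fst p) (snd p)) - f (snd p) = (LINT s:{0..fst p}|lebesgue. g (flow \<Omega> X s (snd p)))"
proof -
  define S where "S = {x. infdist x K < d / 2}"
  have "open S" unfolding S_def by (intro open_Collect_less continuous_intros)
  then have Sb: "S \<in> sets borel" by simp
  have Ub[measurable]: "U \<in> sets borel" using U(1) by simp
  \<comment> \<open>A mollifier of radius at most \<open>d/4\<close> around a point of
    \<open>S\<close> reaches less than \<open>3 * d / 4\<close> away from \<open>K\<close>, so its
    support lies in \<open>V\<close>.\<close>
  have near: "infdist y K < d" if "x \<in> S" "y \<in> cball x (d/4)" for x y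
    using that infdist_triangle[of y K x] d_pos by (auto simp: S_def dist_commute)
  have SKd: "cball x (d/4) \<subseteq> Kd" if "x \<in> S" for x using near[OF that] by (auto simp: Kd_def intro: less_imp_le)
  obtain C where C: "0 \<le> C" "\<And>\<delta>. 0 < \<delta> \<Longrightarrow> \<exists>(\<rho> :: real ^ 'n \<Rightarrow> real) \<rho>'. mollifier C \<delta> \<rho> \<rho>'"
    using mollifier_exists[where 'n='n] by blast
  have weak: "(\<integral>y. G y * \<rho> (x - y) \<partial>lborel) = (\<integral>y. F y * (\<Sum>i\<in>UNIV. Y y $ i * \<rho>' i (x - y)) \<partial>lborel)
        - (\<integral>y. F y * (\<rho> (x - y) * (\<Sum>i\<in>UNIV. dv i y)) \<partial>lborel)"
    if \<delta>: "0 < \<delta>" "\<delta> \<le> d / 4" and mol: "mollifier C \<delta> \<rho> \<rho>'" and x: "x \<in> S" for \<delta> \<rho> \<rho>' x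
  proof -
    define u where "u = (\<lambda>y. \<rho> (x - y))"
    have u: "axis_C1 u (\<lambda>i y. - \<rho>' i (x - y))" unfolding u_def by (rule mollifier_reflected_axis_C1[OF mol])
    have "{y. u y \<noteq> 0} \<subseteq> cball x (d/4)"
    proof
      fix y assume "y \<in> {y. u y \<noteq> 0}"
      then have "\<not> \<delta> < norm (x - y)" using mollifier_props(5)[OF mol, of "x - y"] by (auto simp: u_def)
      then show "y \<in> cball x (d/4)" using \<delta> by (simp add: dist_norm)
    qed
    then have cl: "closure {y. u y \<noteq> 0} \<subseteq> cball x (d/4)" by (rule closure_minimal) simp
    then have supp: "closure {y. u y \<noteq> 0} \<subseteq> V" using near[OF x] by (auto simp: V_def)
    have "test_function \<Omega> u"
      unfolding test_function_def
    proof (intro conjI allI)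
      show "C_k k u" for k using mol by (simp add: mollifier_def u_def)
      show "compact (closure {y. u y \<noteq> 0})"
        using cl by (meson bounded_cball bounded_subset closed_closure compact_eq_bounded_closed)
      show "closure {y. u y \<noteq> 0} \<subseteq> \<Omega>" using supp V_Kd(3) by blast
    qed
    then have "(LINT y:\<Omega>|lebesgue. g y * u y) = - (LINT y:\<Omega>|lebesgue. f y * apply_field X u y)
          - (LINT y:\<Omega>|lebesgue. f y * u y * divergence X y)"
      using distr unfolding is_distr_derivative_def by blast
    moreover have "(\<integral>y. F y * (\<Sum>i\<in>UNIV. Y y $ i * - \<rho>' i (x - y)) \<partial>lborel) = - (\<integral>y. F y * (\<Sum>i\<in>UNIV. Y y $ i * \<rho>' i (x - y)) \<partial>lborel)"
      by (subst integral_minus[symmetric]) (simp add: sum_negf)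
    ultimately show ?thesis unfolding distr_terms_eq[OF u supp] by (simp add: u_def)
  qed
  have US: "\<Phi> s x \<in> S" if "x \<in> U" "s \<in> {0..T}" for x s using U(2)[OF that] by (simp add: S_def)
  have d4: "0 < d / 4" using d_pos by simp
  have inc: "AE x in lborel. x \<in> U \<longrightarrow> F (\<Phi> t x) - F x = (LINT s:{0..t}|lborel. G (\<Phi> s x))" if "t \<in> {0..T}" for t
    by (rule distr_derivative_imp_increment[OF lipschitz_flow_axioms dv F_integrable F_zero G_integrable Kd_compact
          Sb d4 SKd Ub US C weak that])
  have pair: "AE p in lborel \<Otimes>\<^sub>M lborel. p \<in> {0<..<T} \<times> U \<longrightarrow>
      F (\<Phi> (fst p) (snd p)) - F (snd p) = (LINT s:{0..fst p}|lborel. G (\<Phi> s (snd p)))"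
  proof (rule lborel_pair.AE_pair_measure)
    have 1: "(\<lambda>p. \<Phi> (fst p) (snd p)) \<in> borel_measurable (lborel \<Otimes>\<^sub>M lborel)"
      using flow_measurable_pair by simp
    have [measurable]: "(\<lambda>p. F (\<Phi> (fst p) (snd p))) \<in> borel_measurable (lborel \<Otimes>\<^sub>M lborel)"
      by (rule measurable_compose[OF 1 F_measurable])
    have 2: "(\<lambda>q. \<Phi> (snd q) (snd (fst q))) \<in> borel_measurable ((lborel \<Otimes>\<^sub>M lborel) \<Otimes>\<^sub>M lborel)"
      by (rule flow_measurable) measurable
    have [measurable]: "(\<lambda>q. G (\<Phi> (snd q) (snd (fst q)))) \<in> borel_measurable ((lborel \<Otimes>\<^sub>M lborel) \<Otimes>\<^sub>M lborel)"
      by (rule measurable_compose[OF 2 G_measurable])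
    have [measurable]: "(\<lambda>p. LINT s:{0..fst p}|lborel. G (\<Phi> s (snd p))) \<in> borel_measurable (lborel \<Otimes>\<^sub>M lborel)"
      unfolding set_lebesgue_integral_def
    proof (rule lborel.borel_measurable_lebesgue_integral)
      \<comment> \<open>The interval \<open>{0..fst p}\<close> varies with \<open>p\<close>; written
        as inequalities, its indicator is jointly measurable.\<close>
      have "(\<lambda>q. (if 0 \<le> snd q \<and> snd q \<le> fst (fst q) then 1 else 0 :: real) * G (\<Phi> (snd q) (snd (fst q))))
          \<in> borel_measurable ((lborel \<Otimes>\<^sub>M lborel) \<Otimes>\<^sub>M lborel)" by measurable
      then show "(\<lambda>(p, s). indicat_real {0..fst p} s *\<^sub>R G (\<Phi> s (snd p))) \<in> borel_measurable ((lborel \<Otimes>\<^sub>M lborel) \<Otimes>\<^sub>M lborel)"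
        by (simp add: case_prod_unfold indicator_def)
    qed
    have [measurable]: "{0<..<T} \<times> U \<in> sets (lborel \<Otimes>\<^sub>M lborel)" by (intro pair_measureI) auto
    show "{p \<in> space (lborel \<Otimes>\<^sub>M lborel). p \<in> {0<..<T} \<times> U \<longrightarrow>
      F (\<Phi> (fst p) (snd p)) - F (snd p) = (LINT s:{0..fst p}|lborel. G (\<Phi> s (snd p)))} \<in> sets (lborel \<Otimes>\<^sub>M lborel)"
      by measurable
    show "AE t in lborel. AE x in lborel. (t, x) \<in> {0<..<T} \<times> U \<longrightarrow>
      F (\<Phi> (fst (t, x)) (snd (t, x))) - F (snd (t, x)) = (LINT s:{0..fst (t, x)}|lborel. G (\<Phi> s (snd (t, x))))"
    proof (rule AE_I2)
      fix t
      show "AE x in lborel. (t, x) \<in> {0<..<T} \<times> U \<longrightarrow>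
        F (\<Phi> (fst (t, x)) (snd (t, x))) - F (snd (t, x)) = (LINT s:{0..fst (t, x)}|lborel. G (\<Phi> s (snd (t, x))))"
      proof (cases "t \<in> {0<..<T}")
        case True
        then show ?thesis using inc[of t] by auto
      next
        case False
        then show ?thesis by (intro AE_I2) auto
      qed
    qed
  qed
  have "AE p in lborel \<Otimes>\<^sub>M lborel. p \<in> {0<..<T} \<times> U \<longrightarrow>
    f (flow \<Omega> X (fst p) (snd p)) - f (snd p) = (LINT s:{0..fst p}|lebesgue. g (flow \<Omega> X s (snd p)))"
    using pair orbit_AE_notin(1)[OF rep(3)] AE_lborel_pair_snd[OF AE_N] AE_lborel_pair_snd[OF orbit_AE_notin(2)[OF rep(3)]]
  proof eventually_elim
    case (elim p)
    show ?case
    proof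
      assume p: "p \<in> {0<..<T} \<times> U"
      obtain t x where tx: "p = (t, x)" by force
      have t: "0 \<le> t" "t \<le> T" "x \<in> U" using p by (auto simp: tx)
      have V: "\<Phi> s x \<in> V" if "s \<in> {0..t}" for s
        using U(2)[OF t(3), of s] that t d_pos by (auto simp: V_def)
      show "f (flow \<Omega> X (fst p) (snd p)) - f (snd p) = (LINT s:{0..fst p}|lebesgue. g (flow \<Omega> X s (snd p)))"
        using elim p increment_eq_iff[OF t(1) V] by (simp add: tx)
    qed
  qed
  then show ?thesis by (intro AE_completion) (simp only: lborel_prod)
qed

end

section \<open>The equivalence\<close>

lemma field_chart_exists:
  fixes \<Omega> :: "(real ^ 'n) set"
  assumes \<Omega>: "open \<Omega>" and X: "locally_lipschitz_field \<Omega> X" and f: "L1loc \<Omega> f" and g: "L1loc \<Omega> g"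
    and K: "compact K" "K \<noteq> {}" "K \<subseteq> \<Omega>"
  obtains Y L M \<Phi> d dv f' g' N where "field_chart Y L M \<Phi> \<Omega> X K d dv f g f' g' N"
proof -
  obtain Y L M \<Phi> d where c: "0 < d" "lipschitz_flow Y L M \<Phi>"
    "compact {x. infdist x K \<le> d}" "{x. infdist x K \<le> d} \<subseteq> \<Omega>" "\<And>x. infdist x K \<le> d \<Longrightarrow> Y x = X x"
    using cutoff_field_exists[OF \<Omega> X K] by metis
  have "L-lipschitz_on UNIV Y" using c(2) by (rule lipschitz_flow.lip)
  then obtain dv where dv: "diagonal_derivatives Y dv" "\<And>i x. \<bar>dv i x\<bar> \<le> L"
    using diagonal_derivatives_exist by blast
  obtain f' g' where f': "f' \<in> borel_measurable borel" "AE x in lborel. x \<in> \<Omega> \<longrightarrow> f x = f' x"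
    and g': "g' \<in> borel_measurable borel" "AE x in lborel. x \<in> \<Omega> \<longrightarrow> g x = g' x"
    using L1loc_borel_representative[OF \<Omega> f] L1loc_borel_representative[OF \<Omega> g] by blast
  have "AE x in lborel. x \<in> \<Omega> \<longrightarrow> f x = f' x \<and> g x = g' x" using f'(2) g'(2) by eventually_elim auto
  then obtain N where N: "{x \<in> space lborel. \<not> (x \<in> \<Omega> \<longrightarrow> f x = f' x \<and> g x = g' x)} \<subseteq> N" "emeasure lborel N = 0" "N \<in> sets lborel"
    by (rule AE_E)
  have "field_chart Y L M \<Phi> \<Omega> X K d dv f g f' g' N"
    by (intro field_chart.intro field_chart_axioms.intro c X dv f g f'(1) g'(1)) (use N in auto)
  then show thesis by (rule that)
qed

text \<open>Each point of the positive flow domain has an open neighbourhood on which the equation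
  holds almost everywhere, obtained from a chart around its orbit. Countably many of these cover the
  domain, so the exceptional sets add up to a null set.\<close>

lemma distr_imp_lie_derivative:
  fixes \<Omega> :: "(real ^ 'n) set"
  assumes \<Omega>: "open \<Omega>" and X: "locally_lipschitz_field \<Omega> X" and f: "L1loc \<Omega> f" and g: "L1loc \<Omega> g"
    and distr: "is_distr_derivative \<Omega> X f g"
  shows "is_lie_derivative \<Omega> X f g"
proof -
  define Q where "Q p \<longleftrightarrow> f (flow \<Omega> X (fst p) (snd p)) - f (snd p) = (LINT s:{0..fst p}|lebesgue. g (flow \<Omega> X s (snd p)))" for p
  have local: "\<exists>W. open W \<and> p \<in> W \<and> (AE q in lebesgue. q \<in> W \<longrightarrow> Q q)" if p: "p \<in> flow_domain_pos \<Omega> X" for p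
  proof -
    obtain t x where tx: "p = (t, x)" by force
    have t: "0 < t" "t \<in> flow_interval \<Omega> X x" "x \<in> \<Omega>" using p by (auto simp: tx flow_domain_pos_def flow_domain_def)
    \<comment> \<open>A chart around \<open>x\<close> alone supplies some local solution; from this
      it follows that \<open>flow\<close> is a solution on the whole maximal interval.\<close>
    have sol: "solution \<Omega> X x (flow_interval \<Omega> X x) (\<lambda>t. flow \<Omega> X t x)"
    proof -
      have "compact {x}" "{x} \<noteq> {}" "{x} \<subseteq> \<Omega>" using t(3) by auto
      from field_chart_exists[OF \<Omega> X f g this]
      obtain Y L M \<Phi> d dv f' g' N where "field_chart Y L M \<Phi> \<Omega> X {x} d dv f g f' g' N" by metis
      then interpret field_chart Y L M \<Phi> \<Omega> X "{x}" d dv f g f' g' N .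
      show ?thesis
      proof (rule flow_eq_lipschitz_flow(3)[OF field lipschitz_flow_axioms V_open V_Kd(3) _ order_refl])
        show "Y y = X y" if "y \<in> V" for y using that Y_eq_X by (simp add: V_def)
        show "\<Phi> s x \<in> V" if "s \<in> {0..0}" for s using that d_pos by (simp add: V_def init)
      qed
    qed
    \<comment> \<open>The orbit piece up to time \<open>t\<close> is the compact set of the second
      chart.\<close>
    define K where "K = (\<lambda>s. flow \<Omega> X s x) ` {0..t}"
    have sub: "{0..t} \<subseteq> flow_interval \<Omega> X x"
      using sol t(1,2) unfolding solution_def is_interval_1 by (meson atLeastAtMost_iff subsetI)
    have "continuous_on {0..t} (\<lambda>s. flow \<Omega> X s x)"
      using sol sub unfolding solution_def
      by (meson continuous_at_imp_continuous_on has_vector_derivative_continuous subsetD)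
    then have K: "compact K" unfolding K_def by (intro compact_continuous_image) auto
    have K\<Omega>: "K \<subseteq> \<Omega>" "K \<noteq> {}" using sol sub t(1) unfolding K_def solution_def by auto
    obtain Y L M \<Phi> d dv f' g' N where "field_chart Y L M \<Phi> \<Omega> X K d dv f g f' g' N"
      using field_chart_exists[OF \<Omega> X f g K K\<Omega>(2,1)] by metis
    then interpret field_chart Y L M \<Phi> \<Omega> X K d dv f g f' g' N .
    \<comment> \<open>On \<open>K\<close> the two fields agree, so the maximal flow solves the
      equation of \<open>Y\<close> up to time \<open>t\<close> and coincides with
      \<open>\<Phi>\<close> by Gronwall's estimate.\<close>
    have orbit: "\<Phi> s x \<in> K" if s: "s \<in> {0..t}" for s
    proof -
      have "flow \<Omega> X r x \<in> K" if "r \<in> {0..s}" for r using that s by (auto simp: K_def)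
      then have Xr: "X (flow \<Omega> X r x) = Y (flow \<Omega> X r x)" if "r \<in> {0..s}" for r
        using that Y_eq_X d_pos by simp
      have "norm (flow \<Omega> X s x - \<Phi> s x) \<le> exp (L * (s - 0)) * norm (flow \<Omega> X 0 x - \<Phi> 0 x)"
      proof (rule solution_distance_forward[OF lip])
        show "((\<lambda>s. flow \<Omega> X s x) has_vector_derivative Y (flow \<Omega> X r x)) (at r) \<and> flow \<Omega> X r x \<in> UNIV"
          if "r \<in> {0..s}" for r
        proof -
          have "r \<in> flow_interval \<Omega> X x" using sub that s by auto
          then have "((\<lambda>s. flow \<Omega> X s x) has_vector_derivative X (flow \<Omega> X r x)) (at r)"
            using sol by (simp add: solution_def)
          then show ?thesis unfolding Xr[OF that] by simp
        qed
      qed (use s deriv in auto)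
      also have "flow \<Omega> X 0 x = \<Phi> 0 x" using sol by (simp add: solution_def init)
      finally have "flow \<Omega> X s x = \<Phi> s x" by simp
      moreover have "flow \<Omega> X s x \<in> K" using s unfolding K_def by (rule imageI)
      ultimately show ?thesis by simp
    qed
    \<comment> \<open>Slightly beyond \<open>t\<close>, so that \<open>(t, x)\<close> is interior to
      the rectangle; the extra time moves points by at most \<open>d / 4\<close>.\<close>
    define T where "T = t + d / (4 * (M + 1))"
    have T: "t < T" using d_pos M_nonneg by (simp add: T_def)
    have MT: "M * (T - t) \<le> d / 4"
    proof -
      have "M * (T - t) \<le> (M + 1) * (T - t)" using T by (intro mult_right_mono) auto
      also have "\<dots> = d / 4"
      proof -
        have "M + 1 \<noteq> 0" using M_nonneg by linarith
        then show ?thesis by (simp add: T_def divide_simps)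
      qed
      finally show ?thesis .
    qed
    have orbitT: "infdist (\<Phi> s x) K \<le> d / 4" if s: "s \<in> {0..T}" for s
    proof (cases "s \<le> t")
      case True
      then show ?thesis using orbit[of s] s d_pos by simp
    next
      case False
      have "infdist (\<Phi> s x) K \<le> infdist (\<Phi> t x) K + dist (\<Phi> s x) (\<Phi> t x)" by (rule infdist_triangle)
      also have "infdist (\<Phi> t x) K = 0" using orbit[of t] t(1) by simp
      also have "dist (\<Phi> s x) (\<Phi> t x) \<le> M * (s - t)" using flow_speed[of s x t] False by simp
      also have "\<dots> \<le> M * (T - t)" using s M_nonneg by (intro mult_left_mono) auto
      finally show ?thesis using MT by simp
    qed
    \<comment> \<open>Up to time \<open>T\<close> orbits from the ball deviate from that of
      \<open>x\<close> by at most \<open>d / 8\<close>, and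
      \<open>d / 4 + d / 8 < d / 2\<close>.\<close>
    define r where "r = d / (8 * exp (L * T))"
    have r: "0 < r" using d_pos by (simp add: r_def)
    have U: "infdist (\<Phi> s y) K < d / 2" if y: "y \<in> ball x r" and s: "s \<in> {0..T}" for s y
    proof -
      have "infdist (\<Phi> s y) K \<le> infdist (\<Phi> s x) K + dist (\<Phi> s y) (\<Phi> s x)" by (rule infdist_triangle)
      also have "dist (\<Phi> s y) (\<Phi> s x) \<le> exp (L * \<bar>s\<bar>) * dist y x" using lipschitz_onD[OF flow_lipschitz] by auto
      also have "\<dots> \<le> exp (L * T) * r"
        using s y L_nonneg by (intro mult_mono) (auto simp: dist_commute intro!: mult_left_mono)
      also have "\<dots> = d / 8" by (simp add: r_def)
      finally show ?thesis using orbitT[OF s] d_pos by linarith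
    qed
    have "AE q in lebesgue. q \<in> {0<..<T} \<times> ball x r \<longrightarrow> Q q"
      unfolding Q_def by (rule distr_imp_lie_on_rectangle[OF distr open_ball U])
    moreover have "open ({0<..<T} \<times> ball x r)" by (intro open_Times) auto
    moreover have "p \<in> {0<..<T} \<times> ball x r" using t(1) T r by (simp add: tx)
    ultimately show ?thesis by blast
  qed
  define \<W> where "\<W> = {W. open W \<and> (AE q in lebesgue. q \<in> W \<longrightarrow> Q q)}"
  obtain \<C> where \<C>: "\<C> \<subseteq> \<W>" "countable \<C>" "\<Union>\<C> = \<Union>\<W>"
    by (rule Lindelof[of \<W>]) (auto simp: \<W>_def)
  have "AE q in lebesgue. \<forall>W\<in>\<C>. q \<in> W \<longrightarrow> Q q"
    using \<C>(1,2) by (subst AE_ball_countable) (auto simp: \<W>_def)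
  then have "AE q in lebesgue. q \<in> flow_domain_pos \<Omega> X \<longrightarrow> Q q"
  proof eventually_elim
    case (elim q)
    show ?case
    proof
      assume "q \<in> flow_domain_pos \<Omega> X"
      then have "q \<in> \<Union>\<W>" using local[of q] by (auto simp: \<W>_def)
      then show "Q q" using elim \<C>(3) by blast
    qed
  qed
  then show ?thesis unfolding is_lie_derivative_def
    by eventually_elim (auto simp: Q_def)
qed

lemma lie_derivative_imp_quotient_converges:
  fixes \<Omega> :: "(real ^ 'n) set"
  assumes \<Omega>: "open \<Omega>" and X: "locally_lipschitz_field \<Omega> X" and f: "L1loc \<Omega> f" and g: "L1loc \<Omega> g"
    and lie: "is_lie_derivative \<Omega> X f g"
    and W: "open W" "compact (closure W)" "closure W \<subseteq> \<Omega>"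
  shows "((\<lambda>t. LINT x:W|lebesgue. \<bar>diff_quotient \<Omega> X t f x - g x\<bar>) \<longlongrightarrow> 0) (at_right 0)"
proof (cases "W = {}")
  \<comment> \<open>Treated separately because a chart is built around a non-empty compact set;
    \<open>infdist\<close> to the empty set is 0 everywhere.\<close>
  case True
  then show ?thesis by (simp add: set_lebesgue_integral_def)
next
  case False
  then have "closure W \<noteq> {}" by simp
  from field_chart_exists[OF \<Omega> X f g W(2) this W(3)]
  obtain Y L M \<Phi> d dv f' g' N where "field_chart Y L M \<Phi> \<Omega> X (closure W) d dv f g f' g' N" by metis
  then interpret field_chart Y L M \<Phi> \<Omega> X "closure W" d dv f g f' g' N .
  show ?thesis
    by (rule lie_derivative_imp_limit[OF lie]) (use W(1) closure_subset in auto)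
qed

lemma quotient_converges_imp_distr_derivative:
  fixes \<Omega> :: "(real ^ 'n) set"
  assumes \<Omega>: "open \<Omega>" and X: "locally_lipschitz_field \<Omega> X" and f: "L1loc \<Omega> f" and g: "L1loc \<Omega> g"
    and lim: "\<And>W. open W \<Longrightarrow> compact (closure W) \<Longrightarrow> closure W \<subseteq> \<Omega> \<Longrightarrow>
      ((\<lambda>t. LINT x:W|lebesgue. \<bar>diff_quotient \<Omega> X t f x - g x\<bar>) \<longlongrightarrow> 0) (at_right 0)"
  shows "is_distr_derivative \<Omega> X f g"
  unfolding is_distr_derivative_def
proof (intro allI impI)
  fix u assume u: "test_function \<Omega> u"
  show "(LINT x:\<Omega>|lebesgue. g x * u x) = - (LINT x:\<Omega>|lebesgue. f x * apply_field X u x)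
          - (LINT x:\<Omega>|lebesgue. f x * u x * divergence X x)"
  proof (cases "\<Omega> = {}")
    case True
    then show ?thesis by (simp add: set_lebesgue_integral_def)
  next
    case False
    then obtain x0 where x0: "x0 \<in> \<Omega>" by blast
    \<comment> \<open>The extra point keeps \<open>K\<close> non-empty when \<open>u\<close> is
      identically zero.\<close>
    define K where "K = insert x0 (closure {x. u x \<noteq> 0})"
    have K: "compact K" "K \<noteq> {}" "K \<subseteq> \<Omega>" using u x0 by (auto simp: K_def test_function_def)
    obtain Y L M \<Phi> d dv f' g' N where "field_chart Y L M \<Phi> \<Omega> X K d dv f g f' g' N"
      using field_chart_exists[OF \<Omega> X f g K] by metis
    then interpret field_chart Y L M \<Phi> \<Omega> X K d dv f g f' g' N .
    \<comment> \<open>The neighbourhood of the support to which (iii) is applied; its closure lies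
      in the compact set \<open>Kd\<close>.\<close>
    define W where "W = {x. infdist x K < d / 2}"
    have "closed {x. infdist x K \<le> d / 2}" by (intro closed_Collect_le continuous_intros)
    then have "closure W \<subseteq> {x. infdist x K \<le> d / 2}" by (intro closure_minimal) (auto simp: W_def)
    also have "\<dots> \<subseteq> Kd" using d_pos by (auto simp: Kd_def)
    finally have cl: "closure W \<subseteq> Kd" .
    have "open W" unfolding W_def by (intro open_Collect_less continuous_intros)
    moreover have "compact (closure W)"
      using compact_Int_closed[OF Kd_compact closed_closure, of W] cl by (simp add: Int_absorb1)
    moreover have "closure W \<subseteq> \<Omega>" using cl V_Kd(2) by blast
    ultimately have "((\<lambda>t. LINT x:W|lebesgue. \<bar>diff_quotient \<Omega> X t f x - g x\<bar>) \<longlongrightarrow> 0) (at_right 0)"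
      by (rule lim)
    then show ?thesis
      by (intro limit_imp_distr_equation[OF test_function_axis_C1[OF u]]) (auto simp: K_def W_def)
  qed
qed

theorem theorem1p1:
  fixes \<Omega> :: "(real ^ 'n) set"
    and X :: "real ^ 'n \<Rightarrow> real ^ 'n"
    and f g :: "real ^ 'n \<Rightarrow> real"
  assumes "open \<Omega>"
    and "locally_lipschitz_field \<Omega> X"
    and "L1loc \<Omega> f"
    and "L1loc \<Omega> g"
  shows "(is_distr_derivative \<Omega> X f g \<longleftrightarrow> is_lie_derivative \<Omega> X f g) \<and>
         (is_lie_derivative \<Omega> X f g \<longleftrightarrow>
           (\<forall>\<Omega>'. open \<Omega>' \<and> compact (closure \<Omega>') \<and> closure \<Omega>' \<subseteq> \<Omega> \<longrightarrow>
              ((\<lambda>t. LINT x:\<Omega>'|lebesgue. \<bar>diff_quotient \<Omega> X t f x - g x\<bar>) \<longlongrightarrow> 0) (at_right 0)))"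
  using distr_imp_lie_derivative[OF assms] lie_derivative_imp_quotient_converges[OF assms]
    quotient_converges_imp_distr_derivative[OF assms] by blast

end
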